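(* Fix integers $M\ge1$, $d\ge1$. Let $\nu_0,\nu_1$ be probability laws on $\mathbb R^d$ with Lebesgue densities $f_0,f_1$, and let $X_1,\dots,X_n$ be i.i.d. from $\nu_0$. Let $\mathcal A_M(x)$ be the catchment area, and $\alpha(d)$, $\alpha(M,d)$ the constants, defined in the context. (i) Assume that $\nu_1$ is absolutely continuous with respect to $\nu_0$, that $f_0$ and $f_1$ share a common support $\mathcal X$ which is compact, and that $f_0$ and $f_1$ are continuous on $\mathcal X$. Then for $\nu_0$-almost all $x$, $$\lim_{n\to\infty}n\,\mathrm E\big[\nu_1(\mathcal A_M(x))\mid X_1=x\big]=M\cdot\frac{f_1(x)}{f_0(x)},$$ $$\lim_{n\to\infty}n^2\,\mathrm E\big[\nu_1(\mathcal A_M(x))^2\mid X_1=x\big]=\alpha(M,d)\cdot\Big(\frac{f_1(x)}{f_0(x)}\Big)^2.$$ (ii) For $d=1$, $\alpha(M,1)=M(2M+1)/2$. For $M=1$, $\alpha(1,d)=\alpha(d)$.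
   Context: $\|\cdot\|$ is the Euclidean norm on $\mathbb R^d$. **Catchment area.** For $z\in\mathbb R^d$, $\mathcal X_M(z)$ denotes the $M$-th nearest neighbor of $z$ in $\{X_i\}_{i=1}^n$, i.e. the point $x\in\{X_i\}_{i=1}^n$ with $\sum_{i=1}^n\mathbf 1\{\|X_i-z\|\le\|x-z\|\}=M$. For $x\in\mathbb R^d$, $\mathcal A_M(x)=\mathcal A_M(x;\{X_i\}_{i=1}^n)=\{z\in\mathbb R^d:\|z-x\|\le\|\mathcal X_M(z)-z\|\}$. **The constants.** $\lambda$ is Lebesgue measure on $\mathbb R^d$, $B(x,r)$ the closed Euclidean ball, $c_d=\lambda(B(0,1))$. Let $D$ be uniform on $B(0,1)$, $\bar 1=(1,0,\dots,0)$, $\bar B=B(\bar 1,1)\cup B(D,\|D\|)$, $T=\lambda(\bar B)/\lambda(B(0,1))$, $\alpha(d)=\mathrm E[2/T^2]$. Then $$\alpha(M,d)=\alpha(d)\sum_{\substack{i,j,k\ge0\\ i+k\le M-1,\ j+k\le M-1}}\frac{c_{ijk}(d)\,(i+j+k+1)!}{i!\,j!\,k!},$$ where the constants $c_{ijk}(d)$ are as follows. For $d\ge2$: $$c_{ijk}(d)=\frac1{\alpha(d)}\int_{D(1)}(1-v_1)^i(1-v_2)^j(v_1+v_2-1)^k f_{S,v_1,v_2}(1)\,dv_1dv_2,$$ with $D(1)=\{(v_1,v_2):0\le v_1,v_2\le1,\ v_1+v_2\ge1\}$, and $f_{S,v_1,v_2}$ the density (the version continuous on $(\max(v_1,v_2),v_1+v_2)$)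 of $c_d^{-1}S(v_1^{1/d},v_2^{1/d},\tilde\theta_1,\tilde\theta_2)$, where $S(r_1,r_2,\theta_1,\theta_2)=\lambda(B(r_1\theta_1,r_1)\cup B(r_2\theta_2,r_2))$ and $\tilde\theta_1,\tilde\theta_2$ are independent and uniform on the unit sphere of $\mathbb R^d$. For $d=1$: $c_{000}(1)=1$; if exactly one of $i,j,k$ is $0$ and $a,b$ denote the other two, $c_{ijk}(1)=\frac13\frac{a!\,b!}{(a+b+1)!}$; if exactly one of $i,j,k$ is nonzero and equals $a$, $c_{ijk}(1)=\frac23\frac1{a+1}$; if $i,j,k$ are all nonzero, $c_{ijk}(1)=0$. *)

theory Defs
  imports "HOL-Probability.Probability"
begin

(* Tied distances (and n < M) leave the point undetermined; for n >= M and distinct sample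
   points, ties only occur for z in finitely many hyperplanes. *)
definition nearest_neighbor :: "nat \<Rightarrow> nat \<Rightarrow> (nat \<Rightarrow> real ^ 'n) \<Rightarrow> real ^ 'n \<Rightarrow> real ^ 'n" where
  "nearest_neighbor M n xs z =
     (THE x. x \<in> xs ` {1..n} \<and>
        (\<Sum>i=1..n. of_bool (norm (xs i - z) \<le> norm (x - z))) = M)"

definition catchment_area :: "nat \<Rightarrow> nat \<Rightarrow> (nat \<Rightarrow> real ^ 'n) \<Rightarrow> real ^ 'n \<Rightarrow> (real ^ 'n) set" where
  "catchment_area M n xs x = {z. norm (z - x) \<le> norm (nearest_neighbor M n xs z - z)}"

(* h is a version of z \<mapsto> E[Y | Z = z]; it is determined up to null sets of the law of Z. *)
definition cond_exp_given ::
    "'w measure \<Rightarrow> ('w \<Rightarrow> real ^ 'n) \<Rightarrow> ('w \<Rightarrow> real) \<Rightarrow> (real ^ 'n \<Rightarrow> real) \<Rightarrow> bool" where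
  "cond_exp_given P Z Y h \<longleftrightarrow>
     h \<in> borel_measurable borel \<and>
     (AE \<omega> in P. real_cond_exp P (vimage_algebra (space P) Z borel) Y \<omega> = h (Z \<omega>))"

definition is_lebesgue_density :: "(real ^ 'n) measure \<Rightarrow> (real ^ 'n \<Rightarrow> real) \<Rightarrow> bool" where
  "is_lebesgue_density \<nu> f \<longleftrightarrow>
     f \<in> borel_measurable borel \<and> (\<forall>x. 0 \<le> f x) \<and> \<nu> = density lborel (\<lambda>x. ennreal (f x))"

definition fun_support :: "(real ^ 'n \<Rightarrow> real) \<Rightarrow> (real ^ 'n) set" where
  "fun_support f = closure {x. f x \<noteq> 0}"

text \<open>
  The constants below depend on the dimension \<open>d = CARD('n)\<close> only; it is passed as \<open>TYPE('n)\<close>.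
\<close>

definition ball_volume :: "'n::finite itself \<Rightarrow> real" where
  "ball_volume TYPE('n) = measure lborel (cball (0 :: real ^ 'n) 1)"

definition uniform_ball :: "(real ^ 'n) measure" where
  "uniform_ball = uniform_measure lborel (cball 0 1)"

(* The normalised surface measure of the unit sphere, as the law of the direction of a uniform
   point of the unit ball (the centre has probability 0). *)
definition uniform_sphere :: "(real ^ 'n) measure" where
  "uniform_sphere = distr uniform_ball borel (\<lambda>z. z /\<^sub>R norm z)"

(* A finite index type has no distinguished first coordinate, so an arbitrary one is chosen;
   by rotation invariance the law of T does not depend on the choice. *)
definition first_unit_vector :: "real ^ 'n" where
  "first_unit_vector = axis (SOME i. True) 1"

definition T_ratio :: "real ^ 'n \<Rightarrow> real" where
  "T_ratio D =
     measure lborel (cball first_unit_vector 1 \<union> cball D (norm D)) / ball_volume TYPE('n)"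

definition alpha :: "'n::finite itself \<Rightarrow> real" where
  "alpha TYPE('n) = (\<integral>D. 2 / (T_ratio D)\<^sup>2 \<partial>(uniform_ball :: (real ^ 'n) measure))"

definition union_volume :: "real \<Rightarrow> real \<Rightarrow> real ^ 'n \<Rightarrow> real ^ 'n \<Rightarrow> real" where
  "union_volume r1 r2 \<theta>1 \<theta>2 =
     measure lborel (cball (r1 *\<^sub>R \<theta>1) r1 \<union> cball (r2 *\<^sub>R \<theta>2) r2)"

(* For CARD('n) >= 2 and v1, v2 > 0 such a density exists and its values on the open interval
   are unique. *)
definition union_density :: "'n::finite itself \<Rightarrow> real \<Rightarrow> real \<Rightarrow> real \<Rightarrow> real" where
  "union_density TYPE('n) v1 v2 =
     (SOME f. (\<forall>s. 0 \<le> f s) \<and> continuous_on {max v1 v2<..<v1 + v2} f \<and>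
        distributed (uniform_sphere \<Otimes>\<^sub>M uniform_sphere) lborel
          (\<lambda>(\<theta>1, \<theta>2 :: real ^ 'n).
             union_volume (root CARD('n) v1) (root CARD('n) v2) \<theta>1 \<theta>2 / ball_volume TYPE('n))
          (\<lambda>s. ennreal (f s)))"

definition D1 :: "(real \<times> real) set" where
  "D1 = {(v1, v2). 0 \<le> v1 \<and> v1 \<le> 1 \<and> 0 \<le> v2 \<and> v2 \<le> 1 \<and> v1 + v2 \<ge> 1}"

definition c_line :: "nat \<Rightarrow> nat \<Rightarrow> nat \<Rightarrow> real" where
  "c_line i j k =
     (if i = 0 \<and> j = 0 \<and> k = 0 then 1
      else if j = 0 \<and> k = 0 then 2 / 3 * (1 / (real i + 1))
      else if i = 0 \<and> k = 0 then 2 / 3 * (1 / (real j + 1))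
      else if i = 0 \<and> j = 0 then 2 / 3 * (1 / (real k + 1))
      else if i = 0 then 1 / 3 * (fact j * fact k / fact (j + k + 1))
      else if j = 0 then 1 / 3 * (fact i * fact k / fact (i + k + 1))
      else if k = 0 then 1 / 3 * (fact i * fact j / fact (i + j + 1))
      else 0)"

(* The integral is over the completed measure because the values of union_density on the
   (null) boundary of D1 are unspecified, hence possibly not Borel. *)
definition c_const :: "'n::finite itself \<Rightarrow> nat \<Rightarrow> nat \<Rightarrow> nat \<Rightarrow> real" where
  "c_const TYPE('n) i j k =
     (if CARD('n) = 1 then c_line i j k
      else 1 / alpha TYPE('n) *
        (LINT v:D1|lebesgue.
           (1 - fst v) ^ i * (1 - snd v) ^ j * (fst v + snd v - 1) ^ k
             * union_density TYPE('n) (fst v) (snd v) 1))"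

definition alpha_M :: "nat \<Rightarrow> 'n::finite itself \<Rightarrow> real" where
  "alpha_M M TYPE('n) =
     alpha TYPE('n) *
     (\<Sum>(i, j, k) \<in> {(i, j, k). i + k \<le> M - 1 \<and> j + k \<le> M - 1}.
        c_const TYPE('n) i j k * fact (i + j + k + 1) / (fact i * fact j * fact k))"

end

(* With g0, g1 the densities, the event z in A_M(x) given X_1 = x says, for almost all z, that at most
   M - 1 of the other n - 1 sample points lie in the closed ball around z through x. By Fubini the first
   two moments are integrals of g1(z) and g1(z1) g1(z2) against multinomial probabilities of hitting one
   or two such balls. Blowing up around x by the factor n^(1/d), at a Lebesgue density point x of the
   support, these probabilities become Poisson probabilities with intensities g0(x) times the volumes of
   the three pieces cut out by the balls B(w1, |w1|) and B(w2, |w2|); a lower bound c |z - x|^d for the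
   mass of the balls gives an exponential dominating function. The limits are the integrals of these
   Poisson probabilities. In polar coordinates v = |w|^d the double integral depends on the law of
   S(v1^(1/d), v2^(1/d), theta1, theta2) only, and scaling turns the value of its density at 1 into an
   integral over D(1), which gives c_ijk(d). For d = 1 the directions are signs and everything is explicit. *)
theory Submission
  imports Defs
begin

text \<open>Two features of the hypotheses shape the proof. The closure of the set where
  \<open>f0\<close> is nonzero may contain points that carry no mass, isolated ones for instance; it
  is therefore replaced by the compact set \<open>K\<close> of those of its points all of whose
  balls have positive mass. Both laws live on \<open>K\<close>, and compactness bounds ball masses
  from below away from \<open>x\<close>. Moreover the densities are continuous on \<open>K\<close>
  only and may jump to 0 off it, so the blown-up densities need not converge pointwise; they are
  compared with a constant times the indicator of the blown-up \<open>K\<close>, and the density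
  point property makes the difference vanish in the integral. The other difficulty is that
  \<open>union_density\<close> is a choice. That a continuous density exists is shown with the
  cotangent of the angle between the two directions as coordinate. Its measurability in
  \<open>v1\<close>, \<open>v2\<close> is read off from the distribution function, which is
  canonical, by differentiation. Integrals behind the constants are taken over nonnegative extended
  reals, so that Tonelli applies without integrability; finiteness is supplied separately by
  \<open>poisson_integral_finite\<close>.\<close>

section \<open>Lebesgue density points of a compact set\<close>

text \<open>By Vitali covering: the points of \<open>K\<close> violating the bound for a given
  \<open>e\<close> have arbitrarily small balls inside an open \<open>U\<close> containing
  \<open>K\<close>, each with a fixed share of its volume in \<open>U - K\<close>. Disjoint balls
  among them cover almost all bad points, and their total volume is at most a constant times that of
  \<open>U - K\<close>, which is as small as desired.\<close>

lemma AE_lebesgue_density: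
  fixes K :: "'a::euclidean_space set"
  assumes K: "compact K"
  shows "AE x in lborel. x \<in> K \<longrightarrow>
    (\<forall>e>0. \<exists>\<delta>>0. \<forall>r. 0 < r \<and> r < \<delta> \<longrightarrow> measure lborel (ball x r - K) \<le> e * r ^ DIM('a))"
proof -
  define A where "A e = {x\<in>K. \<forall>\<delta>>0. \<exists>r. 0 < r \<and> r < \<delta> \<and> e * r ^ DIM('a) < measure lborel (ball x r - K)}" for e
  have Kb [measurable]: "K \<in> sets borel" using K by (simp add: borel_compact)
  have negl: "negligible (A e)" if e: "e > 0" for e
    \<comment> \<open>Outer covers avoid the question whether \<open>A e\<close> is
      measurable.\<close>
    unfolding negligible_outer
  proof (intro allI impI)
    fix \<eta> :: real assume \<eta>: "\<eta> > 0"
    define v where "v = unit_ball_vol (DIM('a))"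
    have v: "v > 0" unfolding v_def by simp
    \<comment> \<open>The volume of a bad ball is less than \<open>v / e\<close> times the volume of
      its part outside \<open>K\<close>. With this \<open>\<eta>'\<close> the total becomes
      \<open>\<eta> / 2\<close>.\<close>
    define \<eta>' where "\<eta>' = \<eta> * e / (2 * v)"
    have \<eta>': "\<eta>' > 0" unfolding \<eta>'_def using \<eta> e v by simp
    have "K \<in> lmeasurable" using K by (simp add: lmeasurable_compact)
    then obtain U where U: "open U" "K \<subseteq> U" "U - K \<in> lmeasurable" "emeasure lebesgue (U - K) < ennreal \<eta>'"
      using sets_lebesgue_outer_open[OF fmeasurableD \<eta>'] by metis
    define I where "I = {(x, r). x \<in> A e \<and> 0 < r \<and> ball x r \<subseteq> U \<and> e * r ^ DIM('a) < measure lborel (ball x r - K)}"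
    have "\<exists>i. i \<in> I \<and> x \<in> ball (fst i) (snd i) \<and> snd i < d" if "x \<in> A e" "0 < d" for x d
    proof -
      have "x \<in> U" using that U by (auto simp: A_def)
      then obtain d' where d': "d' > 0" "ball x d' \<subseteq> U" using U by (meson openE)
      have "min d d' > 0" using that d' by auto
      moreover have "\<forall>\<delta>>0. \<exists>r. 0 < r \<and> r < \<delta> \<and> e * r ^ DIM('a) < measure lborel (ball x r - K)"
        using that(1) by (simp add: A_def)
      ultimately obtain r where r: "0 < r" "r < min d d'" "e * r ^ DIM('a) < measure lborel (ball x r - K)"
        by metis
      have "ball x r \<subseteq> U" using d' r by (meson ball_subset_ball_iff less_imp_le min_less_iff_conj order_trans subset_ball)
      then show ?thesis using r that by (intro exI[of _ "(x, r)"]) (auto simp: I_def)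
    qed
    then obtain C where C: "countable C" "C \<subseteq> I"
      "pairwise (\<lambda>i j. disjnt (ball (fst i) (snd i)) (ball (fst j) (snd j))) C"
      "negligible (A e - (\<Union>i\<in>C. ball (fst i) (snd i)))"
      by (rule Vitali_covering_theorem_balls[of "A e" I fst snd]) blast+
    define B where "B = (\<Union>i\<in>C. ball (fst i) (snd i))"
    have sub: "ball (fst i) (snd i) \<subseteq> U" if "i \<in> C" for i
      using subsetD[OF C(2) that] by (simp add: I_def case_prod_beta)
    have disj: "disjoint_family_on (\<lambda>i. ball (fst i) (snd i)) C"
      using C(3) by (auto simp: disjoint_family_on_def pairwise_def disjnt_def)
    have disj': "disjoint_family_on (\<lambda>i. ball (fst i) (snd i) - K) C"
      unfolding disjoint_family_on_def
    proof (intro ballI impI)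
      fix i j assume "i \<in> C" "j \<in> C" "i \<noteq> j"
      then have "ball (fst i) (snd i) \<inter> ball (fst j) (snd j) = {}"
        by (rule disjoint_family_onD[OF disj])
      then show "(ball (fst i) (snd i) - K) \<inter> (ball (fst j) (snd j) - K) = {}" by blast
    qed
    have fin: "emeasure lborel (ball (x::'a) r - K) \<noteq> \<infinity>" for x r
      using emeasure_mono[of "ball x r - K" "ball x r" lborel] emeasure_lborel_ball_finite[of x r]
      by (auto simp: less_top[symmetric] top_unique)
    have one: "emeasure lborel (ball (fst i) (snd i)) \<le> ennreal (v / e) * emeasure lborel (ball (fst i) (snd i) - K)"
      if "i \<in> C" for i
    proof -
      have i: "0 < snd i" "e * snd i ^ DIM('a) < measure lborel (ball (fst i) (snd i) - K)"
        using that C(2) by (auto simp: I_def)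
      have "emeasure lborel (ball (fst i) (snd i)) = ennreal (v * snd i ^ DIM('a))"
        using i unfolding v_def by (subst emeasure_ball) auto
      also have "\<dots> \<le> ennreal (v / e * measure lborel (ball (fst i) (snd i) - K))"
        using i e v by (intro ennreal_leI) (simp add: field_simps)
      also have "\<dots> = ennreal (v / e) * emeasure lborel (ball (fst i) (snd i) - K)"
        using v e fin[of "fst i" "snd i"] by (simp add: ennreal_mult'[symmetric] emeasure_eq_ennreal_measure)
      finally show ?thesis .
    qed
    have "emeasure lborel B = (\<integral>\<^sup>+ i. emeasure lborel (ball (fst i) (snd i)) \<partial>count_space C)"
      unfolding B_def by (rule emeasure_UN_countable[OF _ C(1) disj]) auto
    also have "\<dots> \<le> (\<integral>\<^sup>+ i. ennreal (v / e) * emeasure lborel (ball (fst i) (snd i) - K) \<partial>count_space C)"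
      by (intro nn_integral_mono) (use one in auto)
    also have "\<dots> = ennreal (v / e) * (\<integral>\<^sup>+ i. emeasure lborel (ball (fst i) (snd i) - K) \<partial>count_space C)"
      by (rule nn_integral_cmult) auto
    also have "(\<integral>\<^sup>+ i. emeasure lborel (ball (fst i) (snd i) - K) \<partial>count_space C)
      = emeasure lborel (\<Union>i\<in>C. ball (fst i) (snd i) - K)"
      by (rule emeasure_UN_countable[symmetric, OF _ C(1)])
         (use disj' in auto)
    also have "\<dots> \<le> emeasure lborel (U - K)"
    proof (rule emeasure_mono)
      show "(\<Union>i\<in>C. ball (fst i) (snd i) - K) \<subseteq> U - K" using sub by blast
    qed (use U in simp)
    also have "\<dots> \<le> ennreal \<eta>'"
      using U by (simp add: emeasure_completion)
    also have "ennreal (v / e) * ennreal \<eta>' = ennreal (\<eta> / 2)"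
      using v e \<eta>' by (simp add: ennreal_mult'[symmetric] \<eta>'_def)
    finally have B: "emeasure lborel B \<le> ennreal (\<eta> / 2)" by (simp add: mult_left_mono)
    have Bo: "open B" unfolding B_def by auto
    have Bm: "B \<in> lmeasurable"
      using B Bo by (auto simp: fmeasurable_def emeasure_completion intro: le_less_trans)
    have "measure lebesgue B \<le> \<eta> / 2"
      unfolding measure_def using B Bo \<eta> by (intro enn2real_leI) (auto simp: emeasure_completion)
    show "\<exists>T. A e \<subseteq> T \<and> T \<in> lmeasurable \<and> measure lebesgue T < \<eta>"
    proof (intro exI conjI)
      show "A e \<subseteq> (A e - B) \<union> B" by auto
      have n: "A e - B \<in> null_sets lebesgue" using C(4) by (simp add: B_def negligible_iff_null_sets)
      then show "(A e - B) \<union> B \<in> lmeasurable" by (rule fmeasurable.Un[OF fmeasurableI_null_sets Bm])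
      have "measure lebesgue ((A e - B) \<union> B) = measure lebesgue B"
        unfolding Un_commute[of _ B] by (rule measure_Un_null_set[OF fmeasurableD[OF Bm] n])
      then show "measure lebesgue ((A e - B) \<union> B) < \<eta>" using \<open>measure lebesgue B \<le> \<eta> / 2\<close> \<eta> by simp
    qed
  qed
  \<comment> \<open>Countably many \<open>e\<close> suffice, since the condition weakens as
    \<open>e\<close> grows.\<close>
  have "AE x in lebesgue. x \<notin> (\<Union>n. A (1 / real (Suc n)))"
    by (intro AE_not_in) (use negl in \<open>auto simp: negligible_iff_null_sets\<close>)
  then have "AE x in lborel. x \<notin> (\<Union>n. A (1 / real (Suc n)))"
    by (simp add: AE_completion_iff)
  then show ?thesis
  proof eventually_elim
    case (elim x)
    show ?case
    proof (intro impI allI)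
      fix e :: real assume x: "x \<in> K" and e: "e > 0"
      then obtain n where n: "1 / real (Suc n) < e" using nat_approx_posE by blast
      have "x \<notin> A (1 / real (Suc n))" using elim by auto
      then obtain \<delta> where \<delta>: "\<delta> > 0" "\<And>r. 0 < r \<and> r < \<delta> \<Longrightarrow> measure lborel (ball x r - K) \<le> 1 / real (Suc n) * r ^ DIM('a)"
        using x by (auto simp: A_def not_less) (meson not_less)
      have "measure lborel (ball x r - K) \<le> e * r ^ DIM('a)" if "0 < r" "r < \<delta>" for r
        using \<delta>(2)[of r] that n by (smt (verit) mult_right_mono zero_less_power)
      then show "\<exists>\<delta>>0. \<forall>r. 0 < r \<and> r < \<delta> \<longrightarrow> measure lborel (ball x r - K) \<le> e * r ^ DIM('a)"
        using \<delta>(1) by blast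
    qed
  qed
qed

section \<open>Polar coordinates\<close>

lemma nn_integral_affine:
  fixes t :: "'a::euclidean_space"
  assumes [measurable]: "f \<in> borel_measurable borel" and c: "c \<noteq> 0"
  shows "(\<integral>\<^sup>+x. f x \<partial>lborel) = ennreal (\<bar>c\<bar> ^ DIM('a)) * (\<integral>\<^sup>+x. f (t + c *\<^sub>R x) \<partial>lborel)"
  by (subst lborel_affine[OF c, of t])
     (simp add: nn_integral_density nn_integral_distr nn_integral_cmult)

lemma measure_real_eqI:
  assumes "sets M = sets borel" "sets N = sets borel"
    and eq: "\<And>v::real. emeasure M {..v} = emeasure N {..v}"
    and fin: "\<And>v::real. emeasure M {..v} < \<infinity>"
  shows "M = N"
proof (rule measure_eqI_generator_eq[of "range atMost" UNIV M N "\<lambda>i. {..real i}"])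
  show "Int_stable (range (atMost :: real \<Rightarrow> _))"
    by (auto simp: Int_stable_def)
  show "sets M = sigma_sets UNIV (range atMost)" "sets N = sigma_sets UNIV (range atMost)"
    using assms(1,2) by (simp_all add: borel_eq_atMost)
  show "\<Union> (range (\<lambda>i. {..real i})) = UNIV"
    using real_arch_simple by auto
  show "emeasure M {..real i} \<noteq> \<infinity>" for i
    using fin[of "real i"] by simp
qed (auto simp: eq)

text \<open>The image measure is translation invariant, and the usual Fubini argument for the uniqueness of
  Haar measure, tested against the rotation invariant unit ball, identifies it with Lebesgue measure.\<close>
lemma lborel_orthogonal:
  fixes f :: "'a::euclidean_space \<Rightarrow> 'a"
  assumes f: "orthogonal_transformation f"
  shows "distr lborel borel f = lborel"
proof (rule measure_eqI)
  have lin: "linear f" by (rule orthogonal_transformation_linear[OF f])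
  have [measurable]: "f \<in> borel_measurable borel"
    using lin by (intro borel_measurable_continuous_onI) (simp add: linear_continuous_on linear_linear)
  have surj: "f (inv f y) = y" for y
    by (rule surj_f_inv_f[OF orthogonal_transformation_surj[OF f]])
  define B where "B = cball (0::'a) 1"
  have B [measurable]: "B \<in> sets borel" by (simp add: B_def)
  let ?c = "emeasure lborel B"
  have c: "?c \<noteq> 0" "?c \<noteq> \<infinity>"
    using less_imp_neq[OF unit_ball_vol_pos[of "real DIM('a)"]] by (simp_all add: B_def emeasure_cball)
  fix A assume "A \<in> sets (distr lborel borel f)"
  then have [measurable]: "A \<in> sets borel" by simp
  have "?c * emeasure (distr lborel borel f) A
    = (\<integral>\<^sup>+(y::'a). indicator B y * (\<integral>\<^sup>+x. indicator A (f x) \<partial>lborel) \<partial>lborel)"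
    using nn_integral_distr[of f lborel borel "indicator A"] by (subst nn_integral_multc) simp_all
  \<comment> \<open>For each \<open>y\<close> the variable \<open>x\<close> is translated by
    \<open>inv f y\<close>, which adds \<open>y\<close> to \<open>f x\<close> by linearity. This is
    the translation invariance of the image measure.\<close>
  also have "\<dots> = (\<integral>\<^sup>+y. indicator B y * (\<integral>\<^sup>+x. indicator A (f x + y) \<partial>lborel) \<partial>lborel)"
  proof (rule nn_integral_cong, rule arg_cong2[where f = "(*)", OF refl])
    fix y :: 'a
    have "(\<integral>\<^sup>+x. indicator A (f x) \<partial>lborel) = ennreal (\<bar>1\<bar> ^ DIM('a)) * (\<integral>\<^sup>+x. indicator A (f (inv f y + 1 *\<^sub>R x)) \<partial>lborel)"
      by (rule nn_integral_affine) auto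
    then show "(\<integral>\<^sup>+x. indicator A (f x) \<partial>lborel) = (\<integral>\<^sup>+x. (indicator A (f x + y) :: ennreal) \<partial>lborel)"
      by (simp add: linear_add[OF lin] surj add.commute)
  qed
  also have "\<dots> = (\<integral>\<^sup>+y. \<integral>\<^sup>+x. indicator B y * indicator A (f x + y) \<partial>lborel \<partial>lborel)"
    by (intro nn_integral_cong nn_integral_cmult[symmetric]) auto
  also have "\<dots> = (\<integral>\<^sup>+x. \<integral>\<^sup>+y. indicator B y * indicator A (f x + y) \<partial>lborel \<partial>lborel)"
    by (rule lborel_pair.Fubini') measurable
  also have "\<dots> = (\<integral>\<^sup>+x. \<integral>\<^sup>+y. indicator B (y - f x) * indicator A y \<partial>lborel \<partial>lborel)"
  proof (rule nn_integral_cong)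
    fix x
    have "(\<integral>\<^sup>+y. indicator B y * indicator A (f x + y) \<partial>lborel) = ennreal (\<bar>1\<bar> ^ DIM('a)) *
      (\<integral>\<^sup>+y. (indicator B (- f x + 1 *\<^sub>R y) * indicator A (f x + (- f x + 1 *\<^sub>R y)) :: ennreal) \<partial>lborel)"
      by (rule nn_integral_affine) auto
    then show "(\<integral>\<^sup>+y. indicator B y * indicator A (f x + y) \<partial>lborel)
      = (\<integral>\<^sup>+y. (indicator B (y - f x) * indicator A y :: ennreal) \<partial>lborel)"
      by simp
  qed
  also have "\<dots> = (\<integral>\<^sup>+y. \<integral>\<^sup>+x. indicator B (y - f x) * indicator A y \<partial>lborel \<partial>lborel)"
    by (rule lborel_pair.Fubini') measurable
  also have "\<dots> = (\<integral>\<^sup>+y. ?c * indicator A y \<partial>lborel)"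
  proof (intro nn_integral_cong)
    fix y
    \<comment> \<open>Because \<open>f\<close> preserves norms, the \<open>x\<close> with
      \<open>y - f x\<close> in the unit ball form the unit ball about \<open>inv f y\<close>. Its
      volume \<open>?c\<close> is the same for all \<open>y\<close> and cancels at the end.\<close>
    have "dist 0 (y - f x) = dist (inv f y) x" for x
      using orthogonal_transformation_norm[OF f, of "inv f y - x"]
      by (simp add: dist_norm linear_diff[OF lin] surj norm_minus_commute)
    then have "(\<integral>\<^sup>+x. indicator B (y - f x) * indicator A y \<partial>lborel)
      = (\<integral>\<^sup>+x. indicator (cball (inv f y) 1) x * indicator A y \<partial>lborel)"
      by (intro nn_integral_cong) (auto simp: indicator_def B_def)
    also have "\<dots> = ?c * indicator A y"
      by (subst nn_integral_multc) (auto simp: emeasure_cball B_def intro!: borel_measurable_indicator)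
    finally show "(\<integral>\<^sup>+x. indicator B (y - f x) * indicator A y \<partial>lborel) = ?c * indicator A y" .
  qed
  also have "\<dots> = ?c * emeasure lborel A"
    by (simp add: nn_integral_cmult)
  finally show "emeasure (distr lborel borel f) A = emeasure lborel A"
    using c by (simp add: ennreal_mult_cancel_left)
qed simp

section \<open>The uniform laws on the ball and the sphere\<close>

lemma ball_volume_pos: "0 < ball_volume TYPE('n::finite)"
  by (simp add: ball_volume_def)

lemma emeasure_cball_ball_volume:
  assumes "r \<ge> 0"
  shows "emeasure lborel (cball (c :: real ^ 'n) r) = ennreal (ball_volume TYPE('n) * r ^ CARD('n))"
  using assms by (simp add: emeasure_cball ball_volume_def content_cball)

lemma measure_cball_ball_volume:
  assumes "r \<ge> 0"
  shows "measure lborel (cball (c :: real ^ 'n) r) = ball_volume TYPE('n) * r ^ CARD('n)"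
  using assms by (simp add: measure_def emeasure_cball_ball_volume ball_volume_pos less_imp_le)

lemma sets_uniform_ball [simp, measurable_cong]: "sets (uniform_ball :: (real ^ 'n) measure) = sets borel"
  by (simp add: uniform_ball_def)

lemma space_uniform_ball [simp]: "space (uniform_ball :: (real ^ 'n) measure) = UNIV"
  by (simp add: uniform_ball_def)

lemma sets_uniform_sphere [simp, measurable_cong]: "sets (uniform_sphere :: (real ^ 'n) measure) = sets borel"
  by (simp add: uniform_sphere_def)

lemma space_uniform_sphere [simp]: "space (uniform_sphere :: (real ^ 'n) measure) = UNIV"
  by (simp add: uniform_sphere_def)

lemma prob_space_uniform_ball: "prob_space (uniform_ball :: (real ^ 'n) measure)"
  unfolding uniform_ball_def
  by (rule prob_space_uniform_measure) (simp_all add: emeasure_cball less_imp_neq[OF unit_ball_vol_pos, symmetric])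

lemma prob_space_uniform_sphere: "prob_space (uniform_sphere :: (real ^ 'n) measure)"
  unfolding uniform_sphere_def by (rule prob_space.prob_space_distr[OF prob_space_uniform_ball]) simp

interpretation uniform_sphere: prob_space "uniform_sphere :: (real ^ 'n) measure"
  by (rule prob_space_uniform_sphere)

interpretation uniform_sphere2: pair_prob_space
  "uniform_sphere :: (real ^ 'n) measure" "uniform_sphere :: (real ^ 'n) measure" ..

lemma AE_uniform_sphere: "AE \<theta> in uniform_sphere. norm (\<theta> :: real ^ 'n) = 1"
proof -
  have "AE z in lborel. z \<noteq> (0 :: real ^ 'n)" by (rule AE_lborel_singleton)
  then have "AE z in uniform_ball. z \<noteq> (0 :: real ^ 'n)"
    unfolding uniform_ball_def by (intro AE_uniform_measureI) auto
  then show ?thesis unfolding uniform_sphere_def by (subst AE_distr_iff) auto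
qed

text \<open>Undoes the encoding of the surface measure as the law of a direction: spherical measures
  become volumes of truncated cones, which Fubini can compute.\<close>

lemma emeasure_uniform_sphere:
  assumes [measurable]: "B \<in> sets borel"
  shows "ennreal (ball_volume TYPE('n)) * emeasure uniform_sphere (B :: (real ^ 'n) set)
    = emeasure lborel {w. norm w \<le> 1 \<and> w /\<^sub>R norm w \<in> B}"
proof -
  have "emeasure uniform_sphere B = emeasure uniform_ball {w. w /\<^sub>R norm w \<in> B}"
    unfolding uniform_sphere_def by (subst emeasure_distr) (auto simp: vimage_def)
  also have "\<dots> = emeasure lborel (cball 0 1 \<inter> {w. w /\<^sub>R norm w \<in> B}) / ennreal (ball_volume TYPE('n))"
    unfolding uniform_ball_def by (subst emeasure_uniform_measure) (auto simp: emeasure_cball_ball_volume)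
  also have "cball 0 1 \<inter> {w. w /\<^sub>R norm w \<in> B} = {w. norm w \<le> 1 \<and> w /\<^sub>R norm w \<in> B}"
    by (auto simp: cball_def dist_norm)
  finally show ?thesis using ball_volume_pos[where 'n='n]
    by (simp add: ennreal_times_divide ennreal_mult_divide_eq mult.commute[of "ennreal _"])
qed

lemma distr_uniform_ball_orthogonal:
  assumes f: "orthogonal_transformation (f :: real ^ 'n \<Rightarrow> real ^ 'n)"
  shows "distr uniform_ball borel f = uniform_ball"
proof (rule measure_eqI)
  have [measurable]: "f \<in> borel_measurable borel"
    using f by (intro borel_measurable_continuous_onI)
      (simp add: linear_continuous_on linear_linear orthogonal_transformation_linear)
  fix A assume "A \<in> sets (distr uniform_ball borel f)"
  then have [measurable]: "A \<in> sets borel" by simp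
  have [measurable]: "f -` A \<in> sets borel" using measurable_sets[of f borel borel A] by simp
  have "emeasure (distr uniform_ball borel f) A = emeasure lborel (cball 0 1 \<inter> f -` A) / emeasure lborel (cball (0 :: real ^ 'n) 1)"
    by (simp add: emeasure_distr uniform_ball_def)
  also have "cball 0 1 \<inter> f -` A = f -` (cball 0 1 \<inter> A)"
    by (auto simp: dist_norm orthogonal_transformation_norm[OF f])
  also have "emeasure lborel (f -` (cball 0 1 \<inter> A)) = emeasure (distr lborel borel f) (cball 0 1 \<inter> A)"
    by (subst emeasure_distr) auto
  finally show "emeasure (distr uniform_ball borel f) A = emeasure uniform_ball A"
    by (simp add: lborel_orthogonal[OF f] uniform_ball_def)
qed simp

lemma distr_uniform_sphere_orthogonal:
  assumes f: "orthogonal_transformation (f :: real ^ 'n \<Rightarrow> real ^ 'n)"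
  shows "distr uniform_sphere borel f = uniform_sphere"
proof -
  have [measurable]: "f \<in> borel_measurable borel"
    using f by (intro borel_measurable_continuous_onI)
      (simp add: linear_continuous_on linear_linear orthogonal_transformation_linear)
  have "distr uniform_sphere borel f = distr (distr uniform_ball borel f) borel (\<lambda>z. z /\<^sub>R norm z)"
    unfolding uniform_sphere_def
    by (simp add: distr_distr comp_def orthogonal_transformation_norm[OF f]
        linear_scale[OF orthogonal_transformation_linear[OF f]])
  then show ?thesis by (simp add: distr_uniform_ball_orthogonal[OF f] uniform_sphere_def)
qed

text \<open>Dilation by \<open>root CARD('n) v\<close> multiplies volumes by exactly
  \<open>v\<close>. Measuring the radius by \<open>norm w ^ CARD('n)\<close> thus makes radial
  volume linear, and polar coordinates need no further Jacobian. For \<open>v \<le> 0\<close> the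
  set is contained in the origin.\<close>

lemma emeasure_sector:
  assumes [measurable]: "B \<in> sets borel"
  shows "emeasure lborel {w :: real ^ 'n. norm w ^ CARD('n) \<le> v \<and> w /\<^sub>R norm w \<in> B}
    = ennreal v * (ennreal (ball_volume TYPE('n)) * emeasure uniform_sphere B)"
proof (cases "v > 0")
  case False
  have "{w :: real ^ 'n. norm w ^ CARD('n) \<le> v \<and> w /\<^sub>R norm w \<in> B} \<subseteq> {0}"
    using False by (auto simp: not_less) (meson norm_ge_zero order_trans zero_less_card_finite zero_less_norm_iff zero_less_power not_le)
  then have "emeasure lborel {w :: real ^ 'n. norm w ^ CARD('n) \<le> v \<and> w /\<^sub>R norm w \<in> B} \<le> emeasure lborel {0 :: real ^ 'n}"
    by (intro emeasure_mono) auto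
  then show ?thesis using False by (simp add: ennreal_neg not_less)
next
  case True
  define r where "r = root CARD('n) v"
  have r: "r > 0" "r ^ CARD('n) = v" using True by (auto simp: r_def)
  have iff: "norm w ^ CARD('n) \<le> v \<longleftrightarrow> norm w \<le> r" for w :: "real ^ 'n"
    unfolding r(2)[symmetric] using r(1) by (intro power_mono_iff) auto
  have "emeasure lborel {w :: real ^ 'n. norm w ^ CARD('n) \<le> v \<and> w /\<^sub>R norm w \<in> B}
    = (\<integral>\<^sup>+w. indicator {w :: real ^ 'n. norm w \<le> r \<and> w /\<^sub>R norm w \<in> B} w \<partial>lborel)"
    by (simp add: iff)
  also have "\<dots> = ennreal (\<bar>r\<bar> ^ CARD('n)) * (\<integral>\<^sup>+w. indicator {w :: real ^ 'n. norm w \<le> r \<and> w /\<^sub>R norm w \<in> B} (0 + r *\<^sub>R w) \<partial>lborel)"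
    using r(1) by (subst nn_integral_affine[where c = r and t = 0]) auto
  also have "\<dots> = ennreal v * (\<integral>\<^sup>+w. indicator {w :: real ^ 'n. norm w \<le> 1 \<and> w /\<^sub>R norm w \<in> B} w \<partial>lborel)"
    using r by (intro arg_cong2[where f = "(*)"] nn_integral_cong) (auto simp: indicator_def field_simps)
  also have "\<dots> = ennreal v * (ennreal (ball_volume TYPE('n)) * emeasure uniform_sphere B)"
    by (subst emeasure_uniform_sphere) auto
  finally show ?thesis .
qed

text \<open>It is enough to test rectangles. For a fixed set \<open>B\<close> of directions both
  sides are measures of the radial set \<open>A\<close>, and they agree on half-lines by
  \<open>emeasure_sector\<close>.\<close>

lemma polar_measure:
  "density lborel (\<lambda>v. ennreal (ball_volume TYPE('n)) * indicator {0<..} v) \<Otimes>\<^sub>M uniform_sphere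
    = distr lborel (borel \<Otimes>\<^sub>M borel) (\<lambda>w :: real ^ 'n. (norm w ^ CARD('n), w /\<^sub>R norm w))"
proof (rule pair_measure_eqI)
  let ?M = "density lborel (\<lambda>v::real. ennreal (ball_volume TYPE('n)) * indicator {0<..} v)"
  show "sigma_finite_measure ?M"
    by (subst sigma_finite_measure.sigma_finite_iff_density_finite[OF sigma_finite_lborel]) (auto simp: ennreal_mult_eq_top_iff indicator_def)
  show "sigma_finite_measure (uniform_sphere :: (real ^ 'n) measure)" ..
  show "sets (?M \<Otimes>\<^sub>M uniform_sphere) = sets (distr lborel (borel \<Otimes>\<^sub>M borel) (\<lambda>w :: real ^ 'n. (norm w ^ CARD('n), w /\<^sub>R norm w)))"
    by (simp cong: sets_pair_measure_cong)
  fix A :: "real set" and B :: "(real ^ 'n) set" assume "A \<in> sets ?M" "B \<in> sets uniform_sphere"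
  then have [measurable]: "A \<in> sets borel" "B \<in> sets borel" by auto
  let ?s = "emeasure uniform_sphere B"
  have s: "?s < \<infinity>" by (simp add: less_top[symmetric])
  have IntD: "indicator {0<..} x * indicator {..v} x = (indicator {0<..v} x :: ennreal)" for x v :: real
    by (auto simp: indicator_def)
  have "density lborel (\<lambda>v. ?s * (ennreal (ball_volume TYPE('n)) * indicator {0<..} v))
    = distr (density lborel (\<lambda>w. indicator {w. w /\<^sub>R norm w \<in> B} w)) borel (\<lambda>w :: real ^ 'n. norm w ^ CARD('n))"
    (is "?L = ?R")
  proof (rule measure_real_eqI)
    fix v
    have "emeasure ?L {..v} = ?s * ennreal (ball_volume TYPE('n)) * emeasure lborel {0<..v}"
      by (simp add: emeasure_density mult.assoc nn_integral_cmult IntD)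
    also have "\<dots> = ennreal v * (ennreal (ball_volume TYPE('n)) * ?s)"
      by (cases "v \<ge> 0") (simp_all add: mult_ac ennreal_neg)
    finally have L: "emeasure ?L {..v} = ennreal v * (ennreal (ball_volume TYPE('n)) * ?s)" .
    have "emeasure ?R {..v} = emeasure (density lborel (\<lambda>w. indicator {w. w /\<^sub>R norm w \<in> B} w)) {w :: real ^ 'n. norm w ^ CARD('n) \<le> v}"
      by (subst emeasure_distr) (auto simp: vimage_def)
    also have "\<dots> = (\<integral>\<^sup>+ w. indicator {w :: real ^ 'n. norm w ^ CARD('n) \<le> v \<and> w /\<^sub>R norm w \<in> B} w \<partial>lborel)"
      by (subst emeasure_density) (auto intro!: nn_integral_cong simp del: nn_integral_indicator split: split_indicator)
    also have "\<dots> = emeasure ?L {..v}"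
      unfolding L by (subst emeasure_sector[symmetric]) auto
    finally show "emeasure ?L {..v} = emeasure ?R {..v}" ..
    show "emeasure ?L {..v} < \<infinity>"
      unfolding L using s by (simp add: ennreal_mult_less_top)
  qed auto
  then have "emeasure ?L A = emeasure ?R A" by simp
  also have "emeasure ?L A = ?s * emeasure ?M A"
    by (simp add: emeasure_density mult.assoc nn_integral_cmult)
  also have "emeasure ?R A = emeasure (density lborel (\<lambda>w. indicator {w. w /\<^sub>R norm w \<in> B} w)) {w :: real ^ 'n. norm w ^ CARD('n) \<in> A}"
    by (subst emeasure_distr) (auto simp: vimage_def)
  also have "\<dots> = (\<integral>\<^sup>+ w. indicator {w :: real ^ 'n. norm w ^ CARD('n) \<in> A \<and> w /\<^sub>R norm w \<in> B} w \<partial>lborel)"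
    by (subst emeasure_density) (auto intro!: nn_integral_cong simp del: nn_integral_indicator split: split_indicator)
  also have "\<dots> = emeasure (distr lborel (borel \<Otimes>\<^sub>M borel) (\<lambda>w :: real ^ 'n. (norm w ^ CARD('n), w /\<^sub>R norm w))) (A \<times> B)"
    by (subst emeasure_distr) (auto simp: vimage_def)
  finally show "emeasure ?M A * ?s = \<dots>" by (simp add: mult.commute)
qed

text \<open>The map in \<open>polar_measure\<close> is inverted by
  \<open>root CARD('n) v *\<^sub>R \<theta>\<close>, even at the origin, whose normalised direction
  is 0.\<close>

lemma nn_integral_polar:
  assumes [measurable]: "g \<in> borel_measurable borel"
  shows "(\<integral>\<^sup>+(w :: real ^ 'n). g w \<partial>lborel) = ennreal (ball_volume TYPE('n)) *
    (\<integral>\<^sup>+v. indicator {0<..} v * (\<integral>\<^sup>+\<theta>. g (root CARD('n) v *\<^sub>R \<theta>) \<partial>uniform_sphere) \<partial>lborel)"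
proof -
  let ?M = "density lborel (\<lambda>v::real. ennreal (ball_volume TYPE('n)) * indicator {0<..} v)"
  have [measurable]: "root CARD('n) \<in> borel_measurable borel"
    by (intro borel_measurable_continuous_onI continuous_intros)
  have "(\<integral>\<^sup>+(w :: real ^ 'n). g w \<partial>lborel) =
    (\<integral>\<^sup>+(w :: real ^ 'n). (\<lambda>(v, \<theta>). g (root CARD('n) v *\<^sub>R \<theta>)) (norm w ^ CARD('n), w /\<^sub>R norm w) \<partial>lborel)"
  proof (rule nn_integral_cong)
    fix w :: "real ^ 'n"
    have "root CARD('n) (norm w ^ CARD('n)) = norm w" by (intro real_root_power_cancel) auto
    then show "g w = (\<lambda>(v, \<theta>). g (root CARD('n) v *\<^sub>R \<theta>)) (norm w ^ CARD('n), w /\<^sub>R norm w)"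
      by (cases "w = 0") auto
  qed
  also have "\<dots> = (\<integral>\<^sup>+p. (\<lambda>(v, \<theta>). g (root CARD('n) v *\<^sub>R \<theta>)) p
      \<partial>distr lborel (borel \<Otimes>\<^sub>M borel) (\<lambda>w :: real ^ 'n. (norm w ^ CARD('n), w /\<^sub>R norm w)))"
    by (subst nn_integral_distr) auto
  also have "\<dots> = (\<integral>\<^sup>+v. \<integral>\<^sup>+\<theta>. g (root CARD('n) v *\<^sub>R \<theta>) \<partial>uniform_sphere \<partial>?M)"
    unfolding polar_measure[symmetric]
    by (subst uniform_sphere.nn_integral_fst[symmetric]) (auto cong: measurable_cong_sets)
  also have "\<dots> = (\<integral>\<^sup>+v. ennreal (ball_volume TYPE('n)) * (indicator {0<..} v *
      (\<integral>\<^sup>+\<theta>. g (root CARD('n) v *\<^sub>R \<theta>) \<partial>uniform_sphere)) \<partial>lborel)"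
    by (subst nn_integral_density) (auto simp: mult.assoc)
  also have "\<dots> = ennreal (ball_volume TYPE('n)) *
    (\<integral>\<^sup>+v. indicator {0<..} v * (\<integral>\<^sup>+\<theta>. g (root CARD('n) v *\<^sub>R \<theta>) \<partial>uniform_sphere) \<partial>lborel)"
    by (rule nn_integral_cmult) auto
  finally show ?thesis .
qed

section \<open>Spherical caps\<close>

text \<open>The function \<open>f\<close> may be unbounded near \<open>a\<close> and
  \<open>b\<close>, so the fundamental theorem is used in its improper form. The boundary limits it
  needs, 0 at \<open>a\<close> and 1 at \<open>b\<close>, come from the open interval carrying the
  whole mass.\<close>

lemma density_eq_of_cdf:
  fixes \<mu> :: "real measure"
  assumes "real_distribution \<mu>" and ab: "a < b"
    and supp: "measure \<mu> {a<..<b} = 1"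
    and F: "\<And>s. a < s \<Longrightarrow> s < b \<Longrightarrow> measure \<mu> {..s} = F s"
    and deriv: "\<And>s. a < s \<Longrightarrow> s < b \<Longrightarrow> DERIV F s :> f s"
    and cont: "continuous_on {a<..<b} f" and nonneg: "\<And>s. a < s \<Longrightarrow> s < b \<Longrightarrow> 0 \<le> f s"
  shows "\<mu> = density lborel (\<lambda>s. ennreal (indicator {a<..<b} s * f s))"
proof -
  interpret real_distribution \<mu> by fact
  have fm [measurable]: "(\<lambda>s. indicator {a<..<b} s * f s) \<in> borel_measurable borel"
    using borel_measurable_continuous_on_indicator[OF _ cont] by simp
  have cont': "isCont f s" if "a < s" "s < b" for s
    using cont that by (simp add: continuous_on_eq_continuous_at)
  have a0: "measure \<mu> {..a} = 0" and b1: "measure \<mu> {..<b} = 1"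
  proof -
    have "measure \<mu> ({..a} \<union> {a<..<b}) = measure \<mu> {..a} + measure \<mu> {a<..<b}"
      by (rule finite_measure_Union) auto
    then show "measure \<mu> {..a} = 0"
      using supp prob_le_1[of "{..a} \<union> {a<..<b}"] measure_nonneg[of \<mu> "{..a}"] by linarith
    have "measure \<mu> {a<..<b} \<le> measure \<mu> {..<b}" by (rule finite_measure_mono) auto
    then show "measure \<mu> {..<b} = 1" using supp prob_le_1[of "{..<b}"] by linarith
  qed
  have lim_a: "(F \<longlongrightarrow> 0) (at_right a)"
  proof -
    have "(cdf \<mu> \<longlongrightarrow> cdf \<mu> a) (at_right a)"
      using cdf_is_right_cont[of a] by (simp add: continuous_within)
    moreover have "eventually (\<lambda>s. cdf \<mu> s = F s) (at_right a)"
      using ab by (auto simp: eventually_at_right cdf_def F intro!: exI[of _ b])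
    ultimately show ?thesis using a0 by (simp add: cdf_def tendsto_cong)
  qed
  have lim_b: "(F \<longlongrightarrow> 1) (at_left b)"
  proof -
    have "(cdf \<mu> \<longlongrightarrow> 1) (at_left b)"
      using cdf_at_left[of b] b1 by simp
    moreover have "eventually (\<lambda>s. cdf \<mu> s = F s) (at_left b)"
      using ab by (auto simp: eventually_at_left cdf_def F intro!: exI[of _ a])
    ultimately show ?thesis by (simp add: tendsto_cong)
  qed
  have int: "(\<integral>\<^sup>+s. ennreal (f s) * indicator {a<..<v} s \<partial>lborel) = ennreal L"
    if v: "a < v" "v \<le> b" and lim: "(F \<longlongrightarrow> L) (at_left v)" for v L
  proof -
    have A: "((F \<circ> real_of_ereal) \<longlongrightarrow> 0) (at_right (ereal a))"
      using lim_a by (simp add: ereal_tendsto_simps)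
    have B: "((F \<circ> real_of_ereal) \<longlongrightarrow> L) (at_left (ereal v))"
      using lim by (simp add: ereal_tendsto_simps)
    have *: "set_integrable lborel (einterval (ereal a) (ereal v)) f"
      "(LBINT x=ereal a..ereal v. f x) = L - 0"
      by (rule interval_integral_FTC_nonneg[OF _ _ _ _ A B]; use v deriv cont' nonneg in \<open>auto\<close>)+
    then have i: "integrable lborel (\<lambda>s. indicator {a<..<v} s *\<^sub>R f s)"
      by (simp add: set_integrable_def)
    have "(\<integral>\<^sup>+s. ennreal (f s) * indicator {a<..<v} s \<partial>lborel) = (\<integral>\<^sup>+s. ennreal (indicator {a<..<v} s *\<^sub>R f s) \<partial>lborel)"
      by (intro nn_integral_cong) (auto split: split_indicator)
    also have "\<dots> = ennreal (\<integral>s. indicator {a<..<v} s *\<^sub>R f s \<partial>lborel)"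
      by (rule nn_integral_eq_integral[OF i]) (use v nonneg in \<open>auto split: split_indicator\<close>)
    also have "(\<integral>s. indicator {a<..<v} s *\<^sub>R f s \<partial>lborel) = L"
      using *(2) v by (simp add: interval_lebesgue_integral_def set_lebesgue_integral_def)
    finally show ?thesis .
  qed
  show ?thesis
  proof (rule measure_real_eqI)
    fix v :: real
    have D: "emeasure (density lborel (\<lambda>s. ennreal (indicator {a<..<b} s * f s))) {..v}
      = (\<integral>\<^sup>+s. ennreal (indicator {a<..<b} s * f s) * indicator {..v} s \<partial>lborel)"
      by (rule emeasure_density) auto
    consider "v \<le> a" | "a < v" "v < b" | "b \<le> v" by linarith
    then show "emeasure \<mu> {..v} = emeasure (density lborel (\<lambda>s. ennreal (indicator {a<..<b} s * f s))) {..v}"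
    proof cases
      case 1
      have "measure \<mu> {..v} \<le> measure \<mu> {..a}" using 1 by (intro finite_measure_mono) auto
      then have "emeasure \<mu> {..v} = 0" using a0 measure_nonneg[of \<mu> "{..v}"] by (simp add: emeasure_eq_measure)
      moreover have "(\<integral>\<^sup>+s. ennreal (indicator {a<..<b} s * f s) * indicator {..v} s \<partial>lborel) = (\<integral>\<^sup>+s. 0 \<partial>(lborel :: real measure))"
        using 1 by (intro nn_integral_cong) (auto split: split_indicator)
      ultimately show ?thesis unfolding D by simp
    next
      case 2
      have "(F \<longlongrightarrow> F v) (at_left v)"
        using DERIV_isCont[OF deriv[OF 2]] by (auto simp: isCont_def intro: tendsto_within_subset)
      then have "(\<integral>\<^sup>+s. ennreal (f s) * indicator {a<..<v} s \<partial>lborel) = ennreal (F v)"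
        using int 2 by auto
      moreover have "(\<integral>\<^sup>+s. ennreal (indicator {a<..<b} s * f s) * indicator {..v} s \<partial>lborel) = (\<integral>\<^sup>+s. ennreal (f s) * indicator {a<..<v} s \<partial>lborel)"
        using 2 AE_lborel_singleton[of v] by (intro nn_integral_cong_AE) (auto elim!: eventually_mono split: split_indicator)
      ultimately show ?thesis unfolding D using F[OF 2] by (simp add: emeasure_eq_measure)
    next
      case 3
      have "measure \<mu> {..<b} \<le> measure \<mu> {..v}" using 3 by (intro finite_measure_mono) auto
      then have "emeasure \<mu> {..v} = 1" using b1 prob_le_1[of "{..v}"] by (simp add: emeasure_eq_measure)
      moreover have "(\<integral>\<^sup>+s. ennreal (indicator {a<..<b} s * f s) * indicator {..v} s \<partial>lborel) = (\<integral>\<^sup>+s. ennreal (f s) * indicator {a<..<b} s \<partial>lborel)"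
        using 3 by (intro nn_integral_cong) (auto split: split_indicator)
      ultimately show ?thesis unfolding D using int[OF ab order_refl lim_b] by simp
    qed
    show "emeasure \<mu> {..v} < \<infinity>" by (simp add: less_top[symmetric])
  qed auto
qed

text \<open>The ball of radius \<open>v\<close> has volume
  \<open>unit_ball_vol (real (Suc m)) * v ^ Suc m\<close>, and the density is the derivative of this
  in \<open>v\<close>. The statement is about a product over an index set, not about a vector space,
  because it is applied to all basis vectors but one.\<close>

lemma distr_norm_PiM:
  assumes A: "finite A" and m: "card A = Suc m"
  shows "distr (Pi\<^sub>M A (\<lambda>_. lborel)) borel (\<lambda>f. sqrt (\<Sum>i\<in>A. (f i)\<^sup>2))
    = density lborel (\<lambda>\<rho>. ennreal (unit_ball_vol (real (Suc m)) * real (Suc m) * \<rho> ^ m) * indicator {0<..} \<rho>)"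
    (is "?L = ?R")
proof (rule measure_real_eqI)
  let ?K = "unit_ball_vol (real (Suc m))"
  have K: "?K > 0" by simp
  have L: "emeasure ?L {..v} = emeasure (Pi\<^sub>M A (\<lambda>_. lborel)) ({f. sqrt (\<Sum>i\<in>A. (f i)\<^sup>2) \<le> v} \<inter> space (Pi\<^sub>M A (\<lambda>_. lborel)))" for v
    by (subst emeasure_distr) (auto intro!: arg_cong2[where f = emeasure])
  have Lpos: "emeasure ?L {..v} = ennreal (?K * v ^ Suc m)" if "v > 0" for v
    unfolding L using emeasure_cball_aux[OF A that] m by simp
  \<comment> \<open>The formula in \<open>Lpos\<close> is for positive radii. For the others the set
    is compared with balls of radius \<open>1 / real (Suc n)\<close>, whose volumes tend to
    0.\<close>
  have L0: "emeasure ?L {..v} = 0" if "v \<le> 0" for v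
  proof -
    have "(\<lambda>n. ennreal (?K * (1 / real (Suc n)) ^ Suc m)) \<longlonglongrightarrow> ennreal (?K * 0 ^ Suc m)"
      by (intro tendsto_ennrealI tendsto_intros LIMSEQ_divide_realpow_zero lim_1_over_n[THEN LIMSEQ_Suc])
    moreover have "emeasure ?L {..v} \<le> ennreal (?K * (1 / real (Suc n)) ^ Suc m)" for n
    proof -
      have "emeasure ?L {..v} \<le> emeasure ?L {..1 / real (Suc n)}"
        using that by (intro emeasure_mono) (auto intro: order_trans)
      then show ?thesis by (subst (asm) Lpos[of "1 / real (Suc n)"]) auto
    qed
    ultimately have "emeasure ?L {..v} \<le> ennreal (?K * 0 ^ Suc m)"
      by (intro LIMSEQ_le_const) auto
    then show ?thesis by simp
  qed
  have R: "emeasure ?R {..v} = (\<integral>\<^sup>+\<rho>. ennreal (?K * real (Suc m) * \<rho> ^ m) * indicator {0<..} \<rho> * indicator {..v} \<rho> \<partial>lborel)" for v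
    by (rule emeasure_density) auto
  fix v
  show "emeasure ?L {..v} = emeasure ?R {..v}"
  proof (cases "v > 0")
    case False
    have "(\<integral>\<^sup>+\<rho>. ennreal (?K * real (Suc m) * \<rho> ^ m) * indicator {0<..} \<rho> * indicator {..v} \<rho> \<partial>lborel) = (\<integral>\<^sup>+\<rho>. 0 \<partial>(lborel :: real measure))"
      using False by (intro nn_integral_cong) (auto split: split_indicator)
    then show ?thesis using False L0[of v] unfolding R by simp
  next
    case True
    have "(\<integral>\<^sup>+\<rho>. ennreal (?K * real (Suc m) * \<rho> ^ m) * indicator {0<..} \<rho> * indicator {..v} \<rho> \<partial>lborel)
      = (\<integral>\<^sup>+\<rho>. ennreal (?K * real (Suc m) * \<rho> ^ m) * indicator {0..v} \<rho> \<partial>lborel)"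
      using AE_lborel_singleton[of 0] by (intro nn_integral_cong_AE) (auto elim!: eventually_mono split: split_indicator)
    also have "\<dots> = ennreal (?K * v ^ Suc m - ?K * 0 ^ Suc m)"
      using True K by (intro nn_integral_FTC_Icc) (auto intro!: derivative_eq_intros simp del: power_Suc)
    finally show ?thesis using Lpos[OF True] unfolding R by simp
  qed
  show "emeasure ?L {..v} < \<infinity>"
    using Lpos[of v] L0[of v] by (cases "v > 0") auto
qed auto

text \<open>Cylindrical coordinates about the axis \<open>e\<close> in dimension
  \<open>m + 2\<close>. A rotation moves \<open>e\<close> to a basis vector; its coordinate is split
  off the product measure, and the law of the norm of the remaining \<open>m + 1\<close> coordinates
  is \<open>distr_norm_PiM\<close>.\<close>

lemma nn_integral_cylindrical:
  fixes e :: "real ^ 'n" and g :: "real \<Rightarrow> real \<Rightarrow> ennreal"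
  assumes m: "CARD('n) = Suc (Suc m)" and e: "norm e = 1"
    and g [measurable]: "case_prod g \<in> borel_measurable (borel \<Otimes>\<^sub>M borel)"
  shows "(\<integral>\<^sup>+z. g (z \<bullet> e) (norm (z - (z \<bullet> e) *\<^sub>R e)) \<partial>lborel)
    = (\<integral>\<^sup>+x. \<integral>\<^sup>+\<rho>. ennreal (unit_ball_vol (real (Suc m)) * real (Suc m) * \<rho> ^ m) * indicator {0<..} \<rho> * g x \<rho> \<partial>lborel \<partial>lborel)"
proof -
  obtain b :: "real ^ 'n" where b: "b \<in> Basis" using nonempty_Basis by blast
  have "norm b = norm e" using b e by simp
  then obtain f where f: "orthogonal_transformation f" "f b = e"
    by (rule orthogonal_transformation_exists)
  have lin: "linear f" by (rule orthogonal_transformation_linear[OF f(1)])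
  have [measurable]: "f \<in> borel_measurable borel"
    using lin by (intro borel_measurable_continuous_onI) (simp add: linear_continuous_on linear_linear)
  have gm [measurable]: "(\<lambda>z :: real ^ 'n. g (z \<bullet> c) (norm (z - (z \<bullet> c) *\<^sub>R c))) \<in> borel_measurable borel" for c
    using measurable_compose[of "\<lambda>z. (z \<bullet> c, norm (z - (z \<bullet> c) *\<^sub>R c))" borel, OF _ g] by simp
  let ?A = "Basis - {b}"
  have bA: "insert b ?A = Basis" using b by blast
  define G where "G z = g (z \<bullet> b) (norm (z - (z \<bullet> b) *\<^sub>R b))" for z
  have Gm [measurable]: "G \<in> borel_measurable borel" unfolding G_def[abs_def] by (rule gm)
  interpret product_sigma_finite "\<lambda>_. lborel :: real measure" by standard
  have "(\<integral>\<^sup>+z. g (z \<bullet> e) (norm (z - (z \<bullet> e) *\<^sub>R e)) \<partial>lborel)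
    = (\<integral>\<^sup>+z. g (z \<bullet> e) (norm (z - (z \<bullet> e) *\<^sub>R e)) \<partial>distr lborel borel f)"
    by (simp add: lborel_orthogonal[OF f(1)])
  also have "\<dots> = (\<integral>\<^sup>+z. g (z \<bullet> b) (norm (z - (z \<bullet> b) *\<^sub>R b)) \<partial>lborel)"
  proof -
    have 1: "f z \<bullet> e = z \<bullet> b" for z
      using f(1) f(2)[symmetric] by (simp add: orthogonal_transformation_def)
    have 2: "norm (f z - c *\<^sub>R e) = norm (z - c *\<^sub>R b)" for z c
      using orthogonal_transformation_norm[OF f(1), of "z - c *\<^sub>R b"]
      by (simp only: linear_diff[OF lin] linear_scale[OF lin] f(2))
    have "(\<integral>\<^sup>+z. g (z \<bullet> e) (norm (z - (z \<bullet> e) *\<^sub>R e)) \<partial>distr lborel borel f)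
      = (\<integral>\<^sup>+z. g (f z \<bullet> e) (norm (f z - (f z \<bullet> e) *\<^sub>R e)) \<partial>lborel)"
      using gm[of e] by (intro nn_integral_distr) simp_all
    then show ?thesis by (simp only: 1 2)
  qed
  also have "\<dots> = (\<integral>\<^sup>+z. G z \<partial>distr (Pi\<^sub>M Basis (\<lambda>_. lborel)) borel (\<lambda>h. \<Sum>i\<in>Basis. h i *\<^sub>R i))"
    by (simp only: lborel_eq[where 'a = "real ^ 'n", symmetric] G_def)
  also have "\<dots> = (\<integral>\<^sup>+h. G (\<Sum>i\<in>Basis. h i *\<^sub>R i) \<partial>Pi\<^sub>M Basis (\<lambda>_. lborel))"
    by (rule nn_integral_distr) (auto simp: Gm)
  also have "\<dots> = (\<integral>\<^sup>+h. G (\<Sum>i\<in>Basis. h i *\<^sub>R i) \<partial>Pi\<^sub>M (insert b ?A) (\<lambda>_. lborel))"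
    by (simp only: bA)
  \<comment> \<open>Here \<open>x\<close> is the coordinate along \<open>b\<close>, and the root is
    the distance from the axis by Pythagoras.\<close>
  also have "\<dots> = (\<integral>\<^sup>+x. \<integral>\<^sup>+h. g x (sqrt (\<Sum>i\<in>?A. (h i)\<^sup>2)) \<partial>Pi\<^sub>M ?A (\<lambda>_. lborel) \<partial>lborel)"
  proof (subst product_nn_integral_insert_rev)
    have G_eq: "G (\<Sum>i\<in>Basis. (h(b := x)) i *\<^sub>R i) = g x (sqrt (\<Sum>i\<in>?A. (h i)\<^sup>2))" for x h
    proof -
      let ?y = "\<Sum>i\<in>?A. h i *\<^sub>R i"
      have z: "(\<Sum>i\<in>Basis. (h(b := x)) i *\<^sub>R i) = x *\<^sub>R b + ?y"
        unfolding sum.remove[OF finite_Basis b] by (intro arg_cong2[where f = "(+)"] sum.cong) auto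
      have y: "?y \<bullet> b = 0"
        unfolding inner_sum_left using b by (intro sum.neutral) (auto simp: inner_Basis)
      have bb: "b \<bullet> b = 1" using b by simp
      have "pairwise (\<lambda>i j. orthogonal (h i *\<^sub>R i) (h j *\<^sub>R j)) ?A"
        unfolding pairwise_def orthogonal_def by (auto simp: inner_Basis)
      then have "(norm ?y)\<^sup>2 = (\<Sum>i\<in>?A. (norm (h i *\<^sub>R i))\<^sup>2)"
        by (intro norm_sum_Pythagorean) auto
      also have "\<dots> = (\<Sum>i\<in>?A. (h i)\<^sup>2)" by (rule sum.cong[OF refl]) (simp add: power_mult_distrib)
      finally have "norm ?y = sqrt (\<Sum>i\<in>?A. (h i)\<^sup>2)" by (rule real_sqrt_unique[OF _ norm_ge_zero, symmetric])
      then show ?thesis unfolding G_def z by (simp add: inner_add_left y bb)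
    qed
    show "(\<integral>\<^sup>+x. \<integral>\<^sup>+h. G (\<Sum>i\<in>Basis. (h(b := x)) i *\<^sub>R i) \<partial>Pi\<^sub>M ?A (\<lambda>_. lborel) \<partial>lborel)
      = (\<integral>\<^sup>+x. \<integral>\<^sup>+h. g x (sqrt (\<Sum>i\<in>?A. (h i)\<^sup>2)) \<partial>Pi\<^sub>M ?A (\<lambda>_. lborel) \<partial>lborel)"
      by (simp only: G_eq)
    show "(\<lambda>h. G (\<Sum>i\<in>Basis. h i *\<^sub>R i)) \<in> borel_measurable (Pi\<^sub>M (insert b ?A) (\<lambda>_. lborel))"
      by (simp only: bA) measurable
  qed simp_all
  also have "\<dots> = (\<integral>\<^sup>+x. \<integral>\<^sup>+\<rho>. g x \<rho> \<partial>distr (Pi\<^sub>M ?A (\<lambda>_. lborel)) borel (\<lambda>h. sqrt (\<Sum>i\<in>?A. (h i)\<^sup>2)) \<partial>lborel)"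
    by (intro nn_integral_cong nn_integral_distr[symmetric]) measurable
  also have "\<dots> = (\<integral>\<^sup>+x. \<integral>\<^sup>+\<rho>. ennreal (unit_ball_vol (real (Suc m)) * real (Suc m) * \<rho> ^ m) * indicator {0<..} \<rho> * g x \<rho> \<partial>lborel \<partial>lborel)"
  proof (rule nn_integral_cong)
    fix x
    have "finite ?A" "card ?A = Suc m" using b m by (simp_all add: card_Diff_singleton)
    then show "(\<integral>\<^sup>+\<rho>. g x \<rho> \<partial>distr (Pi\<^sub>M ?A (\<lambda>_. lborel)) borel (\<lambda>h. sqrt (\<Sum>i\<in>?A. (h i)\<^sup>2)))
      = (\<integral>\<^sup>+\<rho>. ennreal (unit_ball_vol (real (Suc m)) * real (Suc m) * \<rho> ^ m) * indicator {0<..} \<rho> * g x \<rho> \<partial>lborel)"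
      by (simp only: distr_norm_PiM[where m = m]) (rule nn_integral_density; measurable)
  qed
  finally show ?thesis .
qed

lemma norm_decomp:
  fixes z e :: "'a::real_inner"
  assumes "norm e = 1"
  shows "(norm z)\<^sup>2 = (z \<bullet> e)\<^sup>2 + (norm (z - (z \<bullet> e) *\<^sub>R e))\<^sup>2"
proof -
  have "e \<bullet> e = 1" using assms by (simp add: norm_eq_sqrt_inner)
  then have "(norm (z - (z \<bullet> e) *\<^sub>R e))\<^sup>2 = z \<bullet> z - (z \<bullet> e)\<^sup>2"
    unfolding power2_norm_eq_inner
    by (simp add: inner_diff_left inner_diff_right inner_commute power2_eq_square)
  then show ?thesis by (simp add: power2_norm_eq_inner)
qed

lemma nn_integral_power_Ioc:
  assumes "c \<ge> 0" "R \<ge> 0"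
  shows "(\<integral>\<^sup>+\<rho>. ennreal (c * real (Suc m) * \<rho> ^ m) * indicator {0<..} \<rho> * of_bool (\<rho> \<le> R) \<partial>lborel) = ennreal (c * R ^ Suc m)"
proof -
  have "(\<integral>\<^sup>+\<rho>. ennreal (c * real (Suc m) * \<rho> ^ m) * indicator {0<..} \<rho> * of_bool (\<rho> \<le> R) \<partial>lborel)
    = (\<integral>\<^sup>+\<rho>. ennreal (c * real (Suc m) * \<rho> ^ m) * indicator {0..R} \<rho> \<partial>lborel)"
    using AE_lborel_singleton[of 0] by (intro nn_integral_cong_AE) (auto elim!: eventually_mono split: split_indicator)
  also have "\<dots> = ennreal (c * R ^ Suc m - c * 0 ^ Suc m)"
    using assms by (intro nn_integral_FTC_Icc) (auto intro!: derivative_eq_intros simp del: power_Suc)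
  finally show ?thesis by simp
qed

lemma nn_integral_indicator_Icc:
  fixes f :: "real \<Rightarrow> real"
  assumes [measurable]: "f \<in> borel_measurable borel" and f: "continuous_on {a..b} f" "\<And>x. 0 \<le> f x"
  shows "(\<integral>\<^sup>+x. ennreal (indicator {a..b} x * f x) \<partial>lborel) = ennreal (integral {a..b} f)"
proof -
  have "(f has_integral integral {a..b} f) {a..b}"
    using f by (simp add: integrable_continuous_real has_integral_integral[symmetric])
  then have "((\<lambda>x. indicator {a..b} x * f x) has_integral integral {a..b} f) UNIV"
    by (subst (asm) has_integral_restrict_UNIV[symmetric]) (erule has_integral_eq[rotated], simp add: indicator_def)
  then show ?thesis using f by (intro nn_integral_has_integral_lborel) auto
qed

section \<open>Volumes of caps and of intersections of two balls\<close>

text \<open>For \<open>- r \<le> c \<le> r\<close>: the volume of the part of a ball of radius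
  \<open>r\<close> in dimension \<open>m + 2\<close> beyond a hyperplane at signed distance
  \<open>c\<close> from its centre. Truncating at 0 makes the integrand continuous on the whole
  line.\<close>

definition cap_volume :: "nat \<Rightarrow> real \<Rightarrow> real \<Rightarrow> real" where
  "cap_volume m r c = unit_ball_vol (real (Suc m)) * integral {c..r} (\<lambda>x. sqrt (max 0 (r\<^sup>2 - x\<^sup>2)) ^ Suc m)"

text \<open>The slice at height \<open>x\<close> along \<open>e\<close> is a ball of radius
  \<open>sqrt (r\<^sup>2 - x\<^sup>2)\<close> in dimension \<open>m + 1\<close>.\<close>

lemma emeasure_cap_centered:
  fixes e :: "real ^ 'n"
  assumes m: "CARD('n) = Suc (Suc m)" and e: "norm e = 1" and r: "r \<ge> 0" and c: "c \<le> r"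
  shows "emeasure lborel {z. norm z \<le> r \<and> c \<le> z \<bullet> e} = ennreal (cap_volume m r c)"
proof -
  let ?K = "unit_ball_vol (real (Suc m))"
  let ?h = "\<lambda>x. sqrt (max 0 (r\<^sup>2 - x\<^sup>2)) ^ Suc m"
  have K: "?K \<ge> 0" by simp
  have iff: "norm z \<le> r \<longleftrightarrow> (z \<bullet> e)\<^sup>2 + (norm (z - (z \<bullet> e) *\<^sub>R e))\<^sup>2 \<le> r\<^sup>2" for z
    unfolding norm_decomp[OF e, symmetric] using r by (simp add: power_mono_iff)
  have "emeasure lborel {z. norm z \<le> r \<and> c \<le> z \<bullet> e} = (\<integral>\<^sup>+z. indicator {z. norm z \<le> r \<and> c \<le> z \<bullet> e} z \<partial>lborel)"
    by simp
  also have "\<dots> = (\<integral>\<^sup>+z. (\<lambda>x \<rho>. of_bool (c \<le> x \<and> x\<^sup>2 + \<rho>\<^sup>2 \<le> r\<^sup>2)) (z \<bullet> e) (norm (z - (z \<bullet> e) *\<^sub>R e)) \<partial>lborel)"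
    by (intro nn_integral_cong) (auto simp: iff indicator_def)
  also have "\<dots> = (\<integral>\<^sup>+x. \<integral>\<^sup>+\<rho>. ennreal (?K * real (Suc m) * \<rho> ^ m) * indicator {0<..} \<rho> * of_bool (c \<le> x \<and> x\<^sup>2 + \<rho>\<^sup>2 \<le> r\<^sup>2) \<partial>lborel \<partial>lborel)"
    by (rule nn_integral_cylindrical[OF m e]) measurable
  also have "\<dots> = (\<integral>\<^sup>+x. indicator {c..r} x * ennreal (?K * ?h x) \<partial>lborel)"
  proof (rule nn_integral_cong)
    fix x
    let ?R = "sqrt (max 0 (r\<^sup>2 - x\<^sup>2))"
    \<comment> \<open>Where \<open>x\<^sup>2\<close> exceeds \<open>r\<^sup>2\<close> the truncated
      radius is 0, so that no positive \<open>\<rho>\<close> satisfies either side.\<close>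
    have ob: "of_bool (c \<le> x \<and> x\<^sup>2 + \<rho>\<^sup>2 \<le> r\<^sup>2) = (indicator {c..} x * of_bool (\<rho> \<le> ?R) :: ennreal)" if "\<rho> > 0" for \<rho>
    proof -
      have "x\<^sup>2 + \<rho>\<^sup>2 \<le> r\<^sup>2 \<longleftrightarrow> \<rho> \<le> ?R"
      proof (cases "x\<^sup>2 \<le> r\<^sup>2")
        case True
        then have "x\<^sup>2 + \<rho>\<^sup>2 \<le> r\<^sup>2 \<longleftrightarrow> sqrt (\<rho>\<^sup>2) \<le> ?R" by (simp only: real_sqrt_le_iff) linarith
        then show ?thesis using that by simp
      next
        case False
        then have "?R = 0" by simp
        moreover have "\<rho>\<^sup>2 \<ge> 0" by simp
        ultimately show ?thesis using that False by linarith
      qed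
      then show ?thesis by (simp add: indicator_def)
    qed
    have "(\<integral>\<^sup>+\<rho>. ennreal (?K * real (Suc m) * \<rho> ^ m) * indicator {0<..} \<rho> * of_bool (c \<le> x \<and> x\<^sup>2 + \<rho>\<^sup>2 \<le> r\<^sup>2) \<partial>lborel)
      = (\<integral>\<^sup>+\<rho>. indicator {c..} x * (ennreal (?K * real (Suc m) * \<rho> ^ m) * indicator {0<..} \<rho> * of_bool (\<rho> \<le> ?R)) \<partial>lborel)"
    proof (intro nn_integral_cong)
      fix \<rho> :: real
      show "ennreal (?K * real (Suc m) * \<rho> ^ m) * indicator {0<..} \<rho> * of_bool (c \<le> x \<and> x\<^sup>2 + \<rho>\<^sup>2 \<le> r\<^sup>2)
        = indicator {c..} x * (ennreal (?K * real (Suc m) * \<rho> ^ m) * indicator {0<..} \<rho> * of_bool (\<rho> \<le> ?R))"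
      proof (cases "\<rho> > 0")
        case True
        show ?thesis unfolding ob[OF True] by (simp only: mult_ac)
      qed simp
    qed
    also have "\<dots> = indicator {c..} x * ennreal (?K * ?h x)"
    proof -
      have "?R \<ge> 0" by simp
      then show ?thesis by (subst nn_integral_cmult, measurable) (simp only: nn_integral_power_Ioc[OF K])
    qed
    also have "\<dots> = indicator {c..r} x * ennreal (?K * ?h x)"
    proof (cases "x \<le> r")
      case False
      then have "r\<^sup>2 \<le> x\<^sup>2" using r by (intro power_mono) auto
      then show ?thesis by simp
    qed (simp add: indicator_def)
    finally show "(\<integral>\<^sup>+\<rho>. ennreal (?K * real (Suc m) * \<rho> ^ m) * indicator {0<..} \<rho> * of_bool (c \<le> x \<and> x\<^sup>2 + \<rho>\<^sup>2 \<le> r\<^sup>2) \<partial>lborel)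
      = indicator {c..r} x * ennreal (?K * ?h x)" .
  qed
  also have "\<dots> = ennreal (?K * integral {c..r} ?h)"
  proof -
    have "(\<integral>\<^sup>+x. ennreal (indicator {c..r} x * (?K * ?h x)) \<partial>lborel) = ennreal (integral {c..r} (\<lambda>x. ?K * ?h x))"
      using K by (intro nn_integral_indicator_Icc continuous_intros) auto
    moreover have "integral {c..r} (\<lambda>x. ?K * ?h x) = ?K * integral {c..r} ?h"
      by (rule integral_mult_right)
    moreover have "ennreal (indicator {c..r} x * (?K * ?h x)) = indicator {c..r} x * ennreal (?K * ?h x)" for x
      by (simp add: indicator_def)
    ultimately show ?thesis by simp
  qed
  finally show ?thesis by (simp add: cap_volume_def)
qed

lemma emeasure_cap:
  fixes e a :: "real ^ 'n"
  assumes m: "CARD('n) = Suc (Suc m)" and e: "norm e = 1" and r: "r \<ge> 0" and c: "c \<le> r"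
  shows "emeasure lborel {z. norm (z - a) \<le> r \<and> c \<le> (z - a) \<bullet> e} = ennreal (cap_volume m r c)"
proof -
  have "emeasure lborel {z. norm (z - a) \<le> r \<and> c \<le> (z - a) \<bullet> e} = (\<integral>\<^sup>+z. indicator {z. norm (z - a) \<le> r \<and> c \<le> (z - a) \<bullet> e} z \<partial>lborel)"
    by simp
  also have "\<dots> = ennreal (\<bar>1\<bar> ^ DIM(real ^ 'n)) * (\<integral>\<^sup>+z. indicator {z. norm (z - a) \<le> r \<and> c \<le> (z - a) \<bullet> e} (a + 1 *\<^sub>R z) \<partial>lborel)"
    by (rule nn_integral_affine) auto
  also have "\<dots> = (\<integral>\<^sup>+z. indicator {z. norm z \<le> r \<and> c \<le> z \<bullet> e} z \<partial>lborel)"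
    by (simp add: indicator_def)
  also have "\<dots> = ennreal (cap_volume m r c)"
    using emeasure_cap_centered[OF assms] by simp
  finally show ?thesis .
qed

lemma cap_volume_nonneg: "0 \<le> cap_volume m r c"
  unfolding cap_volume_def by (intro mult_nonneg_nonneg integral_nonneg integrable_continuous_real continuous_intros) auto

lemma cap_volume_self [simp]: "cap_volume m r r = 0"
  by (simp add: cap_volume_def)

lemma cap_volume_split:
  assumes "a \<le> c" "c \<le> r"
  shows "cap_volume m r c = cap_volume m r a - unit_ball_vol (real (Suc m)) * integral {a..c} (\<lambda>x. sqrt (max 0 (r\<^sup>2 - x\<^sup>2)) ^ Suc m)"
proof -
  let ?h = "\<lambda>x. sqrt (max 0 (r\<^sup>2 - x\<^sup>2)) ^ Suc m"
  have "?h integrable_on {a..r}" by (intro integrable_continuous_real continuous_intros)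
  then have "integral {a..c} ?h + integral {c..r} ?h = integral {a..r} ?h"
    using assms by (intro Henstock_Kurzweil_Integration.integral_combine) auto
  then show ?thesis unfolding cap_volume_def by (simp add: algebra_simps flip: distrib_left)
qed

lemma DERIV_cap_volume:
  assumes "- r < c" "c < r"
  shows "DERIV (cap_volume m r) c :> - unit_ball_vol (real (Suc m)) * sqrt (r\<^sup>2 - c\<^sup>2) ^ Suc m"
proof -
  let ?h = "\<lambda>x. sqrt (max 0 (r\<^sup>2 - x\<^sup>2)) ^ Suc m"
  let ?K = "unit_ball_vol (real (Suc m))"
  have "((\<lambda>x. integral {-r..x} ?h) has_real_derivative ?h c) (at c within {-r..r})"
    using assms by (intro integral_has_real_derivative continuous_intros) auto
  then have d: "((\<lambda>x. integral {-r..x} ?h) has_real_derivative ?h c) (at c)"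
    using assms by (simp add: at_within_Icc_at)
  have "c\<^sup>2 \<le> r\<^sup>2" using assms by (intro power2_le_iff_abs_le[THEN iffD2]) auto
  then have h: "?h c = sqrt (r\<^sup>2 - c\<^sup>2) ^ Suc m" by simp
  have D: "((\<lambda>x. cap_volume m r (-r) - ?K * integral {-r..x} ?h) has_real_derivative 0 - ?K * ?h c) (at c)"
    by (intro DERIV_diff DERIV_const DERIV_cmult d)
  have "(cap_volume m r has_real_derivative 0 - ?K * ?h c) (at c)"
  proof (rule has_field_derivative_transform_within_open[OF D, of "{-r<..<r}"])
    show "cap_volume m r (-r) - ?K * integral {-r..x} ?h = cap_volume m r x" if "x \<in> {-r<..<r}" for x
      using cap_volume_split[of "-r" x r m] that by simp
  qed (use assms in auto)
  then show ?thesis unfolding h by simp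
qed

lemma continuous_on_cap_volume: "r \<ge> 0 \<Longrightarrow> continuous_on {-r..r} (cap_volume m r)"
proof -
  assume r: "r \<ge> 0"
  let ?h = "\<lambda>x. sqrt (max 0 (r\<^sup>2 - x\<^sup>2)) ^ Suc m"
  have "continuous_on {-r..r} (\<lambda>x. cap_volume m r (-r) - unit_ball_vol (real (Suc m)) * integral {-r..x} ?h)"
    by (rule continuous_on_diff[OF continuous_on_const continuous_on_mult[OF continuous_on_const indefinite_integral_continuous_1]])
      (intro integrable_continuous_real continuous_intros)
  then show ?thesis
    by (rule continuous_on_eq) (rule cap_volume_split[symmetric]; simp)
qed

text \<open>A cut at \<open>- r\<close> removes nothing. This evaluates the limit in which the
  smaller of two balls is swallowed by the larger one.\<close>

lemma cap_volume_full:
  assumes m: "CARD('n::finite) = Suc (Suc m)" and r: "r \<ge> 0"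
  shows "cap_volume m r (- r) = ball_volume TYPE('n) * r ^ CARD('n)"
proof -
  obtain e :: "real ^ 'n" where e: "norm e = 1" using vector_choose_size[of 1] by auto
  have "- r \<le> z \<bullet> e" if "norm z \<le> r" for z
    using Cauchy_Schwarz_ineq2[of z e] e that by simp
  then have "{z. norm z \<le> r \<and> - r \<le> z \<bullet> e} = cball 0 r" by (auto simp: dist_norm)
  then have "ennreal (cap_volume m r (- r)) = ennreal (ball_volume TYPE('n) * r ^ CARD('n))"
    using emeasure_cap_centered[OF m e r, of "-r"] r emeasure_cball_ball_volume[OF r, of "0 :: real ^ 'n"] by simp
  then show ?thesis using r ball_volume_pos[where 'n = 'n] cap_volume_nonneg
    by (subst (asm) ennreal_inj) (auto intro!: mult_nonneg_nonneg simp: less_imp_le)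
qed

text \<open>The half balls with axes \<open>e\<close> and \<open>- e\<close> cover the ball. Only
  this inequality is needed, to bound a limit from above when the two radii coincide.\<close>

lemma cap_volume_half:
  assumes m: "CARD('n::finite) = Suc (Suc m)" and r: "r \<ge> 0"
  shows "ball_volume TYPE('n) * r ^ CARD('n) \<le> 2 * cap_volume m r 0"
proof -
  obtain e :: "real ^ 'n" where e: "norm e = 1" using vector_choose_size[of 1] by auto
  have e': "norm (- e) = 1" using e by simp
  have "ennreal (ball_volume TYPE('n) * r ^ CARD('n)) = emeasure lborel (cball (0 :: real ^ 'n) r)"
    using emeasure_cball_ball_volume[OF r, of "0 :: real ^ 'n"] by simp
  also have "\<dots> \<le> emeasure lborel ({z. norm z \<le> r \<and> 0 \<le> z \<bullet> e} \<union> {z. norm z \<le> r \<and> 0 \<le> z \<bullet> - e})"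
    by (intro emeasure_mono) (auto simp: dist_norm)
  also have "\<dots> \<le> ennreal (cap_volume m r 0) + ennreal (cap_volume m r 0)"
    using emeasure_cap_centered[OF m e r, of 0] emeasure_cap_centered[OF m e' r, of 0] r
    by (intro order_trans[OF emeasure_subadditive]) auto
  also have "\<dots> = ennreal (2 * cap_volume m r 0)"
    using cap_volume_nonneg[of m r 0] by (simp add: ennreal_plus[symmetric] del: ennreal_plus)
  finally show ?thesis using cap_volume_nonneg[of m r 0] by (subst (asm) ennreal_le_iff) auto
qed

text \<open>The intersection is cut by the radical hyperplane, where both balls have equal power;
  \<open>x\<close> is its signed distance from \<open>a\<close> in the direction of
  \<open>b\<close>. On either side only one of the two balls is restrictive, which leaves two
  caps.\<close>

lemma emeasure_cball_Int_cball:
  fixes a b :: "real ^ 'n"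
  assumes m: "CARD('n) = Suc (Suc m)" and r: "r1 \<ge> 0" "r2 \<ge> 0"
    and \<rho>: "\<rho> = dist a b" "\<rho> > 0" and x: "x = (\<rho>\<^sup>2 + r1\<^sup>2 - r2\<^sup>2) / (2 * \<rho>)" "x \<le> r1" "\<rho> - x \<le> r2"
  shows "emeasure lborel (cball a r1 \<inter> cball b r2) = ennreal (cap_volume m r1 x + cap_volume m r2 (\<rho> - x))"
proof -
  define e where "e = (b - a) /\<^sub>R \<rho>"
  have e: "norm e = 1" "norm (- e) = 1" using \<rho> by (simp_all add: e_def dist_norm norm_minus_commute)
  have ba: "b = a + \<rho> *\<^sub>R e" using \<rho>(2) by (simp add: e_def)
  have ee: "e \<bullet> e = 1" using e by (simp add: norm_eq_sqrt_inner)
  let ?A = "{z. norm (z - a) \<le> r1 \<and> x \<le> (z - a) \<bullet> e}"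
  let ?B = "{z. norm (z - b) \<le> r2 \<and> \<rho> - x \<le> (z - b) \<bullet> (- e)}"
  have zb: "(z - b) \<bullet> (- e) = \<rho> - (z - a) \<bullet> e" for z
    unfolding ba by (simp add: algebra_simps ee)
  have nb: "(norm (z - b))\<^sup>2 = (norm (z - a))\<^sup>2 - 2 * (\<rho> * ((z - a) \<bullet> e)) + \<rho>\<^sup>2" for z
    unfolding ba power2_norm_eq_inner by (simp add: algebra_simps ee power2_eq_square inner_commute)
  have xr: "2 * (\<rho> * x) = \<rho>\<^sup>2 + r1\<^sup>2 - r2\<^sup>2" using \<rho>(2) by (simp add: x(1))
  have le1: "norm (z - a) \<le> r1 \<longleftrightarrow> (norm (z - a))\<^sup>2 \<le> r1\<^sup>2" and le2: "norm (z - b) \<le> r2 \<longleftrightarrow> (norm (z - b))\<^sup>2 \<le> r2\<^sup>2" for z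
    using r by (simp_all add: power_mono_iff)
  \<comment> \<open>The powers of \<open>z\<close> with respect to the two balls differ by
    \<open>2 * \<rho> * (x - (z - a) \<bullet> e)\<close>. So on the side of \<open>?A\<close>
    membership in the ball about \<open>a\<close> implies membership in the other, and conversely on
    the side of \<open>?B\<close>.\<close>
  have eq: "cball a r1 \<inter> cball b r2 = ?A \<union> ?B"
  proof (rule set_eqI)
    fix z
    have "\<rho> * x \<le> \<rho> * ((z - a) \<bullet> e) \<longleftrightarrow> x \<le> (z - a) \<bullet> e" "\<rho> * ((z - a) \<bullet> e) \<le> \<rho> * x \<longleftrightarrow> (z - a) \<bullet> e \<le> x"
      using \<rho>(2) by (simp_all add: mult_le_cancel_left_pos)
    moreover have "z \<in> cball a r1 \<longleftrightarrow> norm (z - a) \<le> r1" "z \<in> cball b r2 \<longleftrightarrow> norm (z - b) \<le> r2"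
      by (simp_all add: dist_norm norm_minus_commute)
    ultimately show "z \<in> cball a r1 \<inter> cball b r2 \<longleftrightarrow> z \<in> ?A \<union> ?B"
      unfolding Un_iff Int_iff mem_Collect_eq le1 le2 zb
      using nb[of z] xr by argo
  qed
  have "?A \<inter> ?B \<subseteq> {z. e \<bullet> z = x + a \<bullet> e}"
    unfolding zb by (auto simp: algebra_simps inner_commute)
  moreover have "{z. e \<bullet> z = x + a \<bullet> e} \<in> null_sets lborel"
  proof -
    have "negligible {z. e \<bullet> z = x + a \<bullet> e}" using e by (intro negligible_hyperplane) auto
    then show ?thesis by (simp add: negligible_iff_null_sets null_sets_completion_iff)
  qed
  ultimately have null: "?A \<inter> ?B \<in> null_sets lborel"
    by (rule null_sets_subset[rotated 2]) measurable
  have "emeasure lborel (cball a r1 \<inter> cball b r2) = emeasure lborel ?A + emeasure lborel ?B"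
    unfolding eq by (rule emeasure_Un'[OF _ _ null]) measurable
  also have "\<dots> = ennreal (cap_volume m r1 x) + ennreal (cap_volume m r2 (\<rho> - x))"
    using emeasure_cap[OF m e(1) r(1) x(2), of a] emeasure_cap[OF m e(2) r(2) x(3), of b] by simp
  also have "\<dots> = ennreal (cap_volume m r1 x + cap_volume m r2 (\<rho> - x))"
    by (simp add: cap_volume_nonneg)
  finally show ?thesis .
qed

section \<open>The law of the cotangent of the angle between a fixed and a uniform direction\<close>

text \<open>The density of the cotangent of the angle between a fixed axis and a uniform direction.
  The last factor is the sine to the power \<open>d\<close>: the angle has density proportional to
  the sine to the power \<open>d - 2\<close>, and the cotangent contributes the square. The constant
  is the ratio of the surface areas of the unit spheres in dimensions \<open>d - 1\<close> and
  \<open>d\<close>.\<close>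

definition cot_density :: "'n::finite itself \<Rightarrow> real \<Rightarrow> real" where
  "cot_density TYPE('n) y = unit_ball_vol (real (CARD('n) - 1)) * real (CARD('n) - 1) / (real CARD('n) * ball_volume TYPE('n))
     * (1 / sqrt (1 + y\<^sup>2)) ^ CARD('n)"

lemma cot_density_nonneg: "0 \<le> cot_density TYPE('n::finite) y"
  using ball_volume_pos[where 'n = 'n] unfolding cot_density_def by (intro mult_nonneg_nonneg divide_nonneg_nonneg) auto

lemma continuous_on_cot_density [continuous_intros]: "continuous_on A (cot_density TYPE('n::finite))"
  unfolding cot_density_def[abs_def]
  by (intro continuous_intros) (auto simp: add_nonneg_eq_0_iff)

lemma borel_measurable_cot_density [measurable]: "cot_density TYPE('n::finite) \<in> borel_measurable borel"
  by (intro borel_measurable_continuous_onI continuous_on_cot_density)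

text \<open>The set says that the cotangent of the angle to \<open>e\<close> is at least
  \<open>\<kappa>\<close>. It is invariant under positive dilations, so its spherical measure is the
  volume of a cone in the unit ball, computed in cylindrical coordinates.\<close>

lemma emeasure_uniform_sphere_cone:
  fixes e :: "real ^ 'n"
  assumes m: "CARD('n) = Suc (Suc m)" and e: "norm e = 1"
  shows "emeasure uniform_sphere {\<theta>. \<kappa> * norm (\<theta> - (\<theta> \<bullet> e) *\<^sub>R e) \<le> \<theta> \<bullet> e}
    = (\<integral>\<^sup>+y. ennreal (cot_density TYPE('n) y) * indicator {\<kappa>..} y \<partial>lborel)"
proof -
  let ?C = "unit_ball_vol (real (Suc m)) * real (Suc m)"
  let ?c = "ball_volume TYPE('n)"
  let ?B = "{\<theta>. \<kappa> * norm (\<theta> - (\<theta> \<bullet> e) *\<^sub>R e) \<le> \<theta> \<bullet> e}"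
  have c: "?c > 0" by (rule ball_volume_pos)
  have C: "?C \<ge> 0" by simp
  have B [measurable]: "?B \<in> sets borel" by measurable
  have cone: "w /\<^sub>R norm w \<in> ?B \<longleftrightarrow> w \<in> ?B" for w
  proof (cases "w = 0")
    case False
    have "w /\<^sub>R norm w - ((w /\<^sub>R norm w) \<bullet> e) *\<^sub>R e = (w - (w \<bullet> e) *\<^sub>R e) /\<^sub>R norm w"
      by (simp add: algebra_simps)
    then have "norm (w /\<^sub>R norm w - ((w /\<^sub>R norm w) \<bullet> e) *\<^sub>R e) = norm (w - (w \<bullet> e) *\<^sub>R e) / norm w"
      by (simp add: divide_inverse mult.commute)
    then show ?thesis using False by (simp add: field_simps)
  qed simp
  have iff: "norm z \<le> 1 \<longleftrightarrow> (z \<bullet> e)\<^sup>2 + (norm (z - (z \<bullet> e) *\<^sub>R e))\<^sup>2 \<le> 1" for z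
    unfolding norm_decomp[OF e, symmetric] by (simp add: abs_square_le_1)
  have "ennreal ?c * emeasure uniform_sphere ?B = emeasure lborel {w. norm w \<le> 1 \<and> w /\<^sub>R norm w \<in> ?B}"
    by (rule emeasure_uniform_sphere[OF B])
  also have "\<dots> = emeasure lborel {w. norm w \<le> 1 \<and> w \<in> ?B}" by (simp only: cone)
  also have "\<dots> = (\<integral>\<^sup>+z. indicator {w. norm w \<le> 1 \<and> w \<in> ?B} z \<partial>lborel)"
    by (rule nn_integral_indicator[symmetric]) measurable
  also have "\<dots> = (\<integral>\<^sup>+z. (\<lambda>x \<rho>. of_bool (x\<^sup>2 + \<rho>\<^sup>2 \<le> 1 \<and> \<kappa> * \<rho> \<le> x)) (z \<bullet> e) (norm (z - (z \<bullet> e) *\<^sub>R e)) \<partial>lborel)"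
    by (intro nn_integral_cong) (auto simp: iff indicator_def)
  also have "\<dots> = (\<integral>\<^sup>+x. \<integral>\<^sup>+\<rho>. ennreal (?C * \<rho> ^ m) * indicator {0<..} \<rho> * of_bool (x\<^sup>2 + \<rho>\<^sup>2 \<le> 1 \<and> \<kappa> * \<rho> \<le> x) \<partial>lborel \<partial>lborel)"
    by (rule nn_integral_cylindrical[OF m e]) measurable
  also have "\<dots> = (\<integral>\<^sup>+\<rho>. \<integral>\<^sup>+x. ennreal (?C * \<rho> ^ m) * indicator {0<..} \<rho> * of_bool (x\<^sup>2 + \<rho>\<^sup>2 \<le> 1 \<and> \<kappa> * \<rho> \<le> x) \<partial>lborel \<partial>lborel)"
    by (rule lborel_pair.Fubini') measurable
  \<comment> \<open>Substitution \<open>x = \<rho> * y\<close>, where \<open>y\<close> is the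
    cotangent. The Jacobian raises the power of \<open>\<rho>\<close> by one, and the unit ball
    becomes the bound \<open>\<rho> \<le> 1 / sqrt (1 + y\<^sup>2)\<close>.\<close>
  also have "\<dots> = (\<integral>\<^sup>+\<rho>. \<integral>\<^sup>+y. indicator {\<kappa>..} y * (ennreal (?C * \<rho> ^ Suc m) * indicator {0<..} \<rho> * of_bool (\<rho> \<le> 1 / sqrt (1 + y\<^sup>2))) \<partial>lborel \<partial>lborel)"
  proof (rule nn_integral_cong)
    fix \<rho> :: real
    show "(\<integral>\<^sup>+x. ennreal (?C * \<rho> ^ m) * indicator {0<..} \<rho> * of_bool (x\<^sup>2 + \<rho>\<^sup>2 \<le> 1 \<and> \<kappa> * \<rho> \<le> x) \<partial>lborel)
      = (\<integral>\<^sup>+y. indicator {\<kappa>..} y * (ennreal (?C * \<rho> ^ Suc m) * indicator {0<..} \<rho> * of_bool (\<rho> \<le> 1 / sqrt (1 + y\<^sup>2))) \<partial>lborel)"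
    proof (cases "\<rho> > 0")
      case True
      have "(\<integral>\<^sup>+x. ennreal (?C * \<rho> ^ m) * indicator {0<..} \<rho> * of_bool (x\<^sup>2 + \<rho>\<^sup>2 \<le> 1 \<and> \<kappa> * \<rho> \<le> x) \<partial>lborel)
        = ennreal \<bar>\<rho>\<bar> * (\<integral>\<^sup>+y. ennreal (?C * \<rho> ^ m) * indicator {0<..} \<rho> * of_bool ((0 + \<rho> * y)\<^sup>2 + \<rho>\<^sup>2 \<le> 1 \<and> \<kappa> * \<rho> \<le> 0 + \<rho> * y) \<partial>lborel)"
        using True by (intro nn_integral_real_affine) auto
      also have "\<dots> = (\<integral>\<^sup>+y. ennreal \<bar>\<rho>\<bar> * (ennreal (?C * \<rho> ^ m) * indicator {0<..} \<rho> * of_bool ((0 + \<rho> * y)\<^sup>2 + \<rho>\<^sup>2 \<le> 1 \<and> \<kappa> * \<rho> \<le> 0 + \<rho> * y)) \<partial>lborel)"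
        by (rule nn_integral_cmult[symmetric]) measurable
      also have "\<dots> = (\<integral>\<^sup>+y. indicator {\<kappa>..} y * (ennreal (?C * \<rho> ^ Suc m) * indicator {0<..} \<rho> * of_bool (\<rho> \<le> 1 / sqrt (1 + y\<^sup>2))) \<partial>lborel)"
      proof (rule nn_integral_cong)
        fix y :: real
        have p: "1 + y\<^sup>2 > 0" by (simp add: add_pos_nonneg)
        have "(0 + \<rho> * y)\<^sup>2 + \<rho>\<^sup>2 \<le> 1 \<longleftrightarrow> \<rho>\<^sup>2 * (1 + y\<^sup>2) \<le> 1" by (simp add: algebra_simps power_mult_distrib)
        also have "\<dots> \<longleftrightarrow> sqrt (\<rho>\<^sup>2 * (1 + y\<^sup>2)) \<le> sqrt 1" by (simp only: real_sqrt_le_iff)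
        also have "\<dots> \<longleftrightarrow> \<rho> * sqrt (1 + y\<^sup>2) \<le> 1" using True by (simp add: real_sqrt_mult)
        also have "\<dots> \<longleftrightarrow> \<rho> \<le> 1 / sqrt (1 + y\<^sup>2)" using p by (simp add: pos_le_divide_eq)
        finally have 1: "(0 + \<rho> * y)\<^sup>2 + \<rho>\<^sup>2 \<le> 1 \<longleftrightarrow> \<rho> \<le> 1 / sqrt (1 + y\<^sup>2)" .
        have 2: "\<kappa> * \<rho> \<le> 0 + \<rho> * y \<longleftrightarrow> \<kappa> \<le> y" using True by (simp add: mult.commute)
        have 3: "ennreal (?C * \<rho> ^ Suc m) = ennreal \<bar>\<rho>\<bar> * ennreal (?C * \<rho> ^ m)"
          using True by (subst ennreal_mult[symmetric]) (auto simp: mult_ac)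
        show "ennreal \<bar>\<rho>\<bar> * (ennreal (?C * \<rho> ^ m) * indicator {0<..} \<rho> * of_bool ((0 + \<rho> * y)\<^sup>2 + \<rho>\<^sup>2 \<le> 1 \<and> \<kappa> * \<rho> \<le> 0 + \<rho> * y))
          = indicator {\<kappa>..} y * (ennreal (?C * \<rho> ^ Suc m) * indicator {0<..} \<rho> * of_bool (\<rho> \<le> 1 / sqrt (1 + y\<^sup>2)))"
          unfolding 1 2 3 by (simp add: indicator_def mult_ac)
      qed
      finally show ?thesis .
    qed simp
  qed
  also have "\<dots> = (\<integral>\<^sup>+y. \<integral>\<^sup>+\<rho>. indicator {\<kappa>..} y * (ennreal (?C * \<rho> ^ Suc m) * indicator {0<..} \<rho> * of_bool (\<rho> \<le> 1 / sqrt (1 + y\<^sup>2))) \<partial>lborel \<partial>lborel)"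
    by (rule lborel_pair.Fubini') measurable
  also have "\<dots> = (\<integral>\<^sup>+y. ennreal ?c * (ennreal (cot_density TYPE('n) y) * indicator {\<kappa>..} y) \<partial>lborel)"
  proof (rule nn_integral_cong)
    fix y :: real
    have "(\<integral>\<^sup>+\<rho>. indicator {\<kappa>..} y * (ennreal (?C * \<rho> ^ Suc m) * indicator {0<..} \<rho> * of_bool (\<rho> \<le> 1 / sqrt (1 + y\<^sup>2))) \<partial>lborel)
      = indicator {\<kappa>..} y * (\<integral>\<^sup>+\<rho>. ennreal (?C / real (Suc (Suc m)) * real (Suc (Suc m)) * \<rho> ^ Suc m) * indicator {0<..} \<rho> * of_bool (\<rho> \<le> 1 / sqrt (1 + y\<^sup>2)) \<partial>lborel)"
      by (subst nn_integral_cmult, measurable)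
    also have "\<dots> = indicator {\<kappa>..} y * ennreal (?C / real (Suc (Suc m)) * (1 / sqrt (1 + y\<^sup>2)) ^ Suc (Suc m))"
      by (subst nn_integral_power_Ioc) auto
    also have "?C / real (Suc (Suc m)) * (1 / sqrt (1 + y\<^sup>2)) ^ Suc (Suc m) = ?c * cot_density TYPE('n) y"
      using c by (simp add: cot_density_def m)
    finally show "(\<integral>\<^sup>+\<rho>. indicator {\<kappa>..} y * (ennreal (?C * \<rho> ^ Suc m) * indicator {0<..} \<rho> * of_bool (\<rho> \<le> 1 / sqrt (1 + y\<^sup>2))) \<partial>lborel)
      = ennreal ?c * (ennreal (cot_density TYPE('n) y) * indicator {\<kappa>..} y)"
      using c by (simp add: ennreal_mult' mult_ac)
  qed
  also have "\<dots> = ennreal ?c * (\<integral>\<^sup>+y. ennreal (cot_density TYPE('n) y) * indicator {\<kappa>..} y \<partial>lborel)"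
    by (rule nn_integral_cmult) measurable
  finally show ?thesis using c by (simp add: ennreal_mult_cancel_left)
qed

text \<open>Makes the cotangent, a quotient by the distance from the axis, well defined almost
  surely. In cylindrical coordinates the axis is \<open>\<rho> = 0\<close>, a null set.\<close>

lemma AE_uniform_sphere_not_parallel:
  fixes e :: "real ^ 'n"
  assumes m: "CARD('n) = Suc (Suc m)" and e: "norm e = 1"
  shows "AE \<theta> in uniform_sphere. \<theta> - (\<theta> \<bullet> e) *\<^sub>R e \<noteq> 0"
proof -
  let ?C = "unit_ball_vol (real (Suc m)) * real (Suc m)"
  let ?g = "\<lambda>x \<rho>. of_bool (\<rho> = (0::real)) :: ennreal"
  have "(\<integral>\<^sup>+z. (\<lambda>x \<rho>. of_bool (\<rho> = (0::real))) (z \<bullet> e) (norm (z - (z \<bullet> e) *\<^sub>R e)) \<partial>lborel)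
    = (\<integral>\<^sup>+x. \<integral>\<^sup>+\<rho>. ennreal (?C * \<rho> ^ m) * indicator {0<..} \<rho> * ?g x \<rho> \<partial>lborel \<partial>(lborel :: real measure))"
    by (rule nn_integral_cylindrical[OF m e]) measurable
  also have "\<dots> = (\<integral>\<^sup>+x. \<integral>\<^sup>+\<rho>. 0 \<partial>(lborel :: real measure) \<partial>(lborel :: real measure))"
    by (rule nn_integral_cong, rule nn_integral_cong) (simp add: indicator_def)
  finally have "(\<integral>\<^sup>+z. indicator {z. z - (z \<bullet> e) *\<^sub>R e = 0} z \<partial>lborel) = 0"
    by (simp add: indicator_def del: right_minus_eq)
  then have 0: "emeasure lborel {z. z - (z \<bullet> e) *\<^sub>R e = 0} = 0"
    by (subst (asm) nn_integral_indicator) auto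
  have "ennreal (ball_volume TYPE('n)) * emeasure uniform_sphere {z. z - (z \<bullet> e) *\<^sub>R e = 0}
    = emeasure lborel {w. norm w \<le> 1 \<and> w /\<^sub>R norm w \<in> {z. z - (z \<bullet> e) *\<^sub>R e = 0}}"
    by (rule emeasure_uniform_sphere) measurable
  also have "\<dots> \<le> emeasure lborel {z. z - (z \<bullet> e) *\<^sub>R e = 0}"
  proof (rule emeasure_mono)
    show "{w. norm w \<le> 1 \<and> w /\<^sub>R norm w \<in> {z. z - (z \<bullet> e) *\<^sub>R e = 0}} \<subseteq> {z. z - (z \<bullet> e) *\<^sub>R e = 0}"
    proof (intro subsetI, elim CollectE conjE)
      fix w assume w: "w /\<^sub>R norm w - ((w /\<^sub>R norm w) \<bullet> e) *\<^sub>R e = 0"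
      have "w /\<^sub>R norm w - ((w /\<^sub>R norm w) \<bullet> e) *\<^sub>R e = (w - (w \<bullet> e) *\<^sub>R e) /\<^sub>R norm w"
        by (simp add: algebra_simps)
      then have "w = 0 \<or> w - (w \<bullet> e) *\<^sub>R e = 0" using w by simp
      then show "w \<in> {z. z - (z \<bullet> e) *\<^sub>R e = 0}" by auto
    qed
  qed measurable
  finally have "emeasure uniform_sphere {z. z - (z \<bullet> e) *\<^sub>R e = 0} = 0"
    using 0 ball_volume_pos[where 'n = 'n] by simp
  then show ?thesis by (intro AE_I[where N = "{z. z - (z \<bullet> e) *\<^sub>R e = 0}"]) auto
qed

lemma DERIV_uniform_sphere_cone:
  fixes e :: "real ^ 'n"
  assumes m: "CARD('n) = Suc (Suc m)" and e: "norm e = 1"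
  shows "DERIV (\<lambda>\<kappa>. measure uniform_sphere {\<theta>. \<kappa> * norm (\<theta> - (\<theta> \<bullet> e) *\<^sub>R e) \<le> \<theta> \<bullet> e}) \<kappa> :> - cot_density TYPE('n) \<kappa>"
proof -
  define U where "U \<kappa> = measure uniform_sphere {\<theta>. \<kappa> * norm (\<theta> - (\<theta> \<bullet> e) *\<^sub>R e) \<le> \<theta> \<bullet> e}" for \<kappa>
  let ?u = "cot_density TYPE('n)"
  have U: "ennreal (U \<kappa>) = (\<integral>\<^sup>+y. ennreal (?u y) * indicator {\<kappa>..} y \<partial>lborel)" for \<kappa>
    unfolding U_def uniform_sphere.emeasure_eq_measure[symmetric] by (rule emeasure_uniform_sphere_cone[OF m e])
  have split: "U a = integral {a..b} ?u + U b" if "a \<le> b" for a b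
  proof -
    have i: "(\<integral>\<^sup>+y. indicator {a..b} y * ?u y \<partial>lborel) = ennreal (integral {a..b} ?u)"
      by (intro nn_integral_indicator_Icc continuous_on_cot_density) (auto simp: cot_density_nonneg)
    have "ennreal (U a) = (\<integral>\<^sup>+y. ennreal (indicator {a..b} y * ?u y) + ennreal (?u y) * indicator {b..} y \<partial>lborel)"
      unfolding U using that AE_lborel_singleton[of b]
      by (intro nn_integral_cong_AE) (auto elim!: eventually_mono split: split_indicator)
    also have "\<dots> = ennreal (integral {a..b} ?u) + ennreal (U b)"
      unfolding U i[symmetric] by (rule nn_integral_add) measurable
    also have "\<dots> = ennreal (integral {a..b} ?u + U b)"
      by (rule ennreal_plus[symmetric])
        (auto simp: U_def intro!: integral_nonneg integrable_continuous_real continuous_on_cot_density cot_density_nonneg)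
    finally show ?thesis
      by (subst (asm) ennreal_inj)
        (auto simp: U_def intro!: add_nonneg_nonneg integral_nonneg integrable_continuous_real continuous_on_cot_density cot_density_nonneg)
  qed
  have "((\<lambda>x. integral {\<kappa> - 1..x} ?u) has_real_derivative ?u \<kappa>) (at \<kappa> within {\<kappa> - 1..\<kappa> + 1})"
    by (intro integral_has_real_derivative continuous_on_cot_density) auto
  then have d: "((\<lambda>x. integral {\<kappa> - 1..x} ?u) has_real_derivative ?u \<kappa>) (at \<kappa>)"
    by (simp add: at_within_Icc_at)
  have D: "((\<lambda>x. U (\<kappa> - 1) - integral {\<kappa> - 1..x} ?u) has_real_derivative 0 - ?u \<kappa>) (at \<kappa>)"
    by (intro DERIV_diff DERIV_const d)
  have "(U has_real_derivative 0 - ?u \<kappa>) (at \<kappa>)"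
    by (rule has_field_derivative_transform_within_open[OF D, of "{\<kappa> - 1<..<\<kappa> + 1}"])
      (use split[of "\<kappa> - 1"] in \<open>simp_all add: algebra_simps\<close>)
  then show ?thesis unfolding U_def by simp
qed

section \<open>The density of the volume of the union\<close>

text \<open>If a strictly decreasing \<open>W\<close> parametrises the values, the distribution
  function is \<open>U\<close> composed with the inverse \<open>V\<close> of \<open>W\<close>, and
  the chain rule yields the density \<open>u / (- D)\<close> at \<open>V s\<close>. Since
  \<open>D\<close> never vanishes it is continuous on all of the open interval.\<close>

lemma continuous_density_of_parametrization:
  fixes W D U u :: "real \<Rightarrow> real"
  assumes \<mu>: "real_distribution \<mu>"
    and W: "\<And>\<kappa>. DERIV W \<kappa> :> D \<kappa>" "\<And>\<kappa>. D \<kappa> < 0" "continuous_on UNIV D"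
    and lim: "(W \<longlongrightarrow> A) at_top" "(W \<longlongrightarrow> B) at_bot"
    and U: "\<And>\<kappa>. DERIV U \<kappa> :> - u \<kappa>" "\<And>\<kappa>. 0 \<le> u \<kappa>" "continuous_on UNIV u"
    and cdf: "\<And>\<kappa>. measure \<mu> {..W \<kappa>} = U \<kappa>" and supp: "measure \<mu> (range W) = 1"
  shows "\<exists>f. f \<in> borel_measurable borel \<and> (\<forall>s. 0 \<le> f s) \<and> continuous_on {A<..<B} f \<and> \<mu> = density lborel (\<lambda>s. ennreal (f s))"
proof -
  have dec: "W y < W x" if "x < y" for x y
    by (rule DERIV_neg_imp_decreasing[OF that]) (use W in blast)
  have inj: "inj W"
  proof (rule injI)
    fix x y assume "W x = W y"
    then show "x = y" using dec[of x y] dec[of y x] by (cases x y rule: linorder_cases) simp_all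
  qed
  \<comment> \<open>The limit alone gives a weak inequality; comparing at
    \<open>\<kappa> + 1\<close> makes it strict.\<close>
  have W_gt: "A < W \<kappa>" for \<kappa>
  proof -
    have "eventually (\<lambda>x. W x \<le> W (\<kappa> + 1)) at_top"
      using eventually_gt_at_top[of "\<kappa> + 1"] by eventually_elim (rule less_imp_le[OF dec])
    then have "A \<le> W (\<kappa> + 1)" by (rule tendsto_upperbound[OF lim(1)]) simp
    then show ?thesis using dec[of \<kappa> "\<kappa> + 1"] by simp
  qed
  have W_lt: "W \<kappa> < B" for \<kappa>
  proof -
    have "eventually (\<lambda>x. W (\<kappa> - 1) \<le> W x) at_bot"
      using eventually_gt_at_bot[of "\<kappa> - 1"] by eventually_elim (rule less_imp_le[OF dec])
    then have "W (\<kappa> - 1) \<le> B" by (rule tendsto_lowerbound[OF lim(2)]) simp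
    then show ?thesis using dec[of "\<kappa> - 1" \<kappa>] by simp
  qed
  have contW: "isCont W \<kappa>" for \<kappa> using W(1) by (rule DERIV_isCont)
  have AB: "A < B" using W_gt[of 0] W_lt[of 0] by simp
  have ran: "\<exists>\<kappa>. W \<kappa> = s" if s: "A < s" "s < B" for s
  proof -
    obtain b where b: "W b < s" "b > 0"
      using eventually_happens'[OF trivial_limit_at_top_linorder eventually_conj[OF order_tendstoD(2)[OF lim(1) s(1)] eventually_gt_at_top[of 0]]] by blast
    obtain a where a: "s < W a" "a < 0"
      using eventually_happens'[OF trivial_limit_at_bot_linorder eventually_conj[OF order_tendstoD(1)[OF lim(2) s(2)] eventually_gt_at_bot[of 0]]] by blast
    have "\<exists>x. a \<le> x \<and> x \<le> b \<and> W x = s"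
      using a b by (intro IVT2) (simp_all add: contW)
    then show ?thesis by blast
  qed
  have rangeW: "range W = {A<..<B}"
  proof (intro equalityI subsetI)
    show "s \<in> {A<..<B}" if "s \<in> range W" for s
    proof -
      from that obtain \<kappa> where "s = W \<kappa>" by blast
      then show ?thesis by (simp add: W_gt W_lt)
    qed
    show "s \<in> range W" if "s \<in> {A<..<B}" for s
    proof -
      have "A < s" "s < B" using that by simp_all
      then obtain \<kappa> where "W \<kappa> = s" using ran[of s] by blast
      then show ?thesis by blast
    qed
  qed
  define V where "V = inv W"
  have VW: "V (W \<kappa>) = \<kappa>" for \<kappa> using inj by (simp add: V_def)
  have WV: "W (V s) = s" if s: "A < s" "s < B" for s
  proof -
    obtain \<kappa> where "W \<kappa> = s" using ran[OF s] by blast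
    then show ?thesis using VW[of \<kappa>] by simp
  qed
  have contV: "isCont V s" if s: "A < s" "s < B" for s
  proof -
    have "isCont V (W (V s))"
      by (rule isCont_inverse_function2[of "V s - 1" _ "V s + 1"]) (simp_all add: VW contW)
    then show ?thesis using WV[OF s] by simp
  qed
  have derV: "DERIV V s :> inverse (D (V s))" if s: "A < s" "s < B" for s
    using less_imp_neq[OF W(2), of "V s"]
    by (intro DERIV_inverse_function[where f = W and a = A and b = B] W(1) WV contV s)
  define f where "f s = (if A < s \<and> s < B then u (V s) * inverse (- D (V s)) else 0)" for s
  have f0: "0 \<le> f s" for s
    using U(2)[of "V s"] W(2)[of "V s"] by (simp add: f_def mult_nonneg_nonpos divide_nonneg_nonpos)
  have contVon: "continuous_on {A<..<B} V"
    using contV by (intro continuous_at_imp_continuous_on) auto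
  have "continuous_on {A<..<B} (\<lambda>s. u (V s) * inverse (- D (V s)))"
    by (intro continuous_on_mult continuous_on_inverse continuous_on_minus
        continuous_on_compose2[OF U(3) contVon] continuous_on_compose2[OF W(3) contVon])
      (simp_all add: less_imp_neq[OF W(2)])
  then have fc: "continuous_on {A<..<B} f"
    by (rule continuous_on_eq) (simp add: f_def)
  have "\<mu> = density lborel (\<lambda>s. ennreal (indicator {A<..<B} s * f s))"
  proof (rule density_eq_of_cdf[OF \<mu> AB, where F = "\<lambda>s. U (V s)"])
    show "measure \<mu> {A<..<B} = 1" using supp rangeW by simp
    show "measure \<mu> {..s} = U (V s)" if "A < s" "s < B" for s
      using cdf[of "V s"] WV[OF that] by simp
    show "DERIV (\<lambda>s. U (V s)) s :> f s" if "A < s" "s < B" for s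
      using DERIV_chain2[OF U(1) derV[OF that]] that by (simp add: f_def divide_inverse)
  qed (use fc f0 in auto)
  also have "(\<lambda>s. ennreal (indicator {A<..<B} s * f s)) = (\<lambda>s. ennreal (f s))"
    by (intro ext) (simp add: f_def indicator_def)
  finally have "\<mu> = density lborel (\<lambda>s. ennreal (f s))" .
  moreover have "(\<lambda>s. indicator {A<..<B} s * f s) = f" by (intro ext) (simp add: f_def indicator_def)
  moreover have "(\<lambda>s. indicator {A<..<B} s * f s) \<in> borel_measurable borel"
    using borel_measurable_continuous_on_indicator[OF _ fc] by simp
  ultimately show ?thesis using f0 fc by (intro exI[of _ f]) simp
qed

text \<open>The volume is the measure of a section of a measurable set in the product with
  \<open>lborel\<close>.\<close>

lemma borel_measurable_union_volume [measurable (raw)]: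
  fixes g1 g2 :: "'a \<Rightarrow> real ^ 'n"
  assumes [measurable]: "f1 \<in> borel_measurable M" "f2 \<in> borel_measurable M" "g1 \<in> borel_measurable M" "g2 \<in> borel_measurable M"
  shows "(\<lambda>x. union_volume (f1 x) (f2 x) (g1 x) (g2 x)) \<in> borel_measurable M"
proof -
  define Q where "Q = {p \<in> space (M \<Otimes>\<^sub>M (lborel :: (real ^ 'n) measure)).
    dist (f1 (fst p) *\<^sub>R g1 (fst p)) (snd p) \<le> f1 (fst p) \<or> dist (f2 (fst p) *\<^sub>R g2 (fst p)) (snd p) \<le> f2 (fst p)}"
  have "Q \<in> sets (M \<Otimes>\<^sub>M lborel)" unfolding Q_def by measurable
  then have "(\<lambda>x. emeasure lborel (Pair x -` Q)) \<in> borel_measurable M"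
    by (rule lborel.measurable_emeasure_Pair)
  then have "(\<lambda>x. enn2real (emeasure lborel (Pair x -` Q))) \<in> borel_measurable M"
    by measurable
  then show ?thesis
  proof (rule measurable_cong[THEN iffD1, rotated])
    fix x assume "x \<in> space M"
    then have "Pair x -` Q = cball (f1 x *\<^sub>R g1 x) (f1 x) \<union> cball (f2 x *\<^sub>R g2 x) (f2 x)"
      by (auto simp: Q_def space_pair_measure)
    then show "enn2real (emeasure lborel (Pair x -` Q)) = union_volume (f1 x) (f2 x) (g1 x) (g2 x)"
      by (simp add: union_volume_def measure_def)
  qed
qed

lemma union_volume_eq:
  fixes \<theta>1 \<theta>2 :: "real ^ 'n"
  assumes "r1 \<ge> 0" "r2 \<ge> 0"
  shows "union_volume r1 r2 \<theta>1 \<theta>2 = ball_volume TYPE('n) * r1 ^ CARD('n) + ball_volume TYPE('n) * r2 ^ CARD('n)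
    - measure lborel (cball (r1 *\<^sub>R \<theta>1) r1 \<inter> cball (r2 *\<^sub>R \<theta>2) r2)"
  unfolding union_volume_def
  by (subst measure_Un3) (auto simp: measure_cball_ball_volume assms fmeasurable_def emeasure_cball)

text \<open>The quotient is the cosine of the angle with cotangent \<open>\<kappa>\<close>; the
  limit is that of angle 0.\<close>

lemma tendsto_cot_to_cos: "((\<lambda>\<kappa>::real. \<kappa> / sqrt (1 + \<kappa>\<^sup>2)) \<longlongrightarrow> 1) at_top"
proof -
  have "((\<lambda>\<kappa>::real. 1 / sqrt (inverse \<kappa> ^ 2 + 1)) \<longlongrightarrow> 1 / sqrt (0 ^ 2 + 1)) at_top"
    by (intro tendsto_intros tendsto_inverse_0_at_top filterlim_ident) auto
  moreover have "eventually (\<lambda>\<kappa>::real. 1 / sqrt (inverse \<kappa> ^ 2 + 1) = \<kappa> / sqrt (1 + \<kappa>\<^sup>2)) at_top"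
    using eventually_gt_at_top[of "0::real"]
  proof eventually_elim
    case (elim \<kappa>)
    have "inverse \<kappa> ^ 2 + 1 = (1 + \<kappa>\<^sup>2) / \<kappa>\<^sup>2" using elim by (simp add: field_simps)
    then show ?case using elim by (simp add: real_sqrt_divide)
  qed
  ultimately show ?thesis by (simp add: tendsto_cong)
qed

lemma tendsto_cot_to_cos_bot: "((\<lambda>\<kappa>::real. \<kappa> / sqrt (1 + \<kappa>\<^sup>2)) \<longlongrightarrow> - 1) at_bot"
proof -
  have "((\<lambda>\<kappa>::real. - (\<kappa> / sqrt (1 + \<kappa>\<^sup>2))) \<longlongrightarrow> - 1) at_top"
    by (intro tendsto_minus tendsto_cot_to_cos)
  then show ?thesis by (simp add: filterlim_at_bot_mirror)
qed

lemma DERIV_cot_to_cos: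
  "DERIV (\<lambda>\<kappa>::real. \<kappa> / sqrt (1 + \<kappa>\<^sup>2)) \<kappa> :> (1 / sqrt (1 + \<kappa>\<^sup>2)) ^ 3"
proof -
  have p: "1 + \<kappa>\<^sup>2 > 0" by (simp add: add_pos_nonneg)
  define s where "s = sqrt (1 + \<kappa>\<^sup>2)"
  have s: "s > 0" "s\<^sup>2 = 1 + \<kappa>\<^sup>2" using p by (simp_all add: s_def)
  have "DERIV (\<lambda>\<kappa>::real. sqrt (1 + \<kappa>\<^sup>2)) \<kappa> :> \<kappa> / s"
    using p unfolding s_def by (auto intro!: derivative_eq_intros simp: field_simps)
  then have "DERIV (\<lambda>\<kappa>::real. \<kappa> / sqrt (1 + \<kappa>\<^sup>2)) \<kappa> :> (1 * s - \<kappa> * (\<kappa> / s)) / (s * s)"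
    using s unfolding s_def by (intro DERIV_divide DERIV_ident) auto
  moreover have "(1 * s - \<kappa> * (\<kappa> / s)) / (s * s) = (1 / s) ^ 3"
  proof -
    have "1 * s - \<kappa> * (\<kappa> / s) = (s\<^sup>2 - \<kappa>\<^sup>2) / s" using s(1) by (simp add: field_simps power2_eq_square)
    also have "\<dots> = 1 / s" using s by simp
    finally show ?thesis using s by (simp add: power3_eq_cube)
  qed
  ultimately show ?thesis unfolding s_def by simp
qed

lemma abs_cot_to_cos_less: "\<bar>\<kappa> / sqrt (1 + \<kappa>\<^sup>2)\<bar> < (1::real)"
proof -
  have "sqrt (\<kappa>\<^sup>2) < sqrt (1 + \<kappa>\<^sup>2)" by (simp only: real_sqrt_less_iff)
  then have "\<bar>\<kappa>\<bar> < sqrt (1 + \<kappa>\<^sup>2)" by simp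
  moreover have "sqrt (1 + \<kappa>\<^sup>2) > 0" by (simp add: add_pos_nonneg)
  ultimately show ?thesis by (simp add: abs_divide)
qed

text \<open>For fixed \<open>\<theta>1\<close> the volume is a decreasing function \<open>W\<close> of the cotangent \<open>\<kappa>\<close> of the angle between
  \<open>\<theta>1\<close> and \<open>\<theta>2\<close>, and the law of \<open>\<kappa>\<close> has a continuous density on the whole line.\<close>
lemma ex_union_density:
  assumes d: "CARD('n::finite) \<ge> 2" and v: "v1 > 0" "v2 > 0"
  shows "\<exists>f. (\<forall>s. 0 \<le> f s) \<and> continuous_on {max v1 v2<..<v1 + v2} f \<and>
    distributed (uniform_sphere \<Otimes>\<^sub>M uniform_sphere) lborel
      (\<lambda>(\<theta>1, \<theta>2 :: real ^ 'n). union_volume (root CARD('n) v1) (root CARD('n) v2) \<theta>1 \<theta>2 / ball_volume TYPE('n))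
      (\<lambda>s. ennreal (f s))"
proof -
  define m where "m = CARD('n) - 2"
  have m: "CARD('n) = Suc (Suc m)" by (rule trans[OF le_add_diff_inverse[OF d, symmetric] add_2_eq_Suc, folded m_def])
  let ?c = "ball_volume TYPE('n)"
  let ?K = "unit_ball_vol (real (Suc m))"
  have c: "?c > 0" by (rule ball_volume_pos)
  have K: "?K > 0" by simp
  define r1 r2 where "r1 = root CARD('n) v1" and "r2 = root CARD('n) v2"
  have r: "r1 > 0" "r2 > 0" "r1 ^ CARD('n) = v1" "r2 ^ CARD('n) = v2" using v by (auto simp: r1_def r2_def)
  define S where "S = (\<lambda>(\<theta>1, \<theta>2 :: real ^ 'n). union_volume r1 r2 \<theta>1 \<theta>2 / ?c)"
  have Sm [measurable]: "S \<in> borel_measurable (uniform_sphere \<Otimes>\<^sub>M uniform_sphere)"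
    unfolding S_def by measurable
  \<comment> \<open>Geometry as a function of the cotangent \<open>\<kappa>\<close>:
    \<open>t\<close> is the cosine of the angle, \<open>q\<close> the squared distance of the two
    centres by the law of cosines, \<open>\<rho>\<close> that distance, \<open>x\<close> the signed
    distance of the first centre from the radical hyperplane. \<open>W\<close> is the normalised
    volume of the union by inclusion-exclusion, and \<open>D\<close> will be its derivative.\<close>
  define t where "t \<kappa> = \<kappa> / sqrt (1 + \<kappa>\<^sup>2)" for \<kappa> :: real
  define q where "q \<kappa> = r1\<^sup>2 + r2\<^sup>2 - 2 * r1 * r2 * t \<kappa>" for \<kappa>
  define \<rho> where "\<rho> \<kappa> = sqrt (q \<kappa>)" for \<kappa>
  define x where "x \<kappa> = (q \<kappa> + r1\<^sup>2 - r2\<^sup>2) / (2 * \<rho> \<kappa>)" for \<kappa>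
  define W where "W \<kappa> = v1 + v2 - (cap_volume m r1 (x \<kappa>) + cap_volume m r2 (\<rho> \<kappa> - x \<kappa>)) / ?c" for \<kappa>
  define D where "D \<kappa> = - (?K * sqrt (r1\<^sup>2 - (x \<kappa>)\<^sup>2) ^ Suc m * (r1 * r2 * (1 / sqrt (1 + \<kappa>\<^sup>2)) ^ 3 / \<rho> \<kappa>) / ?c)" for \<kappa>
  have t1: "- 1 < t \<kappa>" "t \<kappa> < 1" for \<kappa>
    unfolding t_def using abs_cot_to_cos_less[of \<kappa>] by linarith+
  have q_gt: "(r1 - r2)\<^sup>2 < q \<kappa>" for \<kappa>
  proof -
    have "r1 * r2 * t \<kappa> < r1 * r2 * 1" using r t1[of \<kappa>] by (intro mult_strict_left_mono) auto
    then show ?thesis by (simp add: q_def power2_diff)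
  qed
  have q_lt: "q \<kappa> < (r1 + r2)\<^sup>2" for \<kappa>
  proof -
    have "r1 * r2 * (-1) < r1 * r2 * t \<kappa>" using r t1[of \<kappa>] by (intro mult_strict_left_mono) auto
    then show ?thesis by (simp add: q_def power2_sum)
  qed
  have q0: "0 < q \<kappa>" for \<kappa> using q_gt[of \<kappa>] zero_le_power2[of "r1 - r2"] by linarith
  have \<rho>0: "0 < \<rho> \<kappa>" "(\<rho> \<kappa>)\<^sup>2 = q \<kappa>" for \<kappa> using q0[of \<kappa>] by (simp_all add: \<rho>_def)
  have x\<rho>: "2 * \<rho> \<kappa> * x \<kappa> = q \<kappa> + r1\<^sup>2 - r2\<^sup>2" for \<kappa> using \<rho>0[of \<kappa>] by (simp add: x_def)
  have h2: "r2\<^sup>2 - (\<rho> \<kappa> - x \<kappa>)\<^sup>2 = r1\<^sup>2 - (x \<kappa>)\<^sup>2" for \<kappa>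
    using x\<rho>[of \<kappa>] \<rho>0(2)[of \<kappa>] by (simp add: power2_diff)
  \<comment> \<open>Heron's factorisation: \<open>4 * q * (r1\<^sup>2 - x\<^sup>2)\<close> is a
    product whose factors are positive because the distance of the centres lies strictly between
    \<open>\<bar>r1 - r2\<bar>\<close> and \<open>r1 + r2\<close>. Hence the spheres cross and both
    caps are nondegenerate.\<close>
  have h0: "0 < r1\<^sup>2 - (x \<kappa>)\<^sup>2" for \<kappa>
  proof -
    have "4 * q \<kappa> * (r1\<^sup>2 - (x \<kappa>)\<^sup>2) = 4 * q \<kappa> * r1\<^sup>2 - (2 * \<rho> \<kappa> * x \<kappa>)\<^sup>2"
      by (simp add: power_mult_distrib \<rho>0(2) algebra_simps)
    also have "\<dots> = ((r1 + r2)\<^sup>2 - q \<kappa>) * (q \<kappa> - (r1 - r2)\<^sup>2)"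
      unfolding x\<rho> by algebra
    finally have "0 < 4 * q \<kappa> * (r1\<^sup>2 - (x \<kappa>)\<^sup>2)" using q_gt[of \<kappa>] q_lt[of \<kappa>] by simp
    then show ?thesis using q0[of \<kappa>] by (simp add: zero_less_mult_iff)
  qed
  have x1: "\<bar>x \<kappa>\<bar> < r1" for \<kappa>
  proof (rule power2_less_imp_less)
    show "\<bar>x \<kappa>\<bar>\<^sup>2 < r1\<^sup>2" unfolding power2_abs using h0[of \<kappa>] by linarith
  qed (use r in simp)
  have x2: "\<bar>\<rho> \<kappa> - x \<kappa>\<bar> < r2" for \<kappa>
  proof (rule power2_less_imp_less)
    show "\<bar>\<rho> \<kappa> - x \<kappa>\<bar>\<^sup>2 < r2\<^sup>2" unfolding power2_abs using h0[of \<kappa>] h2[of \<kappa>] by linarith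
  qed (use r in simp)
  have dq: "DERIV q \<kappa> :> - (2 * r1 * r2 * (1 / sqrt (1 + \<kappa>\<^sup>2)) ^ 3)" for \<kappa>
  proof -
    have "DERIV q \<kappa> :> 0 - 2 * r1 * r2 * (1 / sqrt (1 + \<kappa>\<^sup>2)) ^ 3"
      unfolding q_def[abs_def] t_def by (rule DERIV_diff[OF DERIV_const DERIV_cmult[OF DERIV_cot_to_cos]])
    then show ?thesis by (simp only: diff_0)
  qed
  define \<rho>' where "\<rho>' \<kappa> = - (r1 * r2 * (1 / sqrt (1 + \<kappa>\<^sup>2)) ^ 3 / \<rho> \<kappa>)" for \<kappa>
  have d\<rho>: "DERIV \<rho> \<kappa> :> \<rho>' \<kappa>" for \<kappa>
  proof -
    have "DERIV \<rho> \<kappa> :> inverse (sqrt (q \<kappa>)) / 2 * - (2 * r1 * r2 * (1 / sqrt (1 + \<kappa>\<^sup>2)) ^ 3)"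
      unfolding \<rho>_def[abs_def] by (rule DERIV_chain2[OF DERIV_real_sqrt[OF q0] dq])
    moreover have "inverse (sqrt (q \<kappa>)) / 2 * - (2 * r1 * r2 * (1 / sqrt (1 + \<kappa>\<^sup>2)) ^ 3) = \<rho>' \<kappa>"
      by (simp add: \<rho>'_def \<rho>_def field_simps)
    ultimately show ?thesis by (rule DERIV_cong)
  qed
  have dx: "\<exists>x'. DERIV x \<kappa> :> x'" for \<kappa>
    unfolding x_def[abs_def]
    by (rule exI, rule DERIV_divide[OF DERIV_diff[OF DERIV_add[OF dq DERIV_const] DERIV_const] DERIV_cmult[OF d\<rho>]])
      (use \<rho>0[of \<kappa>] in simp)
  \<comment> \<open>The derivative of \<open>x\<close> cancels, because both caps end in the same
    slice by \<open>h2\<close>. Its mere existence is enough, and what remains is the area of that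
    slice times \<open>\<rho>'\<close>.\<close>
  have dW: "DERIV W \<kappa> :> D \<kappa>" for \<kappa>
  proof -
    obtain x' where x': "DERIV x \<kappa> :> x'" using dx by blast
    let ?h = "sqrt (r1\<^sup>2 - (x \<kappa>)\<^sup>2) ^ Suc m"
    have 1: "DERIV (\<lambda>\<kappa>. cap_volume m r1 (x \<kappa>)) \<kappa> :> - ?K * ?h * x'"
      by (rule DERIV_chain2[OF DERIV_cap_volume x']) (use x1[of \<kappa>] in auto)
    have 2: "DERIV (\<lambda>\<kappa>. cap_volume m r2 (\<rho> \<kappa> - x \<kappa>)) \<kappa> :> - ?K * ?h * (\<rho>' \<kappa> - x')"
      unfolding h2[of \<kappa>, symmetric]
      by (rule DERIV_chain2[OF DERIV_cap_volume DERIV_diff[OF d\<rho> x']]) (use x2[of \<kappa>] in auto)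
    have "DERIV W \<kappa> :> 0 - (- ?K * ?h * x' + - ?K * ?h * (\<rho>' \<kappa> - x')) / ?c"
      unfolding W_def[abs_def] by (rule DERIV_diff[OF DERIV_const DERIV_cdivide[OF DERIV_add[OF 1 2]]])
    moreover have "0 - (- ?K * ?h * x' + - ?K * ?h * (\<rho>' \<kappa> - x')) / ?c = D \<kappa>"
      unfolding D_def by (simp add: \<rho>'_def algebra_simps)
    ultimately show ?thesis by (rule DERIV_cong)
  qed
  have D0: "D \<kappa> < 0" for \<kappa>
  proof -
    have "1 + \<kappa>\<^sup>2 > 0" by (simp add: add_pos_nonneg)
    then have "0 < ?K * sqrt (r1\<^sup>2 - (x \<kappa>)\<^sup>2) ^ Suc m * (r1 * r2 * (1 / sqrt (1 + \<kappa>\<^sup>2)) ^ 3 / \<rho> \<kappa>) / ?c"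
      using K c r h0[of \<kappa>] \<rho>0[of \<kappa>] by (intro divide_pos_pos mult_pos_pos zero_less_power) auto
    then show ?thesis by (simp add: D_def)
  qed
  have cx: "continuous_on UNIV x" and c\<rho>: "continuous_on UNIV \<rho>"
    by (intro continuous_at_imp_continuous_on ballI; use dx d\<rho> DERIV_isCont in blast)+
  have cD: "continuous_on UNIV D"
  proof -
    have "\<rho> \<kappa> \<noteq> 0" "sqrt (1 + \<kappa>\<^sup>2) \<noteq> 0" for \<kappa>
      using \<rho>0(1)[of \<kappa>] by (simp_all add: add_nonneg_eq_0_iff)
    moreover have "?c \<noteq> 0" using c by simp
    ultimately show ?thesis
      unfolding D_def[abs_def]
      by (intro continuous_on_minus continuous_on_mult continuous_on_divide continuous_on_power continuous_on_real_sqrt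
          continuous_on_diff continuous_on_add continuous_on_const continuous_on_id cx c\<rho> ballI)
  qed
  have limW: "(W \<longlongrightarrow> v1 + v2 - (cap_volume m r1 l1 + cap_volume m r2 l2) / ?c) F"
    if "(x \<longlongrightarrow> l1) F" "((\<lambda>\<kappa>. \<rho> \<kappa> - x \<kappa>) \<longlongrightarrow> l2) F" "\<bar>l1\<bar> \<le> r1" "\<bar>l2\<bar> \<le> r2" for l1 l2 F
  proof -
    have b1: "- r1 \<le> x \<kappa>" "x \<kappa> \<le> r1" and b2: "- r2 \<le> \<rho> \<kappa> - x \<kappa>" "\<rho> \<kappa> - x \<kappa> \<le> r2" for \<kappa>
      using x1[of \<kappa>] x2[of \<kappa>] by linarith+
    have "((\<lambda>\<kappa>. cap_volume m r1 (x \<kappa>)) \<longlongrightarrow> cap_volume m r1 l1) F"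
      by (rule continuous_on_tendsto_compose[OF continuous_on_cap_volume that(1)])
        (use r that(3) in \<open>auto simp: abs_le_iff minus_le_iff intro!: always_eventually b1\<close>)
    moreover have "((\<lambda>\<kappa>. cap_volume m r2 (\<rho> \<kappa> - x \<kappa>)) \<longlongrightarrow> cap_volume m r2 l2) F"
      by (rule continuous_on_tendsto_compose[OF continuous_on_cap_volume that(2)])
        (use r that(4) in \<open>auto simp: abs_le_iff minus_le_iff intro!: always_eventually b2\<close>)
    ultimately show ?thesis unfolding W_def[abs_def] using c by (intro tendsto_intros) auto
  qed
  have lim_q: "(q \<longlongrightarrow> r1\<^sup>2 + r2\<^sup>2 - 2 * r1 * r2 * l) F" if "(t \<longlongrightarrow> l) F" for l F
    unfolding q_def[abs_def] by (intro tendsto_intros that)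
  have lim_x: "(x \<longlongrightarrow> (l\<^sup>2 + r1\<^sup>2 - r2\<^sup>2) / (2 * l)) F" "(\<rho> \<longlongrightarrow> l) F"
    if "(q \<longlongrightarrow> l\<^sup>2) F" "l > 0" for l F
  proof -
    have "((\<lambda>\<kappa>. sqrt (q \<kappa>)) \<longlongrightarrow> sqrt (l\<^sup>2)) F" by (intro tendsto_real_sqrt that)
    then show \<rho>: "(\<rho> \<longlongrightarrow> l) F" using that(2) by (simp add: \<rho>_def[abs_def])
    show "(x \<longlongrightarrow> (l\<^sup>2 + r1\<^sup>2 - r2\<^sup>2) / (2 * l)) F"
      unfolding x_def[abs_def] by (intro tendsto_intros that \<rho>) (use that in auto)
  qed
  have t_top: "(t \<longlongrightarrow> 1) at_top" and t_bot: "(t \<longlongrightarrow> - 1) at_bot"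
    unfolding t_def[abs_def] by (rule tendsto_cot_to_cos, rule tendsto_cot_to_cos_bot)
  have limB: "(W \<longlongrightarrow> v1 + v2) at_bot"
  proof -
    have "(q \<longlongrightarrow> (r1 + r2)\<^sup>2) at_bot"
      using lim_q[OF t_bot] by (simp add: power2_sum)
    from lim_x[OF this] r have l: "(x \<longlongrightarrow> ((r1 + r2)\<^sup>2 + r1\<^sup>2 - r2\<^sup>2) / (2 * (r1 + r2))) at_bot" "(\<rho> \<longlongrightarrow> r1 + r2) at_bot" by auto
    have e: "((r1 + r2)\<^sup>2 + r1\<^sup>2 - r2\<^sup>2) / (2 * (r1 + r2)) = r1"
      using r by (simp add: field_simps power2_eq_square)
    from limW[OF l(1)[unfolded e] tendsto_diff[OF l(2) l(1)[unfolded e]]] r show ?thesis by simp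
  qed
  \<comment> \<open>For \<open>\<kappa>\<close> tending to infinity the directions merge. An upper
    bound for the limit suffices, since continuity on a larger interval restricts to
    \<open>{max v1 v2<..<v1 + v2}\<close>. Equal radii are separate: the distance of the centres
    then tends to 0, and the limit of the quotient defining \<open>x\<close> is not that of
    \<open>lim_x\<close>.\<close>
  have limA: "\<exists>A. A \<le> max v1 v2 \<and> (W \<longlongrightarrow> A) at_top"
  proof -
    have q_top: "(q \<longlongrightarrow> (r1 - r2)\<^sup>2) at_top"
      using lim_q[OF t_top] by (simp add: power2_diff)
    consider "r1 > r2" | "r1 < r2" | "r1 = r2" by linarith
    then show ?thesis
    proof cases
      case 1
      from lim_x[OF q_top] 1 have l: "(x \<longlongrightarrow> ((r1 - r2)\<^sup>2 + r1\<^sup>2 - r2\<^sup>2) / (2 * (r1 - r2))) at_top" "(\<rho> \<longlongrightarrow> r1 - r2) at_top" by auto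
      have e: "((r1 - r2)\<^sup>2 + r1\<^sup>2 - r2\<^sup>2) / (2 * (r1 - r2)) = r1"
        using 1 by (simp add: field_simps power2_eq_square)
      from limW[OF l(1)[unfolded e] tendsto_diff[OF l(2) l(1)[unfolded e]]] r have "(W \<longlongrightarrow> v1 + v2 - cap_volume m r2 (- r2) / ?c) at_top" by simp
      then show ?thesis using cap_volume_full[OF m, of r2] r c by (intro exI[of _ v1]) simp
    next
      case 2
      have "(q \<longlongrightarrow> (r2 - r1)\<^sup>2) at_top" using q_top by (simp add: power2_commute)
      from lim_x[OF this] 2 have l: "(x \<longlongrightarrow> ((r2 - r1)\<^sup>2 + r1\<^sup>2 - r2\<^sup>2) / (2 * (r2 - r1))) at_top" "(\<rho> \<longlongrightarrow> r2 - r1) at_top" by auto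
      have e: "((r2 - r1)\<^sup>2 + r1\<^sup>2 - r2\<^sup>2) / (2 * (r2 - r1)) = - r1"
        using 2 by (simp add: field_simps power2_eq_square)
      from limW[OF l(1)[unfolded e] tendsto_diff[OF l(2) l(1)[unfolded e]]] r have "(W \<longlongrightarrow> v1 + v2 - cap_volume m r1 (- r1) / ?c) at_top" by simp
      then show ?thesis using cap_volume_full[OF m, of r1] r c by (intro exI[of _ v2]) simp
    next
      case 3
      \<comment> \<open>For equal radii the radical hyperplane is the perpendicular bisector of the
        centres.\<close>
      have xh: "x \<kappa> = \<rho> \<kappa> / 2" for \<kappa>
        unfolding x_def 3 using \<rho>0[of \<kappa>] by (simp add: power2_eq_square flip: \<rho>0(2))
      have "((\<lambda>\<kappa>. sqrt (q \<kappa>)) \<longlongrightarrow> sqrt ((r1 - r2)\<^sup>2)) at_top"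
        by (rule tendsto_real_sqrt[OF q_top])
      then have "(\<rho> \<longlongrightarrow> 0) at_top" using 3 by (simp add: \<rho>_def[abs_def])
      from tendsto_divide[OF this tendsto_const[of 2]] have h: "((\<lambda>\<kappa>. \<rho> \<kappa> / 2) \<longlongrightarrow> 0) at_top" by simp
      have "x = (\<lambda>\<kappa>. \<rho> \<kappa> / 2)" "(\<lambda>\<kappa>. \<rho> \<kappa> - x \<kappa>) = (\<lambda>\<kappa>. \<rho> \<kappa> / 2)"
        by (rule ext, simp add: xh)+
      then have "(x \<longlongrightarrow> 0) at_top" "((\<lambda>\<kappa>. \<rho> \<kappa> - x \<kappa>) \<longlongrightarrow> 0) at_top"
        using h by (simp_all only:)
      from limW[OF this] r have "(W \<longlongrightarrow> v1 + v2 - (cap_volume m r1 0 + cap_volume m r2 0) / ?c) at_top" by simp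
      moreover have "v1 + v2 - (cap_volume m r1 0 + cap_volume m r2 0) / ?c \<le> max v1 v2"
        using cap_volume_half[OF m, of r1] cap_volume_half[OF m, of r2] r 3 c by (simp add: field_simps)
      ultimately show ?thesis by blast
    qed
  qed
  have S_W: "S (\<theta>1, \<theta>2) = W ((\<theta>2 \<bullet> \<theta>1) / norm (\<theta>2 - (\<theta>2 \<bullet> \<theta>1) *\<^sub>R \<theta>1))"
    if u: "norm \<theta>1 = 1" "norm \<theta>2 = 1" and p: "\<theta>2 - (\<theta>2 \<bullet> \<theta>1) *\<^sub>R \<theta>1 \<noteq> 0" for \<theta>1 \<theta>2
  proof -
    define p where "p = norm (\<theta>2 - (\<theta>2 \<bullet> \<theta>1) *\<^sub>R \<theta>1)"
    define \<tau> where "\<tau> = \<theta>2 \<bullet> \<theta>1"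
    define \<kappa> where "\<kappa> = \<tau> / p"
    have p0: "p > 0" using p by (simp add: p_def)
    have tp: "1 = \<tau>\<^sup>2 + p\<^sup>2" using norm_decomp[OF u(1), of \<theta>2] u by (simp add: p_def \<tau>_def)
    have "1 + \<kappa>\<^sup>2 = (1 / p)\<^sup>2" using p0 tp by (simp add: \<kappa>_def field_simps)
    then have "sqrt (1 + \<kappa>\<^sup>2) = 1 / p" using p0 by simp
    then have t\<kappa>: "t \<kappa> = \<tau>" using p0 by (simp add: t_def \<kappa>_def)
    have "(dist (r1 *\<^sub>R \<theta>1) (r2 *\<^sub>R \<theta>2))\<^sup>2 = (r1 *\<^sub>R \<theta>1 - r2 *\<^sub>R \<theta>2) \<bullet> (r1 *\<^sub>R \<theta>1 - r2 *\<^sub>R \<theta>2)"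
      by (simp only: dist_norm power2_norm_eq_inner)
    also have "\<dots> = r1\<^sup>2 * (\<theta>1 \<bullet> \<theta>1) + r2\<^sup>2 * (\<theta>2 \<bullet> \<theta>2) - 2 * r1 * r2 * (\<theta>2 \<bullet> \<theta>1)"
      by (simp add: inner_diff_left inner_diff_right inner_commute[of \<theta>1 \<theta>2] power2_eq_square algebra_simps)
    also have "\<dots> = q \<kappa>"
      using u by (simp add: q_def t\<kappa> \<tau>_def norm_eq_1)
    finally have "(dist (r1 *\<^sub>R \<theta>1) (r2 *\<^sub>R \<theta>2))\<^sup>2 = q \<kappa>" .
    then have dist: "dist (r1 *\<^sub>R \<theta>1) (r2 *\<^sub>R \<theta>2) = \<rho> \<kappa>"
      unfolding \<rho>_def by (intro real_sqrt_unique[symmetric]) auto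
    have xe: "x \<kappa> = ((\<rho> \<kappa>)\<^sup>2 + r1\<^sup>2 - r2\<^sup>2) / (2 * \<rho> \<kappa>)" by (simp add: x_def \<rho>0(2))
    have "emeasure lborel (cball (r1 *\<^sub>R \<theta>1) r1 \<inter> cball (r2 *\<^sub>R \<theta>2) r2)
      = ennreal (cap_volume m r1 (x \<kappa>) + cap_volume m r2 (\<rho> \<kappa> - x \<kappa>))"
      by (rule emeasure_cball_Int_cball[OF m less_imp_le[OF r(1)] less_imp_le[OF r(2)] dist[symmetric] \<rho>0(1) xe])
        (use x1[of \<kappa>] x2[of \<kappa>] in linarith)+
    then have "measure lborel (cball (r1 *\<^sub>R \<theta>1) r1 \<inter> cball (r2 *\<^sub>R \<theta>2) r2) = cap_volume m r1 (x \<kappa>) + cap_volume m r2 (\<rho> \<kappa> - x \<kappa>)"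
      by (simp add: measure_def cap_volume_nonneg del: ennreal_plus)
    then have "S (\<theta>1, \<theta>2) = W \<kappa>"
      using r c by (simp add: S_def W_def union_volume_eq field_simps)
    then show ?thesis by (simp add: \<kappa>_def \<tau>_def p_def)
  qed
  have dec: "W b < W a" if "a < b" for a b
    by (rule DERIV_neg_imp_decreasing[OF that]) (use dW D0 in blast)
  have W_le: "W a \<le> W b \<longleftrightarrow> b \<le> a" for a b
    using dec[of a b] dec[of b a] by (cases a b rule: linorder_cases) simp_all
  obtain e0 :: "real ^ 'n" where e0: "norm e0 = 1" using vector_choose_size[of 1] by auto
  define U where "U \<kappa> = measure uniform_sphere {\<theta>. \<kappa> * norm (\<theta> - (\<theta> \<bullet> e0) *\<^sub>R e0) \<le> \<theta> \<bullet> e0}" for \<kappa>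
  define \<mu> where "\<mu> = distr (uniform_sphere \<Otimes>\<^sub>M uniform_sphere) lborel S"
  have \<mu>: "real_distribution \<mu>"
    unfolding \<mu>_def real_distribution_def real_distribution_axioms_def
    by (auto intro!: uniform_sphere2.prob_space_distr)
  \<comment> \<open>Since \<open>W\<close> decreases, volume at most \<open>W \<kappa>\<close> means
    cotangent at least \<open>\<kappa>\<close>. Given \<open>\<theta>1\<close>, the probability of
    this is the cone measure, which does not depend on the axis and can be taken at the fixed
    \<open>e0\<close>.\<close>
  have cdf: "measure \<mu> {..W \<kappa>} = U \<kappa>" for \<kappa>
  proof -
    let ?Q = "{p \<in> space (uniform_sphere \<Otimes>\<^sub>M uniform_sphere). S p \<le> W \<kappa>}"
    have Q: "?Q \<in> sets (uniform_sphere \<Otimes>\<^sub>M uniform_sphere)" by measurable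
    have "emeasure \<mu> {..W \<kappa>} = emeasure (uniform_sphere \<Otimes>\<^sub>M uniform_sphere) ?Q"
      unfolding \<mu>_def by (subst emeasure_distr) (auto intro!: arg_cong2[where f = emeasure])
    also have "\<dots> = (\<integral>\<^sup>+\<theta>1. emeasure uniform_sphere (Pair \<theta>1 -` ?Q) \<partial>uniform_sphere)"
      by (rule uniform_sphere.emeasure_pair_measure_alt[OF Q])
    also have "\<dots> = (\<integral>\<^sup>+(\<theta>1 :: real ^ 'n). ennreal (U \<kappa>) \<partial>uniform_sphere)"
    proof (rule nn_integral_cong_AE)
      show "AE \<theta>1 in uniform_sphere. emeasure uniform_sphere (Pair \<theta>1 -` ?Q) = ennreal (U \<kappa>)"
        using AE_uniform_sphere
      proof eventually_elim
        case (elim \<theta>1)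
        have "emeasure uniform_sphere (Pair \<theta>1 -` ?Q) = emeasure uniform_sphere {\<theta>. \<kappa> * norm (\<theta> - (\<theta> \<bullet> \<theta>1) *\<^sub>R \<theta>1) \<le> \<theta> \<bullet> \<theta>1}"
        proof (rule emeasure_eq_AE)
          show "AE \<theta> in uniform_sphere. \<theta> \<in> Pair \<theta>1 -` ?Q \<longleftrightarrow> \<theta> \<in> {\<theta>. \<kappa> * norm (\<theta> - (\<theta> \<bullet> \<theta>1) *\<^sub>R \<theta>1) \<le> \<theta> \<bullet> \<theta>1}"
            using AE_uniform_sphere AE_uniform_sphere_not_parallel[OF m elim]
          proof eventually_elim
            case h: (elim \<theta>)
            have "\<theta> \<in> Pair \<theta>1 -` ?Q \<longleftrightarrow> S (\<theta>1, \<theta>) \<le> W \<kappa>" by (simp add: space_pair_measure)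
            also have "\<dots> \<longleftrightarrow> \<kappa> \<le> (\<theta> \<bullet> \<theta>1) / norm (\<theta> - (\<theta> \<bullet> \<theta>1) *\<^sub>R \<theta>1)"
              unfolding S_W[OF elim h] W_le ..
            also have "\<dots> \<longleftrightarrow> \<kappa> * norm (\<theta> - (\<theta> \<bullet> \<theta>1) *\<^sub>R \<theta>1) \<le> \<theta> \<bullet> \<theta>1"
              by (rule pos_le_divide_eq) (rule zero_less_norm_iff[THEN iffD2, OF h(2)])
            finally show ?case by simp
          qed
          show "Pair \<theta>1 -` ?Q \<in> sets uniform_sphere" by (rule sets_Pair1[OF Q])
        qed simp
        also have "\<dots> = emeasure uniform_sphere {\<theta>. \<kappa> * norm (\<theta> - (\<theta> \<bullet> e0) *\<^sub>R e0) \<le> \<theta> \<bullet> e0}"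
          unfolding emeasure_uniform_sphere_cone[OF m elim] emeasure_uniform_sphere_cone[OF m e0] ..
        finally show ?case by (simp add: U_def uniform_sphere.emeasure_eq_measure)
      qed
    qed
    also have "\<dots> = ennreal (U \<kappa>)" by (simp add: uniform_sphere.emeasure_space_1[simplified])
    finally show ?thesis by (simp add: measure_def U_def)
  qed
  have rangeW: "range W \<in> sets borel"
  proof -
    have "continuous_on UNIV W" using dW DERIV_isCont by (blast intro!: continuous_at_imp_continuous_on)
    then have "connected (range W)" by (intro connected_continuous_image) auto
    then have "is_interval (range W)" by (simp add: is_interval_connected_1)
    then show ?thesis by (rule real_interval_borel_measurable)
  qed
  have supp: "measure \<mu> (range W) = 1"
  proof -
    interpret real_distribution \<mu> by fact
    have "AE p in uniform_sphere \<Otimes>\<^sub>M uniform_sphere. S p \<in> range W"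
    proof (rule uniform_sphere2.AE_pair_measure)
      show "{p \<in> space (uniform_sphere \<Otimes>\<^sub>M uniform_sphere). S p \<in> range W} \<in> sets (uniform_sphere \<Otimes>\<^sub>M uniform_sphere)"
        using measurable_sets[OF Sm rangeW] by (simp add: vimage_def Int_def conj_commute)
      show "AE \<theta>1 in uniform_sphere. AE \<theta>2 in uniform_sphere. S (\<theta>1, \<theta>2) \<in> range W"
        using AE_uniform_sphere
      proof eventually_elim
        case (elim \<theta>1)
        show ?case using AE_uniform_sphere AE_uniform_sphere_not_parallel[OF m elim]
          by eventually_elim (simp add: S_W[OF elim])
      qed
    qed
    then have "AE s in \<mu>. s \<in> range W"
      unfolding \<mu>_def using rangeW by (subst AE_distr_iff) auto
    then show ?thesis using rangeW by (intro prob_eq_1[THEN iffD2]) auto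
  qed
  obtain A where A: "A \<le> max v1 v2" "(W \<longlongrightarrow> A) at_top" using limA by blast
  obtain f where f: "f \<in> borel_measurable borel" "\<forall>s. 0 \<le> f s" "continuous_on {A<..<v1 + v2} f" "\<mu> = density lborel (\<lambda>s. ennreal (f s))"
    using continuous_density_of_parametrization[OF \<mu> dW D0 cD A(2) limB
        DERIV_uniform_sphere_cone[OF m e0, folded U_def] cot_density_nonneg continuous_on_cot_density cdf supp] by blast
  have "continuous_on {max v1 v2<..<v1 + v2} f"
    by (rule continuous_on_subset[OF f(3)]) (use A in auto)
  then show ?thesis
    using f Sm unfolding distributed_def \<mu>_def S_def r1_def r2_def by (intro exI[of _ f]) auto
qed

section \<open>Counting sample points in two sets\<close>

text \<open>Probability that among \<open>m\<close> independent trials exactly \<open>i\<close>,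
  \<open>j\<close>, \<open>k\<close> fall into three disjoint classes of probabilities
  \<open>p1\<close>, \<open>p2\<close>, \<open>p3\<close>. Writing the coefficient through a
  binomial coefficient makes it 0 when \<open>i + j + k > m\<close>, where the last exponent is
  truncated.\<close>

definition multinomial_weight :: "nat \<Rightarrow> real \<Rightarrow> real \<Rightarrow> real \<Rightarrow> nat \<Rightarrow> nat \<Rightarrow> nat \<Rightarrow> real" where
  "multinomial_weight m p1 p2 p3 i j k =
    real (m choose (i + j + k)) * fact (i + j + k) / (fact i * fact j * fact k)
      * (p1 ^ i * p2 ^ j * p3 ^ k) * (1 - p1 - p2 - p3) ^ (m - (i + j + k))"

lemma multinomial_weight_0: "multinomial_weight 0 p1 p2 p3 i j k = of_bool (i = 0 \<and> j = 0 \<and> k = 0)"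
  by (auto simp: multinomial_weight_def binomial_eq_0)

text \<open>Conditioning on the class of one trial; the induction in
  \<open>measure_PiM_multinomial\<close> has the same recursion.\<close>

lemma multinomial_weight_Suc:
  "multinomial_weight (Suc m) p1 p2 p3 i j k =
    p1 * (if i = 0 then 0 else multinomial_weight m p1 p2 p3 (i - 1) j k)
    + p2 * (if j = 0 then 0 else multinomial_weight m p1 p2 p3 i (j - 1) k)
    + p3 * (if k = 0 then 0 else multinomial_weight m p1 p2 p3 i j (k - 1))
    + (1 - p1 - p2 - p3) * multinomial_weight m p1 p2 p3 i j k"
proof -
  define F where "F m s = real (m choose s) * fact s" for m s
  define s where "s = i + j + k"
  define r where "r = 1 - p1 - p2 - p3"
  define P where "P = p1 ^ i * p2 ^ j * p3 ^ k / (fact i * fact j * fact k)"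
  \<comment> \<open>\<open>F m s\<close> is the falling factorial. In this recursion
    \<open>real s = real i + real j + real k\<close> distributes the second term over the three
    classes.\<close>
  have FS: "F (Suc m) s = F m s + real s * F m (s - 1)"
  proof (cases s)
    case (Suc t)
    then show ?thesis unfolding F_def by (simp add: algebra_simps)
  qed (simp add: F_def)
  have Q: "multinomial_weight (Suc m) p1 p2 p3 i j k = P * (F (Suc m) s * r ^ (Suc m - s))"
    unfolding multinomial_weight_def P_def F_def s_def[symmetric] r_def[symmetric] by (simp add: mult_ac)
  have 1: "p1 * (if i = 0 then 0 else multinomial_weight m p1 p2 p3 (i - 1) j k) = P * (real i * F m (s - 1) * r ^ (Suc m - s))"
  proof (cases i)
    case (Suc i')
    have "i' + j + k = s - 1" "m - (s - 1) = Suc m - s" using Suc by (auto simp: s_def)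
    moreover have "fact (Suc i') = real (Suc i') * fact i'" "real (Suc i') \<noteq> 0" by simp_all
    ultimately show ?thesis unfolding multinomial_weight_def r_def[symmetric] P_def F_def Suc
      by (simp add: field_simps del: of_nat_Suc fact_Suc)
  qed simp
  have 2: "p2 * (if j = 0 then 0 else multinomial_weight m p1 p2 p3 i (j - 1) k) = P * (real j * F m (s - 1) * r ^ (Suc m - s))"
  proof (cases j)
    case (Suc i')
    have "i + i' + k = s - 1" "m - (s - 1) = Suc m - s" using Suc by (auto simp: s_def)
    moreover have "fact (Suc i') = real (Suc i') * fact i'" "real (Suc i') \<noteq> 0" by simp_all
    ultimately show ?thesis unfolding multinomial_weight_def r_def[symmetric] P_def F_def Suc
      by (simp add: field_simps del: of_nat_Suc fact_Suc)
  qed simp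
  have 3: "p3 * (if k = 0 then 0 else multinomial_weight m p1 p2 p3 i j (k - 1)) = P * (real k * F m (s - 1) * r ^ (Suc m - s))"
  proof (cases k)
    case (Suc i')
    have "i + j + i' = s - 1" "m - (s - 1) = Suc m - s" using Suc by (auto simp: s_def)
    moreover have "fact (Suc i') = real (Suc i') * fact i'" "real (Suc i') \<noteq> 0" by simp_all
    ultimately show ?thesis unfolding multinomial_weight_def r_def[symmetric] P_def F_def Suc
      by (simp add: field_simps del: of_nat_Suc fact_Suc)
  qed simp
  have 4: "r * multinomial_weight m p1 p2 p3 i j k = P * (F m s * r ^ (Suc m - s))"
  proof (cases "s \<le> m")
    case True
    then show ?thesis unfolding multinomial_weight_def r_def[symmetric] s_def[symmetric]
      by (simp add: P_def F_def Suc_diff_le mult_ac)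
  next
    case False
    then show ?thesis unfolding multinomial_weight_def s_def[symmetric] F_def by (simp add: binomial_eq_0)
  qed
  have "real s = real i + real j + real k" by (simp add: s_def)
  then show ?thesis
    unfolding Q 1 2 3 r_def[symmetric] 4 FS by (simp add: algebra_simps)
qed

lemma card_insert_upd:
  assumes "l \<notin> I" "finite I"
  shows "card {l' \<in> insert l I. (x(l := y)) l' \<in> B} = card {l' \<in> I. x l' \<in> B} + of_bool (y \<in> B)"
proof -
  have "{l' \<in> insert l I. (x(l := y)) l' \<in> B} = {l' \<in> I. x l' \<in> B} \<union> (if y \<in> B then {l} else {})"
    using assms by auto
  then show ?thesis using assms by auto
qed

lemma measurable_card_in [measurable]:
  assumes "finite I" and [measurable]: "B \<in> sets N"
  shows "(\<lambda>y. card {l \<in> I. y l \<in> B}) \<in> measurable (Pi\<^sub>M I (\<lambda>_. N)) (count_space UNIV)"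
proof -
  have "(\<lambda>y. \<Sum>l\<in>I. of_bool (y l \<in> B) :: nat) \<in> measurable (Pi\<^sub>M I (\<lambda>_. N)) (count_space UNIV)"
    by measurable
  moreover have "(\<Sum>l\<in>I. of_bool (y l \<in> B) :: nat) = card {l \<in> I. y l \<in> B}" for y
    using assms(1) by (simp add: of_bool_def sum.If_cases Int_def)
  ultimately show ?thesis by simp
qed

text \<open>Induction on the index set: integrating out the new coordinate reproduces
  \<open>multinomial_weight_Suc\<close>, because the classes are disjoint and a single point raises
  at most one of the three counts.\<close>

lemma (in prob_space) measure_PiM_multinomial:
  fixes I :: "nat set"
  assumes I: "finite I" and [measurable]: "A \<in> events" "B \<in> events" "C \<in> events"
    and disj: "A \<inter> B = {}" "A \<inter> C = {}" "B \<inter> C = {}"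
  shows "measure (Pi\<^sub>M I (\<lambda>_. M)) {y \<in> space (Pi\<^sub>M I (\<lambda>_. M)).
      card {l \<in> I. y l \<in> A} = i \<and> card {l \<in> I. y l \<in> B} = j \<and> card {l \<in> I. y l \<in> C} = k}
    = multinomial_weight (card I) (prob A) (prob B) (prob C) i j k"
  using I
proof (induction I arbitrary: i j k rule: finite_induct)
  case empty
  show ?case by (auto simp: multinomial_weight_0 space_PiM measure_def emeasure_PiM_empty)
next
  case (insert l I)
  interpret P: product_prob_space "\<lambda>_. M" "UNIV" by unfold_locales
  interpret PI: prob_space "Pi\<^sub>M I (\<lambda>_. M)" by (rule prob_space_PiM) unfold_locales
  interpret PI': prob_space "Pi\<^sub>M (insert l I) (\<lambda>_. M)" by (rule prob_space_PiM) unfold_locales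
  note [measurable] = measurable_card_in[OF insert.hyps(1)]
  have fin': "finite (insert l I)" using insert by simp
  note [measurable] = measurable_card_in[OF fin']
  define e :: "nat set \<Rightarrow> nat \<Rightarrow> nat \<Rightarrow> nat \<Rightarrow> (nat \<Rightarrow> 'a) \<Rightarrow> real" where
    "e I i j k y = of_bool (card {l \<in> I. y l \<in> A} = i \<and> card {l \<in> I. y l \<in> B} = j \<and> card {l \<in> I. y l \<in> C} = k)" for I i j k y
  have em [measurable]: "e I i j k \<in> borel_measurable (Pi\<^sub>M I (\<lambda>_. M))"
      "e (insert l I) i j k \<in> borel_measurable (Pi\<^sub>M (insert l I) (\<lambda>_. M))" for i j k
    unfolding e_def by measurable
  have meas: "measure (Pi\<^sub>M J (\<lambda>_. M)) {y \<in> space (Pi\<^sub>M J (\<lambda>_. M)). card {l \<in> J. y l \<in> A} = i \<and> card {l \<in> J. y l \<in> B} = j \<and> card {l \<in> J. y l \<in> C} = k}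
    = (\<integral>y. e J i j k y \<partial>Pi\<^sub>M J (\<lambda>_. M))" for J i j k
  proof -
    let ?S = "{y \<in> space (Pi\<^sub>M J (\<lambda>_. M)). card {l \<in> J. y l \<in> A} = i \<and> card {l \<in> J. y l \<in> B} = j \<and> card {l \<in> J. y l \<in> C} = k}"
    have "(\<integral>y. e J i j k y \<partial>Pi\<^sub>M J (\<lambda>_. M)) = (\<integral>y. indicator ?S y \<partial>Pi\<^sub>M J (\<lambda>_. M))"
      by (rule Bochner_Integration.integral_cong[OF refl]) (simp add: e_def indicator_def)
    also have "\<dots> = measure (Pi\<^sub>M J (\<lambda>_. M)) (?S \<inter> space (Pi\<^sub>M J (\<lambda>_. M)))"
      by (rule Bochner_Integration.integral_indicator)
    also have "?S \<inter> space (Pi\<^sub>M J (\<lambda>_. M)) = ?S" by blast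
    finally show ?thesis ..
  qed
  have int: "integrable (Pi\<^sub>M I (\<lambda>_. M)) (e I i j k)" for i j k
    by (rule PI.integrable_const_bound[where B = 1]) (auto simp: e_def)
  have int': "integrable (Pi\<^sub>M (insert l I) (\<lambda>_. M)) (e (insert l I) i j k)"
    by (rule PI'.integrable_const_bound[where B = 1]) (auto simp: e_def)
  \<comment> \<open>The recursion already holds pointwise for the indicators, with the indicators of
    \<open>A\<close>, \<open>B\<close>, \<open>C\<close> at the new point in place of their
    probabilities.\<close>
  have step: "e (insert l I) i j k (x(l := y)) =
      indicator A y * (if i = 0 then 0 else e I (i - 1) j k x)
    + indicator B y * (if j = 0 then 0 else e I i (j - 1) k x)
    + indicator C y * (if k = 0 then 0 else e I i j (k - 1) x)
    + (1 - indicator A y - indicator B y - indicator C y) * e I i j k x" for x y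
  proof -
    consider "y \<in> A" "y \<notin> B" "y \<notin> C" | "y \<notin> A" "y \<in> B" "y \<notin> C" | "y \<notin> A" "y \<notin> B" "y \<in> C"
      | "y \<notin> A" "y \<notin> B" "y \<notin> C" using disj by blast
    then show ?thesis
    proof cases
      case 1
      then show ?thesis unfolding e_def card_insert_upd[OF insert.hyps(2,1)] by (cases i) simp_all
    next
      case 2
      then show ?thesis unfolding e_def card_insert_upd[OF insert.hyps(2,1)] by (cases j) simp_all
    next
      case 3
      then show ?thesis unfolding e_def card_insert_upd[OF insert.hyps(2,1)] by (cases k) simp_all
    next
      case 4
      then show ?thesis unfolding e_def card_insert_upd[OF insert.hyps(2,1)] by simp
    qed
  qed
  have "(\<integral>y. e (insert l I) i j k y \<partial>Pi\<^sub>M (insert l I) (\<lambda>_. M))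
    = (\<integral>x. \<integral>y. e (insert l I) i j k (x(l := y)) \<partial>M \<partial>Pi\<^sub>M I (\<lambda>_. M))"
    by (rule P.product_integral_insert[OF insert.hyps int'])
  also have "\<dots> = (\<integral>x. prob A * (if i = 0 then 0 else e I (i - 1) j k x)
    + prob B * (if j = 0 then 0 else e I i (j - 1) k x)
    + prob C * (if k = 0 then 0 else e I i j (k - 1) x)
    + (1 - prob A - prob B - prob C) * e I i j k x \<partial>Pi\<^sub>M I (\<lambda>_. M))"
    unfolding step by (intro Bochner_Integration.integral_cong refl) (simp add: prob_space emeasure_eq_measure)
  also have "\<dots> = prob A * (if i = 0 then 0 else \<integral>x. e I (i - 1) j k x \<partial>Pi\<^sub>M I (\<lambda>_. M))
    + prob B * (if j = 0 then 0 else \<integral>x. e I i (j - 1) k x \<partial>Pi\<^sub>M I (\<lambda>_. M))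
    + prob C * (if k = 0 then 0 else \<integral>x. e I i j (k - 1) x \<partial>Pi\<^sub>M I (\<lambda>_. M))
    + (1 - prob A - prob B - prob C) * (\<integral>x. e I i j k x \<partial>Pi\<^sub>M I (\<lambda>_. M))"
    using int by (cases "i = 0"; cases "j = 0"; cases "k = 0") simp_all
  also have "\<dots> = multinomial_weight (Suc (card I)) (prob A) (prob B) (prob C) i j k"
    unfolding multinomial_weight_Suc meas[symmetric] insert.IH ..
  finally show ?case using insert.hyps unfolding meas by simp
qed

text \<open>Here \<open>i\<close> and \<open>j\<close> count points lying in exactly one of two sets
  and \<open>k\<close> those in both, so that \<open>i + k\<close> and \<open>j + k\<close> are the
  total counts. It will be used with \<open>K = M - 1\<close>.\<close>

definition triples :: "nat \<Rightarrow> (nat \<times> nat \<times> nat) set" where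
  "triples K = {(i, j, k). i + k \<le> K \<and> j + k \<le> K}"

lemma finite_triples [simp]: "finite (triples K)"
  by (rule finite_subset[of _ "{..K} \<times> {..K} \<times> {..K}"]) (auto simp: triples_def)

definition low_counts :: "'a measure \<Rightarrow> nat set \<Rightarrow> nat \<Rightarrow> 'a set \<Rightarrow> 'a set \<Rightarrow> real" where
  "low_counts N I K B1 B2 = measure (Pi\<^sub>M I (\<lambda>_. N)) {y \<in> space (Pi\<^sub>M I (\<lambda>_. N)).
      card {l \<in> I. y l \<in> B1} \<le> K \<and> card {l \<in> I. y l \<in> B2} \<le> K}"

text \<open>The sets themselves overlap; splitting each count over the two differences and the
  intersection reduces the event to disjoint multinomial ones.\<close>

lemma (in prob_space) low_counts_eq:
  assumes I: "finite I" and [measurable]: "B1 \<in> events" "B2 \<in> events"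
  shows "low_counts M I K B1 B2 = (\<Sum>(i, j, k)\<in>triples K.
    multinomial_weight (card I) (prob (B1 - B2)) (prob (B2 - B1)) (prob (B1 \<inter> B2)) i j k)"
proof -
  interpret PI: prob_space "Pi\<^sub>M I (\<lambda>_. M)" by (rule prob_space_PiM) unfold_locales
  note [measurable] = measurable_card_in[OF I]
  define E where "E = (\<lambda>(i, j, k). {y \<in> space (Pi\<^sub>M I (\<lambda>_. M)).
      card {l \<in> I. y l \<in> B1 - B2} = i \<and> card {l \<in> I. y l \<in> B2 - B1} = j \<and> card {l \<in> I. y l \<in> B1 \<inter> B2} = k})"
  have Em: "E t \<in> sets (Pi\<^sub>M I (\<lambda>_. M))" for t :: "nat \<times> nat \<times> nat"
    unfolding E_def by (cases t) simp
  have c1: "card {l \<in> I. y l \<in> B1} = card {l \<in> I. y l \<in> B1 - B2} + card {l \<in> I. y l \<in> B1 \<inter> B2}" for y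
    using I by (subst card_Un_disjoint[symmetric]) (auto intro!: arg_cong[where f = card])
  have c2: "card {l \<in> I. y l \<in> B2} = card {l \<in> I. y l \<in> B2 - B1} + card {l \<in> I. y l \<in> B1 \<inter> B2}" for y
    using I by (subst card_Un_disjoint[symmetric]) (auto intro!: arg_cong[where f = card])
  have "{y \<in> space (Pi\<^sub>M I (\<lambda>_. M)). card {l \<in> I. y l \<in> B1} \<le> K \<and> card {l \<in> I. y l \<in> B2} \<le> K} = (\<Union>t\<in>triples K. E t)"
    unfolding c1 c2 E_def triples_def by auto
  then have "low_counts M I K B1 B2 = measure (Pi\<^sub>M I (\<lambda>_. M)) (\<Union>t\<in>triples K. E t)"
    by (simp add: low_counts_def)
  also have "\<dots> = (\<Sum>t\<in>triples K. measure (Pi\<^sub>M I (\<lambda>_. M)) (E t))"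
    by (rule PI.finite_measure_finite_Union) (auto simp: Em disjoint_family_on_def, auto simp: E_def)
  also have "\<dots> = (\<Sum>(i, j, k)\<in>triples K. multinomial_weight (card I) (prob (B1 - B2)) (prob (B2 - B1)) (prob (B1 \<inter> B2)) i j k)"
  proof (rule sum.cong[OF refl])
    fix t :: "nat \<times> nat \<times> nat"
    obtain i j k where t: "t = (i, j, k)" by (cases t)
    show "measure (Pi\<^sub>M I (\<lambda>_. M)) (E t) = (case t of (i, j, k) \<Rightarrow>
      multinomial_weight (card I) (prob (B1 - B2)) (prob (B2 - B1)) (prob (B1 \<inter> B2)) i j k)"
      unfolding t E_def prod.case by (rule measure_PiM_multinomial[OF I, of "B1 - B2" "B2 - B1" "B1 \<inter> B2"]) auto
  qed
  finally show ?thesis .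
qed

text \<open>Markov's inequality for \<open>2 ^ (- N\<^sub>1 - N\<^sub>2)\<close>, where \<open>N\<^sub>1\<close> and \<open>N\<^sub>2\<close> are the two counts: its mean factorizes
  over the sample, and \<open>2 ^ (- a - b) \<le> 1 - (a + b) / 4\<close> for \<open>a, b \<in> {0, 1}\<close>.\<close>
lemma (in prob_space) low_counts_le:
  assumes I: "finite I" and [measurable]: "B1 \<in> events" "B2 \<in> events"
  shows "low_counts M I K B1 B2 \<le> 4 ^ K * exp (- (real (card I) * (prob B1 + prob B2) / 4))"
proof -
  interpret P: product_prob_space "\<lambda>_. M" "UNIV" by unfold_locales
  interpret PI: prob_space "Pi\<^sub>M I (\<lambda>_. M)" by (rule prob_space_PiM) unfold_locales
  note [measurable] = measurable_card_in[OF I]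
  define w :: "'a \<Rightarrow> real" where "w y = 1 - (indicator B1 y + indicator B2 y) / 4" for y
  have w: "0 \<le> w y" "w y \<le> 1" "(1/2) ^ of_bool (y \<in> B1) * (1/2) ^ of_bool (y \<in> B2) \<le> w y" for y
    by (auto simp: w_def indicator_def)
  have wm [measurable]: "w \<in> borel_measurable M" unfolding w_def[abs_def] by measurable
  let ?E = "{y \<in> space (Pi\<^sub>M I (\<lambda>_. M)). card {l \<in> I. y l \<in> B1} \<le> K \<and> card {l \<in> I. y l \<in> B2} \<le> K}"
  have E: "?E \<in> sets (Pi\<^sub>M I (\<lambda>_. M))" by measurable
  have pm: "(\<lambda>y. \<Prod>l\<in>I. w (y l)) \<in> borel_measurable (Pi\<^sub>M I (\<lambda>_. M))" by measurable
  have le1: "(\<Prod>l\<in>I. w (y l)) \<le> 1" for y by (intro prod_le_1) (use w in auto)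
  have ge0: "0 \<le> (\<Prod>l\<in>I. w (y l))" for y by (intro prod_nonneg) (use w in auto)
  have intp: "integrable (Pi\<^sub>M I (\<lambda>_. M)) (\<lambda>y. 4 ^ K * (\<Prod>l\<in>I. w (y l)))"
    by (intro integrable_mult_right PI.integrable_const_bound[where B = 1]) (use le1 ge0 pm in auto)
  have c: "(\<Sum>l\<in>I. of_bool (y l \<in> B) :: nat) = card {l \<in> I. y l \<in> B}" for y B
    using I by (simp add: of_bool_def sum.If_cases Int_def)
  have pw: "indicator ?E y \<le> 4 ^ K * (\<Prod>l\<in>I. w (y l))" for y
  proof (cases "y \<in> ?E")
    case True
    \<comment> \<open>On the event the two counts add up to at most \<open>2 * K\<close>, which is
      the source of the factor \<open>4 ^ K\<close>.\<close>
    have "(1/2::real) ^ (2 * K) \<le> (1/2) ^ (card {l \<in> I. y l \<in> B1} + card {l \<in> I. y l \<in> B2})"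
      using True by (intro power_decreasing) auto
    also have "\<dots> = (\<Prod>l\<in>I. (1/2) ^ of_bool (y l \<in> B1) * (1/2) ^ of_bool (y l \<in> B2))"
      unfolding c[symmetric] by (simp add: power_add power_sum prod.distrib)
    also have "\<dots> \<le> (\<Prod>l\<in>I. w (y l))"
      by (intro prod_mono conjI w(3)) auto
    finally have "(1/2::real) ^ (2 * K) \<le> (\<Prod>l\<in>I. w (y l))" .
    then have "4 ^ K * (1/2::real) ^ (2 * K) \<le> 4 ^ K * (\<Prod>l\<in>I. w (y l))" by (intro mult_left_mono) auto
    moreover have "4 ^ K * (1/2::real) ^ (2 * K) = 1"
      by (simp add: power_mult power_mult_distrib[symmetric] power2_eq_square)
    ultimately show ?thesis using True by simp
  qed (use ge0 in auto)
  have "low_counts M I K B1 B2 = (\<integral>y. indicator ?E y \<partial>Pi\<^sub>M I (\<lambda>_. M))"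
    unfolding low_counts_def using E by simp
  also have "\<dots> \<le> (\<integral>y. 4 ^ K * (\<Prod>l\<in>I. w (y l)) \<partial>Pi\<^sub>M I (\<lambda>_. M))"
    by (rule integral_mono[OF _ intp pw]) (use E in \<open>simp add: PI.emeasure_eq_measure\<close>)
  also have "\<dots> = 4 ^ K * (\<Prod>l\<in>I. \<integral>y. w y \<partial>M)"
    by (subst integral_mult_right_zero, subst P.product_integral_prod[OF I])
      (auto intro!: integrable_const_bound[where B = 1] simp: w)
  also have "(\<integral>y. w y \<partial>M) = 1 - (prob B1 + prob B2) / 4"
    unfolding w_def[abs_def] by (simp add: prob_space emeasure_eq_measure)
  also have "4 ^ K * (\<Prod>l\<in>I. 1 - (prob B1 + prob B2) / 4) = 4 ^ K * (1 - (prob B1 + prob B2) / 4) ^ card I"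
    by simp
  also have "\<dots> \<le> 4 ^ K * exp (- ((prob B1 + prob B2) / 4)) ^ card I"
  proof (intro mult_left_mono power_mono)
    show "1 - (prob B1 + prob B2) / 4 \<le> exp (- ((prob B1 + prob B2) / 4))"
      using exp_ge_add_one_self[of "- ((prob B1 + prob B2) / 4)"] by simp
    have "0 \<le> 1 - (a + b) / 4" if "a \<le> 1" "b \<le> 1" for a b :: real using that by simp
    then show "0 \<le> 1 - (prob B1 + prob B2) / 4" by this (rule prob_le_1)+
  qed auto
  also have "exp (- ((prob B1 + prob B2) / 4)) ^ card I = exp (- (real (card I) * (prob B1 + prob B2) / 4))"
    by (simp add: exp_of_nat_mult[symmetric])
  finally show ?thesis .
qed

section \<open>Poisson limits of multinomial probabilities\<close>

text \<open>Probability that three independent Poisson variables with means \<open>a\<close>,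
  \<open>b\<close>, \<open>c\<close> take the values \<open>i\<close>, \<open>j\<close>,
  \<open>k\<close>.\<close>

definition poisson_weight :: "real \<Rightarrow> real \<Rightarrow> real \<Rightarrow> nat \<Rightarrow> nat \<Rightarrow> nat \<Rightarrow> real" where
  "poisson_weight a b c i j k = exp (- (a + b + c)) * (a ^ i * b ^ j * c ^ k) / (fact i * fact j * fact k)"

text \<open>There are \<open>n - 1\<close> trials but the scaling is by \<open>n\<close>, because
  one of the \<open>n\<close> sample points is the one conditioned on. A fixed number of factors
  each tends to 1.\<close>

lemma tendsto_falling_factorial:
  "(\<lambda>n. real ((n - 1) choose s) * fact s / real n ^ s) \<longlonglongrightarrow> 1"
proof -
  have "(\<lambda>n. \<Prod>l<s. (real n - 1 - real l) / real n) \<longlonglongrightarrow> (\<Prod>l<s. 1)"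
  proof (rule tendsto_prod)
    fix l
    have "(\<lambda>n. 1 - (1 + real l) * (1 / real n)) \<longlonglongrightarrow> 1 - (1 + real l) * 0"
      by (intro tendsto_intros lim_1_over_n)
    moreover have "eventually (\<lambda>n. 1 - (1 + real l) * (1 / real n) = (real n - 1 - real l) / real n) sequentially"
      using eventually_gt_at_top[of 0] by eventually_elim (simp add: field_simps)
    ultimately show "(\<lambda>n. (real n - 1 - real l) / real n) \<longlonglongrightarrow> 1" by (simp add: tendsto_cong)
  qed
  moreover have "eventually (\<lambda>n. (\<Prod>l<s. (real n - 1 - real l) / real n) = real ((n - 1) choose s) * fact s / real n ^ s) sequentially"
    using eventually_gt_at_top[of 0]
  proof eventually_elim
    case (elim n)
    have "real ((n - 1) choose s) = (\<Prod>i = 0..<s. real (n - 1) - real i) / fact s"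
      unfolding binomial_gbinomial gbinomial_prod_rev by (simp add: mult.commute)
    then have "real ((n - 1) choose s) * fact s = (\<Prod>l<s. real n - 1 - real l)"
      using elim by (simp add: lessThan_atLeast0 of_nat_diff)
    then show ?case by (simp add: prod_dividef)
  qed
  ultimately show ?thesis by (simp add: tendsto_cong)
qed

text \<open>The numbers \<open>1 - p n\<close> and \<open>exp (- p n)\<close> differ by at most the
  square of \<open>p n\<close>, so their powers differ by at most \<open>real n * p n * p n\<close>,
  which tends to 0. The fixed shift \<open>s\<close> changes the exponent by a multiple of
  \<open>p n\<close> only.\<close>

lemma tendsto_one_minus_power:
  fixes p :: "nat \<Rightarrow> real"
  assumes p: "\<And>n. 0 \<le> p n" "\<And>n. p n \<le> 1" and lim: "(\<lambda>n. real n * p n) \<longlonglongrightarrow> a"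
  shows "(\<lambda>n. (1 - p n) ^ (n - 1 - s)) \<longlonglongrightarrow> exp (- a)"
proof -
  have p0: "p \<longlonglongrightarrow> 0"
  proof -
    have "(\<lambda>n. (real n * p n) * (1 / real n)) \<longlonglongrightarrow> a * 0" by (intro tendsto_mult lim lim_1_over_n)
    moreover have "eventually (\<lambda>n. (real n * p n) * (1 / real n) = p n) sequentially"
      using eventually_gt_at_top[of 0] by eventually_elim simp
    ultimately show ?thesis by (simp add: tendsto_cong)
  qed
  have e: "(\<lambda>n. exp (- (real (n - 1 - s) * p n))) \<longlonglongrightarrow> exp (- (a - (1 + real s) * 0))"
  proof -
    have "(\<lambda>n. exp (- (real n * p n - (1 + real s) * p n))) \<longlonglongrightarrow> exp (- (a - (1 + real s) * 0))"
      by (intro tendsto_intros lim p0)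
    moreover have "eventually (\<lambda>n. exp (- (real n * p n - (1 + real s) * p n)) = exp (- (real (n - 1 - s) * p n))) sequentially"
      using eventually_gt_at_top[of "1 + s"] by eventually_elim (simp add: of_nat_diff algebra_simps)
    ultimately show ?thesis by (simp only: tendsto_cong)
  qed
  have "(\<lambda>n. (1 - p n) ^ (n - 1 - s) - exp (- (real (n - 1 - s) * p n))) \<longlonglongrightarrow> 0"
  proof (rule Lim_null_comparison)
    show "eventually (\<lambda>n. norm ((1 - p n) ^ (n - 1 - s) - exp (- (real (n - 1 - s) * p n))) \<le> (real n * p n) * p n) sequentially"
    proof (rule always_eventually, rule allI)
      fix n
      have "exp (- p n) \<le> 1 - p n + (p n)\<^sup>2"
      proof -
        have "exp (- p n) = 1 / exp (p n)" by (simp add: exp_minus inverse_eq_divide)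
        also have "\<dots> \<le> 1 / (1 + p n)"
          using exp_ge_add_one_self[of "p n"] p(1)[of n] by (intro divide_left_mono) auto
        also have "\<dots> \<le> 1 - p n + (p n)\<^sup>2"
        proof -
          have "(1 - p n + (p n)\<^sup>2) * (1 + p n) = 1 + (p n) ^ 3" by (simp add: power2_eq_square power3_eq_cube algebra_simps)
          then show ?thesis using p(1)[of n] by (simp add: divide_le_eq)
        qed
        finally show ?thesis .
      qed
      moreover have "1 - p n \<le> exp (- p n)" using exp_ge_add_one_self[of "- p n"] by simp
      ultimately have d: "norm (1 - p n - exp (- p n)) \<le> (p n)\<^sup>2" by simp
      have "norm ((1 - p n) ^ (n - 1 - s) - exp (- p n) ^ (n - 1 - s)) \<le> real (n - 1 - s) * norm (1 - p n - exp (- p n))"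
        using p[of n] by (intro norm_power_diff) auto
      also have "\<dots> \<le> real n * (p n)\<^sup>2" using d by (intro mult_mono) auto
      finally show "norm ((1 - p n) ^ (n - 1 - s) - exp (- (real (n - 1 - s) * p n))) \<le> (real n * p n) * p n"
        by (simp add: exp_of_nat_mult[symmetric] power2_eq_square mult_ac)
    qed
    show "(\<lambda>n. (real n * p n) * p n) \<longlonglongrightarrow> 0" using tendsto_mult[OF lim p0] by simp
  qed
  from tendsto_add[OF this e] show ?thesis by simp
qed

lemma tendsto_multinomial_weight:
  assumes p: "\<And>n. 0 \<le> p1 n" "\<And>n. 0 \<le> p2 n" "\<And>n. 0 \<le> p3 n" "\<And>n. p1 n + p2 n + p3 n \<le> 1"
    and lim: "(\<lambda>n. real n * p1 n) \<longlonglongrightarrow> a" "(\<lambda>n. real n * p2 n) \<longlonglongrightarrow> b" "(\<lambda>n. real n * p3 n) \<longlonglongrightarrow> c"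
  shows "(\<lambda>n. multinomial_weight (n - 1) (p1 n) (p2 n) (p3 n) i j k) \<longlonglongrightarrow> poisson_weight a b c i j k"
proof -
  let ?s = "i + j + k"
  have "(\<lambda>n. real n * (p1 n + p2 n + p3 n)) \<longlonglongrightarrow> a + b + c"
    unfolding distrib_left by (intro tendsto_add lim)
  then have l: "(\<lambda>n. (1 - (p1 n + p2 n + p3 n)) ^ (n - 1 - ?s)) \<longlonglongrightarrow> exp (- (a + b + c))"
    by (intro tendsto_one_minus_power) (use p in \<open>auto intro!: add_nonneg_nonneg\<close>)
  have "(\<lambda>n. (real ((n - 1) choose ?s) * fact ?s / real n ^ ?s) / (fact i * fact j * fact k)
      * ((real n * p1 n) ^ i * (real n * p2 n) ^ j * (real n * p3 n) ^ k) * (1 - (p1 n + p2 n + p3 n)) ^ (n - 1 - ?s))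
    \<longlonglongrightarrow> 1 / (fact i * fact j * fact k) * (a ^ i * b ^ j * c ^ k) * exp (- (a + b + c))"
    by (intro tendsto_mult tendsto_divide tendsto_falling_factorial tendsto_const tendsto_power lim l) simp
  moreover have "eventually (\<lambda>n. (real ((n - 1) choose ?s) * fact ?s / real n ^ ?s) / (fact i * fact j * fact k)
      * ((real n * p1 n) ^ i * (real n * p2 n) ^ j * (real n * p3 n) ^ k) * (1 - (p1 n + p2 n + p3 n)) ^ (n - 1 - ?s)
    = multinomial_weight (n - 1) (p1 n) (p2 n) (p3 n) i j k) sequentially"
    using eventually_gt_at_top[of 0]
  proof eventually_elim
    case (elim n)
    have "(real n * p1 n) ^ i * (real n * p2 n) ^ j * (real n * p3 n) ^ k = real n ^ ?s * (p1 n ^ i * p2 n ^ j * p3 n ^ k)"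
      by (simp add: power_mult_distrib power_add mult_ac)
    moreover have e: "1 - p1 n - p2 n - p3 n = 1 - (p1 n + p2 n + p3 n)" by simp
    ultimately show ?case using elim unfolding multinomial_weight_def e by simp
  qed
  ultimately show ?thesis unfolding poisson_weight_def by (simp add: tendsto_cong mult_ac)
qed

section \<open>Scaling of the union volume\<close>

text \<open>Normalised volume of the union of two balls through the origin, with \<open>v1\<close>
  and \<open>v2\<close> their own normalised volumes. In these parameters it is homogeneous of
  degree 1.\<close>

definition scaled_volume :: "real \<Rightarrow> real \<Rightarrow> real ^ 'n \<Rightarrow> real ^ 'n \<Rightarrow> real" where
  "scaled_volume v1 v2 \<theta>1 \<theta>2 = union_volume (root CARD('n) v1) (root CARD('n) v2) \<theta>1 \<theta>2 / ball_volume TYPE('n)"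

lemma borel_measurable_root [measurable (raw)]:
  "f \<in> borel_measurable M \<Longrightarrow> (\<lambda>x. root n (f x)) \<in> borel_measurable M"
  by (rule borel_measurable_continuous_on[where f = "root n"]) (auto intro!: continuous_intros)

lemma borel_measurable_scaled_volume [measurable (raw)]:
  fixes g1 g2 :: "'a \<Rightarrow> real ^ 'n"
  assumes [measurable]: "f1 \<in> borel_measurable M" "f2 \<in> borel_measurable M" "g1 \<in> borel_measurable M" "g2 \<in> borel_measurable M"
  shows "(\<lambda>x. scaled_volume (f1 x) (f2 x) (g1 x) (g2 x)) \<in> borel_measurable M"
  unfolding scaled_volume_def by measurable

lemma scaled_volume_commute: "scaled_volume v1 v2 \<theta>1 \<theta>2 = scaled_volume v2 v1 \<theta>2 \<theta>1"
  by (simp add: scaled_volume_def union_volume_def Un_commute)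

lemma root_power_card: "v \<ge> 0 \<Longrightarrow> root CARD('n::finite) v ^ CARD('n) = v"
  by (intro real_root_pow_pos2) auto

lemma scaled_volume_eq:
  fixes \<theta>1 \<theta>2 :: "real ^ 'n"
  assumes "v1 \<ge> 0" "v2 \<ge> 0"
  shows "scaled_volume v1 v2 \<theta>1 \<theta>2 = v1 + v2 - measure lborel (cball (root CARD('n) v1 *\<^sub>R \<theta>1) (root CARD('n) v1) \<inter> cball (root CARD('n) v2 *\<^sub>R \<theta>2) (root CARD('n) v2)) / ball_volume TYPE('n)"
proof -
  have "root CARD('n) v1 \<ge> 0" "root CARD('n) v2 \<ge> 0" using assms by simp_all
  then show ?thesis using ball_volume_pos[where 'n = 'n]
    by (simp add: scaled_volume_def union_volume_eq root_power_card assms field_simps)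
qed

lemma scaled_volume_le:
  fixes \<theta>1 \<theta>2 :: "real ^ 'n"
  assumes "v1 \<ge> 0" "v2 \<ge> 0"
  shows "scaled_volume v1 v2 \<theta>1 \<theta>2 \<le> v1 + v2"
  using ball_volume_pos[where 'n = 'n] by (simp add: scaled_volume_eq[OF assms] less_imp_le)

lemma scaled_volume_ge:
  fixes \<theta>1 \<theta>2 :: "real ^ 'n"
  assumes "v1 \<ge> 0" "v2 \<ge> 0"
  shows "max v1 v2 \<le> scaled_volume v1 v2 \<theta>1 \<theta>2"
proof -
  have r: "root CARD('n) v1 \<ge> 0" "root CARD('n) v2 \<ge> 0" using assms by simp_all
  have fin: "cball (root CARD('n) v1 *\<^sub>R \<theta>1) (root CARD('n) v1) \<union> cball (root CARD('n) v2 *\<^sub>R \<theta>2) (root CARD('n) v2) \<in> fmeasurable lborel"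
    by (intro fmeasurable.Un) (auto simp: fmeasurable_def emeasure_cball r)
  have "measure lborel (cball (root CARD('n) v1 *\<^sub>R \<theta>1) (root CARD('n) v1)) \<le> union_volume (root CARD('n) v1) (root CARD('n) v2) \<theta>1 \<theta>2"
    "measure lborel (cball (root CARD('n) v2 *\<^sub>R \<theta>2) (root CARD('n) v2)) \<le> union_volume (root CARD('n) v1) (root CARD('n) v2) \<theta>1 \<theta>2"
    unfolding union_volume_def by (intro measure_mono_fmeasurable fin; auto)+
  then show ?thesis using r ball_volume_pos[where 'n = 'n]
    by (simp add: scaled_volume_def measure_cball_ball_volume root_power_card assms field_simps)
qed

lemma union_volume_scale:
  fixes \<theta>1 \<theta>2 :: "real ^ 'n"
  assumes r: "r > 0"
  shows "union_volume (r * a) (r * b) \<theta>1 \<theta>2 = r ^ CARD('n) * union_volume a b \<theta>1 \<theta>2"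
proof -
  have cb: "r *\<^sub>R x \<in> cball ((r * a) *\<^sub>R \<theta>) (r * a) \<longleftrightarrow> x \<in> cball (a *\<^sub>R \<theta>) a" for x \<theta> :: "real ^ 'n" and a
  proof -
    have "dist ((r * a) *\<^sub>R \<theta>) (r *\<^sub>R x) = r * dist (a *\<^sub>R \<theta>) x"
      using r by (simp add: dist_norm scaleR_right_diff_distrib[symmetric] flip: scaleR_scaleR)
    then show ?thesis using r by simp
  qed
  let ?A = "cball ((r * a) *\<^sub>R \<theta>1) (r * a) \<union> cball ((r * b) *\<^sub>R \<theta>2) (r * b)"
  let ?B = "cball (a *\<^sub>R \<theta>1) a \<union> cball (b *\<^sub>R \<theta>2) b"
  have "emeasure lborel ?A = (\<integral>\<^sup>+x. indicator ?A x \<partial>lborel)" by simp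
  also have "\<dots> = ennreal (\<bar>r\<bar> ^ DIM(real ^ 'n)) * (\<integral>\<^sup>+x. indicator ?A (0 + r *\<^sub>R x) \<partial>lborel)"
    using r by (intro nn_integral_affine borel_measurable_indicator) auto
  also have "(\<integral>\<^sup>+x. indicator ?A (0 + r *\<^sub>R x) \<partial>lborel) = (\<integral>\<^sup>+x. indicator ?B x \<partial>lborel)"
    by (intro nn_integral_cong) (simp add: indicator_def cb del: mem_cball)
  also have "\<dots> = emeasure lborel ?B" by simp
  finally show ?thesis using r by (simp add: union_volume_def measure_def enn2real_mult)
qed

lemma scaled_volume_scale:
  fixes \<theta>1 \<theta>2 :: "real ^ 'n"
  assumes t: "t > 0"
  shows "scaled_volume (t * v1) (t * v2) \<theta>1 \<theta>2 = t * scaled_volume v1 v2 \<theta>1 \<theta>2"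
  using t by (simp add: scaled_volume_def real_root_mult union_volume_scale root_power_card)

section \<open>The density as the derivative of the distribution function\<close>

text \<open>Unlike the chosen \<open>union_density\<close>, this function is canonical: it is
  jointly measurable in all its arguments and inherits the homogeneity of the volume. Both
  properties are transferred to the density by differentiation.\<close>

definition volume_cdf :: "'n::finite itself \<Rightarrow> real \<Rightarrow> real \<Rightarrow> real \<Rightarrow> real" where
  "volume_cdf TYPE('n) v1 v2 s = measure (uniform_sphere \<Otimes>\<^sub>M uniform_sphere)
     {p \<in> space (uniform_sphere \<Otimes>\<^sub>M uniform_sphere). scaled_volume v1 v2 (fst p :: real ^ 'n) (snd p) \<le> s}"

lemma volume_cdf_scale: "t > 0 \<Longrightarrow> volume_cdf TYPE('n::finite) (t * v1) (t * v2) (t * s) = volume_cdf TYPE('n) v1 v2 s"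
  by (simp add: volume_cdf_def scaled_volume_scale)

lemma borel_measurable_volume_cdf [measurable (raw)]:
  assumes [measurable]: "f1 \<in> borel_measurable M" "f2 \<in> borel_measurable M" "g \<in> borel_measurable M"
  shows "(\<lambda>x. volume_cdf TYPE('n::finite) (f1 x) (f2 x) (g x)) \<in> borel_measurable M"
proof -
  let ?\<sigma> = "uniform_sphere \<Otimes>\<^sub>M uniform_sphere :: ((real ^ 'n) \<times> (real ^ 'n)) measure"
  define Q where "Q = {p \<in> space (M \<Otimes>\<^sub>M ?\<sigma>). scaled_volume (f1 (fst p)) (f2 (fst p)) (fst (snd p)) (snd (snd p)) \<le> g (fst p)}"
  have "Q \<in> sets (M \<Otimes>\<^sub>M ?\<sigma>)" unfolding Q_def by measurable
  then have "(\<lambda>x. emeasure ?\<sigma> (Pair x -` Q)) \<in> borel_measurable M"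
    by (rule uniform_sphere2.P.measurable_emeasure_Pair)
  then have "(\<lambda>x. enn2real (emeasure ?\<sigma> (Pair x -` Q))) \<in> borel_measurable M"
    by measurable
  then show ?thesis
  proof (rule measurable_cong[THEN iffD1, rotated])
    fix x assume "x \<in> space M"
    then have "Pair x -` Q = {p \<in> space ?\<sigma>. scaled_volume (f1 x) (f2 x) (fst p :: real ^ 'n) (snd p) \<le> g x}"
      by (auto simp: Q_def space_pair_measure)
    then show "enn2real (emeasure ?\<sigma> (Pair x -` Q)) = volume_cdf TYPE('n) (f1 x) (f2 x) (g x)"
      by (simp add: volume_cdf_def measure_def)
  qed
qed

lemma union_density_props:
  assumes d: "CARD('n::finite) \<ge> 2" and v: "v1 > 0" "v2 > 0"
  shows "0 \<le> (union_density TYPE('n) v1 v2) s" "continuous_on {max v1 v2<..<v1 + v2} (union_density TYPE('n) v1 v2)"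
  "distributed (uniform_sphere \<Otimes>\<^sub>M uniform_sphere) lborel (\<lambda>p. scaled_volume v1 v2 (fst p :: real ^ 'n) (snd p)) (\<lambda>s. ennreal ((union_density TYPE('n) v1 v2) s))"
proof -
  have "(\<forall>s. 0 \<le> (union_density TYPE('n) v1 v2) s) \<and> continuous_on {max v1 v2<..<v1 + v2} (union_density TYPE('n) v1 v2) \<and>
    distributed (uniform_sphere \<Otimes>\<^sub>M uniform_sphere) lborel
      (\<lambda>(\<theta>1, \<theta>2 :: real ^ 'n). union_volume (root CARD('n) v1) (root CARD('n) v2) \<theta>1 \<theta>2 / ball_volume TYPE('n))
      (\<lambda>s. ennreal ((union_density TYPE('n) v1 v2) s))"
    unfolding union_density_def by (rule someI_ex[OF ex_union_density[OF d v]])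
  then show "0 \<le> (union_density TYPE('n) v1 v2) s" "continuous_on {max v1 v2<..<v1 + v2} (union_density TYPE('n) v1 v2)"
  "distributed (uniform_sphere \<Otimes>\<^sub>M uniform_sphere) lborel (\<lambda>p. scaled_volume v1 v2 (fst p :: real ^ 'n) (snd p)) (\<lambda>s. ennreal ((union_density TYPE('n) v1 v2) s))"
    by (auto simp: scaled_volume_def case_prod_beta')
qed

lemma borel_measurable_union_density:
  assumes d: "CARD('n::finite) \<ge> 2" and v: "v1 > 0" "v2 > 0"
  shows "(union_density TYPE('n) v1 v2) \<in> borel_measurable borel"
  using distributed_real_measurable[OF union_density_props(1)[OF d v] union_density_props(3)[OF d v]] by simp

text \<open>Continuity on the open interval turns the integral formula for the law into a
  derivative, and so fixes the value of the chosen density at each point there.\<close>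

lemma DERIV_volume_cdf:
  assumes d: "CARD('n::finite) \<ge> 2" and v: "v1 > 0" "v2 > 0"
    and s: "max v1 v2 < s" "s < v1 + v2"
  shows "DERIV (volume_cdf TYPE('n) v1 v2) s :> (union_density TYPE('n) v1 v2) s"
proof -
  let ?\<sigma> = "uniform_sphere \<Otimes>\<^sub>M uniform_sphere :: ((real ^ 'n) \<times> (real ^ 'n)) measure"
  let ?S = "\<lambda>p. scaled_volume v1 v2 (fst p :: real ^ 'n) (snd p)"
  let ?F = "volume_cdf TYPE('n) v1 v2"
  note [measurable] = borel_measurable_union_density[OF d v]
  have Sm: "?S \<in> measurable ?\<sigma> lborel" by measurable
  interpret D: prob_space "distr ?\<sigma> lborel ?S" by (rule uniform_sphere2.prob_space_distr[OF Sm])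
  have F: "?F x = measure (distr ?\<sigma> lborel ?S) {..x}" for x
    unfolding volume_cdf_def by (subst measure_distr[OF Sm]) (auto intro!: arg_cong2[where f = measure])
  define a b where "a = (max v1 v2 + s) / 2" and "b = (s + (v1 + v2)) / 2"
  have ab: "max v1 v2 < a" "a < s" "s < b" "b < v1 + v2" using s by (auto simp: a_def b_def)
  have cont: "continuous_on {a..b} (union_density TYPE('n) v1 v2)"
    by (rule continuous_on_subset[OF union_density_props(2)[OF d v]]) (use ab in auto)
  have split: "?F x = ?F a + integral {a..x} (union_density TYPE('n) v1 v2)" if x: "a \<le> x" "x \<le> b" for x
  proof -
    have c: "continuous_on {a..x} (union_density TYPE('n) v1 v2)" by (rule continuous_on_subset[OF cont]) (use x in auto)
    let ?m = "measure (distr ?\<sigma> lborel ?S)"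
    have "{..x} = {..a} \<union> {a<..x}" using x by auto
    then have 1: "?m {..x} = ?m {..a} + ?m {a<..x}"
      by (simp only:) (rule D.finite_measure_Union, auto)
    have "ennreal (?m {a<..x}) = emeasure (density lborel (\<lambda>s. ennreal ((union_density TYPE('n) v1 v2) s))) {a<..x}"
      by (simp only: D.emeasure_eq_measure[symmetric]) (simp only: distributed_distr_eq_density[OF union_density_props(3)[OF d v]])
    also have "\<dots> = (\<integral>\<^sup>+s. ennreal ((union_density TYPE('n) v1 v2) s) * indicator {a<..x} s \<partial>lborel)"
      by (rule emeasure_density) auto
    also have "\<dots> = (\<integral>\<^sup>+s. ennreal (indicator {a..x} s * (union_density TYPE('n) v1 v2) s) \<partial>lborel)"
      using AE_lborel_singleton[of a] by (intro nn_integral_cong_AE) (auto elim!: eventually_mono split: split_indicator)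
    also have "\<dots> = ennreal (integral {a..x} (union_density TYPE('n) v1 v2))"
      by (rule nn_integral_indicator_Icc[OF _ c union_density_props(1)[OF d v]]) simp
    finally have "?m {a<..x} = integral {a..x} (union_density TYPE('n) v1 v2)"
      by (subst (asm) ennreal_inj) (auto intro!: integral_nonneg integrable_continuous_real c union_density_props(1)[OF d v])
    then show ?thesis unfolding F 1 by (simp only:)
  qed
  have "((\<lambda>x. integral {a..x} (union_density TYPE('n) v1 v2)) has_real_derivative (union_density TYPE('n) v1 v2) s) (at s within {a..b})"
    using ab by (intro integral_has_real_derivative cont) auto
  then have "((\<lambda>x. integral {a..x} (union_density TYPE('n) v1 v2)) has_real_derivative (union_density TYPE('n) v1 v2) s) (at s)"
    using ab by (simp only: at_within_Icc_at)
  from DERIV_add[OF DERIV_const[of "?F a"] this]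
  have D: "((\<lambda>x. ?F a + integral {a..x} (union_density TYPE('n) v1 v2)) has_real_derivative (union_density TYPE('n) v1 v2) s) (at s)" by (simp only: add_0)
  show ?thesis
  proof (rule has_field_derivative_transform_within_open[OF D, of "{a<..<b}"])
    show "?F a + integral {a..x} (union_density TYPE('n) v1 v2) = ?F x" if "x \<in> {a<..<b}" for x
      by (rule split[symmetric]) (use that in simp_all)
  qed (use ab in simp_all)
qed

text \<open>The integral is cut to the open interval because \<open>union_density\<close> is only specified almost everywhere
  outside of it; the law charges neither the complement nor the endpoints.\<close>
lemma nn_integral_union_density:
  assumes d: "CARD('n::finite) \<ge> 2" and v: "v1 > 0" "v2 > 0"
    and [measurable]: "h \<in> borel_measurable borel"
  shows "(\<integral>\<^sup>+\<theta>1. \<integral>\<^sup>+\<theta>2. h (scaled_volume v1 v2 \<theta>1 \<theta>2) \<partial>uniform_sphere \<partial>(uniform_sphere :: (real ^ 'n) measure))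
    = (\<integral>\<^sup>+s. indicator {max v1 v2<..<v1 + v2} s * (ennreal ((union_density TYPE('n) v1 v2) s) * h s) \<partial>lborel)"
proof -
  note [measurable] = borel_measurable_union_density[OF d v]
  let ?I = "indicator {max v1 v2..v1 + v2} :: real \<Rightarrow> ennreal"
  have "(\<integral>\<^sup>+\<theta>1. \<integral>\<^sup>+\<theta>2. h (scaled_volume v1 v2 \<theta>1 \<theta>2) \<partial>uniform_sphere \<partial>(uniform_sphere :: (real ^ 'n) measure))
    = (\<integral>\<^sup>+p. h (scaled_volume v1 v2 (fst p) (snd p)) \<partial>(uniform_sphere \<Otimes>\<^sub>M (uniform_sphere :: (real ^ 'n) measure)))"
    by (subst uniform_sphere.nn_integral_fst[symmetric]) auto
  also have "\<dots> = (\<integral>\<^sup>+p. ?I (scaled_volume v1 v2 (fst p) (snd p)) * h (scaled_volume v1 v2 (fst p) (snd p)) \<partial>(uniform_sphere \<Otimes>\<^sub>M (uniform_sphere :: (real ^ 'n) measure)))"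
  proof (rule nn_integral_cong)
    fix p :: "(real ^ 'n) \<times> (real ^ 'n)"
    have "scaled_volume v1 v2 (fst p) (snd p) \<in> {max v1 v2..v1 + v2}"
      using scaled_volume_le[of v1 v2 "fst p" "snd p"] scaled_volume_ge[of v1 v2 "fst p" "snd p"] v by simp
    then show "h (scaled_volume v1 v2 (fst p) (snd p)) = ?I (scaled_volume v1 v2 (fst p) (snd p)) * h (scaled_volume v1 v2 (fst p) (snd p))"
      by (simp only: indicator_simps mult_1)
  qed
  also have "\<dots> = (\<integral>\<^sup>+s. ennreal ((union_density TYPE('n) v1 v2) s) * (?I s * h s) \<partial>lborel)"
    by (rule distributed_nn_integral[OF union_density_props(3)[OF d v], symmetric]) measurable
  also have "\<dots> = (\<integral>\<^sup>+s. indicator {max v1 v2<..<v1 + v2} s * (ennreal ((union_density TYPE('n) v1 v2) s) * h s) \<partial>lborel)"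
    by (intro nn_integral_cong_AE, use AE_lborel_singleton[of "max v1 v2"] AE_lborel_singleton[of "v1 + v2"] in \<open>eventually_elim\<close>)
      (auto simp: indicator_def)
  finally show ?thesis .
qed

text \<open>The density at 1, cut to the interior of \<open>D1\<close>, where the choice in
  \<open>union_density\<close> is determined. This makes it Borel measurable; only boundary values
  are lost.\<close>

definition unit_density :: "'n::finite itself \<Rightarrow> real \<Rightarrow> real \<Rightarrow> real" where
  "unit_density TYPE('n) u1 u2 = (if u1 < 1 \<and> u2 < 1 \<and> 1 < u1 + u2 then union_density TYPE('n) u1 u2 1 else 0)"

lemma unit_density_nonneg:
  assumes d: "CARD('n::finite) \<ge> 2"
  shows "0 \<le> unit_density TYPE('n) u1 u2"
  using union_density_props(1)[OF d, of u1 u2] by (simp add: unit_density_def)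

text \<open>Joint dilation leaves the distribution function unchanged by
  \<open>volume_cdf_scale\<close>; differentiating produces the factor \<open>1 / s\<close>. All
  values on the open interval are thereby reduced to values at 1.\<close>

lemma union_density_homogeneous:
  assumes d: "CARD('n::finite) \<ge> 2" and v: "v1 > 0" "v2 > 0" and s: "max v1 v2 < s" "s < v1 + v2"
  shows "union_density TYPE('n) v1 v2 s = unit_density TYPE('n) (v1 / s) (v2 / s) / s"
proof -
  have s0: "s > 0" using s v by simp
  have u: "v1 / s > 0" "v2 / s > 0" "max (v1 / s) (v2 / s) < 1" "1 < v1 / s + v2 / s"
    using s0 v s by (auto simp: field_simps)
  have "DERIV (volume_cdf TYPE('n) (v1 / s) (v2 / s)) (1 / s * s) :> union_density TYPE('n) (v1 / s) (v2 / s) 1"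
    using DERIV_volume_cdf[OF d u] s0 by simp
  from DERIV_chain2[OF this DERIV_cmult[OF DERIV_ident]]
  have "DERIV (\<lambda>x. volume_cdf TYPE('n) (v1 / s) (v2 / s) (1 / s * x)) s :> union_density TYPE('n) (v1 / s) (v2 / s) 1 * (1 / s * 1)"
    by this
  moreover have "volume_cdf TYPE('n) (v1 / s) (v2 / s) (1 / s * x) = volume_cdf TYPE('n) v1 v2 x" for x
    using volume_cdf_scale[of "1 / s" v1 v2 x, where 'n = 'n] s0 by simp
  ultimately have "DERIV (volume_cdf TYPE('n) v1 v2) s :> union_density TYPE('n) (v1 / s) (v2 / s) 1 * (1 / s * 1)"
    by (simp only: )
  then have "union_density TYPE('n) v1 v2 s = union_density TYPE('n) (v1 / s) (v2 / s) 1 * (1 / s * 1)"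
    by (rule DERIV_unique[OF DERIV_volume_cdf[OF d v s]])
  then show ?thesis using u by (simp add: unit_density_def)
qed

text \<open>A pointwise limit of difference quotients of the jointly measurable
  \<open>volume_cdf\<close>.\<close>

lemma borel_measurable_unit_density:
  assumes d: "CARD('n::finite) \<ge> 2"
  shows "(\<lambda>u. unit_density TYPE('n) (fst u) (snd u)) \<in> borel_measurable (borel \<Otimes>\<^sub>M borel)"
proof -
  define D where "D = {u :: real \<times> real. fst u < 1 \<and> snd u < 1 \<and> 1 < fst u + snd u}"
  have "{u \<in> space (borel \<Otimes>\<^sub>M borel). fst u < 1 \<and> snd u < 1 \<and> 1 < fst u + snd u} \<in> sets (borel \<Otimes>\<^sub>M (borel :: real measure))" by measurable
  then have [measurable]: "D \<in> sets (borel \<Otimes>\<^sub>M borel)" by (simp add: D_def space_pair_measure)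
  define g where "g N u = indicator D u * ((volume_cdf TYPE('n) (fst u) (snd u) (1 + 1 / real (Suc N)) - volume_cdf TYPE('n) (fst u) (snd u) 1) / (1 / real (Suc N)))" for N u
  have "g N \<in> borel_measurable (borel \<Otimes>\<^sub>M borel)" for N unfolding g_def[abs_def] by measurable
  then show ?thesis
  proof (rule borel_measurable_LIMSEQ_real[rotated])
    fix u :: "real \<times> real"
    show "(\<lambda>N. g N u) \<longlonglongrightarrow> unit_density TYPE('n) (fst u) (snd u)"
    proof (cases "u \<in> D")
      case True
      then have u: "fst u > 0" "snd u > 0" "max (fst u) (snd u) < 1" "1 < fst u + snd u" by (auto simp: D_def)
      have "((\<lambda>h. (volume_cdf TYPE('n) (fst u) (snd u) (1 + h) - volume_cdf TYPE('n) (fst u) (snd u) 1) / h) \<longlongrightarrow> union_density TYPE('n) (fst u) (snd u) 1) (at 0)"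
        using DERIV_volume_cdf[OF d u] unfolding DERIV_def .
      moreover have "filterlim (\<lambda>N. 1 / real (Suc N)) (at 0) sequentially"
        unfolding filterlim_at by (intro conjI LIMSEQ_Suc lim_1_over_n always_eventually) auto
      ultimately have "(\<lambda>N. (volume_cdf TYPE('n) (fst u) (snd u) (1 + 1 / real (Suc N)) - volume_cdf TYPE('n) (fst u) (snd u) 1) / (1 / real (Suc N))) \<longlonglongrightarrow> union_density TYPE('n) (fst u) (snd u) 1"
        by (rule filterlim_compose)
      then show ?thesis using True u by (simp only: g_def indicator_simps mult_1 unit_density_def) simp
    next
      case False
      then have "unit_density TYPE('n) (fst u) (snd u) = 0" by (auto simp: unit_density_def D_def)
      then show ?thesis using False by (simp add: g_def)
    qed
  qed
qed

lemma nn_integral_power_exp: "(\<integral>\<^sup>+s. indicator {0<..} s * ennreal (s ^ k * exp (- s)) \<partial>lborel) = ennreal (fact k)"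
proof -
  have "(\<integral>\<^sup>+s. indicator {0<..} s * ennreal (s ^ k * exp (- s)) \<partial>lborel) = (\<integral>\<^sup>+s. ennreal (s ^ k * exp (- s)) * indicator {0..} s \<partial>lborel)"
    by (intro nn_integral_cong_AE, use AE_lborel_singleton[of 0] in \<open>eventually_elim\<close>) (auto simp: indicator_def mult.commute)
  then show ?thesis by (simp add: nn_intergal_power_times_exp_Ici)
qed

section \<open>Poisson integrals and the constants\<close>

text \<open>One term of the limiting second moment, in normalised volumes and at intensity 1.
  \<open>S - v1\<close> is the part of the second ball outside the first, \<open>S - v2\<close> the
  converse, \<open>v1 + v2 - S\<close> the overlap; this order pairs \<open>i\<close> with the
  factor \<open>1 - v1\<close> of the constants.\<close>

definition poisson_integral :: "'n::finite itself \<Rightarrow> nat \<Rightarrow> nat \<Rightarrow> nat \<Rightarrow> ennreal" where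
  "poisson_integral TYPE('n) i j k = (\<integral>\<^sup>+v1. \<integral>\<^sup>+v2. indicator {0<..} v1 * indicator {0<..} v2 *
     (\<integral>\<^sup>+(\<theta>1 :: real ^ 'n). \<integral>\<^sup>+\<theta>2. ennreal (poisson_weight (scaled_volume v1 v2 \<theta>1 \<theta>2 - v1) (scaled_volume v1 v2 \<theta>1 \<theta>2 - v2)
        (v1 + v2 - scaled_volume v1 v2 \<theta>1 \<theta>2) i j k) \<partial>uniform_sphere \<partial>uniform_sphere) \<partial>lborel \<partial>lborel)"

lemma borel_measurable_poisson_weight [measurable (raw)]:
  assumes [measurable]: "a \<in> borel_measurable M" "b \<in> borel_measurable M" "c \<in> borel_measurable M"
  shows "(\<lambda>x. poisson_weight (a x) (b x) (c x) i j k) \<in> borel_measurable M"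
  unfolding poisson_weight_def by measurable

lemma poisson_weight_nonneg: "0 \<le> a \<Longrightarrow> 0 \<le> b \<Longrightarrow> 0 \<le> c \<Longrightarrow> 0 \<le> poisson_weight a b c i j k"
  by (simp add: poisson_weight_def)

lemma power_le_fact_mult_exp:
  fixes x :: real
  assumes "x \<ge> 0"
  shows "x ^ n / fact n \<le> 2 ^ n * exp (x / 2)"
proof -
  have "(\<Sum>i\<in>{n}. (x / 2) ^ i /\<^sub>R fact i) \<le> (\<Sum>i. (x / 2) ^ i /\<^sub>R fact i)"
    using assms summable_exp_generic[of "x / 2"] by (intro sum_le_suminf) auto
  also have "\<dots> = exp (x / 2)" by (simp only: exp_def)
  finally have "(x / 2) ^ n / fact n \<le> exp (x / 2)" by (simp add: field_simps)
  then have "2 ^ n * ((x / 2) ^ n / fact n) \<le> 2 ^ n * exp (x / 2)" by (intro mult_left_mono) auto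
  then show ?thesis by (simp add: power_divide)
qed

text \<open>Half of the exponential decay absorbs the powers, uniformly in the means, and the other
  half remains for integration.\<close>

lemma poisson_weight_le:
  assumes "0 \<le> a" "0 \<le> b" "0 \<le> c"
  shows "poisson_weight a b c i j k \<le> 2 ^ (i + j + k) * exp (- (a + b + c) / 2)"
proof -
  have "poisson_weight a b c i j k = exp (- (a + b + c)) * ((a ^ i / fact i) * (b ^ j / fact j) * (c ^ k / fact k))"
    by (simp add: poisson_weight_def)
  also have "\<dots> \<le> exp (- (a + b + c)) * ((2 ^ i * exp (a / 2)) * (2 ^ j * exp (b / 2)) * (2 ^ k * exp (c / 2)))"
    using assms by (intro mult_left_mono mult_mono power_le_fact_mult_exp mult_nonneg_nonneg divide_nonneg_nonneg) auto
  also have "\<dots> = 2 ^ (i + j + k) * (exp (- (a + b + c)) * (exp (a / 2) * exp (b / 2) * exp (c / 2)))"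
    by (simp add: power_add)
  also have "exp (- (a + b + c)) * (exp (a / 2) * exp (b / 2) * exp (c / 2)) = exp (- (a + b + c) / 2)"
    unfolding exp_add[symmetric] by (simp add: field_simps)
  finally show ?thesis .
qed

lemma nn_integral_power_exp_scaled:
  assumes s: "s > 0"
  shows "(\<integral>\<^sup>+v. indicator {0<..} v * ennreal (v ^ k * exp (- (s * v))) \<partial>lborel) = ennreal (fact k / s ^ Suc k)"
proof -
  have "(\<integral>\<^sup>+v. indicator {0<..} v * ennreal (v ^ k * exp (- (s * v))) \<partial>lborel)
    = ennreal \<bar>1 / s\<bar> * (\<integral>\<^sup>+v. indicator {0<..} (0 + 1 / s * v) * ennreal ((0 + 1 / s * v) ^ k * exp (- (s * (0 + 1 / s * v)))) \<partial>lborel)"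
    using s by (intro nn_integral_real_affine) auto
  also have "\<dots> = ennreal (1 / s) * (\<integral>\<^sup>+v. ennreal (1 / s ^ k) * (indicator {0<..} v * ennreal (v ^ k * exp (- v))) \<partial>lborel)"
  proof -
    have "indicator {0<..} (0 + 1 / s * v) * ennreal ((0 + 1 / s * v) ^ k * exp (- (s * (0 + 1 / s * v))))
      = ennreal (1 / s ^ k) * (indicator {0<..} v * ennreal (v ^ k * exp (- v)))" for v
    proof (cases "v > 0")
      case True
      then show ?thesis using s by (simp add: ennreal_mult[symmetric] power_divide zero_less_divide_iff)
    qed (use s in \<open>simp add: zero_less_divide_iff\<close>)
    then show ?thesis using s by simp
  qed
  also have "\<dots> = ennreal (1 / s) * (ennreal (1 / s ^ k) * ennreal (fact k))"
    by (subst nn_integral_cmult) (simp_all only: nn_integral_power_exp, measurable)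
  also have "\<dots> = ennreal (fact k / s ^ Suc k)"
    using s by (simp add: ennreal_mult[symmetric])
  finally show ?thesis .
qed

lemma scaled_volume_gaps:
  fixes \<theta>1 \<theta>2 :: "real ^ 'n"
  assumes "v1 \<ge> 0" "v2 \<ge> 0"
  shows "0 \<le> scaled_volume v1 v2 \<theta>1 \<theta>2 - v1" "0 \<le> scaled_volume v1 v2 \<theta>1 \<theta>2 - v2" "0 \<le> v1 + v2 - scaled_volume v1 v2 \<theta>1 \<theta>2"
  using scaled_volume_le[OF assms, of \<theta>1 \<theta>2] scaled_volume_ge[OF assms, of \<theta>1 \<theta>2] by auto

lemma poisson_integral_finite: "poisson_integral TYPE('n::finite) i j k < \<infinity>"
proof -
  let ?C = "2 ^ (i + j + k) :: real"
  have "poisson_integral TYPE('n) i j k \<le> (\<integral>\<^sup>+v1. \<integral>\<^sup>+v2. ennreal ?C * ((indicator {0<..} v1 * ennreal (v1 ^ 0 * exp (- (1 / 4 * v1)))) *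
      (indicator {0<..} v2 * ennreal (v2 ^ 0 * exp (- (1 / 4 * v2))))) \<partial>lborel \<partial>lborel)"
    unfolding poisson_integral_def
  proof (rule nn_integral_mono, rule nn_integral_mono)
    fix v1 v2 :: real
    show "indicator {0<..} v1 * indicator {0<..} v2 *
     (\<integral>\<^sup>+(\<theta>1 :: real ^ 'n). \<integral>\<^sup>+\<theta>2. ennreal (poisson_weight (scaled_volume v1 v2 \<theta>1 \<theta>2 - v1) (scaled_volume v1 v2 \<theta>1 \<theta>2 - v2)
        (v1 + v2 - scaled_volume v1 v2 \<theta>1 \<theta>2) i j k) \<partial>uniform_sphere \<partial>uniform_sphere)
      \<le> ennreal ?C * ((indicator {0<..} v1 * ennreal (v1 ^ 0 * exp (- (1 / 4 * v1)))) *
      (indicator {0<..} v2 * ennreal (v2 ^ 0 * exp (- (1 / 4 * v2)))))"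
    proof (cases "v1 > 0 \<and> v2 > 0")
      case True
      have pw: "poisson_weight (scaled_volume v1 v2 \<theta>1 \<theta>2 - v1) (scaled_volume v1 v2 \<theta>1 \<theta>2 - v2)
        (v1 + v2 - scaled_volume v1 v2 \<theta>1 \<theta>2) i j k \<le> ?C * exp (- (1 / 4 * v1) - (1 / 4 * v2))" for \<theta>1 \<theta>2 :: "real ^ 'n"
      proof -
        let ?s = "scaled_volume v1 v2 \<theta>1 \<theta>2"
        have "poisson_weight (?s - v1) (?s - v2) (v1 + v2 - ?s) i j k \<le> ?C * exp (- ((?s - v1) + (?s - v2) + (v1 + v2 - ?s)) / 2)"
          using True by (intro poisson_weight_le scaled_volume_gaps) auto
        \<comment> \<open>The three means sum to the volume of the union, which is at least
          \<open>max v1 v2\<close> and hence at least \<open>(v1 + v2) / 2\<close>.\<close>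
        also have "\<dots> \<le> ?C * exp (- (1 / 4 * v1) - (1 / 4 * v2))"
          using scaled_volume_ge[of v1 v2 \<theta>1 \<theta>2] True by simp
        finally show ?thesis .
      qed
      have "(\<integral>\<^sup>+(\<theta>1 :: real ^ 'n). \<integral>\<^sup>+\<theta>2. ennreal (poisson_weight (scaled_volume v1 v2 \<theta>1 \<theta>2 - v1) (scaled_volume v1 v2 \<theta>1 \<theta>2 - v2)
        (v1 + v2 - scaled_volume v1 v2 \<theta>1 \<theta>2) i j k) \<partial>uniform_sphere \<partial>uniform_sphere)
        \<le> (\<integral>\<^sup>+(\<theta>1 :: real ^ 'n). \<integral>\<^sup>+(\<theta>2 :: real ^ 'n). ennreal (?C * exp (- (1 / 4 * v1) - (1 / 4 * v2))) \<partial>uniform_sphere \<partial>uniform_sphere)"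
        by (intro nn_integral_mono ennreal_leI pw)
      also have "\<dots> = ennreal (?C * exp (- (1 / 4 * v1) - (1 / 4 * v2)))"
        by (simp add: uniform_sphere.emeasure_space_1[simplified])
      also have "?C * exp (- (1 / 4 * v1) - (1 / 4 * v2)) = ?C * ((v1 ^ 0 * exp (- (1 / 4 * v1))) * (v2 ^ 0 * exp (- (1 / 4 * v2))))"
        by (simp add: mult_exp_exp)
      also have "ennreal \<dots> = ennreal ?C * (ennreal (v1 ^ 0 * exp (- (1 / 4 * v1))) * ennreal (v2 ^ 0 * exp (- (1 / 4 * v2))))"
        by (subst ennreal_mult, simp, simp, subst ennreal_mult) simp_all
      finally have le: "(\<integral>\<^sup>+(\<theta>1 :: real ^ 'n). \<integral>\<^sup>+\<theta>2. ennreal (poisson_weight (scaled_volume v1 v2 \<theta>1 \<theta>2 - v1) (scaled_volume v1 v2 \<theta>1 \<theta>2 - v2)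
        (v1 + v2 - scaled_volume v1 v2 \<theta>1 \<theta>2) i j k) \<partial>uniform_sphere \<partial>uniform_sphere)
        \<le> ennreal ?C * (ennreal (v1 ^ 0 * exp (- (1 / 4 * v1))) * ennreal (v2 ^ 0 * exp (- (1 / 4 * v2))))" .
      have i: "indicator {0<..} v1 = (1 :: ennreal)" "indicator {0<..} v2 = (1 :: ennreal)" using True by simp_all
      show ?thesis unfolding i mult_1 by (rule le)
    qed auto
  qed
  also have "\<dots> = ennreal ?C * ((\<integral>\<^sup>+v1. indicator {0<..} v1 * ennreal (v1 ^ 0 * exp (- (1 / 4 * v1))) \<partial>lborel) *
      (\<integral>\<^sup>+v2. indicator {0<..} v2 * ennreal (v2 ^ 0 * exp (- (1 / 4 * v2))) \<partial>lborel))"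
    by (simp add: nn_integral_cmult nn_integral_multc)
  also have "\<dots> < \<infinity>"
    by (subst (1 2) nn_integral_power_exp_scaled) (auto simp: ennreal_mult_less_top)
  finally show ?thesis .
qed

text \<open>Conditioning on the volume \<open>s\<close> of the union and putting
  \<open>v = s * u\<close> separates \<open>s\<close> from the shape \<open>(u1, u2)\<close>. The
  factor \<open>(i + j + k + 1)!\<close> is a Gamma integral in \<open>s\<close>, and the integral
  over the shapes is the one in the definition of the constants.\<close>

lemma poisson_integral_ge2:
  assumes d: "CARD('n::finite) \<ge> 2"
  shows "poisson_integral TYPE('n) i j k = ennreal (fact (i + j + k + 1) / (fact i * fact j * fact k)) *
    (\<integral>\<^sup>+u1. \<integral>\<^sup>+u2. ennreal (unit_density TYPE('n) u1 u2 * ((1 - u1) ^ i * (1 - u2) ^ j * (u1 + u2 - 1) ^ k)) \<partial>lborel \<partial>lborel)"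
proof -
  define n where "n = i + j + k"
  define c :: real where "c = 1 / (fact i * fact j * fact k)"
  have c: "c \<ge> 0" by (simp add: c_def)
  define q where "q u1 u2 = unit_density TYPE('n) u1 u2 * ((1 - u1) ^ i * (1 - u2) ^ j * (u1 + u2 - 1) ^ k)" for u1 u2
  have q0: "0 \<le> q u1 u2" for u1 u2
  proof (cases "u1 < 1 \<and> u2 < 1 \<and> 1 < u1 + u2")
    case True
    then show ?thesis unfolding q_def
      by (intro mult_nonneg_nonneg zero_le_power unit_density_nonneg[OF d]) auto
  next
    case False
    then have "unit_density TYPE('n) u1 u2 = 0" unfolding unit_density_def by (rule if_not_P)
    then show ?thesis by (simp add: q_def)
  qed
  have [measurable (raw)]: "(\<lambda>x. unit_density TYPE('n) (f x) (g x)) \<in> borel_measurable M"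
    if [measurable]: "f \<in> borel_measurable M" "g \<in> borel_measurable M" for f g and M :: "'x measure"
    using measurable_compose[OF measurable_Pair[OF that] borel_measurable_unit_density[OF d]] by simp
  have qm: "case_prod q \<in> borel_measurable (borel \<Otimes>\<^sub>M borel)"
    using borel_measurable_unit_density[OF d] unfolding q_def case_prod_beta' by measurable
  have [measurable (raw)]: "(\<lambda>x. q (f x) (g x)) \<in> borel_measurable M"
    if "f \<in> borel_measurable M" "g \<in> borel_measurable M" for f g :: "'x \<Rightarrow> real" and M
    using measurable_compose[OF measurable_Pair[OF that] qm] by simp
  \<comment> \<open>The quotient by \<open>s\<close> comes from the homogeneity of the density; the
    power \<open>s ^ n\<close> collects the \<open>i + j + k\<close> factors of the three
    means.\<close>
  define K where "K s = c * (s ^ n * exp (- s)) / s" for s :: real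
  have inner: "indicator {0<..} v1 * indicator {0<..} v2 *
     (\<integral>\<^sup>+(\<theta>1 :: real ^ 'n). \<integral>\<^sup>+\<theta>2. ennreal (poisson_weight (scaled_volume v1 v2 \<theta>1 \<theta>2 - v1) (scaled_volume v1 v2 \<theta>1 \<theta>2 - v2)
        (v1 + v2 - scaled_volume v1 v2 \<theta>1 \<theta>2) i j k) \<partial>uniform_sphere \<partial>uniform_sphere)
    = (\<integral>\<^sup>+s. indicator {0<..} s * ennreal (K s * q (v1 / s) (v2 / s)) \<partial>lborel)" for v1 v2
  proof (cases "v1 > 0 \<and> v2 > 0")
    case True
    then have v: "v1 > 0" "v2 > 0" by auto
    have "(\<integral>\<^sup>+(\<theta>1 :: real ^ 'n). \<integral>\<^sup>+\<theta>2. ennreal (poisson_weight (scaled_volume v1 v2 \<theta>1 \<theta>2 - v1) (scaled_volume v1 v2 \<theta>1 \<theta>2 - v2)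
        (v1 + v2 - scaled_volume v1 v2 \<theta>1 \<theta>2) i j k) \<partial>uniform_sphere \<partial>uniform_sphere)
      = (\<integral>\<^sup>+s. indicator {max v1 v2<..<v1 + v2} s * (ennreal (union_density TYPE('n) v1 v2 s) * ennreal (poisson_weight (s - v1) (s - v2) (v1 + v2 - s) i j k)) \<partial>lborel)"
      by (rule nn_integral_union_density[OF d v]) measurable
    also have "\<dots> = (\<integral>\<^sup>+s. indicator {0<..} s * ennreal (K s * q (v1 / s) (v2 / s)) \<partial>lborel)"
    proof (rule nn_integral_cong)
      fix s
      show "indicator {max v1 v2<..<v1 + v2} s * (ennreal (union_density TYPE('n) v1 v2 s) * ennreal (poisson_weight (s - v1) (s - v2) (v1 + v2 - s) i j k))
        = indicator {0<..} s * ennreal (K s * q (v1 / s) (v2 / s))"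
      proof (cases "max v1 v2 < s \<and> s < v1 + v2")
        case s: True
        then have s0: "s > 0" using v by auto
        have "poisson_weight (s - v1) (s - v2) (v1 + v2 - s) i j k
          = c * exp (- s) * ((s * (1 - v1 / s)) ^ i * (s * (1 - v2 / s)) ^ j * (s * (v1 / s + v2 / s - 1)) ^ k)"
        proof -
          have "s - v1 = s * (1 - v1 / s)" "s - v2 = s * (1 - v2 / s)" "v1 + v2 - s = s * (v1 / s + v2 / s - 1)"
            using s0 by (simp_all add: field_simps)
          moreover have "(s - v1) + (s - v2) + (v1 + v2 - s) = s" by simp
          ultimately show ?thesis unfolding poisson_weight_def c_def by (simp only: times_divide_eq_left mult_1_left)
        qed
        also have "\<dots> = c * (s ^ n * exp (- s)) * ((1 - v1 / s) ^ i * (1 - v2 / s) ^ j * (v1 / s + v2 / s - 1) ^ k)"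
          by (simp add: power_mult_distrib power_add n_def mult_ac)
        finally have pw: "poisson_weight (s - v1) (s - v2) (v1 + v2 - s) i j k
          = c * (s ^ n * exp (- s)) * ((1 - v1 / s) ^ i * (1 - v2 / s) ^ j * (v1 / s + v2 / s - 1) ^ k)" .
        have "0 \<le> poisson_weight (s - v1) (s - v2) (v1 + v2 - s) i j k"
          using s by (intro poisson_weight_nonneg) auto
        then have "ennreal (union_density TYPE('n) v1 v2 s) * ennreal (poisson_weight (s - v1) (s - v2) (v1 + v2 - s) i j k)
          = ennreal (union_density TYPE('n) v1 v2 s * poisson_weight (s - v1) (s - v2) (v1 + v2 - s) i j k)"
          using union_density_props(1)[OF d v] by (intro ennreal_mult[symmetric])
        also have "union_density TYPE('n) v1 v2 s * poisson_weight (s - v1) (s - v2) (v1 + v2 - s) i j k = K s * q (v1 / s) (v2 / s)"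
          using s unfolding pw by (subst union_density_homogeneous[OF d v]) (auto simp: K_def q_def mult_ac)
        finally show ?thesis using s s0 by simp
      next
        case False
        then have "q (v1 / s) (v2 / s) = 0" if "s > 0"
        proof -
          have "\<not> (v1 / s < 1 \<and> v2 / s < 1 \<and> 1 < v1 / s + v2 / s)"
            using False that by (auto simp: not_less field_simps)
          then have "unit_density TYPE('n) (v1 / s) (v2 / s) = 0" unfolding unit_density_def by (rule if_not_P)
          then show ?thesis by (simp add: q_def)
        qed
        then show ?thesis using False by (cases "s > 0") auto
      qed
    qed
    finally show ?thesis using True by simp
  next
    case False
    have "q (v1 / s) (v2 / s) = 0" if "s > 0" for s
    proof -
      have "\<not> (v1 / s < 1 \<and> v2 / s < 1 \<and> 1 < v1 / s + v2 / s)"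
        using False that by (auto simp: not_less field_simps)
      then have "unit_density TYPE('n) (v1 / s) (v2 / s) = 0" unfolding unit_density_def by (rule if_not_P)
      then show ?thesis by (simp add: q_def)
    qed
    then have "(\<integral>\<^sup>+s. indicator {0<..} s * ennreal (K s * q (v1 / s) (v2 / s)) \<partial>lborel) = (\<integral>\<^sup>+s. 0 \<partial>(lborel :: real measure))"
      by (intro nn_integral_cong) (simp add: indicator_def)
    then show ?thesis using False by auto
  qed
  define \<Gamma> where "\<Gamma> = (\<integral>\<^sup>+u1. \<integral>\<^sup>+u2. ennreal (q u1 u2) \<partial>lborel \<partial>lborel)"
  have Km [measurable]: "K \<in> borel_measurable borel" unfolding K_def[abs_def] by measurable
  have "poisson_integral TYPE('n) i j k = (\<integral>\<^sup>+v1. \<integral>\<^sup>+v2. \<integral>\<^sup>+s. indicator {0<..} s * ennreal (K s * q (v1 / s) (v2 / s)) \<partial>lborel \<partial>lborel \<partial>lborel)"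
    unfolding poisson_integral_def inner ..
  also have "\<dots> = (\<integral>\<^sup>+v1. \<integral>\<^sup>+s. \<integral>\<^sup>+v2. indicator {0<..} s * ennreal (K s * q (v1 / s) (v2 / s)) \<partial>lborel \<partial>lborel \<partial>lborel)"
    by (rule nn_integral_cong, rule lborel_pair.Fubini') measurable
  also have "\<dots> = (\<integral>\<^sup>+s. \<integral>\<^sup>+v1. \<integral>\<^sup>+v2. indicator {0<..} s * ennreal (K s * q (v1 / s) (v2 / s)) \<partial>lborel \<partial>lborel \<partial>lborel)"
    by (rule lborel_pair.Fubini') measurable
  \<comment> \<open>The two substitutions \<open>v = s * u\<close> contribute the square of
    \<open>s\<close>; against the factor \<open>1 / s\<close> in \<open>K s\<close> one extra power
    survives.\<close>
  also have "\<dots> = (\<integral>\<^sup>+s. ennreal c * (indicator {0<..} s * ennreal (s ^ (n + 1) * exp (- s))) * \<Gamma> \<partial>lborel)"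
  proof (rule nn_integral_cong)
    fix s :: real
    show "(\<integral>\<^sup>+v1. \<integral>\<^sup>+v2. indicator {0<..} s * ennreal (K s * q (v1 / s) (v2 / s)) \<partial>lborel \<partial>lborel)
      = ennreal c * (indicator {0<..} s * ennreal (s ^ (n + 1) * exp (- s))) * \<Gamma>"
    proof (cases "s > 0")
      case True
      have K0: "K s \<ge> 0" using True c by (simp add: K_def)
      have "(\<integral>\<^sup>+v1. \<integral>\<^sup>+v2. indicator {0<..} s * ennreal (K s * q (v1 / s) (v2 / s)) \<partial>lborel \<partial>lborel)
        = (\<integral>\<^sup>+v1. \<integral>\<^sup>+v2. ennreal (K s) * ennreal (q (v1 / s) (v2 / s)) \<partial>lborel \<partial>lborel)"
        using True K0 q0 by (simp add: ennreal_mult)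
      also have "\<dots> = (\<integral>\<^sup>+v1. ennreal \<bar>s\<bar> * (\<integral>\<^sup>+u2. ennreal (K s) * ennreal (q (v1 / s) ((0 + s * u2) / s)) \<partial>lborel) \<partial>lborel)"
        using True by (intro nn_integral_cong nn_integral_real_affine) auto
      also have "\<dots> = ennreal \<bar>s\<bar> * (\<integral>\<^sup>+u1. ennreal \<bar>s\<bar> * (\<integral>\<^sup>+u2. ennreal (K s) * ennreal (q ((0 + s * u1) / s) ((0 + s * u2) / s)) \<partial>lborel) \<partial>lborel)"
        using True by (intro nn_integral_real_affine) auto
      also have "\<dots> = ennreal s * (\<integral>\<^sup>+u1. ennreal s * (\<integral>\<^sup>+u2. ennreal (K s) * ennreal (q u1 u2) \<partial>lborel) \<partial>lborel)"
        using True by simp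
      also have "\<dots> = ennreal s * (ennreal s * (ennreal (K s) * \<Gamma>))"
        unfolding \<Gamma>_def by (simp add: nn_integral_cmult)
      also have "\<dots> = ennreal (s * (s * K s)) * \<Gamma>"
        using True K0 by (simp add: ennreal_mult mult.assoc)
      also have "s * (s * K s) = c * (s ^ (n + 1) * exp (- s))"
        using True by (simp add: K_def)
      finally show ?thesis using True c by (simp add: ennreal_mult)
    qed simp
  qed
  also have "\<dots> = ennreal c * (\<integral>\<^sup>+s. indicator {0<..} s * ennreal (s ^ (n + 1) * exp (- s)) \<partial>lborel) * \<Gamma>"
    by (simp add: nn_integral_cmult nn_integral_multc)
  also have "\<dots> = ennreal (fact (n + 1) / (fact i * fact j * fact k)) * \<Gamma>"
    unfolding nn_integral_power_exp using c by (simp add: ennreal_mult[symmetric] c_def)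
  finally show ?thesis unfolding \<Gamma>_def q_def n_def .
qed

lemma union_volume_orthogonal:
  fixes f :: "real ^ 'n \<Rightarrow> real ^ 'n"
  assumes f: "orthogonal_transformation f"
  shows "union_volume r1 r2 (f \<theta>1) (f \<theta>2) = union_volume r1 r2 \<theta>1 \<theta>2"
proof -
  have lin: "linear f" by (rule orthogonal_transformation_linear[OF f])
  have fm: "f \<in> borel_measurable borel"
    using lin by (intro borel_measurable_continuous_onI) (simp add: linear_continuous_on linear_linear)
  have cb: "f z \<in> cball (r *\<^sub>R f \<theta>) r \<longleftrightarrow> z \<in> cball (r *\<^sub>R \<theta>) r" for z \<theta> r
  proof -
    have "norm (r *\<^sub>R f \<theta> - f z) = norm (r *\<^sub>R \<theta> - z)"
      using orthogonal_transformation_norm[OF f, of "r *\<^sub>R \<theta> - z"]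
      by (simp only: linear_diff[OF lin] linear_scale[OF lin])
    then show ?thesis by (simp add: dist_norm)
  qed
  let ?A = "cball (r1 *\<^sub>R f \<theta>1) r1 \<union> cball (r2 *\<^sub>R f \<theta>2) r2"
  have "emeasure lborel ?A = emeasure (distr lborel borel f) ?A" by (simp only: lborel_orthogonal[OF f])
  also have "\<dots> = emeasure lborel (f -` ?A \<inter> space lborel)"
    using fm by (intro emeasure_distr) auto
  also have "f -` ?A \<inter> space lborel = cball (r1 *\<^sub>R \<theta>1) r1 \<union> cball (r2 *\<^sub>R \<theta>2) r2"
    using cb by (auto simp del: mem_cball)
  finally show ?thesis by (simp add: union_volume_def measure_def)
qed

text \<open>A rotation carrying \<open>e\<close> to \<open>\<theta>1\<close> preserves both the
  volume and the law of \<open>\<theta>2\<close>, so the inner integral does not depend on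
  \<open>\<theta>1\<close>.\<close>

lemma nn_integral_scaled_volume_rotate:
  assumes e: "norm (e :: real ^ 'n) = 1" and [measurable]: "h \<in> borel_measurable borel"
  shows "(\<integral>\<^sup>+(\<theta>1 :: real ^ 'n). \<integral>\<^sup>+\<theta>2. h (scaled_volume v1 v2 \<theta>1 \<theta>2) \<partial>uniform_sphere \<partial>uniform_sphere)
    = (\<integral>\<^sup>+\<theta>. h (scaled_volume v1 v2 e \<theta>) \<partial>uniform_sphere)"
proof -
  have "(\<integral>\<^sup>+(\<theta>1 :: real ^ 'n). \<integral>\<^sup>+\<theta>2. h (scaled_volume v1 v2 \<theta>1 \<theta>2) \<partial>uniform_sphere \<partial>uniform_sphere)
    = (\<integral>\<^sup>+(\<theta>1 :: real ^ 'n). (\<integral>\<^sup>+\<theta>. h (scaled_volume v1 v2 e \<theta>) \<partial>uniform_sphere) \<partial>uniform_sphere)"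
  proof (rule nn_integral_cong_AE)
    show "AE \<theta>1 in (uniform_sphere :: (real ^ 'n) measure). (\<integral>\<^sup>+\<theta>2. h (scaled_volume v1 v2 \<theta>1 \<theta>2) \<partial>uniform_sphere) = (\<integral>\<^sup>+\<theta>. h (scaled_volume v1 v2 e \<theta>) \<partial>uniform_sphere)"
      using AE_uniform_sphere
    proof eventually_elim
      case (elim \<theta>1)
      obtain f where f: "orthogonal_transformation f" "f e = \<theta>1"
        using orthogonal_transformation_exists[of e \<theta>1] e elim by metis
      have fm [measurable]: "f \<in> borel_measurable borel"
        using orthogonal_transformation_linear[OF f(1)]
        by (intro borel_measurable_continuous_onI) (simp add: linear_continuous_on linear_linear)
      have "(\<integral>\<^sup>+\<theta>2. h (scaled_volume v1 v2 \<theta>1 \<theta>2) \<partial>uniform_sphere) = (\<integral>\<^sup>+\<theta>2. h (scaled_volume v1 v2 \<theta>1 \<theta>2) \<partial>distr uniform_sphere borel f)"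
        by (simp only: distr_uniform_sphere_orthogonal[OF f(1)])
      also have "\<dots> = (\<integral>\<^sup>+\<theta>. h (scaled_volume v1 v2 \<theta>1 (f \<theta>)) \<partial>uniform_sphere)"
        by (rule nn_integral_distr) measurable
      also have "\<dots> = (\<integral>\<^sup>+\<theta>. h (scaled_volume v1 v2 e \<theta>) \<partial>uniform_sphere)"
        by (simp add: scaled_volume_def f(2)[symmetric] union_volume_orthogonal[OF f(1)])
      finally show ?case .
    qed
  qed
  also have "\<dots> = (\<integral>\<^sup>+\<theta>. h (scaled_volume v1 v2 e \<theta>) \<partial>uniform_sphere)"
    by (simp add: uniform_sphere.emeasure_space_1[simplified])
  finally show ?thesis .
qed

lemma norm_first_unit_vector: "norm (first_unit_vector :: real ^ 'n) = 1"
  by (simp add: first_unit_vector_def norm_axis_1)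

text \<open>In polar coordinates a uniform point \<open>D\<close> of the unit ball is
  \<open>root CARD('n) u *\<^sub>R \<theta>\<close> with \<open>u\<close> uniform on the unit
  interval, and \<open>T_ratio D\<close> becomes the scaled volume for normalised volumes 1 and
  \<open>u\<close>.\<close>

lemma ennreal_alpha_nn: "alpha TYPE('n::finite) = enn2real (\<integral>\<^sup>+u. indicator {0<..1} u *
    (\<integral>\<^sup>+\<theta>. ennreal (2 / (scaled_volume 1 u (first_unit_vector :: real ^ 'n) \<theta>)\<^sup>2) \<partial>uniform_sphere) \<partial>lborel)"
proof -
  let ?e = "first_unit_vector :: real ^ 'n"
  let ?c = "ball_volume TYPE('n)"
  have c: "?c > 0" by (rule ball_volume_pos)
  have T: "T_ratio D = union_volume 1 (norm D) ?e (D /\<^sub>R norm D) / ?c" for D :: "real ^ 'n"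
    by (cases "D = 0") (simp_all add: T_ratio_def union_volume_def)
  have Tm [measurable]: "(T_ratio :: real ^ 'n \<Rightarrow> real) \<in> borel_measurable borel"
    unfolding T[abs_def] by measurable
  have [measurable]: "cball 0 1 \<in> sets (borel :: (real ^ 'n) measure)" by simp
  have "alpha TYPE('n) = enn2real (\<integral>\<^sup>+(D :: real ^ 'n). ennreal (2 / (T_ratio D)\<^sup>2) \<partial>uniform_ball)"
    unfolding alpha_def by (rule integral_eq_nn_integral) auto
  also have "(\<integral>\<^sup>+(D :: real ^ 'n). ennreal (2 / (T_ratio D)\<^sup>2) \<partial>uniform_ball)
    = (\<integral>\<^sup>+(D :: real ^ 'n). ennreal (2 / (T_ratio D)\<^sup>2) * indicator (cball 0 1) D \<partial>lborel) / ennreal ?c"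
    unfolding uniform_ball_def by (subst nn_integral_uniform_measure) (auto simp: emeasure_cball_ball_volume[of 1])
  also have "(\<integral>\<^sup>+(D :: real ^ 'n). ennreal (2 / (T_ratio D)\<^sup>2) * indicator (cball 0 1) D \<partial>lborel)
    = ennreal ?c * (\<integral>\<^sup>+v. indicator {0<..} v * (\<integral>\<^sup>+\<theta>. ennreal (2 / (T_ratio (root CARD('n) v *\<^sub>R \<theta>))\<^sup>2) *
        indicator (cball 0 1) (root CARD('n) v *\<^sub>R (\<theta> :: real ^ 'n)) \<partial>uniform_sphere) \<partial>lborel)"
    by (rule nn_integral_polar) measurable
  also have "(\<integral>\<^sup>+v. indicator {0<..} v * (\<integral>\<^sup>+\<theta>. ennreal (2 / (T_ratio (root CARD('n) v *\<^sub>R \<theta>))\<^sup>2) *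
        indicator (cball 0 1) (root CARD('n) v *\<^sub>R (\<theta> :: real ^ 'n)) \<partial>uniform_sphere) \<partial>lborel)
    = (\<integral>\<^sup>+u. indicator {0<..1} u * (\<integral>\<^sup>+\<theta>. ennreal (2 / (scaled_volume 1 u ?e \<theta>)\<^sup>2) \<partial>uniform_sphere) \<partial>lborel)"
  proof (rule nn_integral_cong)
    fix v :: real
    show "indicator {0<..} v * (\<integral>\<^sup>+\<theta>. ennreal (2 / (T_ratio (root CARD('n) v *\<^sub>R \<theta>))\<^sup>2) *
        indicator (cball 0 1) (root CARD('n) v *\<^sub>R (\<theta> :: real ^ 'n)) \<partial>uniform_sphere)
      = indicator {0<..1} v * (\<integral>\<^sup>+\<theta>. ennreal (2 / (scaled_volume 1 v ?e \<theta>)\<^sup>2) \<partial>uniform_sphere)"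
    proof (cases "v > 0")
      case True
      have r: "root CARD('n) v > 0" using True by simp
      have "(\<integral>\<^sup>+\<theta>. ennreal (2 / (T_ratio (root CARD('n) v *\<^sub>R \<theta>))\<^sup>2) *
        indicator (cball 0 1) (root CARD('n) v *\<^sub>R (\<theta> :: real ^ 'n)) \<partial>uniform_sphere)
        = (\<integral>\<^sup>+\<theta>. indicator {0<..1} v * ennreal (2 / (scaled_volume 1 v ?e \<theta>)\<^sup>2) \<partial>uniform_sphere)"
      proof (rule nn_integral_cong_AE)
        show "AE \<theta> in uniform_sphere. ennreal (2 / (T_ratio (root CARD('n) v *\<^sub>R \<theta>))\<^sup>2) *
            indicator (cball 0 1) (root CARD('n) v *\<^sub>R (\<theta> :: real ^ 'n))
          = indicator {0<..1} v * ennreal (2 / (scaled_volume 1 v ?e \<theta>)\<^sup>2)"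
          using AE_uniform_sphere
        proof eventually_elim
          case (elim \<theta>)
          have n: "norm (root CARD('n) v *\<^sub>R \<theta>) = root CARD('n) v" using r elim by simp
          have "(root CARD('n) v *\<^sub>R \<theta>) /\<^sub>R root CARD('n) v = \<theta>" using r by simp
          then have "T_ratio (root CARD('n) v *\<^sub>R \<theta>) = scaled_volume 1 v ?e \<theta>"
            unfolding T n by (simp add: scaled_volume_def)
          moreover have "indicator (cball 0 1) (root CARD('n) v *\<^sub>R \<theta>) = (indicator {0<..1} v :: ennreal)"
            using True n by (simp add: indicator_def)
          ultimately show ?case by (simp add: mult.commute)
        qed
      qed
      also have "\<dots> = indicator {0<..1} v * (\<integral>\<^sup>+\<theta>. ennreal (2 / (scaled_volume 1 v ?e \<theta>)\<^sup>2) \<partial>uniform_sphere)"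
        by (rule nn_integral_cmult) measurable
      finally show ?thesis using True by simp
    qed simp
  qed
  finally show ?thesis using c by (simp add: ennreal_mult_divide_eq mult.commute[of "ennreal ?c"])
qed

text \<open>Explains the form of \<alpha>(d). The integrand is \<open>exp (- S)\<close>; by symmetry
  the integral is twice that over \<open>v2 \<le> v1\<close>. With \<open>v2 = v1 * u\<close> the
  volume is \<open>v1\<close> times its value at \<open>(1, u)\<close>, the Jacobian is
  \<open>v1\<close>, and the integral over \<open>v1\<close> leaves the inverse square.\<close>

lemma poisson_integral_000: "poisson_integral TYPE('n::finite) 0 0 0 = ennreal (alpha TYPE('n))"
proof -
  let ?e = "first_unit_vector :: real ^ 'n"
  have e: "norm ?e = 1" by (rule norm_first_unit_vector)
  define \<phi> where "\<phi> v1 v2 = (\<integral>\<^sup>+\<theta>. ennreal (exp (- scaled_volume v1 v2 ?e \<theta>)) \<partial>uniform_sphere)" for v1 v2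
  have [measurable (raw)]: "(\<lambda>x. \<phi> (f x) (g x)) \<in> borel_measurable M"
    if [measurable]: "f \<in> borel_measurable M" "g \<in> borel_measurable M" for f g and M :: "'x measure"
    unfolding \<phi>_def by measurable
  have \<phi>: "(\<integral>\<^sup>+(\<theta>1 :: real ^ 'n). \<integral>\<^sup>+\<theta>2. ennreal (exp (- scaled_volume v1 v2 \<theta>1 \<theta>2)) \<partial>uniform_sphere \<partial>uniform_sphere) = \<phi> v1 v2" for v1 v2
    unfolding \<phi>_def by (rule nn_integral_scaled_volume_rotate[OF e]) measurable
  have sym: "\<phi> v1 v2 = \<phi> v2 v1" for v1 v2
  proof -
    have "\<phi> v1 v2 = (\<integral>\<^sup>+(\<theta>1 :: real ^ 'n). \<integral>\<^sup>+\<theta>2. ennreal (exp (- scaled_volume v2 v1 \<theta>2 \<theta>1)) \<partial>uniform_sphere \<partial>uniform_sphere)"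
      unfolding \<phi>[symmetric] by (simp only: scaled_volume_commute[of v1])
    also have "\<dots> = (\<integral>\<^sup>+\<theta>2. \<integral>\<^sup>+(\<theta>1 :: real ^ 'n). ennreal (exp (- scaled_volume v2 v1 \<theta>2 \<theta>1)) \<partial>uniform_sphere \<partial>uniform_sphere)"
      by (rule uniform_sphere2.Fubini') measurable
    finally show ?thesis unfolding \<phi> .
  qed
  let ?I = "indicator {0<..} :: real \<Rightarrow> ennreal"
  have pw: "poisson_weight (s - v1) (s - v2) (v1 + v2 - s) 0 0 0 = exp (- s)" for s v1 v2
    by (simp add: poisson_weight_def)
  have "poisson_integral TYPE('n) 0 0 0 = (\<integral>\<^sup>+v1. \<integral>\<^sup>+v2. ?I v1 * ?I v2 * \<phi> v1 v2 \<partial>lborel \<partial>lborel)"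
    unfolding poisson_integral_def pw \<phi> ..
  \<comment> \<open>Split along the null diagonal; in the second half the arguments are exchanged by
    \<open>sym\<close>, so that renaming the variables yields the first half.\<close>
  also have "\<dots> = (\<integral>\<^sup>+v1. (\<integral>\<^sup>+v2. ?I v1 * (of_bool (0 < v2 \<and> v2 \<le> v1) * \<phi> v1 v2) \<partial>lborel) + (\<integral>\<^sup>+v2. ?I v2 * (of_bool (0 < v1 \<and> v1 \<le> v2) * \<phi> v2 v1) \<partial>lborel) \<partial>lborel)"
  proof (rule nn_integral_cong)
    fix v1 :: real
    have "(\<integral>\<^sup>+v2. ?I v1 * ?I v2 * \<phi> v1 v2 \<partial>lborel) = (\<integral>\<^sup>+v2. ?I v1 * (of_bool (0 < v2 \<and> v2 \<le> v1) * \<phi> v1 v2) + ?I v2 * (of_bool (0 < v1 \<and> v1 \<le> v2) * \<phi> v2 v1) \<partial>lborel)"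
      by (intro nn_integral_cong_AE, use AE_lborel_singleton[of v1] in \<open>eventually_elim\<close>) (auto simp: indicator_def sym[of v1])
    also have "\<dots> = (\<integral>\<^sup>+v2. ?I v1 * (of_bool (0 < v2 \<and> v2 \<le> v1) * \<phi> v1 v2) \<partial>lborel) + (\<integral>\<^sup>+v2. ?I v2 * (of_bool (0 < v1 \<and> v1 \<le> v2) * \<phi> v2 v1) \<partial>lborel)"
      by (rule nn_integral_add) measurable
    finally show "(\<integral>\<^sup>+v2. ?I v1 * ?I v2 * \<phi> v1 v2 \<partial>lborel) = \<dots>" .
  qed
  also have "\<dots> = (\<integral>\<^sup>+v1. \<integral>\<^sup>+v2. ?I v1 * (of_bool (0 < v2 \<and> v2 \<le> v1) * \<phi> v1 v2) \<partial>lborel \<partial>lborel) + (\<integral>\<^sup>+v1. \<integral>\<^sup>+v2. ?I v2 * (of_bool (0 < v1 \<and> v1 \<le> v2) * \<phi> v2 v1) \<partial>lborel \<partial>lborel)"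
    by (rule nn_integral_add) measurable
  also have "(\<integral>\<^sup>+v1. \<integral>\<^sup>+v2. ?I v2 * (of_bool (0 < v1 \<and> v1 \<le> v2) * \<phi> v2 v1) \<partial>lborel \<partial>lborel) = (\<integral>\<^sup>+v2. \<integral>\<^sup>+v1. ?I v2 * (of_bool (0 < v1 \<and> v1 \<le> v2) * \<phi> v2 v1) \<partial>lborel \<partial>lborel)"
    by (rule lborel_pair.Fubini') measurable
  also have "(\<integral>\<^sup>+v1. \<integral>\<^sup>+v2. ?I v1 * (of_bool (0 < v2 \<and> v2 \<le> v1) * \<phi> v1 v2) \<partial>lborel \<partial>lborel) + \<dots> = 2 * (\<integral>\<^sup>+v1. \<integral>\<^sup>+v2. ?I v1 * (of_bool (0 < v2 \<and> v2 \<le> v1) * \<phi> v1 v2) \<partial>lborel \<partial>lborel)"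
    by (simp add: mult_2)
  also have "\<dots> = 2 * (\<integral>\<^sup>+v. \<integral>\<^sup>+u. \<integral>\<^sup>+\<theta>. indicator {0<..1} u * (?I v * ennreal (v ^ 1 * exp (- (scaled_volume 1 u ?e \<theta> * v)))) \<partial>uniform_sphere \<partial>lborel \<partial>lborel)"
  proof (rule arg_cong2[where f = "(*)", OF refl], rule nn_integral_cong)
    fix v :: real
    show "(\<integral>\<^sup>+v2. ?I v * (of_bool (0 < v2 \<and> v2 \<le> v) * \<phi> v v2) \<partial>lborel)
      = (\<integral>\<^sup>+u. \<integral>\<^sup>+\<theta>. indicator {0<..1} u * (?I v * ennreal (v ^ 1 * exp (- (scaled_volume 1 u ?e \<theta> * v)))) \<partial>uniform_sphere \<partial>lborel)"
    proof (cases "v > 0")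
      case True
      have "(\<integral>\<^sup>+v2. ?I v * (of_bool (0 < v2 \<and> v2 \<le> v) * \<phi> v v2) \<partial>lborel) = ennreal \<bar>v\<bar> * (\<integral>\<^sup>+u. ?I v * (of_bool (0 < 0 + v * u \<and> 0 + v * u \<le> v) * \<phi> v (0 + v * u)) \<partial>lborel)"
        using True by (intro nn_integral_real_affine) auto
      also have "\<dots> = (\<integral>\<^sup>+u. ennreal v * (indicator {0<..1} u * \<phi> (v * 1) (v * u)) \<partial>lborel)"
      proof -
        have "?I v * (of_bool (0 < 0 + v * u \<and> 0 + v * u \<le> v) * \<phi> v (0 + v * u)) = indicator {0<..1} u * \<phi> (v * 1) (v * u)" for u
          using True by (simp add: indicator_def zero_less_mult_iff)
        then show ?thesis using True by (simp add: nn_integral_cmult)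
      qed
      also have "\<dots> = (\<integral>\<^sup>+u. \<integral>\<^sup>+\<theta>. indicator {0<..1} u * (?I v * ennreal (v ^ 1 * exp (- (scaled_volume 1 u ?e \<theta> * v)))) \<partial>uniform_sphere \<partial>lborel)"
      proof (rule nn_integral_cong)
        fix u
        have "(\<integral>\<^sup>+\<theta>. indicator {0<..1} u * (?I v * ennreal (v ^ 1 * exp (- (scaled_volume 1 u ?e \<theta> * v)))) \<partial>uniform_sphere)
          = (\<integral>\<^sup>+\<theta>. ennreal v * indicator {0<..1} u * ennreal (exp (- scaled_volume (v * 1) (v * u) ?e \<theta>)) \<partial>uniform_sphere)"
          unfolding scaled_volume_scale[OF True] using True
          by (intro nn_integral_cong) (simp add: ennreal_mult mult_ac)
        also have "\<dots> = ennreal v * indicator {0<..1} u * \<phi> (v * 1) (v * u)"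
          unfolding \<phi>_def by (rule nn_integral_cmult) measurable
        finally show "ennreal v * (indicator {0<..1} u * \<phi> (v * 1) (v * u)) = (\<integral>\<^sup>+\<theta>. indicator {0<..1} u * (?I v * ennreal (v ^ 1 * exp (- (scaled_volume 1 u ?e \<theta> * v)))) \<partial>uniform_sphere)"
          by (simp add: mult.assoc)
      qed
      finally show ?thesis .
    qed simp
  qed
  also have "(\<integral>\<^sup>+v. \<integral>\<^sup>+u. \<integral>\<^sup>+\<theta>. indicator {0<..1} u * (?I v * ennreal (v ^ 1 * exp (- (scaled_volume 1 u ?e \<theta> * v)))) \<partial>uniform_sphere \<partial>lborel \<partial>lborel)
    = (\<integral>\<^sup>+u. \<integral>\<^sup>+v. \<integral>\<^sup>+\<theta>. indicator {0<..1} u * (?I v * ennreal (v ^ 1 * exp (- (scaled_volume 1 u ?e \<theta> * v)))) \<partial>uniform_sphere \<partial>lborel \<partial>lborel)"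
    by (rule lborel_pair.Fubini') measurable
  also have "\<dots> = (\<integral>\<^sup>+u. \<integral>\<^sup>+\<theta>. \<integral>\<^sup>+v. indicator {0<..1} u * (?I v * ennreal (v ^ 1 * exp (- (scaled_volume 1 u ?e \<theta> * v)))) \<partial>lborel \<partial>uniform_sphere \<partial>lborel)"
  proof (rule nn_integral_cong)
    fix u :: real
    interpret pair_sigma_finite "uniform_sphere :: (real ^ 'n) measure" "lborel :: real measure" ..
    show "(\<integral>\<^sup>+v. \<integral>\<^sup>+\<theta>. indicator {0<..1} u * (?I v * ennreal (v ^ 1 * exp (- (scaled_volume 1 u ?e \<theta> * v)))) \<partial>uniform_sphere \<partial>lborel)
      = (\<integral>\<^sup>+\<theta>. \<integral>\<^sup>+v. indicator {0<..1} u * (?I v * ennreal (v ^ 1 * exp (- (scaled_volume 1 u ?e \<theta> * v)))) \<partial>lborel \<partial>uniform_sphere)"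
      by (rule Fubini') measurable
  qed
  also have "2 * \<dots> = (\<integral>\<^sup>+u. indicator {0<..1} u * (\<integral>\<^sup>+\<theta>. ennreal (2 / (scaled_volume 1 u ?e \<theta>)\<^sup>2) \<partial>uniform_sphere) \<partial>lborel)"
  proof -
    have in1: "(\<integral>\<^sup>+v. indicator {0<..1} u * (?I v * ennreal (v ^ 1 * exp (- (scaled_volume 1 u ?e \<theta> * v)))) \<partial>lborel)
      = indicator {0<..1} u * ennreal (1 / (scaled_volume 1 u ?e \<theta>)\<^sup>2)" for u \<theta>
    proof (cases "u \<in> {0<..1}")
      case True
      then have "scaled_volume 1 u ?e \<theta> > 0" using scaled_volume_ge[of 1 u ?e \<theta>] by simp
      then show ?thesis using True nn_integral_power_exp_scaled[of "scaled_volume 1 u ?e \<theta>" 1]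
        by (simp add: power2_eq_square)
    qed simp
    have "2 * (\<integral>\<^sup>+u. \<integral>\<^sup>+\<theta>. indicator {0<..1} u * ennreal (1 / (scaled_volume 1 u ?e \<theta>)\<^sup>2) \<partial>uniform_sphere \<partial>lborel)
      = (\<integral>\<^sup>+u. \<integral>\<^sup>+\<theta>. 2 * (indicator {0<..1} u * ennreal (1 / (scaled_volume 1 u ?e \<theta>)\<^sup>2)) \<partial>uniform_sphere \<partial>lborel)"
      by (simp add: nn_integral_cmult)
    also have "\<dots> = (\<integral>\<^sup>+u. \<integral>\<^sup>+\<theta>. indicator {0<..1} u * ennreal (2 / (scaled_volume 1 u ?e \<theta>)\<^sup>2) \<partial>uniform_sphere \<partial>lborel)"
    proof (intro nn_integral_cong)
      fix u \<theta>
      have "ennreal (2 / (scaled_volume 1 u ?e \<theta>)\<^sup>2) = ennreal 2 * ennreal (1 / (scaled_volume 1 u ?e \<theta>)\<^sup>2)"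
        by (subst ennreal_mult[symmetric]) auto
      then show "2 * (indicator {0<..1} u * ennreal (1 / (scaled_volume 1 u ?e \<theta>)\<^sup>2)) = indicator {0<..1} u * ennreal (2 / (scaled_volume 1 u ?e \<theta>)\<^sup>2)"
        by (simp add: mult_ac)
    qed
    finally show ?thesis unfolding in1 by (simp add: nn_integral_cmult)
  qed
  finally have *: "poisson_integral TYPE('n) 0 0 0 = (\<integral>\<^sup>+u. indicator {0<..1} u * (\<integral>\<^sup>+\<theta>. ennreal (2 / (scaled_volume 1 u ?e \<theta>)\<^sup>2) \<partial>uniform_sphere) \<partial>lborel)" .
  show ?thesis
    unfolding ennreal_alpha_nn *[symmetric] using poisson_integral_finite[of 0 0 0, where 'n = 'n] by simp
qed

section \<open>Dimension one\<close>

lemma nn_integral_gamma_product: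
  "(\<integral>\<^sup>+x. \<integral>\<^sup>+y. indicator {0<..} x * indicator {0<..} y * ennreal (x ^ a * exp (- x) / fact a * (y ^ b * exp (- y) / fact b)) \<partial>lborel \<partial>lborel) = 1"
proof -
  have 1: "(\<integral>\<^sup>+x. indicator {0<..} x * ennreal (x ^ a * exp (- x) / fact a) \<partial>lborel) = 1" for a
  proof -
    have "(\<integral>\<^sup>+x. indicator {0<..} x * ennreal (x ^ a * exp (- x) / fact a) \<partial>lborel)
      = (\<integral>\<^sup>+x. (indicator {0<..} x * ennreal (x ^ a * exp (- x))) * ennreal (1 / fact a) \<partial>lborel)"
    proof (rule nn_integral_cong)
      fix x :: real
      show "indicator {0<..} x * ennreal (x ^ a * exp (- x) / fact a) = (indicator {0<..} x * ennreal (x ^ a * exp (- x))) * ennreal (1 / fact a)"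
        by (cases "x > 0") (simp_all add: ennreal_mult[symmetric])
    qed
    also have "\<dots> = ennreal (fact a) * ennreal (1 / fact a)"
      by (subst nn_integral_multc) (simp_all add: nn_integral_power_exp)
    also have "\<dots> = 1" by (simp add: ennreal_mult[symmetric])
    finally show ?thesis .
  qed
  have "(\<integral>\<^sup>+x. \<integral>\<^sup>+y. indicator {0<..} x * indicator {0<..} y * ennreal (x ^ a * exp (- x) / fact a * (y ^ b * exp (- y) / fact b)) \<partial>lborel \<partial>lborel)
    = (\<integral>\<^sup>+x. \<integral>\<^sup>+y. (indicator {0<..} x * ennreal (x ^ a * exp (- x) / fact a)) * (indicator {0<..} y * ennreal (y ^ b * exp (- y) / fact b)) \<partial>lborel \<partial>lborel)"
  proof (rule nn_integral_cong, rule nn_integral_cong)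
    fix x y :: real
    show "indicator {0<..} x * indicator {0<..} y * ennreal (x ^ a * exp (- x) / fact a * (y ^ b * exp (- y) / fact b))
      = (indicator {0<..} x * ennreal (x ^ a * exp (- x) / fact a)) * (indicator {0<..} y * ennreal (y ^ b * exp (- y) / fact b))"
    proof (cases "x > 0 \<and> y > 0")
      case True
      have e: "ennreal (x ^ a * exp (- x) / fact a * (y ^ b * exp (- y) / fact b)) = ennreal (x ^ a * exp (- x) / fact a) * ennreal (y ^ b * exp (- y) / fact b)"
        by (rule ennreal_mult) (use True in simp_all)
      show ?thesis unfolding e by (simp only: mult_ac)
    qed auto
  qed
  also have "\<dots> = 1" by (simp add: nn_integral_cmult nn_integral_multc 1)
  finally show ?thesis .
qed

text \<open>Balls through the origin with the same direction are internally tangent, hence nested.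
  Together with the antipodal case this exhausts dimension one, whose unit sphere has two
  points.\<close>

lemma scaled_volume_same_direction:
  fixes e :: "real ^ 'n"
  assumes e: "norm e = 1" and v: "v1 \<ge> 0" "v2 \<ge> 0"
  shows "scaled_volume v1 v2 e e = max v1 v2"
proof -
  have *: "scaled_volume a b e e = b" if "0 \<le> a" "a \<le> b" for a b
  proof -
    let ?r = "root CARD('n) a" and ?s = "root CARD('n) b"
    have r: "0 \<le> ?r" "?r \<le> ?s" using that by simp_all
    have "cball (?r *\<^sub>R e) ?r \<subseteq> cball (?s *\<^sub>R e) ?s"
    proof
      fix z assume z: "z \<in> cball (?r *\<^sub>R e) ?r"
      have "dist (?s *\<^sub>R e) (?r *\<^sub>R e) = ?s - ?r"
        using r e by (simp add: dist_norm scaleR_diff_left[symmetric])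
      then have "dist (?s *\<^sub>R e) z \<le> (?s - ?r) + ?r"
        using z dist_triangle[of "?s *\<^sub>R e" z "?r *\<^sub>R e"] by simp
      then show "z \<in> cball (?s *\<^sub>R e) ?s" by simp
    qed
    then have "cball (?r *\<^sub>R e) ?r \<union> cball (?s *\<^sub>R e) ?s = cball (?s *\<^sub>R e) ?s" by blast
    then show ?thesis using r that ball_volume_pos[where 'n = 'n]
      by (simp add: scaled_volume_def union_volume_def measure_cball_ball_volume root_power_card)
  qed
  show ?thesis
    using *[of v1 v2] *[of v2 v1] v scaled_volume_commute[of v1 v2 e e] by (cases "v1 \<le> v2") simp_all
qed

text \<open>A point \<open>z\<close> of both balls satisfies
  \<open>z \<bullet> z \<le> 2 * r * (z \<bullet> e)\<close> for one radius and the same with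
  \<open>- e\<close> for the other. One of the right-hand sides is nonpositive, so only the origin
  is common.\<close>

lemma scaled_volume_opposite_direction:
  fixes e :: "real ^ 'n"
  assumes e: "norm e = 1" and v: "v1 \<ge> 0" "v2 \<ge> 0"
  shows "scaled_volume v1 v2 e (- e) = v1 + v2"
proof -
  let ?r = "root CARD('n) v1" and ?s = "root CARD('n) v2"
  have r: "0 \<le> ?r" "0 \<le> ?s" using v by simp_all
  have in_cball: "z \<bullet> z \<le> 2 * t * (z \<bullet> \<theta>)" if "z \<in> cball (t *\<^sub>R \<theta>) t" "t \<ge> 0" "norm \<theta> = 1" for z \<theta> :: "real ^ 'n" and t
  proof -
    have "(norm (t *\<^sub>R \<theta> - z))\<^sup>2 \<le> t\<^sup>2" using that by (intro power_mono) (auto simp: dist_norm)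
    moreover have "(norm (t *\<^sub>R \<theta> - z))\<^sup>2 = t\<^sup>2 * (\<theta> \<bullet> \<theta>) - 2 * t * (z \<bullet> \<theta>) + z \<bullet> z"
      unfolding power2_norm_eq_inner by (simp add: inner_diff_left inner_diff_right inner_commute power2_eq_square algebra_simps)
    moreover have "\<theta> \<bullet> \<theta> = 1" using that(3) by (simp add: norm_eq_1)
    ultimately show ?thesis by simp
  qed
  have "cball (?r *\<^sub>R e) ?r \<inter> cball (?s *\<^sub>R (- e)) ?s \<subseteq> {0}"
  proof
    fix z assume "z \<in> cball (?r *\<^sub>R e) ?r \<inter> cball (?s *\<^sub>R (- e)) ?s"
    then have "z \<bullet> z \<le> 2 * ?r * (z \<bullet> e)" "z \<bullet> z \<le> 2 * ?s * (z \<bullet> - e)"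
      using in_cball[of z ?r e] in_cball[of z ?s "- e"] r e by auto
    moreover have "z \<bullet> e \<ge> 0 \<or> z \<bullet> e \<le> 0" by linarith
    ultimately have "z \<bullet> z \<le> 0"
    proof (elim disjE)
      assume "z \<bullet> z \<le> 2 * ?s * (z \<bullet> - e)" "z \<bullet> e \<ge> 0"
      moreover have "2 * ?s * (z \<bullet> - e) \<le> 0" using r \<open>z \<bullet> e \<ge> 0\<close> by (simp add: mult_nonneg_nonneg)
      ultimately show ?thesis by linarith
    next
      assume "z \<bullet> z \<le> 2 * ?r * (z \<bullet> e)" "z \<bullet> e \<le> 0"
      moreover have "2 * ?r * (z \<bullet> e) \<le> 0" using r \<open>z \<bullet> e \<le> 0\<close> by (intro mult_nonneg_nonpos) auto
      ultimately show ?thesis by linarith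
    qed
    then have "z \<bullet> z = 0" using inner_ge_zero[of z] by linarith
    then show "z \<in> {0}" by simp
  qed
  then have "emeasure lborel (cball (?r *\<^sub>R e) ?r \<inter> cball (?s *\<^sub>R (- e)) ?s) \<le> emeasure lborel {0 :: real ^ 'n}"
    by (intro emeasure_mono) auto
  then have "measure lborel (cball (?r *\<^sub>R e) ?r \<inter> cball (?s *\<^sub>R (- e)) ?s) = 0" by (simp add: measure_def)
  then show ?thesis using scaled_volume_eq[OF v, of e "- e"] by simp
qed

text \<open>Each relative sign has probability 1/2, whence the factor 2. For opposite signs the
  balls do not overlap, the mean belonging to \<open>k\<close> is 0, and the term survives only if
  \<open>k = 0\<close>. For equal signs they are nested, so the difference belonging to
  \<open>j\<close> is empty when \<open>v1 < v2\<close>, and the one belonging to \<open>i\<close>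
  when \<open>v2 < v1\<close>. Each surviving term is a product of two normalised Gamma
  integrals.\<close>

lemma poisson_integral_dim1:
  assumes d: "CARD('n::finite) = 1"
  shows "2 * poisson_integral TYPE('n) i j k = of_bool (i = 0) + of_bool (j = 0) + of_bool (k = 0)"
proof -
  let ?I = "indicator {0<..} :: real \<Rightarrow> ennreal"
  let ?e = "first_unit_vector :: real ^ 'n"
  have e: "norm ?e = 1" by (rule norm_first_unit_vector)
  obtain a where a: "(UNIV :: 'n set) = {a}" using d by (rule card_1_singletonE)
  have pm: "\<theta> = ?e \<or> \<theta> = - ?e" if "norm \<theta> = 1" for \<theta>
  proof -
    have n: "norm x = \<bar>x $ a\<bar>" for x :: "real ^ 'n" by (simp add: norm_vec_def L2_set_def a)
    have "\<theta> $ a = ?e $ a \<or> \<theta> $ a = - (?e $ a)" using that e unfolding n by linarith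
    then show ?thesis by (metis (full_types) UNIV_I a singletonD vec_eq_iff vector_uminus_component)
  qed
  define h where "h v1 v2 s = ennreal (poisson_weight (s - v1) (s - v2) (v1 + v2 - s) i j k)" for v1 v2 s
  have hm [measurable (raw)]: "(\<lambda>x. h (f1 x) (f2 x) (g x)) \<in> borel_measurable M"
    if [measurable]: "f1 \<in> borel_measurable M" "f2 \<in> borel_measurable M" "g \<in> borel_measurable M" for f1 f2 g and M :: "'x measure"
    unfolding h_def by measurable
  have neg: "orthogonal_transformation (uminus :: real ^ 'n \<Rightarrow> real ^ 'n)"
    by (simp add: orthogonal_transformation_def linear_iff)
  have sphere: "2 * (\<integral>\<^sup>+(\<theta>1 :: real ^ 'n). \<integral>\<^sup>+\<theta>2. h v1 v2 (scaled_volume v1 v2 \<theta>1 \<theta>2) \<partial>uniform_sphere \<partial>uniform_sphere)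
    = h v1 v2 (max v1 v2) + h v1 v2 (v1 + v2)" if v: "v1 > 0" "v2 > 0" for v1 v2
  proof -
    have "(\<integral>\<^sup>+\<theta>. h v1 v2 (scaled_volume v1 v2 ?e \<theta>) \<partial>uniform_sphere) = (\<integral>\<^sup>+\<theta>. h v1 v2 (scaled_volume v1 v2 ?e \<theta>) \<partial>distr uniform_sphere borel uminus)"
      by (simp only: distr_uniform_sphere_orthogonal[OF neg])
    also have "\<dots> = (\<integral>\<^sup>+\<theta>. h v1 v2 (scaled_volume v1 v2 ?e (- \<theta>)) \<partial>uniform_sphere)"
      by (rule nn_integral_distr) measurable
    finally have "2 * (\<integral>\<^sup>+\<theta>. h v1 v2 (scaled_volume v1 v2 ?e \<theta>) \<partial>uniform_sphere)
      = (\<integral>\<^sup>+\<theta>. h v1 v2 (scaled_volume v1 v2 ?e \<theta>) \<partial>uniform_sphere) + (\<integral>\<^sup>+\<theta>. h v1 v2 (scaled_volume v1 v2 ?e (- \<theta>)) \<partial>uniform_sphere)"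
      by (simp only: mult_2)
    also have "\<dots> = (\<integral>\<^sup>+\<theta>. h v1 v2 (scaled_volume v1 v2 ?e \<theta>) + h v1 v2 (scaled_volume v1 v2 ?e (- \<theta>)) \<partial>uniform_sphere)"
      by (rule nn_integral_add[symmetric]) measurable
    also have "\<dots> = (\<integral>\<^sup>+(\<theta> :: real ^ 'n). h v1 v2 (max v1 v2) + h v1 v2 (v1 + v2) \<partial>uniform_sphere)"
    proof (rule nn_integral_cong_AE)
      show "AE \<theta> in uniform_sphere. h v1 v2 (scaled_volume v1 v2 ?e \<theta>) + h v1 v2 (scaled_volume v1 v2 ?e (- \<theta>)) = h v1 v2 (max v1 v2) + h v1 v2 (v1 + v2)"
        using AE_uniform_sphere
      proof eventually_elim
        case (elim \<theta>)
        have 1: "scaled_volume v1 v2 ?e ?e = max v1 v2" "scaled_volume v1 v2 ?e (- ?e) = v1 + v2"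
          using v by (simp_all add: scaled_volume_same_direction[OF e] scaled_volume_opposite_direction[OF e])
        from pm[OF elim] show ?case
          by (elim disjE) (simp_all only: 1 minus_minus add.commute)
      qed
    qed
    also have "\<dots> = h v1 v2 (max v1 v2) + h v1 v2 (v1 + v2)"
      by (simp add: uniform_sphere.emeasure_space_1[simplified])
    finally show ?thesis
      by (subst nn_integral_scaled_volume_rotate[OF e]) measurable
  qed
  let ?P = "\<lambda>b x y z. ennreal (of_bool b * (x ^ y * exp (- x) / fact y * z))"
  have "2 * poisson_integral TYPE('n) i j k = (\<integral>\<^sup>+v1. \<integral>\<^sup>+v2. 2 * (?I v1 * ?I v2 *
     (\<integral>\<^sup>+(\<theta>1 :: real ^ 'n). \<integral>\<^sup>+\<theta>2. h v1 v2 (scaled_volume v1 v2 \<theta>1 \<theta>2) \<partial>uniform_sphere \<partial>uniform_sphere)) \<partial>lborel \<partial>lborel)"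
    unfolding poisson_integral_def h_def[symmetric] by (simp add: nn_integral_cmult)
  also have "\<dots> = (\<integral>\<^sup>+v1. \<integral>\<^sup>+v2. ?I v1 * ?I v2 * h v1 v2 (max v1 v2) + ?I v1 * ?I v2 * h v1 v2 (v1 + v2) \<partial>lborel \<partial>lborel)"
  proof (rule nn_integral_cong, rule nn_integral_cong)
    fix v1 v2 :: real
    show "2 * (?I v1 * ?I v2 * (\<integral>\<^sup>+(\<theta>1 :: real ^ 'n). \<integral>\<^sup>+\<theta>2. h v1 v2 (scaled_volume v1 v2 \<theta>1 \<theta>2) \<partial>uniform_sphere \<partial>uniform_sphere))
      = ?I v1 * ?I v2 * h v1 v2 (max v1 v2) + ?I v1 * ?I v2 * h v1 v2 (v1 + v2)"
    proof (cases "v1 > 0 \<and> v2 > 0")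
      case True
      then have "?I v1 = 1" "?I v2 = 1" by simp_all
      then show ?thesis using sphere[of v1 v2] True by (simp only: mult_1)
    qed auto
  qed
  also have "\<dots> = (\<integral>\<^sup>+v1. (\<integral>\<^sup>+v2. ?I v1 * ?I v2 * h v1 v2 (max v1 v2) \<partial>lborel) + (\<integral>\<^sup>+v2. ?I v1 * ?I v2 * h v1 v2 (v1 + v2) \<partial>lborel) \<partial>lborel)"
    by (intro nn_integral_cong nn_integral_add) measurable
  also have "\<dots> = (\<integral>\<^sup>+v1. \<integral>\<^sup>+v2. ?I v1 * ?I v2 * h v1 v2 (max v1 v2) \<partial>lborel \<partial>lborel) + (\<integral>\<^sup>+v1. \<integral>\<^sup>+v2. ?I v1 * ?I v2 * h v1 v2 (v1 + v2) \<partial>lborel \<partial>lborel)"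
    by (rule nn_integral_add) measurable
  also have "(\<integral>\<^sup>+v1. \<integral>\<^sup>+v2. ?I v1 * ?I v2 * h v1 v2 (v1 + v2) \<partial>lborel \<partial>lborel) = of_bool (k = 0)"
  proof -
    have "h v1 v2 (v1 + v2) = of_bool (k = 0) * ennreal (v1 ^ j * exp (- v1) / fact j * (v2 ^ i * exp (- v2) / fact i))" for v1 v2
    proof -
      have e: "exp (- (v1 + v2 - v1 + (v1 + v2 - v2) + (v1 + v2 - (v1 + v2)))) = exp (- v1) * exp (- v2)"
        by (simp add: mult_exp_exp algebra_simps)
      show ?thesis unfolding h_def poisson_weight_def e by (cases "k = 0") (simp_all add: mult_ac power_0_left)
    qed
    then have "(\<integral>\<^sup>+v1. \<integral>\<^sup>+v2. ?I v1 * ?I v2 * h v1 v2 (v1 + v2) \<partial>lborel \<partial>lborel)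
      = of_bool (k = 0) * (\<integral>\<^sup>+v1. \<integral>\<^sup>+v2. ?I v1 * ?I v2 * ennreal (v1 ^ j * exp (- v1) / fact j * (v2 ^ i * exp (- v2) / fact i)) \<partial>lborel \<partial>lborel)"
      by (cases "k = 0") (simp_all)
    then show ?thesis unfolding nn_integral_gamma_product by simp
  qed
  also have "(\<integral>\<^sup>+v1. \<integral>\<^sup>+v2. ?I v1 * ?I v2 * h v1 v2 (max v1 v2) \<partial>lborel \<partial>lborel) = of_bool (i = 0) + of_bool (j = 0)"
  proof -
    \<comment> \<open>The shear \<open>w = v + x\<close> makes the smaller volume \<open>v\<close>
      and the excess \<open>x\<close> independent Gamma variables. The flag \<open>b\<close> says
      that the index of the empty difference is 0.\<close>
    have step: "(\<integral>\<^sup>+v. \<integral>\<^sup>+w. ?I v * (?I (w - v) * ennreal (poisson_weight' v w)) \<partial>lborel \<partial>lborel) = of_bool b"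
      if pw: "\<And>v w. poisson_weight' v w = of_bool b * (v ^ k * exp (- v) / fact k * ((w - v) ^ l * exp (- (w - v)) / fact l))"
      for poisson_weight' b l
    proof -
      have [measurable (raw)]: "(\<lambda>x. poisson_weight' (f x) (g x)) \<in> borel_measurable M"
        if [measurable]: "f \<in> borel_measurable M" "g \<in> borel_measurable M" for f g and M :: "'x measure"
        unfolding pw by measurable
      have "(\<integral>\<^sup>+w. ?I v * (?I (w - v) * ennreal (poisson_weight' v w)) \<partial>lborel)
        = (\<integral>\<^sup>+x. of_bool b * (?I v * ?I x * ennreal (v ^ k * exp (- v) / fact k * (x ^ l * exp (- x) / fact l))) \<partial>lborel)" for v
      proof -
        have "(\<integral>\<^sup>+w. ?I v * (?I (w - v) * ennreal (poisson_weight' v w)) \<partial>lborel)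
          = ennreal \<bar>1\<bar> * (\<integral>\<^sup>+x. ?I v * (?I ((v + 1 * x) - v) * ennreal (poisson_weight' v (v + 1 * x))) \<partial>lborel)"
          by (rule nn_integral_real_affine) measurable
        also have "\<dots> = (\<integral>\<^sup>+x. of_bool b * (?I v * ?I x * ennreal (v ^ k * exp (- v) / fact k * (x ^ l * exp (- x) / fact l))) \<partial>lborel)"
          unfolding pw by (cases b) (simp_all add: mult.assoc)
        finally show ?thesis .
      qed
      then have "(\<integral>\<^sup>+v. \<integral>\<^sup>+w. ?I v * (?I (w - v) * ennreal (poisson_weight' v w)) \<partial>lborel \<partial>lborel)
        = of_bool b * (\<integral>\<^sup>+v. \<integral>\<^sup>+x. ?I v * ?I x * ennreal (v ^ k * exp (- v) / fact k * (x ^ l * exp (- x) / fact l)) \<partial>lborel \<partial>lborel)"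
        by (cases b) simp_all
      then show ?thesis unfolding nn_integral_gamma_product by simp
    qed
    have e2: "exp (- w) = exp (- v) * exp (- (w - v))" for v w :: real by (simp add: mult_exp_exp)
    have A: "(\<integral>\<^sup>+v. \<integral>\<^sup>+w. ?I v * (?I (w - v) * ennreal (poisson_weight (w - v) 0 v i j k)) \<partial>lborel \<partial>lborel) = of_bool (j = 0)"
    proof (rule step)
      fix v w :: real
      have "exp (- (w - v + 0 + v)) = exp (- v) * exp (- (w - v))" using e2[of w v] by simp
      then show "poisson_weight (w - v) 0 v i j k = of_bool (j = 0) * (v ^ k * exp (- v) / fact k * ((w - v) ^ i * exp (- (w - v)) / fact i))"
        unfolding poisson_weight_def by (cases "j = 0") (simp_all only:, simp_all add: mult_ac)
    qed
    have B: "(\<integral>\<^sup>+v. \<integral>\<^sup>+w. ?I v * (?I (w - v) * ennreal (poisson_weight 0 (w - v) v i j k)) \<partial>lborel \<partial>lborel) = of_bool (i = 0)"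
    proof (rule step)
      fix v w :: real
      have "exp (- (0 + (w - v) + v)) = exp (- v) * exp (- (w - v))" using e2[of w v] by simp
      then show "poisson_weight 0 (w - v) v i j k = of_bool (i = 0) * (v ^ k * exp (- v) / fact k * ((w - v) ^ j * exp (- (w - v)) / fact j))"
        unfolding poisson_weight_def by (cases "i = 0") (simp_all only:, simp_all add: mult_ac)
    qed
    have "(\<integral>\<^sup>+v1. \<integral>\<^sup>+v2. ?I v1 * ?I v2 * h v1 v2 (max v1 v2) \<partial>lborel \<partial>lborel)
      = (\<integral>\<^sup>+v1. \<integral>\<^sup>+v2. ?I v1 * (?I (v2 - v1) * ennreal (poisson_weight (v2 - v1) 0 v1 i j k)) + ?I v2 * (?I (v1 - v2) * ennreal (poisson_weight 0 (v1 - v2) v2 i j k)) \<partial>lborel \<partial>lborel)"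
    proof (rule nn_integral_cong, rule nn_integral_cong_AE)
      fix v1 :: real
      show "AE v2 in lborel. ?I v1 * ?I v2 * h v1 v2 (max v1 v2) = ?I v1 * (?I (v2 - v1) * ennreal (poisson_weight (v2 - v1) 0 v1 i j k)) + ?I v2 * (?I (v1 - v2) * ennreal (poisson_weight 0 (v1 - v2) v2 i j k))"
        using AE_lborel_singleton[of v1]
      proof eventually_elim
        case (elim v2)
        then consider "v1 < v2" | "v2 < v1" by linarith
        then show ?case
        proof cases
          case 1
          then show ?thesis by (cases "v1 > 0") (simp_all add: h_def)
        next
          case 2
          then show ?thesis by (cases "v2 > 0") (simp_all add: h_def)
        qed
      qed
    qed
    also have "\<dots> = (\<integral>\<^sup>+v1. (\<integral>\<^sup>+v2. ?I v1 * (?I (v2 - v1) * ennreal (poisson_weight (v2 - v1) 0 v1 i j k)) \<partial>lborel) + (\<integral>\<^sup>+v2. ?I v2 * (?I (v1 - v2) * ennreal (poisson_weight 0 (v1 - v2) v2 i j k)) \<partial>lborel) \<partial>lborel)"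
      by (intro nn_integral_cong nn_integral_add) measurable
    also have "\<dots> = (\<integral>\<^sup>+v1. \<integral>\<^sup>+v2. ?I v1 * (?I (v2 - v1) * ennreal (poisson_weight (v2 - v1) 0 v1 i j k)) \<partial>lborel \<partial>lborel) + (\<integral>\<^sup>+v1. \<integral>\<^sup>+v2. ?I v2 * (?I (v1 - v2) * ennreal (poisson_weight 0 (v1 - v2) v2 i j k)) \<partial>lborel \<partial>lborel)"
      by (rule nn_integral_add) measurable
    also have "(\<integral>\<^sup>+v1. \<integral>\<^sup>+v2. ?I v2 * (?I (v1 - v2) * ennreal (poisson_weight 0 (v1 - v2) v2 i j k)) \<partial>lborel \<partial>lborel)
      = (\<integral>\<^sup>+v2. \<integral>\<^sup>+v1. ?I v2 * (?I (v1 - v2) * ennreal (poisson_weight 0 (v1 - v2) v2 i j k)) \<partial>lborel \<partial>lborel)"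
      by (rule lborel_pair.Fubini') measurable
    finally show ?thesis unfolding A B by (simp add: add.commute)
  qed
  finally show ?thesis .
qed

lemma enn2real_poisson_integral_dim1:
  assumes d: "CARD('n::finite) = 1"
  shows "enn2real (poisson_integral TYPE('n) i j k) = (of_bool (i = 0) + of_bool (j = 0) + of_bool (k = 0)) / 2"
proof -
  let ?r = "of_bool (i = 0) + of_bool (j = 0) + of_bool (k = 0) :: real"
  have "2 * poisson_integral TYPE('n) i j k = ennreal ?r"
    unfolding poisson_integral_dim1[OF d] by (cases "i = 0"; cases "j = 0"; cases "k = 0") simp_all
  then have "enn2real (2 * poisson_integral TYPE('n) i j k) = ?r"
    by (simp only:) (rule enn2real_ennreal, simp)
  then have "2 * enn2real (poisson_integral TYPE('n) i j k) = ?r" by (simp only: enn2real_mult) simp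
  then have "(2 * enn2real (poisson_integral TYPE('n) i j k)) / 2 = ?r / 2" by (simp only:)
  then show ?thesis by (simp only: nonzero_mult_div_cancel_left[OF zero_neq_numeral[symmetric]])
qed

section \<open>The constants in terms of Poisson integrals\<close>

text \<open>Since the union has volume at most \<open>v1 + v2\<close>, the integral is at least that
  of \<open>exp (- v1 - v2)\<close>, which is 1. Positivity allows \<alpha>(d) to be cancelled
  against its inverse in \<open>c_const\<close>.\<close>

lemma alpha_pos: "0 < alpha TYPE('n::finite)"
proof -
  have "(\<integral>\<^sup>+x. \<integral>\<^sup>+y. indicator {0<..} x * indicator {0<..} y * ennreal (x ^ 0 * exp (- x) / fact 0 * (y ^ 0 * exp (- y) / fact 0)) \<partial>lborel \<partial>lborel)
    \<le> poisson_integral TYPE('n) 0 0 0"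
    unfolding poisson_integral_def
  proof (rule nn_integral_mono, rule nn_integral_mono)
    fix v1 v2 :: real
    show "indicator {0<..} v1 * indicator {0<..} v2 * ennreal (v1 ^ 0 * exp (- v1) / fact 0 * (v2 ^ 0 * exp (- v2) / fact 0))
      \<le> indicator {0<..} v1 * indicator {0<..} v2 *
     (\<integral>\<^sup>+(\<theta>1 :: real ^ 'n). \<integral>\<^sup>+\<theta>2. ennreal (poisson_weight (scaled_volume v1 v2 \<theta>1 \<theta>2 - v1) (scaled_volume v1 v2 \<theta>1 \<theta>2 - v2)
        (v1 + v2 - scaled_volume v1 v2 \<theta>1 \<theta>2) 0 0 0) \<partial>uniform_sphere \<partial>uniform_sphere)"
    proof (cases "v1 > 0 \<and> v2 > 0")
      case True
      have pw: "exp (- (v1 + v2)) \<le> poisson_weight (scaled_volume v1 v2 \<theta>1 \<theta>2 - v1) (scaled_volume v1 v2 \<theta>1 \<theta>2 - v2)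
        (v1 + v2 - scaled_volume v1 v2 \<theta>1 \<theta>2) 0 0 0" for \<theta>1 \<theta>2 :: "real ^ 'n"
        using True scaled_volume_le[of v1 v2 \<theta>1 \<theta>2] by (simp add: poisson_weight_def)
      have "ennreal (exp (- (v1 + v2))) = (\<integral>\<^sup>+(\<theta>1 :: real ^ 'n). \<integral>\<^sup>+(\<theta>2 :: real ^ 'n). ennreal (exp (- (v1 + v2))) \<partial>uniform_sphere \<partial>uniform_sphere)"
        by (simp add: uniform_sphere.emeasure_space_1[simplified])
      also have "\<dots> \<le> (\<integral>\<^sup>+(\<theta>1 :: real ^ 'n). \<integral>\<^sup>+\<theta>2. ennreal (poisson_weight (scaled_volume v1 v2 \<theta>1 \<theta>2 - v1) (scaled_volume v1 v2 \<theta>1 \<theta>2 - v2)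
        (v1 + v2 - scaled_volume v1 v2 \<theta>1 \<theta>2) 0 0 0) \<partial>uniform_sphere \<partial>uniform_sphere)"
        by (intro nn_integral_mono ennreal_leI pw)
      finally have le: "ennreal (exp (- (v1 + v2))) \<le> \<dots>" .
      have eq: "v1 ^ 0 * exp (- v1) / fact 0 * (v2 ^ 0 * exp (- v2) / fact 0) = exp (- (v1 + v2))"
        by (simp add: mult_exp_exp)
      show ?thesis unfolding eq by (rule mult_left_mono[OF le]) simp
    qed auto
  qed
  then have "1 \<le> ennreal (alpha TYPE('n))" unfolding nn_integral_gamma_product poisson_integral_000 .
  then show ?thesis by (cases "alpha TYPE('n) \<ge> 0") (auto simp: ennreal_neg)
qed

text \<open>The integrand and its cut-off differ at most on the boundary of \<open>D1\<close>, which
  lies on three lines and is null; the completed measure then inherits measurability from the Borel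
  cut-off.\<close>

lemma LINT_unit_density:
  assumes d: "CARD('n::finite) \<ge> 2"
  shows "(LINT v:D1|lebesgue. (1 - fst v) ^ i * (1 - snd v) ^ j * (fst v + snd v - 1) ^ k * union_density TYPE('n) (fst v) (snd v) 1)
    = enn2real (\<integral>\<^sup>+u1. \<integral>\<^sup>+u2. ennreal (unit_density TYPE('n) u1 u2 * ((1 - u1) ^ i * (1 - u2) ^ j * (u1 + u2 - 1) ^ k)) \<partial>lborel \<partial>lborel)"
proof -
  define G where "G v = unit_density TYPE('n) (fst v) (snd v) * ((1 - fst v) ^ i * (1 - snd v) ^ j * (fst v + snd v - 1) ^ k)" for v :: "real \<times> real"
  define g where "g v = (1 - fst v) ^ i * (1 - snd v) ^ j * (fst v + snd v - 1) ^ k * union_density TYPE('n) (fst v) (snd v) 1" for v :: "real \<times> real"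
  have G0: "0 \<le> G v" for v
  proof (cases "fst v < 1 \<and> snd v < 1 \<and> 1 < fst v + snd v")
    case True
    then show ?thesis unfolding G_def
      by (intro mult_nonneg_nonneg zero_le_power unit_density_nonneg[OF d]) auto
  next
    case False
    then have "unit_density TYPE('n) (fst v) (snd v) = 0" unfolding unit_density_def by (rule if_not_P)
    then show ?thesis by (simp add: G_def)
  qed
  have Gm: "G \<in> borel_measurable (borel \<Otimes>\<^sub>M borel)"
    using borel_measurable_unit_density[OF d] unfolding G_def[abs_def] by measurable
  then have Gm': "G \<in> borel_measurable (lborel :: (real \<times> real) measure)" by (simp add: borel_prod)
  \<comment> \<open>A point of \<open>D1\<close> off these lines satisfies all three strict
    inequalities of \<open>unit_density\<close>; edges with a zero coordinate reduce to corners on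
    the lines.\<close>
  define L1 L2 L3 where "L1 = {v :: real \<times> real. (1, 0) \<bullet> v = 1}" and "L2 = {v :: real \<times> real. (0, 1) \<bullet> v = 1}" and "L3 = {v :: real \<times> real. (1, 1) \<bullet> v = 1}"
  have neg: "negligible L1" "negligible L2" "negligible L3"
    unfolding L1_def L2_def L3_def by (rule negligible_hyperplane, simp add: zero_prod_def)+
  then have "AE v in lebesgue. v \<notin> L1 \<and> v \<notin> L2 \<and> v \<notin> L3"
    by (intro AE_conjI AE_not_in) (simp_all add: negligible_iff_null_sets)
  then have ae: "AE v in lebesgue. G v = indicator D1 v *\<^sub>R g v"
  proof eventually_elim
    case (elim v)
    then have ne: "fst v \<noteq> 1" "snd v \<noteq> 1" "fst v + snd v \<noteq> 1"
      by (auto simp: L1_def L2_def L3_def inner_prod_def)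
    show ?case
    proof (cases "fst v < 1 \<and> snd v < 1 \<and> 1 < fst v + snd v")
      case True
      then have "v \<in> D1" by (auto simp: D1_def case_prod_beta)
      then show ?thesis using True by (simp add: G_def g_def unit_density_def)
    next
      case False
      then have "unit_density TYPE('n) (fst v) (snd v) = 0" unfolding unit_density_def by (rule if_not_P)
      moreover have "v \<notin> D1" using False ne by (auto simp: D1_def case_prod_beta)
      ultimately show ?thesis by (simp add: G_def)
    qed
  qed
  have GL: "G \<in> borel_measurable lebesgue" by (rule measurable_completion[OF Gm'])
  have gL: "(\<lambda>v. indicator D1 v *\<^sub>R g v) \<in> borel_measurable lebesgue"
    by (rule borel_measurable_AE[OF GL ae])
  have "(LINT v:D1|lebesgue. g v) = (\<integral>v. G v \<partial>lebesgue)"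
    unfolding set_lebesgue_integral_def using ae
    by (intro integral_cong_AE gL GL) (auto elim: eventually_mono)
  also have "\<dots> = (\<integral>v. G v \<partial>lborel)" by (rule integral_completion[OF Gm'])
  also have "\<dots> = enn2real (\<integral>\<^sup>+v. ennreal (G v) \<partial>lborel)"
    by (rule integral_eq_nn_integral[OF Gm']) (simp add: G0)
  also have "(\<integral>\<^sup>+v. ennreal (G v) \<partial>lborel) = (\<integral>\<^sup>+u1. \<integral>\<^sup>+u2. ennreal (G (u1, u2)) \<partial>lborel \<partial>lborel)"
    unfolding lborel_prod[symmetric] using Gm by (subst lborel.nn_integral_fst[symmetric]) auto
  finally show ?thesis unfolding g_def G_def by simp
qed

text \<open>For \<open>d \<ge> 2\<close> the factor \<alpha>(d) cancels. In dimension one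
  \<alpha>(1) is 3/2, and the table in \<open>c_line\<close> turns out to say that each term equals
  half the number of vanishing indices.\<close>

lemma alpha_c_const:
  "alpha TYPE('n::finite) * (c_const TYPE('n) i j k * fact (i + j + k + 1) / (fact i * fact j * fact k))
    = enn2real (poisson_integral TYPE('n) i j k)"
proof (cases "CARD('n) = 1")
  case True
  have "ennreal (alpha TYPE('n)) = poisson_integral TYPE('n) 0 0 0" by (rule poisson_integral_000[symmetric])
  then have "alpha TYPE('n) = enn2real (poisson_integral TYPE('n) 0 0 0)"
    using alpha_pos[where 'n = 'n] by (metis enn2real_ennreal less_imp_le)
  then have a: "alpha TYPE('n) = 3 / 2" by (simp add: enn2real_poisson_integral_dim1[OF True])
  have f: "(fact n * fact m / fact (n + m + 1) :: real) * fact (n + m + 1) / (fact n * fact m) = 1" for n m by simp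
  have f1: "1 / (real n + 1) * fact (n + 1) / fact n = (1 :: real)" for n
  proof -
    have "fact (n + 1) = (real n + 1) * (fact n :: real)" by (simp add: algebra_simps)
    moreover have "real n + 1 \<noteq> 0" by linarith
    ultimately show ?thesis by simp
  qed
  show ?thesis
    unfolding enn2real_poisson_integral_dim1[OF True] a
    using True f[of j k] f[of i k] f[of i j] f1[of i] f1[of j] f1[of k]
    by (cases "i = 0"; cases "j = 0"; cases "k = 0") (simp_all add: c_const_def c_line_def field_simps del: fact_Suc)
next
  case False
  have "CARD('n) > 0" by simp
  then have d: "CARD('n) \<ge> 2" using False by linarith
  have "alpha TYPE('n) * c_const TYPE('n) i j k = (LINT v:D1|lebesgue. (1 - fst v) ^ i * (1 - snd v) ^ j * (fst v + snd v - 1) ^ k * union_density TYPE('n) (fst v) (snd v) 1)"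
    using False alpha_pos[where 'n = 'n] by (simp add: c_const_def)
  then show ?thesis
    unfolding poisson_integral_ge2[OF d] LINT_unit_density[OF d] by (simp add: enn2real_mult)
qed

lemma alpha_M_eq: "alpha_M M TYPE('n::finite) = (\<Sum>(i, j, k)\<in>triples (M - 1). enn2real (poisson_integral TYPE('n) i j k))"
  unfolding alpha_M_def triples_def[symmetric] sum_distrib_left
proof (rule sum.cong[OF refl])
  fix t :: "nat \<times> nat \<times> nat"
  obtain i j k where t: "t = (i, j, k)" by (cases t)
  show "alpha TYPE('n) * (case t of (i, j, k) \<Rightarrow> c_const TYPE('n) i j k * fact (i + j + k + 1) / (fact i * fact j * fact k))
    = (case t of (i, j, k) \<Rightarrow> enn2real (poisson_integral TYPE('n) i j k))"
    unfolding t prod.case by (rule alpha_c_const)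
qed

lemma alpha_M_1: "alpha_M 1 TYPE('n::finite) = alpha TYPE('n)"
proof -
  have "triples (1 - 1) = {(0, 0, 0)}" by (auto simp: triples_def)
  then have "alpha_M 1 TYPE('n) = enn2real (poisson_integral TYPE('n) 0 0 0)" unfolding alpha_M_eq by simp
  then show ?thesis unfolding poisson_integral_000 using alpha_pos[where 'n = 'n] by simp
qed

lemma card_triangle: "real (card {(i, j). i + j \<le> (n::nat)}) = real (n + 1) * real (n + 2) / 2"
proof -
  have fin: "finite {(i, j). i + j \<le> n}" by (rule finite_subset[of _ "{..n} \<times> {..n}"]) auto
  have "real (card {(i, j). i + j \<le> n}) = (\<Sum>(i, j)\<in>{(i, j). i + j \<le> n}. 1)" using fin by simp
  also have "\<dots> = (\<Sum>k\<le>n. \<Sum>i\<le>k. 1)" by (rule sum.triangle_reindex_eq)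
  also have "\<dots> = real (n + 1) * real (n + 2) / 2" by (induction n) (simp_all add: field_simps)
  finally show ?thesis .
qed

text \<open>With \<open>K = M - 1\<close>, half of the vanishing indices are counted over all
  triples. The faces \<open>i = 0\<close> and \<open>j = 0\<close> are triangles of
  \<open>(K + 1) * (K + 2) / 2\<close> points each, the face \<open>k = 0\<close> is a square of
  side \<open>K + 1\<close>.\<close>

lemma alpha_M_dim1:
  assumes d: "CARD('n::finite) = 1" and M: "M \<ge> 1"
  shows "alpha_M M TYPE('n) = real M * (2 * real M + 1) / 2"
proof -
  obtain K where K: "M = Suc K" using M by (cases M) auto
  have "alpha_M M TYPE('n) = (\<Sum>t\<in>triples K. (of_bool (fst t = 0) + of_bool (fst (snd t) = 0) + of_bool (snd (snd t) = 0)) / 2)"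
    unfolding alpha_M_eq K enn2real_poisson_integral_dim1[OF d] by (simp add: case_prod_beta)
  also have "\<dots> = ((\<Sum>t\<in>triples K. of_bool (fst t = 0)) + (\<Sum>t\<in>triples K. of_bool (fst (snd t) = 0)) + (\<Sum>t\<in>triples K. of_bool (snd (snd t) = 0))) / 2"
    by (simp only: sum_divide_distrib[symmetric] sum.distrib)
  also have "(\<Sum>t\<in>triples K. of_bool (fst t = 0)) = real (card {(i, j). i + j \<le> K})"
  proof -
    have "(\<Sum>t\<in>triples K. of_bool (fst t = 0)) = real (card (triples K \<inter> {t. fst t = 0}))"
      by (simp add: of_bool_def sum.If_cases)
    also have "triples K \<inter> {t. fst t = 0} = (\<lambda>(i, j). (0, i, j)) ` {(i, j). i + j \<le> K}"
      by (auto simp: triples_def image_iff)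
    also have "card \<dots> = card {(i, j). i + j \<le> K}" by (rule card_image) (auto simp: inj_on_def)
    finally show ?thesis .
  qed
  also have "(\<Sum>t\<in>triples K. of_bool (fst (snd t) = 0)) = real (card {(i, j). i + j \<le> K})"
  proof -
    have "(\<Sum>t\<in>triples K. of_bool (fst (snd t) = 0)) = real (card (triples K \<inter> {t. fst (snd t) = 0}))"
      by (simp add: of_bool_def sum.If_cases)
    also have "triples K \<inter> {t. fst (snd t) = 0} = (\<lambda>(i, j). (i, 0, j)) ` {(i, j). i + j \<le> K}"
      by (auto simp: triples_def image_iff)
    also have "card \<dots> = card {(i, j). i + j \<le> K}" by (rule card_image) (auto simp: inj_on_def)
    finally show ?thesis .
  qed
  also have "(\<Sum>t\<in>triples K. of_bool (snd (snd t) = 0)) = real ((K + 1) * (K + 1))"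
  proof -
    have "(\<Sum>t\<in>triples K. of_bool (snd (snd t) = 0)) = real (card (triples K \<inter> {t. snd (snd t) = 0}))"
      by (simp add: of_bool_def sum.If_cases)
    also have "triples K \<inter> {t. snd (snd t) = 0} = (\<lambda>(i, j). (i, j, 0)) ` ({..K} \<times> {..K})"
      by (auto simp: triples_def image_iff)
    also have "card \<dots> = card ({..K} \<times> {..K})" by (rule card_image) (auto simp: inj_on_def)
    finally show ?thesis by simp
  qed
  finally show ?thesis unfolding card_triangle K by (simp add: field_simps)
qed

section \<open>Blow-up at a density point\<close>

lemma integral_affine:
  fixes t :: "'a::euclidean_space" and f :: "'a \<Rightarrow> real"
  assumes [measurable]: "f \<in> borel_measurable borel" and c: "c \<noteq> 0"
  shows "(\<integral>x. f x \<partial>lborel) = \<bar>c\<bar> ^ DIM('a) * (\<integral>x. f (t + c *\<^sub>R x) \<partial>lborel)"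
proof -
  have "(\<integral>x. f x \<partial>lborel) = (\<integral>x. f x \<partial>density (distr lborel borel (\<lambda>x. t + c *\<^sub>R x)) (\<lambda>_. ennreal (\<bar>c\<bar> ^ DIM('a))))"
    using lborel_affine[OF c, of t] by simp
  also have "\<dots> = (\<integral>x. \<bar>c\<bar> ^ DIM('a) *\<^sub>R f x \<partial>distr lborel borel (\<lambda>x. t + c *\<^sub>R x))"
    by (rule integral_density) auto
  also have "\<dots> = (\<integral>x. \<bar>c\<bar> ^ DIM('a) *\<^sub>R f (t + c *\<^sub>R x) \<partial>lborel)"
    by (rule integral_distr) auto
  finally show ?thesis by simp
qed

lemma (in sigma_finite_measure) borel_measurable_measure_section:
  assumes "{p \<in> space (N \<Otimes>\<^sub>M M). Q (fst p) (snd p)} \<in> sets (N \<Otimes>\<^sub>M M)"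
  shows "(\<lambda>x. measure M {y \<in> space M. Q x y}) \<in> borel_measurable N"
proof -
  let ?Q = "{p \<in> space (N \<Otimes>\<^sub>M M). Q (fst p) (snd p)}"
  have "(\<lambda>x. emeasure M (Pair x -` ?Q)) \<in> borel_measurable N"
    using assms by (rule measurable_emeasure_Pair)
  then have "(\<lambda>x. enn2real (emeasure M (Pair x -` ?Q))) \<in> borel_measurable N" by measurable
  then show ?thesis
  proof (rule measurable_cong[THEN iffD1, rotated])
    fix x assume "x \<in> space N"
    then have "Pair x -` ?Q = {y \<in> space M. Q x y}" by (auto simp: space_pair_measure)
    then show "enn2real (emeasure M (Pair x -` ?Q)) = measure M {y \<in> space M. Q x y}" by (simp add: measure_def)
  qed
qed

lemma nn_integral_radial:
  assumes [measurable]: "F \<in> borel_measurable borel"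
  shows "(\<integral>\<^sup>+(w :: real ^ 'n). F (norm w ^ CARD('n)) \<partial>lborel)
    = ennreal (ball_volume TYPE('n)) * (\<integral>\<^sup>+v. indicator {0<..} v * F v \<partial>lborel)"
proof -
  have "(\<integral>\<^sup>+(w :: real ^ 'n). F (norm w ^ CARD('n)) \<partial>lborel)
    = ennreal (ball_volume TYPE('n)) * (\<integral>\<^sup>+v. indicator {0<..} v * (\<integral>\<^sup>+(\<theta> :: real ^ 'n). F (norm (root CARD('n) v *\<^sub>R \<theta>) ^ CARD('n)) \<partial>uniform_sphere) \<partial>lborel)"
    by (rule nn_integral_polar) measurable
  also have "(\<integral>\<^sup>+v. indicator {0<..} v * (\<integral>\<^sup>+(\<theta> :: real ^ 'n). F (norm (root CARD('n) v *\<^sub>R \<theta>) ^ CARD('n)) \<partial>uniform_sphere) \<partial>lborel)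
    = (\<integral>\<^sup>+v. indicator {0<..} v * F v \<partial>lborel)"
  proof (rule nn_integral_cong)
    fix v :: real
    show "indicator {0<..} v * (\<integral>\<^sup>+(\<theta> :: real ^ 'n). F (norm (root CARD('n) v *\<^sub>R \<theta>) ^ CARD('n)) \<partial>uniform_sphere) = indicator {0<..} v * F v"
    proof (cases "v > 0")
      case True
      have "(\<integral>\<^sup>+(\<theta> :: real ^ 'n). F (norm (root CARD('n) v *\<^sub>R \<theta>) ^ CARD('n)) \<partial>uniform_sphere) = (\<integral>\<^sup>+(\<theta> :: real ^ 'n). F v \<partial>uniform_sphere)"
      proof (rule nn_integral_cong_AE)
        show "AE \<theta> in (uniform_sphere :: (real ^ 'n) measure). F (norm (root CARD('n) v *\<^sub>R \<theta>) ^ CARD('n)) = F v"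
          using AE_uniform_sphere
        proof eventually_elim
          case (elim \<theta>)
          have "norm (root CARD('n) v *\<^sub>R \<theta>) ^ CARD('n) = v" using elim True by (simp add: root_power_card)
          then show ?case by simp
        qed
      qed
      then show ?thesis by (simp add: uniform_sphere.emeasure_space_1[simplified])
    qed simp
  qed
  finally show ?thesis .
qed

lemma nn_integral_exp_norm:
  assumes a: "a > 0"
  shows "(\<integral>\<^sup>+(w :: real ^ 'n). ennreal (exp (- (a * norm w ^ CARD('n)))) \<partial>lborel) < \<infinity>"
proof -
  have "(\<integral>\<^sup>+(w :: real ^ 'n). ennreal (exp (- (a * norm w ^ CARD('n)))) \<partial>lborel)
    = ennreal (ball_volume TYPE('n)) * (\<integral>\<^sup>+v. indicator {0<..} v * ennreal (exp (- (a * v))) \<partial>lborel)"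
    by (rule nn_integral_radial) measurable
  also have "(\<integral>\<^sup>+v. indicator {0<..} v * ennreal (exp (- (a * v))) \<partial>lborel) = ennreal (1 / a)"
    using nn_integral_power_exp_scaled[OF a, of 0] by simp
  finally show ?thesis by (simp add: ennreal_mult_less_top)
qed

text \<open>A sample point lies in this ball iff it is at least as close to \<open>z\<close> as
  \<open>x\<close> is. The number of such points decides the rank of \<open>x\<close> among the
  neighbours of \<open>z\<close>.\<close>

definition ball_through :: "'a::real_normed_vector \<Rightarrow> 'a \<Rightarrow> 'a set" where
  "ball_through x z = cball z (norm (z - x))"

lemma ball_through_sets [measurable, simp]: "ball_through x z \<in> sets borel"
  by (simp add: ball_through_def)

lemma ball_through_affine:
  assumes "c > 0"
  shows "x + c *\<^sub>R y \<in> ball_through x (x + c *\<^sub>R w) \<longleftrightarrow> y \<in> ball_through 0 w"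
proof -
  have "dist (x + c *\<^sub>R w) (x + c *\<^sub>R y) = c * dist w y"
    using assms by (simp add: dist_norm scaleR_right_diff_distrib[symmetric])
  then show ?thesis using assms by (simp add: ball_through_def)
qed

text \<open>Probability that a Poisson process of intensity \<open>a\<close> puts at most
  \<open>\<kappa>\<close> points into each of the two balls.\<close>

definition poisson_kernel :: "nat \<Rightarrow> real \<Rightarrow> real ^ 'n \<Rightarrow> real ^ 'n \<Rightarrow> real" where
  "poisson_kernel \<kappa> a w1 w2 = (\<Sum>(i, j, k)\<in>triples \<kappa>. poisson_weight
     (a * measure lborel (ball_through 0 w2 - ball_through 0 w1)) (a * measure lborel (ball_through 0 w1 - ball_through 0 w2))
     (a * measure lborel (ball_through 0 w1 \<inter> ball_through 0 w2)) i j k)"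

lemma borel_measurable_ball_through_measures:
  fixes f g :: "'x \<Rightarrow> real ^ 'n"
  assumes [measurable]: "f \<in> borel_measurable M" "g \<in> borel_measurable M"
  shows "(\<lambda>x. measure lborel (ball_through 0 (f x) - ball_through 0 (g x))) \<in> borel_measurable M"
    "(\<lambda>x. measure lborel (ball_through 0 (f x) \<inter> ball_through 0 (g x))) \<in> borel_measurable M"
proof -
  have "(\<lambda>x. measure lborel {y \<in> space lborel. dist (f x) y \<le> norm (f x) \<and> \<not> dist (g x) y \<le> norm (g x)}) \<in> borel_measurable M"
    by (rule lborel.borel_measurable_measure_section) measurable
  moreover have "{y \<in> space lborel. dist (f x) y \<le> norm (f x) \<and> \<not> dist (g x) y \<le> norm (g x)} = ball_through 0 (f x) - ball_through 0 (g x)" for x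
    by (auto simp: ball_through_def)
  ultimately show "(\<lambda>x. measure lborel (ball_through 0 (f x) - ball_through 0 (g x))) \<in> borel_measurable M" by (simp only:)
  have "(\<lambda>x. measure lborel {y \<in> space lborel. dist (f x) y \<le> norm (f x) \<and> dist (g x) y \<le> norm (g x)}) \<in> borel_measurable M"
    by (rule lborel.borel_measurable_measure_section) measurable
  moreover have "{y \<in> space lborel. dist (f x) y \<le> norm (f x) \<and> dist (g x) y \<le> norm (g x)} = ball_through 0 (f x) \<inter> ball_through 0 (g x)" for x
    by (auto simp: ball_through_def)
  ultimately show "(\<lambda>x. measure lborel (ball_through 0 (f x) \<inter> ball_through 0 (g x))) \<in> borel_measurable M" by (simp only:)
qed

lemma borel_measurable_poisson_kernel [measurable (raw)]:
  fixes f g :: "'x \<Rightarrow> real ^ 'n"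
  assumes fg: "f \<in> borel_measurable M" "g \<in> borel_measurable M"
  shows "(\<lambda>x. poisson_kernel \<kappa> a (f x) (g x)) \<in> borel_measurable M"
  unfolding poisson_kernel_def case_prod_beta
  by (intro borel_measurable_sum borel_measurable_poisson_weight borel_measurable_times borel_measurable_const
      borel_measurable_ball_through_measures fg)

lemma measure_ball_through: "measure lborel (ball_through 0 (w :: real ^ 'n)) = ball_volume TYPE('n) * norm w ^ CARD('n)"
  by (simp add: ball_through_def measure_cball_ball_volume)

lemma ball_through_fmeasurable [simp]: "ball_through x (w :: real ^ 'n) \<in> fmeasurable lborel"
  by (simp add: ball_through_def fmeasurable_def emeasure_cball)

lemma measure_ball_through_parts:
  fixes w1 w2 :: "real ^ 'n"
  shows "measure lborel (ball_through 0 w1 - ball_through 0 w2) + measure lborel (ball_through 0 w1 \<inter> ball_through 0 w2) = measure lborel (ball_through 0 w1)"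
proof -
  have "measure lborel ((ball_through 0 w1 - ball_through 0 w2) \<union> (ball_through 0 w1 \<inter> ball_through 0 w2))
    = measure lborel (ball_through 0 w1 - ball_through 0 w2) + measure lborel (ball_through 0 w1 \<inter> ball_through 0 w2)"
    by (rule measure_Un2[THEN trans]) (auto intro: fmeasurable_Diff fmeasurable.Int intro!: arg_cong2[where f = "(+)"] arg_cong2[where f = measure])
  moreover have "(ball_through 0 w1 - ball_through 0 w2) \<union> (ball_through 0 w1 \<inter> ball_through 0 w2) = ball_through 0 w1" by blast
  ultimately show ?thesis by simp
qed

lemma poisson_kernel_nonneg: "a \<ge> 0 \<Longrightarrow> 0 \<le> poisson_kernel \<kappa> a w1 w2"
  unfolding poisson_kernel_def by (intro sum_nonneg) (auto intro!: poisson_weight_nonneg split: prod.splits)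

text \<open>The union of the balls has at least half the sum of their volumes, which factorises the
  exponential bound into one factor for each variable.\<close>

lemma poisson_kernel_le:
  fixes w1 w2 :: "real ^ 'n"
  assumes a: "a \<ge> 0"
  shows "poisson_kernel \<kappa> a w1 w2 \<le> (\<Sum>(i, j, k)\<in>triples \<kappa>. 2 ^ (i + j + k)) *
    (exp (- (a * ball_volume TYPE('n) / 4 * norm w1 ^ CARD('n))) * exp (- (a * ball_volume TYPE('n) / 4 * norm w2 ^ CARD('n))))"
proof -
  let ?A = "measure lborel (ball_through 0 w2 - ball_through 0 w1)" and ?B = "measure lborel (ball_through 0 w1 - ball_through 0 w2)"
    and ?C = "measure lborel (ball_through 0 w1 \<inter> ball_through 0 w2)"
  let ?E = "exp (- (a * ball_volume TYPE('n) / 4 * norm w1 ^ CARD('n))) * exp (- (a * ball_volume TYPE('n) / 4 * norm w2 ^ CARD('n)))"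
  have p: "?B + ?C = ball_volume TYPE('n) * norm w1 ^ CARD('n)" "?A + ?C = ball_volume TYPE('n) * norm w2 ^ CARD('n)"
    using measure_ball_through_parts[of w1 w2] measure_ball_through_parts[of w2 w1] by (simp_all add: measure_ball_through Int_commute)
  have "- (a * ?A + a * ?B + a * ?C) / 2 \<le> - (a * ball_volume TYPE('n) / 4 * norm w1 ^ CARD('n)) + - (a * ball_volume TYPE('n) / 4 * norm w2 ^ CARD('n))"
  proof -
    have "a * ((?B + ?C) + (?A + ?C)) \<le> a * (2 * (?A + ?B + ?C))"
      using a by (intro mult_left_mono) (simp_all add: measure_nonneg)
    then have "a * (ball_volume TYPE('n) * norm w1 ^ CARD('n)) + a * (ball_volume TYPE('n) * norm w2 ^ CARD('n)) \<le> 2 * (a * ?A + a * ?B + a * ?C)"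
      unfolding p by (simp add: algebra_simps)
    moreover have "a * ball_volume TYPE('n) / 4 * N = a * (ball_volume TYPE('n) * N) / 4" for N by simp
    ultimately show ?thesis by argo
  qed
  then have e: "exp (- (a * ?A + a * ?B + a * ?C) / 2) \<le> ?E" by (simp add: mult_exp_exp)
  have "poisson_kernel \<kappa> a w1 w2 \<le> (\<Sum>(i, j, k)\<in>triples \<kappa>. 2 ^ (i + j + k) * ?E)"
    unfolding poisson_kernel_def
  proof (rule sum_mono)
    fix t assume "t \<in> triples \<kappa>"
    obtain i j k where t: "t = (i, j, k)" by (cases t)
    have "poisson_weight (a * ?A) (a * ?B) (a * ?C) i j k \<le> 2 ^ (i + j + k) * exp (- (a * ?A + a * ?B + a * ?C) / 2)"
      using a by (intro poisson_weight_le mult_nonneg_nonneg) auto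
    also have "\<dots> \<le> 2 ^ (i + j + k) * ?E" using e by (intro mult_left_mono) auto
    finally show "(case t of (i, j, k) \<Rightarrow> poisson_weight (a * ?A) (a * ?B) (a * ?C) i j k) \<le> (case t of (i, j, k) \<Rightarrow> 2 ^ (i + j + k) * ?E)"
      unfolding t prod.case .
  qed
  also have "\<dots> = (\<Sum>(i, j, k)\<in>triples \<kappa>. 2 ^ (i + j + k)) * ?E"
    by (simp add: sum_distrib_right case_prod_beta)
  finally show ?thesis .
qed

text \<open>Polar coordinates in both variables turn the pieces of the balls into differences of
  scaled volumes; a dilation then reduces the intensity to 1.\<close>

lemma nn_integral_poisson_weight_ball_through:
  assumes a: "a > 0"
  shows "(\<integral>\<^sup>+(w1 :: real ^ 'n). \<integral>\<^sup>+w2. ennreal (poisson_weight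
     (a * measure lborel (ball_through 0 w2 - ball_through 0 w1)) (a * measure lborel (ball_through 0 w1 - ball_through 0 w2))
     (a * measure lborel (ball_through 0 w1 \<inter> ball_through 0 w2)) i j k) \<partial>lborel \<partial>lborel)
    = ennreal (1 / a\<^sup>2) * poisson_integral TYPE('n) i j k"
proof -
  let ?c = "ball_volume TYPE('n)" and ?r = "root CARD('n)"
  have c: "?c > 0" by (rule ball_volume_pos)
  \<comment> \<open>The mean number of points per unit of normalised volume. Rescaling
    \<open>v1\<close> and \<open>v2\<close> by \<open>b\<close> costs the inverse square of
    \<open>b\<close>, of which the two polar constants \<open>?c\<close> leave
    \<open>1 / a\<^sup>2\<close>.\<close>
  define b where "b = a * ?c"
  have b: "b > 0" using a c by (simp add: b_def)
  define F where "F w1 w2 = ennreal (poisson_weight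
     (a * measure lborel (ball_through 0 w2 - ball_through 0 w1)) (a * measure lborel (ball_through 0 w1 - ball_through 0 w2))
     (a * measure lborel (ball_through 0 w1 \<inter> ball_through 0 w2)) i j k)" for w1 w2 :: "real ^ 'n"
  have [measurable (raw)]: "(\<lambda>x. F (f x) (g x)) \<in> borel_measurable M"
    if "f \<in> borel_measurable M" "g \<in> borel_measurable M" for f g and M :: "'x measure"
    unfolding F_def using borel_measurable_ball_through_measures[OF that] borel_measurable_ball_through_measures[OF that(2,1)]
    by measurable
  define H where "H v1 v2 = (\<integral>\<^sup>+(\<theta>1 :: real ^ 'n). \<integral>\<^sup>+\<theta>2. ennreal (poisson_weight (scaled_volume v1 v2 \<theta>1 \<theta>2 - v1) (scaled_volume v1 v2 \<theta>1 \<theta>2 - v2)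
        (v1 + v2 - scaled_volume v1 v2 \<theta>1 \<theta>2) i j k) \<partial>uniform_sphere \<partial>uniform_sphere)" for v1 v2
  have [measurable (raw)]: "(\<lambda>x. H (f x) (g x)) \<in> borel_measurable M"
    if [measurable]: "f \<in> borel_measurable M" "g \<in> borel_measurable M" for f g and M :: "'x measure"
    unfolding H_def by measurable
  let ?I = "indicator {0<..} :: real \<Rightarrow> ennreal"
  have FH: "(\<integral>\<^sup>+(\<theta>1 :: real ^ 'n). \<integral>\<^sup>+\<theta>2. F (?r v1 *\<^sub>R \<theta>1) (?r v2 *\<^sub>R \<theta>2) \<partial>uniform_sphere \<partial>uniform_sphere) = H (b * v1) (b * v2)"
    if v: "v1 > 0" "v2 > 0" for v1 v2
    unfolding H_def
  proof (rule nn_integral_cong_AE)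
    show "AE \<theta>1 in (uniform_sphere :: (real ^ 'n) measure). (\<integral>\<^sup>+\<theta>2. F (?r v1 *\<^sub>R \<theta>1) (?r v2 *\<^sub>R \<theta>2) \<partial>uniform_sphere)
      = (\<integral>\<^sup>+\<theta>2. ennreal (poisson_weight (scaled_volume (b * v1) (b * v2) \<theta>1 \<theta>2 - b * v1) (scaled_volume (b * v1) (b * v2) \<theta>1 \<theta>2 - b * v2)
        (b * v1 + b * v2 - scaled_volume (b * v1) (b * v2) \<theta>1 \<theta>2) i j k) \<partial>uniform_sphere)"
      using AE_uniform_sphere
    proof eventually_elim
      case (elim \<theta>1)
      show ?case
      proof (rule nn_integral_cong_AE)
        show "AE \<theta>2 in uniform_sphere. F (?r v1 *\<^sub>R \<theta>1) (?r v2 *\<^sub>R \<theta>2) = ennreal (poisson_weight (scaled_volume (b * v1) (b * v2) \<theta>1 \<theta>2 - b * v1) (scaled_volume (b * v1) (b * v2) \<theta>1 \<theta>2 - b * v2)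
          (b * v1 + b * v2 - scaled_volume (b * v1) (b * v2) \<theta>1 \<theta>2) i j k)"
          using AE_uniform_sphere
        proof eventually_elim
          case h: (elim \<theta>2)
          let ?B1 = "ball_through 0 (?r v1 *\<^sub>R \<theta>1)" and ?B2 = "ball_through 0 (?r v2 *\<^sub>R \<theta>2)"
          have n: "norm (?r v1 *\<^sub>R \<theta>1) = ?r v1" "norm (?r v2 *\<^sub>R \<theta>2) = ?r v2" using v elim h by simp_all
          have B: "?B1 = cball (?r v1 *\<^sub>R \<theta>1) (?r v1)" "?B2 = cball (?r v2 *\<^sub>R \<theta>2) (?r v2)"
            unfolding ball_through_def diff_zero n by (rule refl)+
          have m: "measure lborel ?B1 = ?c * v1" "measure lborel ?B2 = ?c * v2"
            unfolding measure_ball_through n using v by (simp_all add: root_power_card)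
          have "measure lborel (?B1 \<inter> ?B2) / ?c = v1 + v2 - scaled_volume v1 v2 \<theta>1 \<theta>2"
            using scaled_volume_eq[of v1 v2 \<theta>1 \<theta>2] v unfolding B by simp
          then have i: "measure lborel (?B1 \<inter> ?B2) = ?c * (v1 + v2 - scaled_volume v1 v2 \<theta>1 \<theta>2)" using c by (simp add: field_simps)
          have d1: "measure lborel (?B1 - ?B2) = ?c * (scaled_volume v1 v2 \<theta>1 \<theta>2 - v2)"
            using measure_ball_through_parts[of "?r v1 *\<^sub>R \<theta>1" "?r v2 *\<^sub>R \<theta>2"] unfolding i m by (simp add: algebra_simps)
          have d2: "measure lborel (?B2 - ?B1) = ?c * (scaled_volume v1 v2 \<theta>1 \<theta>2 - v1)"
            using measure_ball_through_parts[of "?r v2 *\<^sub>R \<theta>2" "?r v1 *\<^sub>R \<theta>1"] unfolding Int_commute[of ?B2] i m by (simp add: algebra_simps)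
          have "a * measure lborel (?B2 - ?B1) = b * scaled_volume v1 v2 \<theta>1 \<theta>2 - b * v1"
            "a * measure lborel (?B1 - ?B2) = b * scaled_volume v1 v2 \<theta>1 \<theta>2 - b * v2"
            "a * measure lborel (?B1 \<inter> ?B2) = b * v1 + b * v2 - b * scaled_volume v1 v2 \<theta>1 \<theta>2"
            unfolding d1 d2 i b_def by (simp_all add: algebra_simps)
          then show ?case unfolding F_def scaled_volume_scale[OF b] by (simp only:)
        qed
      qed
    qed
  qed
  have "(\<integral>\<^sup>+w1. \<integral>\<^sup>+w2. F w1 w2 \<partial>lborel \<partial>lborel)
    = (\<integral>\<^sup>+w1. ennreal ?c * (\<integral>\<^sup>+v2. ?I v2 * (\<integral>\<^sup>+\<theta>2. F w1 (?r v2 *\<^sub>R \<theta>2) \<partial>uniform_sphere) \<partial>lborel) \<partial>lborel)"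
    by (intro nn_integral_cong nn_integral_polar) measurable
  also have "\<dots> = ennreal ?c * (\<integral>\<^sup>+v1. ?I v1 * (\<integral>\<^sup>+\<theta>1. ennreal ?c * (\<integral>\<^sup>+v2. ?I v2 * (\<integral>\<^sup>+\<theta>2. F (?r v1 *\<^sub>R \<theta>1) (?r v2 *\<^sub>R \<theta>2) \<partial>uniform_sphere) \<partial>lborel) \<partial>uniform_sphere) \<partial>lborel)"
    by (rule nn_integral_polar) measurable
  also have "\<dots> = ennreal ?c * (\<integral>\<^sup>+v1. ennreal ?c * (\<integral>\<^sup>+v2. ?I v1 * ?I v2 * H (b * v1) (b * v2) \<partial>lborel) \<partial>lborel)"
  proof (rule arg_cong2[where f = "(*)", OF refl], rule nn_integral_cong)
    fix v1 :: real
    interpret pair_sigma_finite "uniform_sphere :: (real ^ 'n) measure" "lborel :: real measure" ..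
    have "?I v1 * (\<integral>\<^sup>+\<theta>1. ennreal ?c * (\<integral>\<^sup>+v2. ?I v2 * (\<integral>\<^sup>+\<theta>2. F (?r v1 *\<^sub>R \<theta>1) (?r v2 *\<^sub>R \<theta>2) \<partial>uniform_sphere) \<partial>lborel) \<partial>uniform_sphere)
      = ennreal ?c * (?I v1 * (\<integral>\<^sup>+\<theta>1. \<integral>\<^sup>+v2. ?I v2 * (\<integral>\<^sup>+\<theta>2. F (?r v1 *\<^sub>R \<theta>1) (?r v2 *\<^sub>R \<theta>2) \<partial>uniform_sphere) \<partial>lborel \<partial>uniform_sphere))"
      by (subst nn_integral_cmult) (auto simp: mult_ac)
    also have "(\<integral>\<^sup>+\<theta>1. \<integral>\<^sup>+v2. ?I v2 * (\<integral>\<^sup>+\<theta>2. F (?r v1 *\<^sub>R \<theta>1) (?r v2 *\<^sub>R \<theta>2) \<partial>uniform_sphere) \<partial>lborel \<partial>uniform_sphere)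
      = (\<integral>\<^sup>+v2. \<integral>\<^sup>+\<theta>1. ?I v2 * (\<integral>\<^sup>+\<theta>2. F (?r v1 *\<^sub>R \<theta>1) (?r v2 *\<^sub>R \<theta>2) \<partial>uniform_sphere) \<partial>uniform_sphere \<partial>lborel)"
      by (rule Fubini'[symmetric]) measurable
    also have "\<dots> = (\<integral>\<^sup>+v2. ?I v2 * (\<integral>\<^sup>+\<theta>1. \<integral>\<^sup>+\<theta>2. F (?r v1 *\<^sub>R \<theta>1) (?r v2 *\<^sub>R \<theta>2) \<partial>uniform_sphere \<partial>uniform_sphere) \<partial>lborel)"
      by (rule nn_integral_cong, rule nn_integral_cmult) measurable
    also have "?I v1 * \<dots> = (\<integral>\<^sup>+v2. ?I v1 * (?I v2 * (\<integral>\<^sup>+\<theta>1. \<integral>\<^sup>+\<theta>2. F (?r v1 *\<^sub>R \<theta>1) (?r v2 *\<^sub>R \<theta>2) \<partial>uniform_sphere \<partial>uniform_sphere)) \<partial>lborel)"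
      by (rule nn_integral_cmult[symmetric]) measurable
    also have "\<dots> = (\<integral>\<^sup>+v2. ?I v1 * ?I v2 * H (b * v1) (b * v2) \<partial>lborel)"
    proof (rule nn_integral_cong)
      fix v2 :: real
      show "?I v1 * (?I v2 * (\<integral>\<^sup>+\<theta>1. \<integral>\<^sup>+\<theta>2. F (?r v1 *\<^sub>R \<theta>1) (?r v2 *\<^sub>R \<theta>2) \<partial>uniform_sphere \<partial>uniform_sphere)) = ?I v1 * ?I v2 * H (b * v1) (b * v2)"
        by (cases "v1 > 0"; cases "v2 > 0") (simp_all add: FH)
    qed
    finally show "?I v1 * (\<integral>\<^sup>+\<theta>1. ennreal ?c * (\<integral>\<^sup>+v2. ?I v2 * (\<integral>\<^sup>+\<theta>2. F (?r v1 *\<^sub>R \<theta>1) (?r v2 *\<^sub>R \<theta>2) \<partial>uniform_sphere) \<partial>lborel) \<partial>uniform_sphere)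
      = ennreal ?c * (\<integral>\<^sup>+v2. ?I v1 * ?I v2 * H (b * v1) (b * v2) \<partial>lborel)" .
  qed
  also have "\<dots> = ennreal (?c * ?c) * (\<integral>\<^sup>+v1. \<integral>\<^sup>+v2. ?I (b * v1) * ?I (b * v2) * H (b * v1) (b * v2) \<partial>lborel \<partial>lborel)"
  proof -
    have "?I (b * v) = ?I v" for v using b by (simp add: indicator_def zero_less_mult_iff)
    then show ?thesis using c by (simp add: nn_integral_cmult ennreal_mult mult.assoc)
  qed
  also have "(\<integral>\<^sup>+v1. \<integral>\<^sup>+v2. ?I (b * v1) * ?I (b * v2) * H (b * v1) (b * v2) \<partial>lborel \<partial>lborel) = ennreal (1 / b\<^sup>2) * poisson_integral TYPE('n) i j k"
  proof -
    have "poisson_integral TYPE('n) i j k = (\<integral>\<^sup>+v1. \<integral>\<^sup>+v2. ?I v1 * ?I v2 * H v1 v2 \<partial>lborel \<partial>lborel)"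
      unfolding poisson_integral_def H_def ..
    also have "\<dots> = (\<integral>\<^sup>+v1. ennreal \<bar>b\<bar> * (\<integral>\<^sup>+v2. ?I v1 * ?I (0 + b * v2) * H v1 (0 + b * v2) \<partial>lborel) \<partial>lborel)"
      using b by (intro nn_integral_cong nn_integral_real_affine) auto
    also have "\<dots> = ennreal \<bar>b\<bar> * (\<integral>\<^sup>+v1. ennreal \<bar>b\<bar> * (\<integral>\<^sup>+v2. ?I (0 + b * v1) * ?I (0 + b * v2) * H (0 + b * v1) (0 + b * v2) \<partial>lborel) \<partial>lborel)"
      using b by (intro nn_integral_real_affine) auto
    also have "\<dots> = ennreal (b\<^sup>2) * (\<integral>\<^sup>+v1. \<integral>\<^sup>+v2. ?I (b * v1) * ?I (b * v2) * H (b * v1) (b * v2) \<partial>lborel \<partial>lborel)"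
      using b by (simp add: nn_integral_cmult ennreal_mult mult.assoc power2_eq_square)
    finally have "ennreal (1 / b\<^sup>2) * poisson_integral TYPE('n) i j k = ennreal (1 / b\<^sup>2) * ennreal (b\<^sup>2) * (\<integral>\<^sup>+v1. \<integral>\<^sup>+v2. ?I (b * v1) * ?I (b * v2) * H (b * v1) (b * v2) \<partial>lborel \<partial>lborel)"
      by (simp add: mult.assoc)
    also have "ennreal (1 / b\<^sup>2) * ennreal (b\<^sup>2) = 1" using b by (subst ennreal_mult[symmetric]) auto
    finally show ?thesis by simp
  qed
  also have "ennreal (?c * ?c) * (ennreal (1 / b\<^sup>2) * poisson_integral TYPE('n) i j k) = ennreal (1 / a\<^sup>2) * poisson_integral TYPE('n) i j k"
  proof -
    have "?c * ?c * (1 / b\<^sup>2) = 1 / a\<^sup>2" using a c by (simp add: b_def power2_eq_square)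
    then show ?thesis by (metis ennreal_mult' mult.assoc zero_le_square)
  qed
  finally show ?thesis unfolding F_def .
qed

lemma borel_measurable_low_counts:
  fixes f g :: "'x \<Rightarrow> real ^ 'n"
  assumes N: "prob_space N" "sets N = sets borel" and I: "finite I"
    and [measurable]: "f \<in> borel_measurable M" "g \<in> borel_measurable M"
  shows "(\<lambda>z. low_counts N I \<kappa> (ball_through x (f z)) (ball_through x (g z))) \<in> borel_measurable M"
proof -
  note [measurable_cong] = N(2)
  interpret P: prob_space "Pi\<^sub>M I (\<lambda>_. N)" by (rule prob_space_PiM) (rule N)
  have c: "card {l \<in> I. y l \<in> ball_through x z} = (\<Sum>l\<in>I. of_bool (dist z (y l) \<le> norm (z - x)) :: nat)" for y and z :: "real ^ 'n"
    using I by (simp add: of_bool_def sum.If_cases Int_def ball_through_def)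
  define Q where "Q = {p \<in> space (M \<Otimes>\<^sub>M Pi\<^sub>M I (\<lambda>_. N)).
    (\<Sum>l\<in>I. of_bool (dist (f (fst p)) (snd p l) \<le> norm (f (fst p) - x)) :: nat) \<le> \<kappa> \<and>
    (\<Sum>l\<in>I. of_bool (dist (g (fst p)) (snd p l) \<le> norm (g (fst p) - x)) :: nat) \<le> \<kappa>}"
  have "Q \<in> sets (M \<Otimes>\<^sub>M Pi\<^sub>M I (\<lambda>_. N))" unfolding Q_def by measurable
  then have "(\<lambda>z. emeasure (Pi\<^sub>M I (\<lambda>_. N)) (Pair z -` Q)) \<in> borel_measurable M"
    by (rule P.measurable_emeasure_Pair)
  then have "(\<lambda>z. enn2real (emeasure (Pi\<^sub>M I (\<lambda>_. N)) (Pair z -` Q))) \<in> borel_measurable M" by measurable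
  then show ?thesis
  proof (rule measurable_cong[THEN iffD1, rotated])
    fix z assume "z \<in> space M"
    then have "Pair z -` Q = {y \<in> space (Pi\<^sub>M I (\<lambda>_. N)). card {l \<in> I. y l \<in> ball_through x (f z)} \<le> \<kappa> \<and> card {l \<in> I. y l \<in> ball_through x (g z)} \<le> \<kappa>}"
      unfolding c by (auto simp: Q_def space_pair_measure)
    then show "enn2real (emeasure (Pi\<^sub>M I (\<lambda>_. N)) (Pair z -` Q)) = low_counts N I \<kappa> (ball_through x (f z)) (ball_through x (g z))"
      by (simp add: low_counts_def measure_def)
  qed
qed

text \<open>Local data at one point \<open>x\<close>: the assumption \<open>dens\<close> controls
  balls near \<open>x\<close>, while \<open>charged\<close> together with compactness controls those
  centred far from it.\<close>

locale density_point =
  fixes K :: "(real ^ 'n) set" and g0 :: "real ^ 'n \<Rightarrow> real" and x :: "real ^ 'n"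
  assumes K: "compact K" and xK: "x \<in> K"
    and g0_meas [measurable]: "g0 \<in> borel_measurable borel" and g0_nonneg: "\<And>z. 0 \<le> g0 z"
    and g0_out: "\<And>z. z \<notin> K \<Longrightarrow> g0 z = 0" and g0_cont: "continuous_on K g0" and g0_x: "0 < g0 x"
    and prob: "prob_space (density lborel (\<lambda>z. ennreal (g0 z)))"
    and charged: "\<And>z r. z \<in> K \<Longrightarrow> 0 < r \<Longrightarrow> 0 < measure (density lborel (\<lambda>z. ennreal (g0 z))) (cball z r)"
    and dens: "\<And>e. 0 < e \<Longrightarrow> \<exists>\<delta>>0. \<forall>r. 0 < r \<and> r < \<delta> \<longrightarrow> measure lborel (ball x r - K) \<le> e * r ^ CARD('n)"
begin

abbreviation "\<nu> \<equiv> density lborel (\<lambda>z. ennreal (g0 z))"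

sublocale nu: prob_space \<nu> by (rule prob)

text \<open>Here \<open>n + 1\<close> is the sample size and \<open>n\<close> the number of
  remaining points; a ball of radius \<open>eps n\<close> has volume of order one over the sample
  size.\<close>

definition eps :: "nat \<Rightarrow> real" where "eps n = 1 / root CARD('n) (real (n + 1))"

lemma K_borel [measurable]: "K \<in> sets borel" using K by (rule borel_compact)

lemma eps_pos: "eps n > 0" by (simp add: eps_def)

lemma eps_power: "eps n ^ CARD('n) = 1 / real (n + 1)"
  by (simp add: eps_def power_divide root_power_card)

lemma eps_tendsto: "eps \<longlonglongrightarrow> 0"
proof -
  have "(\<lambda>n. root CARD('n) (1 / real (n + 1))) \<longlonglongrightarrow> root CARD('n) 0"
    by (intro tendsto_real_root LIMSEQ_ignore_initial_segment[OF lim_1_over_n])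
  then show ?thesis by (simp add: eps_def[abs_def] real_root_divide)
qed

lemma measure_cont: assumes "A \<in> sets borel" shows "measure \<nu> A = (\<integral>z. g0 z * indicator A z \<partial>lborel)"
proof -
  have "emeasure \<nu> A = (\<integral>\<^sup>+z. ennreal (g0 z * indicator A z) \<partial>lborel)"
    using assms by (subst emeasure_density) (auto intro!: nn_integral_cong split: split_indicator)
  then show ?thesis using assms g0_nonneg
    by (subst integral_eq_nn_integral) (auto simp: measure_def)
qed

text \<open>For a fixed \<open>w\<close> the point \<open>x + eps n *\<^sub>R w\<close> may lie
  outside \<open>K\<close> for infinitely many \<open>n\<close>, so dominated convergence does not
  apply. Only the volume of the exceptional set within a fixed ball tends to 0, by
  \<open>dens\<close>; hence \<open>h\<close> is truncated in height and support.\<close>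

lemma outside_null:
  fixes h :: "real ^ 'n \<Rightarrow> real"
  assumes h: "integrable lborel h" "\<And>w. 0 \<le> h w"
  shows "(\<lambda>n. \<integral>w. indicator {w. x + eps n *\<^sub>R w \<notin> K} w * h w \<partial>lborel) \<longlonglongrightarrow> 0"
proof (rule LIMSEQ_I)
  fix \<eta> :: real assume \<eta>: "\<eta> > 0"
  have [measurable]: "h \<in> borel_measurable borel" using h(1) by simp
  define hN where "hN N w = min (h w) (real N) * indicator (ball 0 (real N)) w" for N :: nat and w :: "real ^ 'n"
  have hN0: "0 \<le> hN N w" "hN N w \<le> h w" for N w using h(2)[of w] by (auto simp: hN_def indicator_def)
  have [measurable]: "ball (0 :: real ^ 'n) r \<in> sets borel" for r by simp
  have [measurable]: "hN N \<in> borel_measurable borel" for N unfolding hN_def[abs_def] by measurable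
  have hNi: "integrable lborel (hN N)" for N
    by (rule Bochner_Integration.integrable_bound[OF h(1)]) (use hN0 h(2) in \<open>auto simp: abs_of_nonneg\<close>)
  have "(\<lambda>N. \<integral>w. hN N w \<partial>lborel) \<longlonglongrightarrow> (\<integral>w. h w \<partial>lborel)"
  proof (rule integral_dominated_convergence[where w = h])
    show "AE w in lborel. (\<lambda>N. hN N w) \<longlonglongrightarrow> h w"
    proof (rule AE_I2)
      fix w
      obtain N0 where N0: "real N0 > max (norm w) (h w)" using reals_Archimedean2 by blast
      have "eventually (\<lambda>N. hN N w = h w) sequentially"
        using eventually_ge_at_top[of N0] by eventually_elim (use N0 in \<open>auto simp: hN_def indicator_def\<close>)
      then show "(\<lambda>N. hN N w) \<longlonglongrightarrow> h w" by (rule tendsto_eventually)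
    qed
  qed (use h hN0 in \<open>auto simp: abs_of_nonneg\<close>)
  from LIMSEQ_D[OF this, of "\<eta> / 2"] \<eta> obtain N where N: "\<bar>(\<integral>w. hN N w \<partial>lborel) - (\<integral>w. h w \<partial>lborel)\<bar> < \<eta> / 2"
    by force
  \<comment> \<open>Bounds both the height and the support of the truncated function. The choice of
    \<open>e\<close> then makes its contribution at most \<open>\<eta> / 2\<close>, the other half
    being the truncation error.\<close>
  define R where "R = real N + 1"
  have R: "R > 0" by (simp add: R_def)
  define e where "e = \<eta> / (2 * R * R ^ CARD('n))"
  have e: "e > 0" using \<eta> R by (simp add: e_def)
  obtain \<delta> where \<delta>: "\<delta> > 0" "\<And>r. 0 < r \<Longrightarrow> r < \<delta> \<Longrightarrow> measure lborel (ball x r - K) \<le> e * r ^ CARD('n)"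
    using dens[OF e] by blast
  have "(\<lambda>n. eps n * R) \<longlonglongrightarrow> 0 * R" by (intro tendsto_mult eps_tendsto tendsto_const)
  from LIMSEQ_D[OF this \<delta>(1)] obtain n0 where n0: "\<And>n. n \<ge> n0 \<Longrightarrow> \<bar>eps n * R\<bar> < \<delta>" by auto
  show "\<exists>no. \<forall>n\<ge>no. norm ((\<integral>w. indicator {w. x + eps n *\<^sub>R w \<notin> K} w * h w \<partial>lborel) - 0) < \<eta>"
  proof (intro exI allI impI)
    fix n assume n: "n \<ge> n0"
    let ?F = "{w. x + eps n *\<^sub>R w \<notin> K}"
    have Fm [measurable]: "?F \<in> sets borel" by measurable
    have B: "emeasure lborel (?F \<inter> ball 0 R) < \<infinity>"
      using emeasure_mono[of "?F \<inter> ball 0 R" "ball 0 R" lborel] emeasure_lborel_ball_finite[of "0 :: real ^ 'n" R] by simp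
    have iF: "integrable lborel (\<lambda>w. indicator (?F \<inter> ball 0 R) w :: real)" using B by simp
    have "measure lborel (ball x (eps n * R) - K) = (\<integral>z. indicator (ball x (eps n * R) - K) z \<partial>lborel)" by simp
    also have "\<dots> = \<bar>eps n\<bar> ^ DIM(real ^ 'n) * (\<integral>w. indicator (ball x (eps n * R) - K) (x + eps n *\<^sub>R w) \<partial>lborel)"
      using eps_pos[of n] by (intro integral_affine borel_measurable_indicator) auto
    also have "(\<lambda>w. indicator (ball x (eps n * R) - K) (x + eps n *\<^sub>R w)) = (indicator (?F \<inter> ball 0 R) :: _ \<Rightarrow> real)"
      using eps_pos[of n] by (intro ext) (auto simp: indicator_def dist_norm)
    finally have m: "measure lborel (ball x (eps n * R) - K) = eps n ^ CARD('n) * measure lborel (?F \<inter> ball 0 R)"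
      using eps_pos[of n] by simp
    have "eps n ^ CARD('n) * measure lborel (?F \<inter> ball 0 R) \<le> e * (eps n * R) ^ CARD('n)"
      unfolding m[symmetric] using n0[OF n] eps_pos[of n] R by (intro \<delta>(2)) auto
    then have "eps n ^ CARD('n) * measure lborel (?F \<inter> ball 0 R) \<le> eps n ^ CARD('n) * (e * R ^ CARD('n))"
      by (simp add: power_mult_distrib mult_ac)
    then have mB: "measure lborel (?F \<inter> ball 0 R) \<le> e * R ^ CARD('n)" using eps_pos[of n] by simp
    have i1: "integrable lborel (\<lambda>w. indicator ?F w * h w)"
      using integrable_mult_indicator[OF _ h(1), of ?F] by simp
    have "(\<integral>w. indicator ?F w * h w \<partial>lborel) \<le> (\<integral>w. (h w - hN N w) + R * indicator (?F \<inter> ball 0 R) w \<partial>lborel)"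
    proof (rule integral_mono[OF i1])
      show "integrable lborel (\<lambda>w. (h w - hN N w) + R * indicator (?F \<inter> ball 0 R) w)" using h(1) hNi iF by simp
      show "indicator ?F w * h w \<le> (h w - hN N w) + R * indicator (?F \<inter> ball 0 R) w" for w
        using hN0[of N w] h(2)[of w] by (auto simp: indicator_def hN_def R_def min_def)
    qed
    also have "\<dots> = ((\<integral>w. h w \<partial>lborel) - (\<integral>w. hN N w \<partial>lborel)) + R * measure lborel (?F \<inter> ball 0 R)"
      using h(1) hNi iF by simp
    also have "\<dots> < \<eta> / 2 + R * (e * R ^ CARD('n))"
    proof (rule add_less_le_mono)
      show "(\<integral>w. h w \<partial>lborel) - (\<integral>w. hN N w \<partial>lborel) < \<eta> / 2" using N unfolding abs_less_iff by argo
      show "R * measure lborel (?F \<inter> ball 0 R) \<le> R * (e * R ^ CARD('n))" using mB R by (intro mult_left_mono) auto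
    qed
    also have "\<dots> = \<eta>" using R by (simp add: e_def)
    finally have "(\<integral>w. indicator ?F w * h w \<partial>lborel) < \<eta>" .
    moreover have "0 \<le> (\<integral>w. indicator ?F w * h w \<partial>lborel)" using h(2) by (intro integral_nonneg_AE) auto
    ultimately show "norm ((\<integral>w. indicator ?F w * h w \<partial>lborel) - 0) < \<eta>" by simp
  qed
qed

text \<open>Dominated convergence after blowing up around \<open>x\<close>. The blown-up density does not converge
  pointwise off \<open>K\<close>, so it is compared with \<open>f x\<close> times the indicator of the blown-up \<open>K\<close>.\<close>
lemma blow_up_limit:
  fixes f :: "real ^ 'n \<Rightarrow> real" and h :: "nat \<Rightarrow> real ^ 'n \<Rightarrow> real"
  assumes f [measurable]: "f \<in> borel_measurable borel" and f_out: "\<And>z. z \<notin> K \<Longrightarrow> f z = 0"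
    and f_cont: "continuous_on K f" and f_nonneg: "\<And>z. 0 \<le> f z"
    and h [measurable]: "\<And>n. h n \<in> borel_measurable borel" "H \<in> borel_measurable borel"
    and lim: "\<And>w. (\<lambda>n. h n w) \<longlonglongrightarrow> H w"
    and bound: "\<And>n w. x + eps n *\<^sub>R w \<in> K \<Longrightarrow> \<bar>h n w\<bar> \<le> G w"
    and G: "integrable lborel G" "\<And>w. 0 \<le> G w" and Hi: "integrable lborel H" and H0: "\<And>w. 0 \<le> H w"
  shows "(\<lambda>n. \<integral>w. f (x + eps n *\<^sub>R w) * h n w \<partial>lborel) \<longlonglongrightarrow> f x * (\<integral>w. H w \<partial>lborel)"
proof -
  obtain B where B: "\<And>z. z \<in> K \<Longrightarrow> f z \<le> B"
    using compact_imp_bounded[OF compact_continuous_image[OF f_cont K]] f_nonneg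
    by (auto simp: bounded_iff)
  have B0: "0 \<le> B" using B[OF xK] f_nonneg[of x] by linarith
  let ?in = "\<lambda>n w. indicator K (x + eps n *\<^sub>R w) :: real"
  define T where "T n w = f (x + eps n *\<^sub>R w) * h n w - f x * (?in n w * H w)" for n w
  have Tm [measurable]: "T n \<in> borel_measurable borel" for n unfolding T_def[abs_def] by measurable
  have Tb: "\<bar>T n w\<bar> \<le> B * G w + B * H w" for n w
  proof (cases "x + eps n *\<^sub>R w \<in> K")
    case True
    have "\<bar>T n w\<bar> \<le> \<bar>f (x + eps n *\<^sub>R w) * h n w\<bar> + \<bar>f x * H w\<bar>" using True by (simp add: T_def)
    also have "\<dots> \<le> B * G w + B * H w"
      unfolding abs_mult using B[OF True] B[OF xK] B0 bound[OF True] f_nonneg H0[of w]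
      by (intro add_mono mult_mono) (auto simp: abs_of_nonneg)
    finally show ?thesis .
  next
    case False
    then show ?thesis using f_out B0 G(2)[of w] H0[of w] by (simp add: T_def)
  qed
  have dom: "integrable lborel (\<lambda>w. B * G w + B * H w)" using G(1) Hi by simp
  have Ti: "integrable lborel (T n)" for n
    by (rule Bochner_Integration.integrable_bound[OF dom])
      (use Tb B0 G(2) H0 in \<open>auto intro!: AE_I2 intro: order_trans simp: abs_of_nonneg\<close>)
  have Tlim: "(\<lambda>n. T n w) \<longlonglongrightarrow> 0" for w
  proof -
    \<comment> \<open>Continuity is relative to \<open>K\<close>, so it is used only for those
      \<open>n\<close> at which the blown-up point lies in \<open>K\<close>; the indicator removes
      the others.\<close>
    have f0: "(\<lambda>n. ?in n w * \<bar>f (x + eps n *\<^sub>R w) - f x\<bar>) \<longlonglongrightarrow> 0"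
    proof (rule LIMSEQ_I)
      fix \<eta> :: real assume "\<eta> > 0"
      then obtain \<delta> where \<delta>: "\<delta> > 0" "\<And>z. z \<in> K \<Longrightarrow> dist z x < \<delta> \<Longrightarrow> dist (f z) (f x) < \<eta>"
        using f_cont xK unfolding continuous_on_iff by blast
      have "(\<lambda>n. eps n * norm w) \<longlonglongrightarrow> 0 * norm w" by (intro tendsto_mult eps_tendsto tendsto_const)
      from LIMSEQ_D[OF this \<delta>(1)] obtain n0 where n0: "\<And>n. n \<ge> n0 \<Longrightarrow> \<bar>eps n * norm w\<bar> < \<delta>" by auto
      show "\<exists>no. \<forall>n\<ge>no. norm (?in n w * \<bar>f (x + eps n *\<^sub>R w) - f x\<bar> - 0) < \<eta>"
      proof (intro exI allI impI)
        fix n assume n: "n \<ge> n0"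
        show "norm (?in n w * \<bar>f (x + eps n *\<^sub>R w) - f x\<bar> - 0) < \<eta>"
        proof (cases "x + eps n *\<^sub>R w \<in> K")
          case True
          have "dist (x + eps n *\<^sub>R w) x < \<delta>" using n0[OF n] by (simp add: dist_norm abs_mult)
          from \<delta>(2)[OF True this] show ?thesis using True by (simp add: dist_real_def)
        qed (use \<open>\<eta> > 0\<close> in simp)
      qed
    qed
    have "(\<lambda>n. ?in n w * \<bar>f (x + eps n *\<^sub>R w) - f x\<bar> * \<bar>h n w\<bar> + \<bar>f x\<bar> * \<bar>h n w - H w\<bar>) \<longlonglongrightarrow> 0 * \<bar>H w\<bar> + \<bar>f x\<bar> * \<bar>H w - H w\<bar>"
      by (intro tendsto_add tendsto_mult f0 tendsto_rabs lim tendsto_const tendsto_diff)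
    then have z: "(\<lambda>n. ?in n w * \<bar>f (x + eps n *\<^sub>R w) - f x\<bar> * \<bar>h n w\<bar> + \<bar>f x\<bar> * \<bar>h n w - H w\<bar>) \<longlonglongrightarrow> 0" by simp
    show ?thesis
    proof (rule Lim_null_comparison[OF always_eventually z], rule allI)
      fix n
      show "norm (T n w) \<le> ?in n w * \<bar>f (x + eps n *\<^sub>R w) - f x\<bar> * \<bar>h n w\<bar> + \<bar>f x\<bar> * \<bar>h n w - H w\<bar>"
      proof (cases "x + eps n *\<^sub>R w \<in> K")
        case True
        then have "T n w = (f (x + eps n *\<^sub>R w) - f x) * h n w + f x * (h n w - H w)" by (simp add: T_def algebra_simps)
        then show ?thesis using True by (simp add: abs_mult[symmetric])
      next
        case False
        then show ?thesis using f_out by (simp add: T_def)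
      qed
    qed
  qed
  have "(\<lambda>n. \<integral>w. T n w \<partial>lborel) \<longlonglongrightarrow> (\<integral>w. 0 \<partial>(lborel :: (real ^ 'n) measure))"
    by (rule integral_dominated_convergence[OF _ _ dom]) (use Tlim Tb in auto)
  then have l1: "(\<lambda>n. \<integral>w. T n w \<partial>lborel) \<longlonglongrightarrow> 0" by simp
  have l2: "(\<lambda>n. f x * ((\<integral>w. H w \<partial>lborel) - (\<integral>w. indicator {w. x + eps n *\<^sub>R w \<notin> K} w * H w \<partial>lborel))) \<longlonglongrightarrow> f x * ((\<integral>w. H w \<partial>lborel) - 0)"
    by (intro tendsto_mult tendsto_const tendsto_diff outside_null Hi H0)
  \<comment> \<open>The first term vanishes by dominated convergence; in the second, the part of
    \<open>H\<close> outside the blown-up \<open>K\<close> vanishes by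
    \<open>outside_null\<close>.\<close>
  have "(\<integral>w. f (x + eps n *\<^sub>R w) * h n w \<partial>lborel) = (\<integral>w. T n w \<partial>lborel) + f x * ((\<integral>w. H w \<partial>lborel) - (\<integral>w. indicator {w. x + eps n *\<^sub>R w \<notin> K} w * H w \<partial>lborel))" for n
  proof -
    let ?out = "\<lambda>w. indicator {w. x + eps n *\<^sub>R w \<notin> K} w :: real"
    have oi: "integrable lborel (\<lambda>w. ?out w * H w)"
      using integrable_mult_indicator[OF _ Hi, of "{w. x + eps n *\<^sub>R w \<notin> K}"] by simp
    have "f (x + eps n *\<^sub>R w) * h n w = T n w + f x * (H w - ?out w * H w)" for w
      by (simp add: T_def indicator_def)
    then have "(\<integral>w. f (x + eps n *\<^sub>R w) * h n w \<partial>lborel) = (\<integral>w. T n w + f x * (H w - ?out w * H w) \<partial>lborel)" by (simp only:)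
    also have "\<dots> = (\<integral>w. T n w \<partial>lborel) + f x * ((\<integral>w. H w \<partial>lborel) - (\<integral>w. ?out w * H w \<partial>lborel))"
      using Ti[of n] Hi oi by simp
    finally show ?thesis .
  qed
  then show ?thesis using tendsto_add[OF l1 l2] by simp
qed

text \<open>Sample size times hitting probability tends to intensity times volume, the hypothesis of
  the Poisson limit. It is the blow-up limit for the constant sequence of indicators of
  \<open>B\<close>.\<close>

lemma scaled_mass_limit:
  assumes [measurable]: "B \<in> sets borel" "\<And>n. A n \<in> sets borel" and fin: "emeasure lborel B < \<infinity>"
    and A: "\<And>n w. x + eps n *\<^sub>R w \<in> A n \<longleftrightarrow> w \<in> B"
  shows "(\<lambda>n. real (n + 1) * measure \<nu> (A n)) \<longlonglongrightarrow> g0 x * measure lborel B"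
proof -
  have i: "integrable lborel (\<lambda>w. indicator B w :: real)" using fin by simp
  have "(\<lambda>n. \<integral>w. g0 (x + eps n *\<^sub>R w) * indicator B w \<partial>lborel) \<longlonglongrightarrow> g0 x * (\<integral>w. indicator B w \<partial>lborel)"
    by (rule blow_up_limit[where G = "indicator B"]) (use g0_out g0_cont g0_nonneg i in auto)
  moreover have "(\<integral>w. g0 (x + eps n *\<^sub>R w) * indicator B w \<partial>lborel) = real (n + 1) * measure \<nu> (A n)" for n
  proof -
    have "measure \<nu> (A n) = (\<integral>z. g0 z * indicator (A n) z \<partial>lborel)" by (rule measure_cont) simp
    also have "\<dots> = \<bar>eps n\<bar> ^ DIM(real ^ 'n) * (\<integral>w. g0 (x + eps n *\<^sub>R w) * indicator (A n) (x + eps n *\<^sub>R w) \<partial>lborel)"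
      using eps_pos[of n] by (intro integral_affine) auto
    also have "\<dots> = 1 / real (n + 1) * (\<integral>w. g0 (x + eps n *\<^sub>R w) * indicator B w \<partial>lborel)"
      using eps_pos[of n] eps_power[of n] by (simp add: indicator_def A)
    finally show ?thesis by simp
  qed
  ultimately show ?thesis by simp
qed

text \<open>Near \<open>x\<close>, the set \<open>K\<close> fills at least half of the ball and
  \<open>g0\<close> is at least \<open>g0 x / 2\<close> there. Far from \<open>x\<close> the ball
  contains one of finitely many small balls of positive mass, and the boundedness of
  \<open>K\<close> turns that constant into a multiple of the power of the norm.\<close>

lemma ball_mass_lower_bound:
  obtains c where "c > 0" "\<And>z. z \<in> K \<Longrightarrow> c * norm (z - x) ^ CARD('n) \<le> measure \<nu> (ball_through x z)"
proof -
  let ?v = "ball_volume TYPE('n)"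
  have v: "?v > 0" by (rule ball_volume_pos)
  obtain \<delta>1 where \<delta>1: "\<delta>1 > 0" "\<And>z. z \<in> K \<Longrightarrow> dist z x < \<delta>1 \<Longrightarrow> dist (g0 z) (g0 x) < g0 x / 2"
    using g0_cont xK half_gt_zero[OF g0_x] unfolding continuous_on_iff by blast
  have g0_half: "g0 x / 2 \<le> g0 z" if "z \<in> K" "dist z x < \<delta>1" for z
    using \<delta>1(2)[OF that] unfolding dist_real_def abs_less_iff by argo
  \<comment> \<open>A ball of radius \<open>r\<close> with \<open>x\<close> on its boundary lies in
    \<open>ball x (3 * r)\<close>. With this constant at most half of its volume is outside
    \<open>K\<close>.\<close>
  have e: "?v / (2 * 3 ^ CARD('n)) > 0" using v by simp
  obtain \<delta>2 where \<delta>2: "\<delta>2 > 0" "\<And>r. 0 < r \<Longrightarrow> r < \<delta>2 \<Longrightarrow> measure lborel (ball x r - K) \<le> ?v / (2 * 3 ^ CARD('n)) * r ^ CARD('n)"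
    using dens[OF e] by blast
  define \<delta> where "\<delta> = min \<delta>1 \<delta>2 / 3"
  have \<delta>: "\<delta> > 0" "3 * \<delta> \<le> \<delta>1" "3 * \<delta> \<le> \<delta>2" using \<delta>1(1) \<delta>2(1) by (auto simp: \<delta>_def)
  define c1 where "c1 = g0 x / 2 * (?v / 2)"
  have c1: "c1 > 0" using g0_x v by (simp add: c1_def)
  have near: "c1 * norm (z - x) ^ CARD('n) \<le> measure \<nu> (ball_through x z)" if z: "norm (z - x) < \<delta>" for z
  proof (cases "z = x")
    case True
    then show ?thesis by (simp add: zero_power)
  next
    case False
    define r where "r = norm (z - x)"
    have r: "r > 0" "r < \<delta>" using False z by (auto simp: r_def)
    have sub: "y \<in> ball x (3 * r)" if "y \<in> cball z r" for y
    proof -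
      have "dist x z = r" "dist z y \<le> r" using that by (simp_all add: r_def dist_norm norm_minus_commute)
      then show ?thesis using dist_triangle[of x y z] r(1) by simp
    qed
    have "measure lborel (cball z r - K) \<le> measure lborel (ball x (3 * r) - K)"
    proof (rule measure_mono_fmeasurable)
      have "ball x (3 * r) \<in> fmeasurable lborel" by (simp add: fmeasurable_def emeasure_lborel_ball_finite[simplified])
      then show "ball x (3 * r) - K \<in> fmeasurable lborel" by (rule fmeasurable_Diff) simp
    qed (use sub in auto)
    also have "\<dots> \<le> ?v / (2 * 3 ^ CARD('n)) * (3 * r) ^ CARD('n)" using r \<delta> by (intro \<delta>2(2)) auto
    also have "\<dots> = ?v / 2 * r ^ CARD('n)" by (simp add: power_mult_distrib)
    finally have d: "measure lborel (cball z r - K) \<le> ?v / 2 * r ^ CARD('n)" .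
    have fm: "cball z r \<in> fmeasurable lborel" using r by (simp add: fmeasurable_def emeasure_cball)
    have "?v * r ^ CARD('n) = measure lborel (cball z r)" using r by (simp add: measure_cball_ball_volume)
    also have "\<dots> = measure lborel ((cball z r \<inter> K) \<union> (cball z r - K))" by (rule arg_cong[where f = "measure lborel"]) blast
    also have "\<dots> \<le> measure lborel (cball z r \<inter> K) + measure lborel (cball z r - K)"
      by (rule measure_Un_le) auto
    finally have m: "?v / 2 * r ^ CARD('n) \<le> measure lborel (cball z r \<inter> K)" using d by linarith
    have fin: "emeasure lborel (cball z r \<inter> K) < \<infinity>"
      using emeasure_mono[of "cball z r \<inter> K" "cball z r" lborel] fm by (simp add: fmeasurable_def)
    have gi: "integrable lborel (\<lambda>y. g0 y * indicator (cball z r) y)"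
    proof -
      have "(\<integral>\<^sup>+y. ennreal (g0 y * indicator (cball z r) y) \<partial>lborel) = emeasure \<nu> (cball z r)"
        by (subst emeasure_density) (auto intro!: nn_integral_cong split: split_indicator)
      also have "\<dots> < \<infinity>" by (simp add: less_top[symmetric])
      finally show ?thesis using g0_nonneg
        by (intro integrableI_nonneg) (auto intro!: borel_measurable_times borel_measurable_indicator)
    qed
    have "c1 * r ^ CARD('n) = g0 x / 2 * (?v / 2 * r ^ CARD('n))" by (simp add: c1_def)
    also have "\<dots> \<le> g0 x / 2 * measure lborel (cball z r \<inter> K)" using m g0_x by (intro mult_left_mono) auto
    also have "\<dots> = (\<integral>y. g0 x / 2 * indicator (cball z r \<inter> K) y \<partial>lborel)" by simp
    also have "\<dots> \<le> (\<integral>y. g0 y * indicator (cball z r) y \<partial>lborel)"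
    proof (rule integral_mono[OF _ gi])
      show "integrable lborel (\<lambda>y. g0 x / 2 * indicator (cball z r \<inter> K) y)" using fin by simp
      show "g0 x / 2 * indicator (cball z r \<inter> K) y \<le> g0 y * indicator (cball z r) y" for y
      proof (cases "y \<in> cball z r \<and> y \<in> K")
        case True
        then have "y \<in> ball x (3 * r)" using sub by blast
        then have "dist y x < \<delta>1" using r \<delta> by (simp add: dist_commute)
        then have "g0 x / 2 \<le> g0 y" using True by (intro g0_half) auto
        then show ?thesis using True by (simp only: indicator_simps Int_iff mult_1_right)
      next
        case False
        then have "indicator (cball z r \<inter> K) y = (0 :: real)" by (simp add: indicator_def)
        then show ?thesis using g0_nonneg[of y] by simp
      qed
    qed
    also have "\<dots> = measure \<nu> (cball z r)" by (rule measure_cont[symmetric]) simp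
    finally show ?thesis by (simp add: r_def ball_through_def)
  qed
  \<comment> \<open>Radius \<open>\<delta> / 2\<close>, so that a ball of radius at least
    \<open>\<delta>\<close> about any \<open>z\<close> in \<open>K\<close> contains the covering
    ball in which \<open>z\<close> lies.\<close>
  have "K \<subseteq> (\<Union>y\<in>K. ball y (\<delta> / 2))" using \<delta> by force
  then obtain T where T: "T \<subseteq> K" "finite T" "K \<subseteq> (\<Union>y\<in>T. ball y (\<delta> / 2))"
    by (rule compactE_image[OF K, rotated]) auto
  have Tne: "T \<noteq> {}" using T(3) xK by auto
  define m where "m = Min ((\<lambda>y. measure \<nu> (cball y (\<delta> / 2))) ` T)"
  have m: "m > 0" unfolding m_def using T Tne charged \<delta> by (subst Min_gr_iff) auto
  obtain D0 where D0: "\<And>z. z \<in> K \<Longrightarrow> norm z \<le> D0" using compact_imp_bounded[OF K] by (auto simp: bounded_iff)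
  define D where "D = 2 * D0 + 1"
  have D: "D > 0" "norm (z - x) \<le> D" if "z \<in> K" for z
    using D0[OF that] D0[OF xK] norm_triangle_ineq4[of z x] norm_ge_zero[of x] unfolding D_def by linarith+
  have D0': "D > 0" using D(1)[OF xK] .
  have far: "m / D ^ CARD('n) * norm (z - x) ^ CARD('n) \<le> measure \<nu> (ball_through x z)" if z: "z \<in> K" "\<not> norm (z - x) < \<delta>" for z
  proof -
    obtain y where y: "y \<in> T" "z \<in> ball y (\<delta> / 2)" using T(3) z(1) by blast
    have "cball y (\<delta> / 2) \<subseteq> ball_through x z"
    proof
      fix u assume "u \<in> cball y (\<delta> / 2)"
      then have "dist z u \<le> \<delta>" using y(2) dist_triangle[of z u y] by (simp add: dist_commute)
      then show "u \<in> ball_through x z" using z(2) by (simp add: ball_through_def)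
    qed
    then have "measure \<nu> (cball y (\<delta> / 2)) \<le> measure \<nu> (ball_through x z)" by (intro nu.finite_measure_mono) auto
    moreover have "m \<le> measure \<nu> (cball y (\<delta> / 2))" unfolding m_def using y(1) T(2) by (intro Min_le) auto
    moreover have "m / D ^ CARD('n) * norm (z - x) ^ CARD('n) \<le> m"
    proof -
      have "norm (z - x) ^ CARD('n) \<le> D ^ CARD('n)" using D(2)[OF z(1)] by (intro power_mono) auto
      then have "m * norm (z - x) ^ CARD('n) \<le> m * D ^ CARD('n)" using m by (intro mult_left_mono) auto
      then show ?thesis using D0' by (simp add: field_simps)
    qed
    ultimately show ?thesis by linarith
  qed
  show ?thesis
  proof (rule that[of "min c1 (m / D ^ CARD('n))"])
    show "min c1 (m / D ^ CARD('n)) > 0" using c1 m D0' by simp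
    fix z assume z: "z \<in> K"
    have p: "0 \<le> norm (z - x) ^ CARD('n)" by simp
    show "min c1 (m / D ^ CARD('n)) * norm (z - x) ^ CARD('n) \<le> measure \<nu> (ball_through x z)"
    proof (cases "norm (z - x) < \<delta>")
      case True
      show ?thesis by (rule order_trans[OF mult_right_mono[OF min.cobounded1 p] near[OF True]])
    next
      case False
      show ?thesis by (rule order_trans[OF mult_right_mono[OF min.cobounded2 p] far[OF z False]])
    qed
  qed
qed

end

section \<open>Integrals of the Poisson kernel\<close>

lemma integrable_exp_norm:
  assumes a: "a > 0"
  shows "integrable lborel (\<lambda>w :: real ^ 'n. exp (- (a * norm w ^ CARD('n))))"
  by (rule integrableI_nonneg) (use nn_integral_exp_norm[OF a, where 'n = 'n] in auto)

lemma nn_integral_poisson_kernel: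
  assumes a: "a > 0"
  shows "(\<integral>\<^sup>+(w1 :: real ^ 'n). \<integral>\<^sup>+w2. ennreal (poisson_kernel \<kappa> a w1 w2) \<partial>lborel \<partial>lborel)
    = ennreal (1 / a\<^sup>2 * (\<Sum>(i, j, k)\<in>triples \<kappa>. enn2real (poisson_integral TYPE('n) i j k)))"
proof -
  define F where "F t w1 w2 = (case t of (i, j, k) \<Rightarrow> poisson_weight
     (a * measure lborel (ball_through 0 w2 - ball_through 0 w1)) (a * measure lborel (ball_through 0 w1 - ball_through 0 w2))
     (a * measure lborel (ball_through 0 w1 \<inter> ball_through 0 w2)) i j k)" for t and w1 w2 :: "real ^ 'n"
  have F0: "0 \<le> F t w1 w2" for t w1 w2
    using a by (auto simp: F_def intro!: poisson_weight_nonneg split: prod.split)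
  have [measurable (raw)]: "(\<lambda>x. F t (f x) (g x)) \<in> borel_measurable N"
    if "f \<in> borel_measurable N" "g \<in> borel_measurable N" for f g t and N :: "'x measure"
    unfolding F_def case_prod_beta
    by (intro borel_measurable_poisson_weight borel_measurable_times borel_measurable_const borel_measurable_ball_through_measures that)
  have "(\<integral>\<^sup>+(w1 :: real ^ 'n). \<integral>\<^sup>+w2. ennreal (poisson_kernel \<kappa> a w1 w2) \<partial>lborel \<partial>lborel)
    = (\<integral>\<^sup>+(w1 :: real ^ 'n). \<integral>\<^sup>+w2. (\<Sum>t\<in>triples \<kappa>. ennreal (F t w1 w2)) \<partial>lborel \<partial>lborel)"
    using F0 by (simp add: sum_ennreal poisson_kernel_def F_def)
  also have "\<dots> = (\<integral>\<^sup>+(w1 :: real ^ 'n). (\<Sum>t\<in>triples \<kappa>. \<integral>\<^sup>+w2. ennreal (F t w1 w2) \<partial>lborel) \<partial>lborel)"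
    by (rule nn_integral_cong, rule nn_integral_sum) measurable
  also have "\<dots> = (\<Sum>t\<in>triples \<kappa>. \<integral>\<^sup>+(w1 :: real ^ 'n). \<integral>\<^sup>+w2. ennreal (F t w1 w2) \<partial>lborel \<partial>lborel)"
    by (rule nn_integral_sum) measurable
  also have "\<dots> = (\<Sum>t\<in>triples \<kappa>. ennreal (1 / a\<^sup>2 * (case t of (i, j, k) \<Rightarrow> enn2real (poisson_integral TYPE('n) i j k))))"
  proof (rule sum.cong[OF refl])
    fix t :: "nat \<times> nat \<times> nat"
    obtain i j k where t: "t = (i, j, k)" by (cases t)
    have "(\<integral>\<^sup>+(w1 :: real ^ 'n). \<integral>\<^sup>+w2. ennreal (F t w1 w2) \<partial>lborel \<partial>lborel) = ennreal (1 / a\<^sup>2) * poisson_integral TYPE('n) i j k"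
      unfolding t F_def prod.case by (rule nn_integral_poisson_weight_ball_through[OF a])
    also have "poisson_integral TYPE('n) i j k = ennreal (enn2real (poisson_integral TYPE('n) i j k))"
      using poisson_integral_finite[where 'n = 'n, of i j k] by simp
    also have "ennreal (1 / a\<^sup>2) * ennreal (enn2real (poisson_integral TYPE('n) i j k)) = ennreal (1 / a\<^sup>2 * enn2real (poisson_integral TYPE('n) i j k))"
      by (rule ennreal_mult[symmetric]) auto
    finally show "(\<integral>\<^sup>+(w1 :: real ^ 'n). \<integral>\<^sup>+w2. ennreal (F t w1 w2) \<partial>lborel \<partial>lborel)
      = ennreal (1 / a\<^sup>2 * (case t of (i, j, k) \<Rightarrow> enn2real (poisson_integral TYPE('n) i j k)))"
      by (simp only: t prod.case)
  qed
  also have "\<dots> = ennreal (1 / a\<^sup>2 * (\<Sum>(i, j, k)\<in>triples \<kappa>. enn2real (poisson_integral TYPE('n) i j k)))"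
    unfolding sum_distrib_left by (rule sum_ennreal) (auto split: prod.split)
  finally show ?thesis .
qed

text \<open>For equal balls both differences are empty, so only the triples \<open>(0, 0, k)\<close>
  with \<open>k \<le> \<kappa>\<close> remain. Each contributes \<open>1 / a\<close>, and their
  number \<open>Suc \<kappa>\<close> becomes the factor \<open>M\<close> of the first
  moment.\<close>

lemma nn_integral_poisson_kernel_diagonal:
  assumes a: "a > 0"
  shows "(\<integral>\<^sup>+(w :: real ^ 'n). ennreal (poisson_kernel \<kappa> a w w) \<partial>lborel) = ennreal (real (Suc \<kappa>) / a)"
proof -
  define b where "b = a * ball_volume TYPE('n)"
  have c: "ball_volume TYPE('n) > 0" by (rule ball_volume_pos)
  have b: "b > 0" using a c by (simp add: b_def)
  have P: "poisson_kernel \<kappa> a w w = (\<Sum>k\<le>\<kappa>. b ^ k / fact k * ((norm w ^ CARD('n)) ^ k * exp (- (b * norm w ^ CARD('n)))))" for w :: "real ^ 'n"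
  proof -
    have "poisson_kernel \<kappa> a w w = (\<Sum>(i, j, k)\<in>triples \<kappa>. poisson_weight 0 0 (b * norm w ^ CARD('n)) i j k)"
      by (simp add: poisson_kernel_def measure_ball_through b_def mult.assoc)
    also have "\<dots> = (\<Sum>(i, j, k)\<in>(\<lambda>k. (0, 0, k)) ` {..\<kappa>}. poisson_weight 0 0 (b * norm w ^ CARD('n)) i j k)"
      by (rule sum.mono_neutral_right[OF finite_triples]) (auto simp: triples_def poisson_weight_def)
    also have "\<dots> = (\<Sum>k\<le>\<kappa>. poisson_weight 0 0 (b * norm w ^ CARD('n)) 0 0 k)"
      by (subst sum.reindex) (auto simp: inj_on_def)
    finally show ?thesis by (simp add: poisson_weight_def power_mult_distrib mult_ac)
  qed
  have "(\<integral>\<^sup>+(w :: real ^ 'n). ennreal (poisson_kernel \<kappa> a w w) \<partial>lborel)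
    = (\<integral>\<^sup>+(w :: real ^ 'n). (\<Sum>k\<le>\<kappa>. ennreal (b ^ k / fact k) * ennreal ((norm w ^ CARD('n)) ^ k * exp (- (b * norm w ^ CARD('n))))) \<partial>lborel)"
  proof (rule nn_integral_cong)
    fix w :: "real ^ 'n"
    have "ennreal (poisson_kernel \<kappa> a w w) = (\<Sum>k\<le>\<kappa>. ennreal (b ^ k / fact k * ((norm w ^ CARD('n)) ^ k * exp (- (b * norm w ^ CARD('n))))))"
      unfolding P by (rule sum_ennreal[symmetric]) (use b in simp)
    also have "\<dots> = (\<Sum>k\<le>\<kappa>. ennreal (b ^ k / fact k) * ennreal ((norm w ^ CARD('n)) ^ k * exp (- (b * norm w ^ CARD('n)))))"
      by (rule sum.cong[OF refl], rule ennreal_mult) (use b in simp_all)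
    finally show "ennreal (poisson_kernel \<kappa> a w w) = \<dots>" .
  qed
  also have "\<dots> = (\<Sum>k\<le>\<kappa>. \<integral>\<^sup>+(w :: real ^ 'n). ennreal (b ^ k / fact k) * ennreal ((norm w ^ CARD('n)) ^ k * exp (- (b * norm w ^ CARD('n)))) \<partial>lborel)"
    by (rule nn_integral_sum) measurable
  also have "\<dots> = (\<Sum>k\<le>\<kappa>. ennreal (1 / a))"
  proof (rule sum.cong[OF refl])
    fix k
    have "(\<integral>\<^sup>+(w :: real ^ 'n). ennreal (b ^ k / fact k) * ennreal ((norm w ^ CARD('n)) ^ k * exp (- (b * norm w ^ CARD('n)))) \<partial>lborel)
      = ennreal (b ^ k / fact k) * (\<integral>\<^sup>+(w :: real ^ 'n). ennreal ((norm w ^ CARD('n)) ^ k * exp (- (b * norm w ^ CARD('n)))) \<partial>lborel)"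
      by (rule nn_integral_cmult) measurable
    also have "(\<integral>\<^sup>+(w :: real ^ 'n). ennreal ((norm w ^ CARD('n)) ^ k * exp (- (b * norm w ^ CARD('n)))) \<partial>lborel)
      = ennreal (ball_volume TYPE('n)) * (\<integral>\<^sup>+v. indicator {0<..} v * ennreal (v ^ k * exp (- (b * v))) \<partial>lborel)"
      by (rule nn_integral_radial) measurable
    also have "(\<integral>\<^sup>+v. indicator {0<..} v * ennreal (v ^ k * exp (- (b * v))) \<partial>lborel) = ennreal (fact k / b ^ Suc k)"
      by (rule nn_integral_power_exp_scaled[OF b])
    also have "ennreal (b ^ k / fact k) * (ennreal (ball_volume TYPE('n)) * ennreal (fact k / b ^ Suc k))
      = ennreal (b ^ k / fact k * (ball_volume TYPE('n) * (fact k / b ^ Suc k)))"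
    proof -
      have "ennreal p * (ennreal q * ennreal r) = ennreal (p * (q * r))" if "0 \<le> p" "0 \<le> q" "0 \<le> r" for p q r
        using that by (simp add: ennreal_mult)
      then show ?thesis by this (use b c in auto)
    qed
    also have "b ^ k / fact k * (ball_volume TYPE('n) * (fact k / b ^ Suc k)) = 1 / a"
    proof -
      have "b ^ k / fact k * (C * (fact k / b ^ Suc k)) = C / b" for C using b by (simp add: field_simps)
      then show ?thesis using a c by (simp add: b_def)
    qed
    finally show "(\<integral>\<^sup>+(w :: real ^ 'n). ennreal (b ^ k / fact k) * ennreal ((norm w ^ CARD('n)) ^ k * exp (- (b * norm w ^ CARD('n)))) \<partial>lborel) = ennreal (1 / a)" .
  qed
  also have "\<dots> = ennreal (real (Suc \<kappa>) / a)"
    using a by (subst sum_ennreal) auto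
  finally show ?thesis .
qed

section \<open>Moment limits at a density point\<close>

context density_point
begin

text \<open>The indices \<open>{2..n + 1}\<close> are those of the other points in a sample of size
  \<open>n + 1\<close> whose first point is \<open>x\<close>. The ball of \<open>z2\<close> comes
  first, matching the order of the pieces in \<open>poisson_kernel\<close>.\<close>

definition counts :: "nat \<Rightarrow> nat \<Rightarrow> real ^ 'n \<Rightarrow> real ^ 'n \<Rightarrow> real" where
  "counts \<kappa> n z1 z2 = low_counts \<nu> {2..n + 1} \<kappa> (ball_through x z2) (ball_through x z1)"

lemma counts_nonneg: "0 \<le> counts \<kappa> n z1 z2" by (simp add: counts_def low_counts_def)

lemma borel_measurable_counts [measurable (raw)]:
  assumes "f \<in> borel_measurable N" "g \<in> borel_measurable N"
  shows "(\<lambda>z. counts \<kappa> n (f z) (g z)) \<in> borel_measurable N"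
  unfolding counts_def by (rule borel_measurable_low_counts) (use assms prob in simp_all)

text \<open>The three pieces of the pair of balls are images of fixed sets under the blow-up, so
  their scaled masses converge and each multinomial term tends to its Poisson counterpart.\<close>

lemma counts_limit: "(\<lambda>n. counts \<kappa> n (x + eps n *\<^sub>R w1) (x + eps n *\<^sub>R w2)) \<longlonglongrightarrow> poisson_kernel \<kappa> (g0 x) w1 w2"
proof -
  define p1 where "p1 n = measure \<nu> (ball_through x (x + eps n *\<^sub>R w2) - ball_through x (x + eps n *\<^sub>R w1))" for n
  define p2 where "p2 n = measure \<nu> (ball_through x (x + eps n *\<^sub>R w1) - ball_through x (x + eps n *\<^sub>R w2))" for n
  define p3 where "p3 n = measure \<nu> (ball_through x (x + eps n *\<^sub>R w2) \<inter> ball_through x (x + eps n *\<^sub>R w1))" for n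
  have f: "emeasure lborel (ball_through 0 w \<inter> C) < \<infinity>" "emeasure lborel (ball_through 0 w - C) < \<infinity>" for w :: "real ^ 'n" and C
  proof -
    have "emeasure lborel (ball_through 0 w) < \<infinity>" using ball_through_fmeasurable[of 0 w] by (simp only: fmeasurableD2 less_top[symmetric] fmeasurable_def mem_Collect_eq)
    then show "emeasure lborel (ball_through 0 w \<inter> C) < \<infinity>" "emeasure lborel (ball_through 0 w - C) < \<infinity>"
      by (auto intro: le_less_trans[OF emeasure_mono])
  qed
  note lims = scaled_mass_limit[of "ball_through 0 w2 - ball_through 0 w1" "\<lambda>n. ball_through x (x + eps n *\<^sub>R w2) - ball_through x (x + eps n *\<^sub>R w1)"]
    scaled_mass_limit[of "ball_through 0 w1 - ball_through 0 w2" "\<lambda>n. ball_through x (x + eps n *\<^sub>R w1) - ball_through x (x + eps n *\<^sub>R w2)"]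
    scaled_mass_limit[of "ball_through 0 w2 \<inter> ball_through 0 w1" "\<lambda>n. ball_through x (x + eps n *\<^sub>R w2) \<inter> ball_through x (x + eps n *\<^sub>R w1)"]
  have "(\<lambda>n. real (n + 1) * p1 n) \<longlonglongrightarrow> g0 x * measure lborel (ball_through 0 w2 - ball_through 0 w1)"
    unfolding p1_def by (rule lims(1)) (auto simp: f[simplified] ball_through_affine[OF eps_pos])
  \<comment> \<open>Index shift: \<open>tendsto_multinomial_weight\<close> counts the whole sample
    by \<open>n\<close>, whereas here \<open>n\<close> counts the remaining points.\<close>
  then have l1: "(\<lambda>n. real n * p1 (n - 1)) \<longlonglongrightarrow> g0 x * measure lborel (ball_through 0 w2 - ball_through 0 w1)"
    by (subst filterlim_sequentially_Suc[symmetric]) simp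
  have "(\<lambda>n. real (n + 1) * p2 n) \<longlonglongrightarrow> g0 x * measure lborel (ball_through 0 w1 - ball_through 0 w2)"
    unfolding p2_def by (rule lims(2)) (auto simp: f[simplified] ball_through_affine[OF eps_pos])
  then have l2: "(\<lambda>n. real n * p2 (n - 1)) \<longlonglongrightarrow> g0 x * measure lborel (ball_through 0 w1 - ball_through 0 w2)"
    by (subst filterlim_sequentially_Suc[symmetric]) simp
  have "(\<lambda>n. real (n + 1) * p3 n) \<longlonglongrightarrow> g0 x * measure lborel (ball_through 0 w2 \<inter> ball_through 0 w1)"
    unfolding p3_def by (rule lims(3)) (auto simp: f[simplified] ball_through_affine[OF eps_pos])
  then have l3: "(\<lambda>n. real n * p3 (n - 1)) \<longlonglongrightarrow> g0 x * measure lborel (ball_through 0 w2 \<inter> ball_through 0 w1)"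
    by (subst filterlim_sequentially_Suc[symmetric]) simp
  have sum1: "p1 n + p2 n + p3 n \<le> 1" for n
  proof -
    let ?A = "ball_through x (x + eps n *\<^sub>R w2)" and ?B = "ball_through x (x + eps n *\<^sub>R w1)"
    have "measure \<nu> ((?A - ?B) \<union> (?B - ?A) \<union> (?A \<inter> ?B)) = p1 n + p2 n + p3 n"
      unfolding p1_def p2_def p3_def by (subst nu.finite_measure_Union; (auto; fail)?)+
    then show ?thesis by (metis nu.prob_le_1)
  qed
  have m: "(\<lambda>n. multinomial_weight (Suc n - 1) (p1 (Suc n - 1)) (p2 (Suc n - 1)) (p3 (Suc n - 1)) i j k)
    \<longlonglongrightarrow> poisson_weight (g0 x * measure lborel (ball_through 0 w2 - ball_through 0 w1))
      (g0 x * measure lborel (ball_through 0 w1 - ball_through 0 w2)) (g0 x * measure lborel (ball_through 0 w2 \<inter> ball_through 0 w1)) i j k" for i j k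
    by (rule LIMSEQ_Suc, rule tendsto_multinomial_weight[OF _ _ _ _ l1 l2 l3]) (use sum1 in \<open>auto simp: p1_def p2_def p3_def\<close>)
  have "counts \<kappa> n (x + eps n *\<^sub>R w1) (x + eps n *\<^sub>R w2) = (\<Sum>(i, j, k)\<in>triples \<kappa>. multinomial_weight (Suc n - 1) (p1 (Suc n - 1)) (p2 (Suc n - 1)) (p3 (Suc n - 1)) i j k)" for n
    unfolding counts_def by (subst nu.low_counts_eq) (auto simp: p1_def p2_def p3_def)
  then show ?thesis
    unfolding poisson_kernel_def using m
    by (auto intro!: tendsto_sum simp: Int_commute split: prod.split)
qed

text \<open>Two dominating functions are needed. In the inner integral \<open>w1\<close> is fixed
  and its blown-up point may lie outside \<open>K\<close>, so only the factor for \<open>w2\<close>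
  is available; the outer integral uses the product bound.\<close>

lemma counts_bound:
  obtains C a where "C > 0" "a > 0"
    "\<And>\<kappa> n w1 w2. x + eps n *\<^sub>R w1 \<in> K \<Longrightarrow> x + eps n *\<^sub>R w2 \<in> K \<Longrightarrow>
      counts \<kappa> n (x + eps n *\<^sub>R w1) (x + eps n *\<^sub>R w2) \<le> C * 4 ^ \<kappa> * (exp (- (a * norm w1 ^ CARD('n))) * exp (- (a * norm w2 ^ CARD('n))))"
    "\<And>\<kappa> n w1 w2. x + eps n *\<^sub>R w2 \<in> K \<Longrightarrow>
      counts \<kappa> n (x + eps n *\<^sub>R w1) (x + eps n *\<^sub>R w2) \<le> C * 4 ^ \<kappa> * exp (- (a * norm w2 ^ CARD('n)))"
proof -
  obtain c where c: "c > 0" "\<And>z. z \<in> K \<Longrightarrow> c * norm (z - x) ^ CARD('n) \<le> measure \<nu> (ball_through x z)"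
    by (rule ball_mass_lower_bound) blast
  have lower: "c * norm w ^ CARD('n) \<le> real (n + 1) * measure \<nu> (ball_through x (x + eps n *\<^sub>R w))" if "x + eps n *\<^sub>R w \<in> K" for n w
  proof -
    have "real (n + 1) * (c * norm (x + eps n *\<^sub>R w - x) ^ CARD('n)) \<le> real (n + 1) * measure \<nu> (ball_through x (x + eps n *\<^sub>R w))"
      by (rule mult_left_mono[OF c(2)[OF that]]) simp
    moreover have "norm (x + eps n *\<^sub>R w - x) ^ CARD('n) = 1 / real (n + 1) * norm w ^ CARD('n)"
      using eps_pos[of n] by (simp add: power_mult_distrib eps_power)
    moreover have "real (n + 1) * (c * (1 / real (n + 1) * N)) = c * N" for N by simp
    ultimately show ?thesis by (simp only:)
  qed
  have e: "counts \<kappa> n z1 z2 \<le> exp (1/2) * 4 ^ \<kappa> * exp (- (s / 4))"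
    if s: "s \<le> real (n + 1) * measure \<nu> (ball_through x z1) + real (n + 1) * measure \<nu> (ball_through x z2)" for \<kappa> n z1 z2 s
  proof -
    \<comment> \<open>There are \<open>n\<close> remaining points but masses are scaled by
      \<open>n + 1\<close>; the difference \<open>p + q\<close> is at most 2, and a quarter of it
      explains \<open>exp (1/2)\<close>.\<close>
    have le: "- (real n * (q + p) / 4) \<le> 1 / 2 + - (s / 4)" if "p \<le> 1" "q \<le> 1" "s \<le> real (n + 1) * p + real (n + 1) * q" for p q :: real
    proof -
      have "real (n + 1) * p + real (n + 1) * q = real n * (q + p) + (p + q)" by (simp add: algebra_simps)
      then show ?thesis using that by argo
    qed
    have "counts \<kappa> n z1 z2 \<le> 4 ^ \<kappa> * exp (- (real (card {2..n + 1}) * (measure \<nu> (ball_through x z2) + measure \<nu> (ball_through x z1)) / 4))"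
      unfolding counts_def by (rule nu.low_counts_le) auto
    also have "\<dots> \<le> 4 ^ \<kappa> * exp (1/2 + - (s / 4))"
      using le[OF nu.prob_le_1 nu.prob_le_1 s] by (intro mult_left_mono) simp_all
    finally show ?thesis by (simp only: exp_add mult_ac)
  qed
  show ?thesis
  proof (rule that[of "exp (1/2)" "c / 4"])
    fix \<kappa> n w1 w2
    assume w2: "x + eps n *\<^sub>R w2 \<in> K"
    have "0 \<le> real (n + 1) * measure \<nu> (ball_through x (x + eps n *\<^sub>R w1))" by simp
    with lower[OF w2] have s: "c * norm w2 ^ CARD('n) \<le> real (n + 1) * measure \<nu> (ball_through x (x + eps n *\<^sub>R w1))
      + real (n + 1) * measure \<nu> (ball_through x (x + eps n *\<^sub>R w2))" by linarith
    show "counts \<kappa> n (x + eps n *\<^sub>R w1) (x + eps n *\<^sub>R w2) \<le> exp (1/2) * 4 ^ \<kappa> * exp (- (c / 4 * norm w2 ^ CARD('n)))"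
      using e[OF s, of \<kappa>] by simp
    assume w1: "x + eps n *\<^sub>R w1 \<in> K"
    have "- ((c * norm w1 ^ CARD('n) + c * norm w2 ^ CARD('n)) / 4) = - (c / 4 * norm w1 ^ CARD('n)) + - (c / 4 * norm w2 ^ CARD('n))"
      by (simp add: add_divide_distrib)
    then show "counts \<kappa> n (x + eps n *\<^sub>R w1) (x + eps n *\<^sub>R w2) \<le> exp (1/2) * 4 ^ \<kappa> * (exp (- (c / 4 * norm w1 ^ CARD('n))) * exp (- (c / 4 * norm w2 ^ CARD('n))))"
      using e[OF add_mono[OF lower[OF w1] lower[OF w2]], of \<kappa>] by (simp only: exp_add)
  qed (use c in auto)
qed

lemma poisson_kernel_bound:
  obtains C a where "C > 0" "a > 0"
    "\<And>w1 w2 :: real ^ 'n. poisson_kernel \<kappa> (g0 x) w1 w2 \<le> C * (exp (- (a * norm w1 ^ CARD('n))) * exp (- (a * norm w2 ^ CARD('n))))"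
proof (rule that)
  show "(\<Sum>(i, j, k)\<in>triples \<kappa>. 2 ^ (i + j + k)) > (0 :: real)"
  proof (rule sum_pos[OF finite_triples])
    have "(0, 0, 0) \<in> triples \<kappa>" by (simp add: triples_def)
    then show "triples \<kappa> \<noteq> {}" by blast
  qed (auto split: prod.split)
  show "g0 x * ball_volume TYPE('n) / 4 > 0" using g0_x ball_volume_pos[where 'n = 'n] by simp
qed (rule poisson_kernel_le[OF less_imp_le[OF g0_x]])

context
  fixes g1 :: "real ^ 'n \<Rightarrow> real"
  assumes g1 [measurable]: "g1 \<in> borel_measurable borel" and g1_nonneg: "\<And>z. 0 \<le> g1 z"
    and g1_out: "\<And>z. z \<notin> K \<Longrightarrow> g1 z = 0" and g1_cont: "continuous_on K g1"
begin

lemma first_moment_limit: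
  "(\<lambda>n. real (n + 1) * (\<integral>z. g1 z * counts \<kappa> n z z \<partial>lborel)) \<longlonglongrightarrow> real (Suc \<kappa>) * (g1 x / g0 x)"
proof -
  obtain C a where Ca: "C > 0" "a > 0"
    "\<And>\<kappa> n w1 w2. x + eps n *\<^sub>R w2 \<in> K \<Longrightarrow>
      counts \<kappa> n (x + eps n *\<^sub>R w1) (x + eps n *\<^sub>R w2) \<le> C * 4 ^ \<kappa> * exp (- (a * norm w2 ^ CARD('n)))"
    by (rule counts_bound) blast
  have nn: "(\<integral>\<^sup>+(w :: real ^ 'n). ennreal (poisson_kernel \<kappa> (g0 x) w w) \<partial>lborel) = ennreal (real (Suc \<kappa>) / g0 x)"
    by (rule nn_integral_poisson_kernel_diagonal[OF g0_x])
  have p0: "0 \<le> poisson_kernel \<kappa> (g0 x) w w" for w :: "real ^ 'n" by (rule poisson_kernel_nonneg[OF less_imp_le[OF g0_x]])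
  have ip: "integrable lborel (\<lambda>w :: real ^ 'n. poisson_kernel \<kappa> (g0 x) w w)"
    by (rule integrableI_nonneg) (use nn p0 in auto)
  have ival: "(\<integral>w. poisson_kernel \<kappa> (g0 x) w w \<partial>(lborel :: (real ^ 'n) measure)) = real (Suc \<kappa>) / g0 x"
    using nn nn_integral_eq_integral[OF ip] p0 g0_x by (simp add: integral_nonneg)
  have "(\<lambda>n. \<integral>w. g1 (x + eps n *\<^sub>R w) * counts \<kappa> n (x + eps n *\<^sub>R w) (x + eps n *\<^sub>R w) \<partial>lborel)
    \<longlonglongrightarrow> g1 x * (\<integral>w. poisson_kernel \<kappa> (g0 x) w w \<partial>(lborel :: (real ^ 'n) measure))"
  proof (rule blow_up_limit[where G = "\<lambda>w. C * 4 ^ \<kappa> * exp (- (a * norm w ^ CARD('n)))"])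
    show "integrable lborel (\<lambda>w :: real ^ 'n. C * 4 ^ \<kappa> * exp (- (a * norm w ^ CARD('n))))"
      by (intro integrable_mult_right integrable_exp_norm Ca)
    show "\<bar>counts \<kappa> n (x + eps n *\<^sub>R w) (x + eps n *\<^sub>R w)\<bar> \<le> C * 4 ^ \<kappa> * exp (- (a * norm w ^ CARD('n)))" if "x + eps n *\<^sub>R w \<in> K" for n w
      unfolding abs_of_nonneg[OF counts_nonneg] by (rule Ca(3)[OF that])
    show "(\<lambda>n. counts \<kappa> n (x + eps n *\<^sub>R w) (x + eps n *\<^sub>R w)) \<longlonglongrightarrow> poisson_kernel \<kappa> (g0 x) w w" for w
      by (rule counts_limit)
  qed (use g1_nonneg g1_out g1_cont ip p0 Ca in simp_all)
  moreover have "(\<integral>w. g1 (x + eps n *\<^sub>R w) * counts \<kappa> n (x + eps n *\<^sub>R w) (x + eps n *\<^sub>R w) \<partial>lborel)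
    = real (n + 1) * (\<integral>z. g1 z * counts \<kappa> n z z \<partial>lborel)" for n
  proof -
    have "(\<integral>z. g1 z * counts \<kappa> n z z \<partial>lborel) = \<bar>eps n\<bar> ^ DIM(real ^ 'n) *
      (\<integral>w. g1 (x + eps n *\<^sub>R w) * counts \<kappa> n (x + eps n *\<^sub>R w) (x + eps n *\<^sub>R w) \<partial>lborel)"
      using eps_pos[of n] by (intro integral_affine) auto
    also have "\<bar>eps n\<bar> ^ DIM(real ^ 'n) = 1 / real (n + 1)" using eps_pos[of n] by (simp add: eps_power)
    finally show ?thesis by simp
  qed
  ultimately show ?thesis by (simp add: ival mult.commute)
qed

text \<open>The blow-up limit is applied twice, first to the inner integral with \<open>w1\<close>
  fixed and then to the outer one, where the inner integrals \<open>q n\<close> play the part of the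
  converging sequence. Each application contributes a factor \<open>g1 x\<close>.\<close>

lemma second_moment_limit:
  "(\<lambda>n. (real (n + 1))\<^sup>2 * (\<integral>z1. g1 z1 * (\<integral>z2. g1 z2 * counts \<kappa> n z1 z2 \<partial>lborel) \<partial>lborel))
    \<longlonglongrightarrow> (\<Sum>(i, j, k)\<in>triples \<kappa>. enn2real (poisson_integral TYPE('n) i j k)) * (g1 x / g0 x)\<^sup>2"
proof -
  let ?E = "\<lambda>a (w :: real ^ 'n). exp (- (a * norm w ^ CARD('n)))"
  let ?k = "poisson_kernel \<kappa> (g0 x) :: real ^ 'n \<Rightarrow> real ^ 'n \<Rightarrow> real"
  obtain C a where C0: "C > 0" "a > 0"
    and both: "\<And>\<kappa> n w1 w2. x + eps n *\<^sub>R w1 \<in> K \<Longrightarrow> x + eps n *\<^sub>R w2 \<in> K \<Longrightarrow>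
      counts \<kappa> n (x + eps n *\<^sub>R w1) (x + eps n *\<^sub>R w2) \<le> C * 4 ^ \<kappa> * (?E a w1 * ?E a w2)"
    and one: "\<And>\<kappa> n w1 w2. x + eps n *\<^sub>R w2 \<in> K \<Longrightarrow>
      counts \<kappa> n (x + eps n *\<^sub>R w1) (x + eps n *\<^sub>R w2) \<le> C * 4 ^ \<kappa> * ?E a w2"
    by (rule counts_bound) blast
  obtain C' a' where C': "C' > 0" "a' > 0" "\<And>w1 w2 :: real ^ 'n. ?k w1 w2 \<le> C' * (?E a' w1 * ?E a' w2)"
    by (rule poisson_kernel_bound) blast
  note iE = integrable_exp_norm[OF C0(2), where 'n = 'n] integrable_exp_norm[OF C'(2), where 'n = 'n]
  have k0: "0 \<le> ?k w1 w2" for w1 w2 by (rule poisson_kernel_nonneg[OF less_imp_le[OF g0_x]])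
  have ik: "integrable lborel (?k w1)" for w1
  proof (rule Bochner_Integration.integrable_bound)
    show "integrable lborel (\<lambda>w2. C' * ?E a' w1 * ?E a' w2)" using iE(2) by simp
    show "AE w2 in lborel. norm (?k w1 w2) \<le> norm (C' * ?E a' w1 * ?E a' w2)"
      using C'(1) C'(3)[of w1] k0 by (intro AE_I2) (simp add: abs_of_nonneg mult.assoc)
  qed simp
  define k1 where "k1 w1 = (\<integral>w2. ?k w1 w2 \<partial>lborel)" for w1
  have k1m [measurable]: "k1 \<in> borel_measurable borel" unfolding k1_def[abs_def] by measurable
  have k10: "0 \<le> k1 w1" for w1 unfolding k1_def using k0 by (simp add: integral_nonneg)
  have nk1: "(\<integral>\<^sup>+w2. ennreal (?k w1 w2) \<partial>lborel) = ennreal (k1 w1)" for w1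
    unfolding k1_def by (rule nn_integral_eq_integral[OF ik]) (simp add: k0)
  have nn: "(\<integral>\<^sup>+w1. ennreal (k1 w1) \<partial>lborel) = ennreal (1 / (g0 x)\<^sup>2 * (\<Sum>(i, j, k)\<in>triples \<kappa>. enn2real (poisson_integral TYPE('n) i j k)))"
    using nn_integral_poisson_kernel[OF g0_x, where 'n = 'n, of \<kappa>] by (simp only: nk1)
  have ik1: "integrable lborel k1" by (rule integrableI_nonneg) (use nn k10 in auto)
  have s0: "0 \<le> (\<Sum>(i, j, k)\<in>triples \<kappa>. enn2real (poisson_integral TYPE('n) i j k))" by (rule sum_nonneg) (auto split: prod.split)
  have k1val: "(\<integral>w1. k1 w1 \<partial>lborel) = 1 / (g0 x)\<^sup>2 * (\<Sum>(i, j, k)\<in>triples \<kappa>. enn2real (poisson_integral TYPE('n) i j k))"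
    using nn nn_integral_eq_integral[OF ik1] k10 s0 by (simp add: integral_nonneg)
  obtain B where B: "\<And>z. z \<in> K \<Longrightarrow> g1 z \<le> B"
    using compact_imp_bounded[OF compact_continuous_image[OF g1_cont K]] g1_nonneg by (auto simp: bounded_iff)
  have B0: "0 \<le> B" using B[OF xK] g1_nonneg[of x] by linarith
  \<comment> \<open>The blown-up inner integral without its Jacobian; the two Jacobians are restored
    as the square of \<open>n + 1\<close> at the end.\<close>
  define q where "q n w1 = (\<integral>w2. g1 (x + eps n *\<^sub>R w2) * counts \<kappa> n (x + eps n *\<^sub>R w1) (x + eps n *\<^sub>R w2) \<partial>lborel)" for n w1
  have qm [measurable]: "q n \<in> borel_measurable borel" for n unfolding q_def[abs_def] by measurable
  have qlim: "(\<lambda>n. q n w1) \<longlonglongrightarrow> g1 x * k1 w1" for w1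
    unfolding q_def k1_def
  proof (rule blow_up_limit[where G = "\<lambda>w. C * 4 ^ \<kappa> * ?E a w"])
    show "integrable lborel (\<lambda>w :: real ^ 'n. C * 4 ^ \<kappa> * ?E a w)" using iE(1) by simp
    show "\<bar>counts \<kappa> n (x + eps n *\<^sub>R w1) (x + eps n *\<^sub>R w)\<bar> \<le> C * 4 ^ \<kappa> * ?E a w" if "x + eps n *\<^sub>R w \<in> K" for n w
      unfolding abs_of_nonneg[OF counts_nonneg] by (rule one[OF that])
    show "(\<lambda>n. counts \<kappa> n (x + eps n *\<^sub>R w1) (x + eps n *\<^sub>R w)) \<longlonglongrightarrow> ?k w1 w" for w
      by (rule counts_limit)
  qed (use g1_nonneg g1_out g1_cont ik k0 C0 in simp_all)
  have q0: "0 \<le> q n w" for n w unfolding q_def using g1_nonneg counts_nonneg by (simp add: integral_nonneg)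
  have qb: "q n w1 \<le> B * (C * 4 ^ \<kappa>) * (\<integral>w2. ?E a w2 \<partial>lborel) * ?E a w1" if w1: "x + eps n *\<^sub>R w1 \<in> K" for n w1
  proof -
    have "q n w1 \<le> (\<integral>w2. B * (C * 4 ^ \<kappa>) * ?E a w1 * ?E a w2 \<partial>lborel)"
      unfolding q_def
    proof (rule integral_mono')
      show "integrable lborel (\<lambda>w2. B * (C * 4 ^ \<kappa>) * ?E a w1 * ?E a w2)" using iE(1) by simp
      show "g1 (x + eps n *\<^sub>R w2) * counts \<kappa> n (x + eps n *\<^sub>R w1) (x + eps n *\<^sub>R w2) \<le> B * (C * 4 ^ \<kappa>) * ?E a w1 * ?E a w2" for w2
      proof (cases "x + eps n *\<^sub>R w2 \<in> K")
        case True
        have "g1 (x + eps n *\<^sub>R w2) * counts \<kappa> n (x + eps n *\<^sub>R w1) (x + eps n *\<^sub>R w2) \<le> B * (C * 4 ^ \<kappa> * (?E a w1 * ?E a w2))"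
          by (rule mult_mono[OF B[OF True] both[OF w1 True] B0 counts_nonneg])
        then show ?thesis by (simp only: mult.assoc)
      qed (use g1_out B0 C0 in simp)
    qed (use B0 C0 in simp)
    also have "\<dots> = B * (C * 4 ^ \<kappa>) * ?E a w1 * (\<integral>w2. ?E a w2 \<partial>lborel)" by simp
    finally show ?thesis by (simp only: mult_ac)
  qed
  have E0: "0 \<le> (\<integral>w2. ?E a w2 \<partial>lborel)" by (simp add: integral_nonneg)
  have "(\<lambda>n. \<integral>w1. g1 (x + eps n *\<^sub>R w1) * q n w1 \<partial>lborel) \<longlonglongrightarrow> g1 x * (\<integral>w1. g1 x * k1 w1 \<partial>lborel)"
  proof (rule blow_up_limit[where G = "\<lambda>w. B * (C * 4 ^ \<kappa>) * (\<integral>w2. ?E a w2 \<partial>lborel) * ?E a w"])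
    show "integrable lborel (\<lambda>w :: real ^ 'n. B * (C * 4 ^ \<kappa>) * (\<integral>w2. ?E a w2 \<partial>lborel) * ?E a w)" using iE(1) by simp
    show "\<bar>q n w\<bar> \<le> B * (C * 4 ^ \<kappa>) * (\<integral>w2. ?E a w2 \<partial>lborel) * ?E a w" if "x + eps n *\<^sub>R w \<in> K" for n w
      unfolding abs_of_nonneg[OF q0] by (rule qb[OF that])
    show "0 \<le> B * (C * 4 ^ \<kappa>) * (\<integral>w2. ?E a w2 \<partial>lborel) * ?E a w" for w using B0 C0 E0 by simp
  qed (use g1_nonneg g1_out g1_cont ik1 k10 qlim in simp_all)
  moreover have "(\<integral>w1. g1 (x + eps n *\<^sub>R w1) * q n w1 \<partial>lborel)
    = (real (n + 1))\<^sup>2 * (\<integral>z1. g1 z1 * (\<integral>z2. g1 z2 * counts \<kappa> n z1 z2 \<partial>lborel) \<partial>lborel)" for n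
  proof -
    have e: "\<bar>eps n\<bar> ^ DIM(real ^ 'n) = 1 / real (n + 1)" using eps_pos[of n] by (simp add: eps_power)
    have "(\<integral>z1. g1 z1 * (\<integral>z2. g1 z2 * counts \<kappa> n z1 z2 \<partial>lborel) \<partial>lborel)
      = 1 / real (n + 1) * (\<integral>w1. g1 (x + eps n *\<^sub>R w1) * (\<integral>z2. g1 z2 * counts \<kappa> n (x + eps n *\<^sub>R w1) z2 \<partial>lborel) \<partial>lborel)"
      unfolding e[symmetric] using eps_pos[of n] by (intro integral_affine) auto
    also have "(\<lambda>w1. \<integral>z2. g1 z2 * counts \<kappa> n (x + eps n *\<^sub>R w1) z2 \<partial>lborel) = (\<lambda>w1. 1 / real (n + 1) * q n w1)"
      unfolding q_def e[symmetric] using eps_pos[of n] by (intro ext integral_affine) auto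
    finally show ?thesis by (simp add: power2_eq_square)
  qed
  ultimately show ?thesis by (simp add: k1val power2_eq_square mult_ac)
qed

end

end

section \<open>Catchment areas and conditional expectations\<close>

lemma AE_no_tie:
  fixes u v :: "'a::euclidean_space"
  assumes "u \<noteq> v"
  shows "AE z in lborel. norm (u - z) \<noteq> norm (v - z)"
proof -
  have "{z. norm (u - z) = norm (v - z)} \<subseteq> {z. (2 *\<^sub>R (u - v)) \<bullet> z = u \<bullet> u - v \<bullet> v}"
  proof safe
    fix z assume "norm (u - z) = norm (v - z)"
    then have "(u - z) \<bullet> (u - z) = (v - z) \<bullet> (v - z)" by (simp add: norm_eq)
    then show "(2 *\<^sub>R (u - v)) \<bullet> z = u \<bullet> u - v \<bullet> v" by (simp add: inner_diff inner_commute algebra_simps)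
  qed
  moreover have "negligible {z. (2 *\<^sub>R (u - v)) \<bullet> z = u \<bullet> u - v \<bullet> v}" using assms by (intro negligible_hyperplane) simp
  ultimately have "negligible {z. norm (u - z) = norm (v - z)}" by (rule negligible_subset[rotated])
  then have "{z. norm (u - z) = norm (v - z)} \<in> null_sets lborel"
    by (simp add: negligible_iff_null_sets null_sets_completion_iff)
  then show ?thesis by (rule AE_I') auto
qed

lemma AE_inj_on_distance:
  fixes S :: "'a::euclidean_space set"
  assumes "finite S"
  shows "AE z in lborel. inj_on (\<lambda>u. norm (u - z)) S"
proof -
  have "AE z in lborel. \<forall>u\<in>S. \<forall>v\<in>S. norm (u - z) = norm (v - z) \<longrightarrow> u = v"
  proof (intro AE_finite_allI assms)
    show "AE z in lborel. norm (u - z) = norm (v - z) \<longrightarrow> u = v" for u v :: 'a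
      using AE_no_tie[of u v] by (cases "u = v") (auto elim: eventually_mono)
  qed
  then show ?thesis by (simp add: inj_on_def)
qed

text \<open>The rank of \<open>u\<close> among the sample points by distance from \<open>z\<close>;
  the defining condition of the \<open>M\<close>-th neighbour is that it equals
  \<open>M\<close>.\<close>

definition tally :: "nat \<Rightarrow> (nat \<Rightarrow> real ^ 'n) \<Rightarrow> real ^ 'n \<Rightarrow> real ^ 'n \<Rightarrow> nat" where
  "tally n xs z u = (\<Sum>i=1..n. of_bool (norm (xs i - z) \<le> norm (u - z)))"

lemma tally_eq_card: "tally n xs z u = card {i \<in> {1..n}. norm (xs i - z) \<le> norm (u - z)}"
  by (simp add: tally_def of_bool_def sum.If_cases Int_def)

lemma tally_mono: "norm (u - z) \<le> norm (v - z) \<Longrightarrow> tally n xs z u \<le> tally n xs z v"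
  unfolding tally_eq_card by (rule card_mono) auto

lemma tally_strict_mono:
  assumes "v \<in> xs ` {1..n}" "norm (u - z) < norm (v - z)"
  shows "tally n xs z u < tally n xs z v"
  unfolding tally_eq_card
proof (rule psubset_card_mono)
  obtain i where "i \<in> {1..n}" "v = xs i" using assms(1) by blast
  then have "i \<in> {i \<in> {1..n}. norm (xs i - z) \<le> norm (v - z)} - {i \<in> {1..n}. norm (xs i - z) \<le> norm (u - z)}"
    using assms(2) by simp
  moreover have "{i \<in> {1..n}. norm (xs i - z) \<le> norm (u - z)} \<subseteq> {i \<in> {1..n}. norm (xs i - z) \<le> norm (v - z)}"
    using assms(2) by auto
  ultimately show "{i \<in> {1..n}. norm (xs i - z) \<le> norm (u - z)} \<subset> {i \<in> {1..n}. norm (xs i - z) \<le> norm (v - z)}"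
    by blast
qed simp

lemma tally_inj:
  assumes "u \<in> xs ` {1..n}" "v \<in> xs ` {1..n}" "tally n xs z u = tally n xs z v"
  shows "norm (u - z) = norm (v - z)"
  using tally_strict_mono[OF assms(1), of v z] tally_strict_mono[OF assms(2), of u z] assms(3) by linarith

lemma borel_measurable_tally [measurable]:
  assumes [measurable]: "\<And>i. i \<in> {1..n} \<Longrightarrow> f i \<in> borel_measurable N" "g \<in> borel_measurable N" "h \<in> borel_measurable N"
  shows "(\<lambda>\<omega>. tally n (\<lambda>i. f i \<omega>) (g \<omega>) (h \<omega>)) \<in> measurable N (count_space UNIV)"
  unfolding tally_eq_card by (rule measurable_card) auto

text \<open>The description operator depends on \<open>z\<close> only through the set
  \<open>S\<close> of sample points of rank \<open>M\<close>. There are finitely many such sets, and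
  for each of them the described point is constant.\<close>

lemma catchment_area_borel [measurable]: "catchment_area M n xs x \<in> sets borel"
proof -
  let ?t = "\<lambda>S. THE u. u \<in> S"
  have nn: "nearest_neighbor M n xs z = ?t {u \<in> xs ` {1..n}. tally n xs z u = M}" for z
    by (simp add: nearest_neighbor_def tally_def)
  have "catchment_area M n xs x = (\<Union>S\<in>Pow (xs ` {1..n}).
      {z \<in> space borel. \<forall>u\<in>xs ` {1..n}. (tally n xs z u = M) = (u \<in> S)} \<inter> {z. norm (z - x) \<le> norm (?t S - z)})" (is "?L = ?R")
  proof (rule set_eqI)
    fix z
    let ?S = "{u \<in> xs ` {1..n}. tally n xs z u = M}"
    have "z \<in> ?R \<longleftrightarrow> norm (z - x) \<le> norm (?t ?S - z)"
    proof
      assume "z \<in> ?R"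
      then obtain S where S: "S \<subseteq> xs ` {1..n}" "\<forall>u\<in>xs ` {1..n}. (tally n xs z u = M) = (u \<in> S)" "norm (z - x) \<le> norm (?t S - z)" by blast
      then have "S = ?S" by blast
      then show "norm (z - x) \<le> norm (?t ?S - z)" using S(3) by simp
    next
      assume "norm (z - x) \<le> norm (?t ?S - z)"
      then show "z \<in> ?R" by (intro UN_I[of ?S]) auto
    qed
    then show "z \<in> ?L \<longleftrightarrow> z \<in> ?R" by (simp add: catchment_area_def nn)
  qed
  moreover have "?R \<in> sets borel"
  proof (intro sets.finite_UN sets.Int)
    fix S
    show "{z \<in> space borel. \<forall>u\<in>xs ` {1..n}. (tally n xs z u = M) = (u \<in> S)} \<in> sets borel"
      by (rule sets.sets_Collect_finite_All) (auto intro!: measurable_sets_Collect pred_intros_logic)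
    show "{z. norm (z - x) \<le> norm (?t S - z)} \<in> sets borel" by measurable
  qed auto
  ultimately show ?thesis by simp
qed

text \<open>A measurable substitute for the catchment area: where no or several sample points have rank \<open>M\<close>
  the description operator in \<open>nearest_neighbor\<close> takes unspecified values.\<close>
definition in_catchment :: "nat \<Rightarrow> nat \<Rightarrow> (nat \<Rightarrow> real ^ 'n) \<Rightarrow> real ^ 'n \<Rightarrow> real ^ 'n \<Rightarrow> bool" where
  "in_catchment M n xs x z \<longleftrightarrow>
    (\<exists>i\<in>{1..n}. tally n xs z (xs i) = M \<and> norm (z - x) \<le> norm (xs i - z)) \<or>
    ((\<forall>i\<in>{1..n}. tally n xs z (xs i) \<noteq> M) \<and> norm (z - x) \<le> norm ((THE u. False) - z))"

text \<open>Off the bisecting hyperplanes rank \<open>M\<close> is attained by at most one point,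
  which the description then denotes. If it is attained by none, both sides refer to the same
  unspecified point.\<close>

lemma AE_catchment_area: "AE z in lborel. z \<in> catchment_area M n xs x \<longleftrightarrow> in_catchment M n xs x z"
proof -
  have "AE z in lborel. inj_on (\<lambda>u. norm (u - z)) (xs ` {1..n})" by (rule AE_inj_on_distance) simp
  then show ?thesis
  proof eventually_elim
    case (elim z)
    have nn: "nearest_neighbor M n xs z = (THE u. u \<in> xs ` {1..n} \<and> tally n xs z u = M)"
      by (simp add: nearest_neighbor_def tally_def)
    show ?case
    proof (cases "\<exists>i\<in>{1..n}. tally n xs z (xs i) = M")
      case True
      then obtain i where i: "i \<in> {1..n}" "tally n xs z (xs i) = M" by blast
      have uniq: "xs j = xs i" if "j \<in> {1..n}" "tally n xs z (xs j) = M" for j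
        using tally_inj[of "xs j" xs n "xs i" z] inj_onD[OF elim, of "xs j" "xs i"] i that by simp
      have "nearest_neighbor M n xs z = xs i"
        unfolding nn
      proof (rule the_equality)
        show "xs i \<in> xs ` {1..n} \<and> tally n xs z (xs i) = M" using i by blast
        show "u = xs i" if "u \<in> xs ` {1..n} \<and> tally n xs z u = M" for u using that uniq by blast
      qed
      moreover have "in_catchment M n xs x z \<longleftrightarrow> norm (z - x) \<le> norm (xs i - z)"
        unfolding in_catchment_def using i uniq by metis
      ultimately show ?thesis by (simp only: catchment_area_def mem_Collect_eq)
    next
      case False
      then have "nearest_neighbor M n xs z = (THE u. False)" unfolding nn by (intro arg_cong[where f = The]) auto
      moreover have "in_catchment M n xs x z \<longleftrightarrow> norm (z - x) \<le> norm ((THE u. False) - z)"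
        unfolding in_catchment_def using False by blast
      ultimately show ?thesis by (simp only: catchment_area_def mem_Collect_eq)
    qed
  qed
qed

text \<open>Without ties the rank is injective from \<open>I\<close> into
  \<open>{1..card I}\<close>, hence onto.\<close>

lemma exists_rank:
  fixes r :: "'i \<Rightarrow> 'b::linorder"
  assumes I: "finite I" "inj_on r I" and M: "1 \<le> M" "M \<le> card I"
  shows "\<exists>i\<in>I. card {j \<in> I. r j \<le> r i} = M"
proof -
  let ?c = "\<lambda>i. card {j \<in> I. r j \<le> r i}"
  have mono: "?c i < ?c j" if "j \<in> I" "r i < r j" for i j
  proof (rule psubset_card_mono)
    have "j \<in> {k \<in> I. r k \<le> r j} - {k \<in> I. r k \<le> r i}" using that by simp
    moreover have "{k \<in> I. r k \<le> r i} \<subseteq> {k \<in> I. r k \<le> r j}" using that(2) by auto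
    ultimately show "{k \<in> I. r k \<le> r i} \<subset> {k \<in> I. r k \<le> r j}" by blast
  qed (use I in simp)
  have "inj_on ?c I"
  proof (rule inj_onI)
    fix i j assume ij: "i \<in> I" "j \<in> I" "?c i = ?c j"
    then have "r i = r j" using mono[of i j] mono[of j i] by (metis less_irrefl linorder_neqE)
    then show "i = j" using I ij by (auto dest: inj_onD)
  qed
  then have "card (?c ` I) = card I" by (rule card_image)
  moreover have "?c ` I \<subseteq> {1..card I}"
  proof safe
    fix i assume i: "i \<in> I"
    have "card {i} \<le> ?c i" using I i by (intro card_mono) auto
    moreover have "?c i \<le> card I" using I by (intro card_mono) auto
    ultimately show "?c i \<in> {1..card I}" by simp
  qed
  ultimately have "?c ` I = {1..card I}" by (intro card_subset_eq) auto
  then have "M \<in> ?c ` I" using M by simp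
  then show ?thesis by auto
qed

text \<open>The point \<open>xs 1\<close> is no farther from \<open>z\<close> than the
  \<open>M\<close>-th neighbour iff its own rank is at most \<open>M\<close>.\<close>

lemma in_catchment_iff:
  assumes xs: "inj_on xs {1..n}" "inj_on (\<lambda>u. norm (u - z)) (xs ` {1..n})" and M: "1 \<le> M" "M \<le> n"
  shows "in_catchment M n xs (xs 1) z \<longleftrightarrow> card {l \<in> {2..n}. xs l \<in> ball_through (xs 1) z} \<le> M - 1"
proof -
  have 1: "1 \<in> {1..n}" using M by simp
  have "\<exists>i\<in>{1..n}. tally n xs z (xs i) = M"
    unfolding tally_eq_card using comp_inj_on[OF xs] M by (intro exists_rank) (auto simp: comp_def)
  then obtain i where i: "i \<in> {1..n}" "tally n xs z (xs i) = M" by blast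
  have le: "norm (z - xs 1) \<le> norm (xs j - z) \<longleftrightarrow> tally n xs z (xs 1) \<le> M" if "j \<in> {1..n}" "tally n xs z (xs j) = M" for j
    using tally_mono[of "xs 1" z "xs j" n xs] tally_strict_mono[of "xs 1" xs n "xs j" z] 1 that
    by (auto simp: norm_minus_commute not_le[symmetric])
  have "in_catchment M n xs (xs 1) z \<longleftrightarrow> tally n xs z (xs 1) \<le> M"
    unfolding in_catchment_def using i le by blast
  \<comment> \<open>The rank counts the point itself; removing it turns \<open>M\<close> into
    \<open>M - 1\<close>.\<close>
  also have "{l \<in> {1..n}. norm (xs l - z) \<le> norm (xs 1 - z)} = insert 1 {l \<in> {2..n}. xs l \<in> ball_through (xs 1) z}"
  proof (rule set_eqI)
    fix l
    have "l \<in> {1..n} \<longleftrightarrow> l = 1 \<or> l \<in> {2..n}" using 1 by auto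
    then show "l \<in> {l \<in> {1..n}. norm (xs l - z) \<le> norm (xs 1 - z)} \<longleftrightarrow> l \<in> insert 1 {l \<in> {2..n}. xs l \<in> ball_through (xs 1) z}"
      by (auto simp: ball_through_def dist_norm norm_minus_commute)
  qed
  then have "tally n xs z (xs 1) = Suc (card {l \<in> {2..n}. xs l \<in> ball_through (xs 1) z})"
    unfolding tally_eq_card by simp
  finally show ?thesis using M by (simp add: Suc_le_eq) linarith
qed

text \<open>Given \<open>Z\<close>, an independent \<open>W\<close> keeps its law, so the conditional expectation is an integral over \<open>W\<close>.\<close>
lemma (in prob_space) cond_exp_given_indep:
  fixes Z :: "'a \<Rightarrow> real ^ 'n"
  assumes [measurable]: "random_variable borel Z" "random_variable T W"
    and law: "distr M borel Z \<Otimes>\<^sub>M distr M T W = distr M (borel \<Otimes>\<^sub>M T) (\<lambda>\<omega>. (Z \<omega>, W \<omega>))"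
    and \<phi> [measurable]: "\<phi> \<in> borel_measurable (borel \<Otimes>\<^sub>M T)" and bound: "\<And>p. \<bar>\<phi> p\<bar> \<le> B"
    and Y [measurable]: "Y \<in> borel_measurable M" and YW: "AE \<omega> in M. Y \<omega> = \<phi> (Z \<omega>, W \<omega>)"
    and h: "cond_exp_given M Z Y h"
  shows "AE x in distr M borel Z. h x = (\<integral>w. \<phi> (x, w) \<partial>distr M T W)"
proof -
  interpret Z: prob_space "distr M borel Z" by (rule prob_space_distr) simp
  interpret W: prob_space "distr M T W" by (rule prob_space_distr) simp
  interpret ZW: pair_prob_space "distr M borel Z" "distr M T W" ..
  define F where "F = vimage_algebra (space M) Z borel"
  have sub: "subalgebra M F" unfolding F_def subalgebra_def by (intro conjI sets_image_in_sets) simp_all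
  interpret finite_measure_subalgebra M F by unfold_locales (rule sub)
  have ZF [measurable]: "Z \<in> F \<rightarrow>\<^sub>M borel" unfolding F_def by (rule measurable_vimage_algebra1) simp
  define H where "H x = (\<integral>w. \<phi> (x, w) \<partial>distr M T W)" for x
  have Hm [measurable]: "H \<in> borel_measurable borel" unfolding H_def[abs_def]
    by (rule W.borel_measurable_lebesgue_integral) (simp add: case_prod_eta)
  have B0: "0 \<le> B" using bound[of undefined] by linarith
  have Hb: "\<bar>H x\<bar> \<le> B" for x
  proof -
    have [measurable]: "(\<lambda>w. \<phi> (x, w)) \<in> borel_measurable T" by measurable
    have i: "integrable (distr M T W) (\<lambda>w. \<phi> (x, w))" by (rule W.integrable_const_bound[where B = B]) (use bound in simp_all)
    have "\<bar>H x\<bar> \<le> (\<integral>w. \<bar>\<phi> (x, w)\<bar> \<partial>distr M T W)" unfolding H_def by (rule integral_abs_bound)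
    also have "\<dots> \<le> (\<integral>w. B \<partial>distr M T W)" using i bound by (intro integral_mono) auto
    finally show ?thesis using W.prob_space by simp
  qed
  have Yi: "integrable M Y"
  proof (rule integrable_const_bound[where B = B])
    show "AE \<omega> in M. norm (Y \<omega>) \<le> B" using YW by eventually_elim (simp add: bound)
  qed simp
  have HZi: "integrable M (\<lambda>\<omega>. H (Z \<omega>))" by (rule integrable_const_bound[where B = B]) (use Hb in simp_all)
  \<comment> \<open>Every set of \<open>F\<close> is the preimage of a Borel set \<open>C\<close>
    under \<open>Z\<close>; transported to the product law, the defining integral identity becomes
    Fubini.\<close>
  have "AE \<omega> in M. real_cond_exp M F Y \<omega> = H (Z \<omega>)"
  proof (rule real_cond_exp_charact[OF _ Yi HZi])
    show "(\<lambda>\<omega>. H (Z \<omega>)) \<in> borel_measurable F" by measurable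
    fix A assume "A \<in> sets F"
    then obtain C where C [measurable]: "C \<in> sets borel" and A: "A = Z -` C \<inter> space M"
      unfolding F_def by (auto simp: sets_vimage_algebra2)
    have [measurable]: "A \<in> sets M" unfolding A by measurable
    have "(\<integral>\<omega>\<in>A. Y \<omega> \<partial>M) = (\<integral>\<omega>. indicator C (Z \<omega>) * \<phi> (Z \<omega>, W \<omega>) \<partial>M)"
      unfolding set_lebesgue_integral_def
    proof (rule integral_cong_AE)
      show "AE \<omega> in M. indicat_real A \<omega> *\<^sub>R Y \<omega> = indicator C (Z \<omega>) * \<phi> (Z \<omega>, W \<omega>)"
        using YW AE_space by eventually_elim (simp add: A indicator_def)
    qed measurable
    also have "\<dots> = (\<integral>p. indicator C (fst p) * \<phi> p \<partial>distr M (borel \<Otimes>\<^sub>M T) (\<lambda>\<omega>. (Z \<omega>, W \<omega>)))"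
      by (subst integral_distr) auto
    also have "\<dots> = (\<integral>p. indicator C (fst p) * \<phi> p \<partial>(distr M borel Z \<Otimes>\<^sub>M distr M T W))" unfolding law ..
    also have "\<dots> = (\<integral>x. (\<integral>w. indicator C (fst (x, w)) * \<phi> (x, w) \<partial>distr M T W) \<partial>distr M borel Z)"
    proof (rule ZW.integral_fst'[symmetric], rule ZW.P.integrable_const_bound[where B = B])
      show "AE p in distr M borel Z \<Otimes>\<^sub>M distr M T W. norm (indicator C (fst p) * \<phi> p) \<le> B"
        using bound B0 by (auto simp: indicator_def)
      show "(\<lambda>p. indicator C (fst p) * \<phi> p) \<in> borel_measurable (distr M borel Z \<Otimes>\<^sub>M distr M T W)" unfolding law by simp
    qed
    also have "\<dots> = (\<integral>x. indicator C x * H x \<partial>distr M borel Z)" by (simp add: H_def)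
    also have "\<dots> = (\<integral>\<omega>. indicator C (Z \<omega>) * H (Z \<omega>) \<partial>M)" by (rule integral_distr) auto
    also have "\<dots> = (\<integral>\<omega>\<in>A. H (Z \<omega>) \<partial>M)"
      unfolding set_lebesgue_integral_def by (rule Bochner_Integration.integral_cong) (auto simp: A indicator_def)
    finally show "(\<integral>\<omega>\<in>A. Y \<omega> \<partial>M) = (\<integral>\<omega>\<in>A. H (Z \<omega>) \<partial>M)" .
  qed
  moreover have "AE \<omega> in M. real_cond_exp M F Y \<omega> = h (Z \<omega>)"
    using h by (simp add: cond_exp_given_def F_def)
  ultimately have "AE \<omega> in M. h (Z \<omega>) = H (Z \<omega>)" by eventually_elim simp
  moreover have [measurable]: "h \<in> borel_measurable borel" using h by (simp add: cond_exp_given_def)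
  ultimately show ?thesis unfolding H_def[symmetric] by (subst AE_distr_iff) auto
qed

lemma (in pair_prob_space) integral_measure_section:
  assumes Q: "{p \<in> space (M1 \<Otimes>\<^sub>M M2). Q (fst p) (snd p)} \<in> sets (M1 \<Otimes>\<^sub>M M2)"
  shows "(\<integral>x. measure M2 {y \<in> space M2. Q x y} \<partial>M1) = (\<integral>y. measure M1 {x \<in> space M1. Q x y} \<partial>M2)"
proof -
  let ?S = "{p \<in> space (M1 \<Otimes>\<^sub>M M2). Q (fst p) (snd p)}"
  have i: "integrable (M1 \<Otimes>\<^sub>M M2) (case_prod (\<lambda>x y. indicator ?S (x, y) :: real))"
    using Q by (simp add: P.emeasure_eq_measure)
  have "(\<integral>x. measure M2 {y \<in> space M2. Q x y} \<partial>M1) = (\<integral>x. (\<integral>y. indicator ?S (x, y) \<partial>M2) \<partial>M1)"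
  proof (rule Bochner_Integration.integral_cong[OF refl])
    fix x assume x: "x \<in> space M1"
    have s: "{y \<in> space M2. Q x y} = Pair x -` ?S" using x by (auto simp: space_pair_measure)
    have "{y \<in> space M2. Q x y} \<in> sets M2" unfolding s by (rule sets_Pair1[OF Q])
    moreover have "(\<integral>y. indicator ?S (x, y) \<partial>M2) = (\<integral>y. indicat_real {y \<in> space M2. Q x y} y \<partial>M2)"
      using x by (intro Bochner_Integration.integral_cong) (auto simp: space_pair_measure indicator_def)
    ultimately show "measure M2 {y \<in> space M2. Q x y} = (\<integral>y. indicator ?S (x, y) \<partial>M2)" by simp
  qed
  also have "\<dots> = (\<integral>y. (\<integral>x. indicator ?S (x, y) \<partial>M1) \<partial>M2)" by (rule Fubini_integral[OF i, symmetric])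
  also have "\<dots> = (\<integral>y. measure M1 {x \<in> space M1. Q x y} \<partial>M2)"
  proof (rule Bochner_Integration.integral_cong[OF refl])
    fix y assume y: "y \<in> space M2"
    have s: "{x \<in> space M1. Q x y} = (\<lambda>x. (x, y)) -` ?S" using y by (auto simp: space_pair_measure)
    have "{x \<in> space M1. Q x y} \<in> sets M1" unfolding s by (rule sets_Pair2[OF Q])
    moreover have "(\<integral>x. indicator ?S (x, y) \<partial>M1) = (\<integral>x. indicat_real {x \<in> space M1. Q x y} x \<partial>M1)"
      using y by (intro Bochner_Integration.integral_cong) (auto simp: space_pair_measure indicator_def)
    ultimately show "(\<integral>x. indicator ?S (x, y) \<partial>M1) = measure M1 {x \<in> space M1. Q x y}" by simp
  qed
  finally show ?thesis .
qed

lemma sets_in_catchment: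
  assumes f: "\<And>i. i \<in> {1..n} \<Longrightarrow> f i \<in> borel_measurable N" and [measurable]: "g \<in> borel_measurable N" "h \<in> borel_measurable N"
  shows "{\<omega> \<in> space N. in_catchment m n (\<lambda>i. f i \<omega>) (g \<omega>) (h \<omega>)} \<in> sets N"
proof -
  have t: "(\<lambda>\<omega>. tally n (\<lambda>i. f i \<omega>) (h \<omega>) (f i \<omega>)) \<in> measurable N (count_space UNIV)" if "i \<in> {1..n}" for i
    by (intro borel_measurable_tally f that assms)
  have e: "{\<omega> \<in> space N. tally n (\<lambda>i. f i \<omega>) (h \<omega>) (f i \<omega>) = m} \<in> sets N" if "i \<in> {1..n}" for i
    using measurable_sets[OF t[OF that], of "{m}"] by (simp add: vimage_def Int_def conj_commute)
  have le: "{\<omega> \<in> space N. norm (h \<omega> - g \<omega>) \<le> norm (f i \<omega> - h \<omega>)} \<in> sets N" if "i \<in> {1..n}" for i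
  proof -
    note [measurable] = f[OF that]
    show ?thesis by measurable
  qed
  have le0: "{\<omega> \<in> space N. norm (h \<omega> - g \<omega>) \<le> norm ((THE u. False) - h \<omega>)} \<in> sets N" by measurable
  show ?thesis
    unfolding in_catchment_def
    by (intro sets.sets_Collect_disj sets.sets_Collect_conj sets.sets_Collect_finite_Ex sets.sets_Collect_finite_All
        sets.sets_Collect_neg e le le0) auto
qed

lemma in_catchment_borel: "{z. in_catchment m n xs x z} \<in> sets borel"
proof -
  have "{z \<in> space borel. in_catchment m n (\<lambda>i. xs i) x z} \<in> sets borel"
    by (rule sets_in_catchment) measurable
  then show ?thesis by (simp only: space_borel UNIV_I simp_thms)
qed

lemma sets_few_points:
  fixes f g :: "'x \<Rightarrow> real ^ 'n"
  assumes I: "finite (I :: nat set)" and y: "\<And>l. l \<in> I \<Longrightarrow> y l \<in> borel_measurable N"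
    and [measurable]: "f \<in> borel_measurable N" "g \<in> borel_measurable N"
  shows "{\<omega> \<in> space N. card {l \<in> I. y l \<omega> \<in> ball_through (f \<omega>) (g \<omega>)} \<le> \<kappa>} \<in> sets N"
proof -
  have "{\<omega> \<in> space N. l \<in> {l \<in> I. y l \<omega> \<in> ball_through (f \<omega>) (g \<omega>)}} \<in> sets N" for l
  proof (cases "l \<in> I")
    case True
    note [measurable] = y[OF True]
    have "{\<omega> \<in> space N. dist (g \<omega>) (y l \<omega>) \<le> norm (g \<omega> - f \<omega>)} \<in> sets N" by measurable
    then show ?thesis using True by (simp add: ball_through_def)
  qed simp
  then have [measurable]: "(\<lambda>\<omega>. card {l \<in> I. y l \<omega> \<in> ball_through (f \<omega>) (g \<omega>)}) \<in> measurable N (count_space UNIV)"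
    by (rule measurable_card)
  show ?thesis by measurable
qed

lemma few_points_borel:
  fixes x :: "real ^ 'n"
  assumes "finite (I :: nat set)"
  shows "{z. card {l \<in> I. y l \<in> ball_through x z} \<le> \<kappa>} \<in> sets borel"
proof -
  have "{z \<in> space borel. card {l \<in> I. y l \<in> ball_through x z} \<le> \<kappa>} \<in> sets borel"
    by (rule sets_few_points[OF assms]) measurable
  then show ?thesis by (simp only: space_borel UNIV_I simp_thms)
qed

text \<open>Fubini: the mean measure of a random set is the integral over \<open>z\<close> of the
  probability that \<open>z\<close> belongs to it, and the mean square is the same for pairs of
  points.\<close>

lemma
  fixes x :: "real ^ 'n"
  assumes \<nu>: "prob_space \<nu>" "sets \<nu> = sets borel" and I: "finite I"
    and g [measurable]: "g \<in> borel_measurable borel" and g0: "\<And>z. 0 \<le> g z" and prob: "prob_space (density lborel (\<lambda>z. ennreal (g z)))"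
  shows expectation_few_points:
      "(\<integral>y. measure (density lborel (\<lambda>z. ennreal (g z))) {z. card {l \<in> I. y l \<in> ball_through x z} \<le> \<kappa>} \<partial>Pi\<^sub>M I (\<lambda>_. \<nu>))
        = (\<integral>z. g z * low_counts \<nu> I \<kappa> (ball_through x z) (ball_through x z) \<partial>lborel)" (is ?E1)
    and expectation_few_points_square:
      "(\<integral>y. (measure (density lborel (\<lambda>z. ennreal (g z))) {z. card {l \<in> I. y l \<in> ball_through x z} \<le> \<kappa>})\<^sup>2 \<partial>Pi\<^sub>M I (\<lambda>_. \<nu>))
        = (\<integral>z1. g z1 * (\<integral>z2. g z2 * low_counts \<nu> I \<kappa> (ball_through x z2) (ball_through x z1) \<partial>lborel) \<partial>lborel)" (is ?E2)
proof -
  let ?\<mu> = "density lborel (\<lambda>z. ennreal (g z))"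
  note [measurable_cong] = \<nu>(2)
  interpret Pi: prob_space "Pi\<^sub>M I (\<lambda>_. \<nu>)" by (rule prob_space_PiM) (rule \<nu>)
  interpret G: prob_space ?\<mu> by (rule prob)
  interpret G2: pair_prob_space ?\<mu> ?\<mu> ..
  interpret A: pair_prob_space "Pi\<^sub>M I (\<lambda>_. \<nu>)" ?\<mu> ..
  interpret B: pair_prob_space "Pi\<^sub>M I (\<lambda>_. \<nu>)" "?\<mu> \<Otimes>\<^sub>M ?\<mu>" ..
  note few = few_points_borel[OF I]
  have L: "(\<lambda>z. low_counts \<nu> I \<kappa> (ball_through x (f z)) (ball_through x (h z))) \<in> borel_measurable N"
    if "f \<in> borel_measurable N" "h \<in> borel_measurable N" for f h and N :: "'x measure"
    by (rule borel_measurable_low_counts[OF \<nu> I that])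
  note [measurable (raw)] = L
  have Q1: "{p \<in> space (Pi\<^sub>M I (\<lambda>_. \<nu>) \<Otimes>\<^sub>M ?\<mu>). card {l \<in> I. fst p l \<in> ball_through x (snd p)} \<le> \<kappa>} \<in> sets (Pi\<^sub>M I (\<lambda>_. \<nu>) \<Otimes>\<^sub>M ?\<mu>)"
    by (rule sets_few_points[OF I]) measurable
  show ?E1
  proof -
    have "(\<integral>y. measure ?\<mu> {z. card {l \<in> I. y l \<in> ball_through x z} \<le> \<kappa>} \<partial>Pi\<^sub>M I (\<lambda>_. \<nu>))
      = (\<integral>z. low_counts \<nu> I \<kappa> (ball_through x z) (ball_through x z) \<partial>?\<mu>)"
      using A.integral_measure_section[OF Q1] by (simp add: low_counts_def)
    also have "\<dots> = (\<integral>z. g z *\<^sub>R low_counts \<nu> I \<kappa> (ball_through x z) (ball_through x z) \<partial>lborel)"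
      by (rule integral_density) (use g0 in auto)
    finally show ?thesis by simp
  qed
  have Q2: "{p \<in> space (Pi\<^sub>M I (\<lambda>_. \<nu>) \<Otimes>\<^sub>M (?\<mu> \<Otimes>\<^sub>M ?\<mu>)). card {l \<in> I. fst p l \<in> ball_through x (snd (snd p))} \<le> \<kappa> \<and>
      card {l \<in> I. fst p l \<in> ball_through x (fst (snd p))} \<le> \<kappa>} \<in> sets (Pi\<^sub>M I (\<lambda>_. \<nu>) \<Otimes>\<^sub>M (?\<mu> \<Otimes>\<^sub>M ?\<mu>))"
    by (intro sets.sets_Collect_conj sets_few_points[OF I]) measurable
  show ?E2
  proof -
    \<comment> \<open>A squared measure is the product measure of a square, so the second moment is
      handled like the first.\<close>
    have sq: "(measure ?\<mu> {z. card {l \<in> I. y l \<in> ball_through x z} \<le> \<kappa>})\<^sup>2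
      = measure (?\<mu> \<Otimes>\<^sub>M ?\<mu>) {z \<in> space (?\<mu> \<Otimes>\<^sub>M ?\<mu>). card {l \<in> I. y l \<in> ball_through x (snd z)} \<le> \<kappa> \<and> card {l \<in> I. y l \<in> ball_through x (fst z)} \<le> \<kappa>}" for y
    proof -
      let ?S = "{z. card {l \<in> I. y l \<in> ball_through x z} \<le> \<kappa>}"
      have "{z \<in> space (?\<mu> \<Otimes>\<^sub>M ?\<mu>). card {l \<in> I. y l \<in> ball_through x (snd z)} \<le> \<kappa> \<and> card {l \<in> I. y l \<in> ball_through x (fst z)} \<le> \<kappa>} = ?S \<times> ?S"
        by (auto simp: space_pair_measure)
      moreover have "measure (?\<mu> \<Otimes>\<^sub>M ?\<mu>) (?S \<times> ?S) = measure ?\<mu> ?S * measure ?\<mu> ?S"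
      proof -
        have S: "?S \<in> sets ?\<mu>" by (simp only: sets_density sets_lborel few)
        show ?thesis by (simp only: measure_def G.emeasure_pair_measure_Times[OF S S] enn2real_mult)
      qed
      ultimately show ?thesis by (simp add: power2_eq_square)
    qed
    have "(\<integral>y. (measure ?\<mu> {z. card {l \<in> I. y l \<in> ball_through x z} \<le> \<kappa>})\<^sup>2 \<partial>Pi\<^sub>M I (\<lambda>_. \<nu>))
      = (\<integral>z. low_counts \<nu> I \<kappa> (ball_through x (snd z)) (ball_through x (fst z)) \<partial>(?\<mu> \<Otimes>\<^sub>M ?\<mu>))"
      unfolding sq low_counts_def by (rule B.integral_measure_section[OF Q2])
    also have "\<dots> = (\<integral>z1. (\<integral>z2. low_counts \<nu> I \<kappa> (ball_through x (snd (z1, z2))) (ball_through x (fst (z1, z2))) \<partial>?\<mu>) \<partial>?\<mu>)"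
    proof (rule G2.integral_fst'[symmetric], rule G2.P.integrable_const_bound[where B = 1])
      show "AE z in ?\<mu> \<Otimes>\<^sub>M ?\<mu>. norm (low_counts \<nu> I \<kappa> (ball_through x (snd z)) (ball_through x (fst z))) \<le> 1"
        by (simp add: low_counts_def)
    qed measurable
    also have "\<dots> = (\<integral>z1. (\<integral>z2. g z2 *\<^sub>R low_counts \<nu> I \<kappa> (ball_through x z2) (ball_through x z1) \<partial>lborel) \<partial>?\<mu>)"
      by (rule Bochner_Integration.integral_cong[OF refl], simp only: fst_conv snd_conv, rule integral_density) (use g0 in auto)
    also have "\<dots> = (\<integral>z1. g z1 *\<^sub>R (\<integral>z2. g z2 *\<^sub>R low_counts \<nu> I \<kappa> (ball_through x z2) (ball_through x z1) \<partial>lborel) \<partial>lborel)"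
      by (rule integral_density) (use g0 in auto)
    finally show ?thesis by simp
  qed
qed

section \<open>Independent samples and their conditional moments\<close>

context prob_space
begin

context
  fixes X :: "nat \<Rightarrow> 'a \<Rightarrow> real ^ 'n" and f0 :: "real ^ 'n \<Rightarrow> real" and \<nu>0
  assumes indep: "indep_vars (\<lambda>_. borel) X {1..}" and law: "\<And>i. 1 \<le> i \<Longrightarrow> distr M borel (X i) = \<nu>0"
    and \<nu>0: "\<nu>0 = density lborel (\<lambda>z. ennreal (f0 z))" and f0 [measurable]: "f0 \<in> borel_measurable borel"
begin

lemma measurable_sample: "1 \<le> i \<Longrightarrow> random_variable borel (X i)"
  using indep by (auto simp: indep_vars_def)

text \<open>Independence of blocks of indices concerns tuples, so \<open>X 1\<close> is first
  treated as a tuple over \<open>{1}\<close> and then recovered by projecting both laws.\<close>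

lemma joint_law_sample:
  "distr M borel (X 1) \<Otimes>\<^sub>M distr M (Pi\<^sub>M {2..n} (\<lambda>_. borel)) (\<lambda>\<omega>. restrict (\<lambda>i. X i \<omega>) {2..n})
    = distr M (borel \<Otimes>\<^sub>M Pi\<^sub>M {2..n} (\<lambda>_. borel)) (\<lambda>\<omega>. (X 1 \<omega>, restrict (\<lambda>i. X i \<omega>) {2..n}))"
proof -
  let ?R = "\<lambda>I \<omega>. restrict (\<lambda>i. X i \<omega>) I" and ?P = "\<lambda>I. Pi\<^sub>M I (\<lambda>_. borel) :: (nat \<Rightarrow> real ^ 'n) measure"
  have iv: "indep_var (?P {1}) (?R {1}) (?P {2..n}) (?R {2..n})" by (rule indep_var_restrict[OF indep]) auto
  then have [measurable]: "random_variable (?P {1}) (?R {1})" "random_variable (?P {2..n}) (?R {2..n})"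
    and joint: "distr M (?P {1}) (?R {1}) \<Otimes>\<^sub>M distr M (?P {2..n}) (?R {2..n}) = distr M (?P {1} \<Otimes>\<^sub>M ?P {2..n}) (\<lambda>\<omega>. (?R {1} \<omega>, ?R {2..n} \<omega>))"
    unfolding indep_var_distribution_eq by auto
  have [measurable]: "(\<lambda>f. f 1) \<in> measurable (?P {1}) borel" by (rule measurable_component_singleton) simp
  interpret W: prob_space "distr M (?P {2..n}) (?R {2..n})" by (rule prob_space_distr) simp
  have 1: "distr M borel (X 1) = distr (distr M (?P {1}) (?R {1})) borel (\<lambda>f. f 1)"
    by (subst distr_distr) (auto simp: comp_def simp del: One_nat_def)
  have 2: "distr M (?P {2..n}) (?R {2..n}) = distr (distr M (?P {2..n}) (?R {2..n})) (?P {2..n}) (\<lambda>f. f)"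
    by (subst distr_distr) (auto simp: comp_def)
  have "distr M borel (X 1) \<Otimes>\<^sub>M distr M (?P {2..n}) (?R {2..n})
    = distr (distr M (?P {1}) (?R {1})) borel (\<lambda>f. f 1) \<Otimes>\<^sub>M distr (distr M (?P {2..n}) (?R {2..n})) (?P {2..n}) (\<lambda>f. f)"
    unfolding 1 2[symmetric] ..
  also have "\<dots> = distr (distr M (?P {1}) (?R {1}) \<Otimes>\<^sub>M distr M (?P {2..n}) (?R {2..n})) (borel \<Otimes>\<^sub>M ?P {2..n}) (\<lambda>(f, g). (f 1, g))"
    by (rule pair_measure_distr) (simp_all add: 2[symmetric] W.sigma_finite_measure_axioms)
  also have "\<dots> = distr M (borel \<Otimes>\<^sub>M ?P {2..n}) (\<lambda>\<omega>. (X 1 \<omega>, ?R {2..n} \<omega>))"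
    unfolding joint by (subst distr_distr) (auto simp: comp_def simp del: One_nat_def)
  finally show ?thesis .
qed

lemma law_sample: "2 \<le> n \<Longrightarrow> distr M (Pi\<^sub>M {2..n} (\<lambda>_. borel)) (\<lambda>\<omega>. restrict (\<lambda>i. X i \<omega>) {2..n}) = Pi\<^sub>M {2..n} (\<lambda>_. \<nu>0)"
proof -
  assume n: "2 \<le> n"
  have "indep_vars (\<lambda>_. borel) X {2..n}" by (rule indep_vars_subset[OF indep]) auto
  then have "distr M (Pi\<^sub>M {2..n} (\<lambda>_. borel)) (\<lambda>\<omega>. restrict (\<lambda>i. X i \<omega>) {2..n}) = Pi\<^sub>M {2..n} (\<lambda>i. distr M borel (X i))"
    using n by (subst (asm) indep_vars_iff_distr_eq_PiM') (auto intro: measurable_sample)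
  also have "\<dots> = Pi\<^sub>M {2..n} (\<lambda>_. \<nu>0)" by (rule PiM_cong) (auto simp: law)
  finally show ?thesis .
qed

text \<open>A law with a density has no atoms, so two independent points with this law coincide with
  probability 0.\<close>

lemma AE_sample_distinct: "AE \<omega> in M. inj_on (\<lambda>i. X i \<omega>) {1..n}"
proof -
  have ne: "AE \<omega> in M. X i \<omega> \<noteq> X j \<omega>" if ij: "1 \<le> i" "1 \<le> j" "i \<noteq> j" for i j
  proof -
    have "indep_var borel ((\<lambda>f. f i) \<circ> (\<lambda>\<omega>. restrict (\<lambda>i. X i \<omega>) {i})) borel ((\<lambda>f. f j) \<circ> (\<lambda>\<omega>. restrict (\<lambda>i. X i \<omega>) {j}))"
      using ij by (intro indep_var_compose[OF indep_var_restrict[OF indep]]) auto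
    moreover have "(\<lambda>f. f k) \<circ> (\<lambda>\<omega>. restrict (\<lambda>i. X i \<omega>) {k}) = X k" for k by auto
    ultimately have "indep_var borel (X i) borel (X j)" by simp
    then have joint: "\<nu>0 \<Otimes>\<^sub>M \<nu>0 = distr M (borel \<Otimes>\<^sub>M borel) (\<lambda>\<omega>. (X i \<omega>, X j \<omega>))"
      using ij by (simp add: indep_var_distribution_eq law)
    have [measurable]: "random_variable borel (X i)" "random_variable borel (X j)" using ij by (auto intro: measurable_sample)
    have joint_rv: "(\<lambda>\<omega>. (X i \<omega>, X j \<omega>)) \<in> measurable M (borel \<Otimes>\<^sub>M borel)" by measurable
    interpret N: prob_space \<nu>0 using prob_space_distr[OF measurable_sample[of 1]] law[of 1] by simp
    interpret pair_prob_space \<nu>0 \<nu>0 ..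
    have s: "sets \<nu>0 = sets borel" by (simp add: \<nu>0)
    note [measurable_cong] = s
    have "AE p in \<nu>0 \<Otimes>\<^sub>M \<nu>0. fst p \<noteq> snd p"
    proof (rule AE_pair_measure)
      show "{p \<in> space (\<nu>0 \<Otimes>\<^sub>M \<nu>0). fst p \<noteq> snd p} \<in> sets (\<nu>0 \<Otimes>\<^sub>M \<nu>0)" by measurable
      show "AE x in \<nu>0. AE y in \<nu>0. fst (x, y) \<noteq> snd (x, y)"
      proof (rule AE_I2)
        fix x
        show "AE y in \<nu>0. fst (x, y) \<noteq> snd (x, y)"
          unfolding \<nu>0 using AE_lborel_singleton[of x] by (subst AE_density) (auto elim: eventually_mono)
      qed
    qed
    then have "AE p in distr M (borel \<Otimes>\<^sub>M borel) (\<lambda>\<omega>. (X i \<omega>, X j \<omega>)). fst p \<noteq> snd p" unfolding joint .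
    then have "AE \<omega> in M. fst (X i \<omega>, X j \<omega>) \<noteq> snd (X i \<omega>, X j \<omega>)"
      by (rule AE_distrD[OF joint_rv])
    then show ?thesis by simp
  qed
  have "AE \<omega> in M. \<forall>i\<in>{1..n}. \<forall>j\<in>{1..n}. X i \<omega> = X j \<omega> \<longrightarrow> i = j"
  proof (intro AE_finite_allI finite_atLeastAtMost)
    show "AE \<omega> in M. X i \<omega> = X j \<omega> \<longrightarrow> i = j" if "i \<in> {1..n}" "j \<in> {1..n}" for i j
      using ne[of i j] that by (cases "i = j") (auto elim: eventually_mono)
  qed
  then show ?thesis by (simp add: inj_on_def)
qed

text \<open>The exponent \<open>p\<close> treats both moments at once. Conditioning on
  \<open>X 1\<close> freezes the centre and leaves an integral over the law of the other points,
  after the catchment area has been replaced, up to null sets, by the counting condition.\<close>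

lemma cond_exp_catchment:
  fixes g :: "real ^ 'n \<Rightarrow> real" and p :: nat
  defines "\<mu> \<equiv> density lborel (\<lambda>z. ennreal (g z))"
  assumes g [measurable]: "g \<in> borel_measurable borel" and prob: "prob_space \<mu>" and n: "1 \<le> m" "m \<le> n" "2 \<le> n"
    and h: "cond_exp_given M (X 1) (\<lambda>\<omega>. measure \<mu> (catchment_area m n (\<lambda>i. X i \<omega>) (X 1 \<omega>)) ^ p) h"
  shows "AE x in \<nu>0. h x = (\<integral>y. measure \<mu> {z. card {l \<in> {2..n}. y l \<in> ball_through x z} \<le> m - 1} ^ p \<partial>Pi\<^sub>M {2..n} (\<lambda>_. \<nu>0))"
proof -
  interpret G: prob_space \<mu> by (rule prob)
  have s: "sets \<mu> = sets borel" "space \<mu> = UNIV" by (simp_all add: \<mu>_def)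
  note [measurable_cong] = s(1)
  have ac: "AE z in \<mu>. Q z" if "AE z in lborel. Q z" for Q
    unfolding \<mu>_def using that by (subst AE_density) (auto elim: eventually_mono)
  note inc = in_catchment_borel
  note few = few_points_borel[OF finite_atLeastAtMost]
  have Yeq: "measure \<mu> (catchment_area m n xs x) = measure \<mu> {z. in_catchment m n xs x z}" for xs :: "nat \<Rightarrow> real ^ 'n" and x
    using AE_catchment_area[of m n xs x]
    by (intro G.finite_measure_eq_AE ac) (simp_all only: s inc catchment_area_borel mem_Collect_eq)
  \<comment> \<open>For a fixed sample the catchment area is Borel, but measurability in the sample
    needs a set measurable jointly with \<open>z\<close>; this is the purpose of
    \<open>in_catchment\<close>.\<close>
  have Ym: "(\<lambda>\<omega>. measure \<mu> (catchment_area m n (\<lambda>i. X i \<omega>) (X 1 \<omega>))) \<in> borel_measurable M"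
  proof -
    have "(\<lambda>\<omega>. measure \<mu> {z \<in> space \<mu>. in_catchment m n (\<lambda>i. X i \<omega>) (X 1 \<omega>) z}) \<in> borel_measurable M"
    proof (rule G.borel_measurable_measure_section)
      have "{p \<in> space (M \<Otimes>\<^sub>M \<mu>). in_catchment m n (\<lambda>i. (\<lambda>p. X i (fst p)) p) ((\<lambda>p. X 1 (fst p)) p) (snd p)} \<in> sets (M \<Otimes>\<^sub>M \<mu>)"
      proof (rule sets_in_catchment)
        show "(\<lambda>p. X i (fst p)) \<in> borel_measurable (M \<Otimes>\<^sub>M \<mu>)" if "i \<in> {1..n}" for i
          using that by (intro measurable_compose[OF measurable_fst measurable_sample]) simp
        show "(\<lambda>p. X 1 (fst p)) \<in> borel_measurable (M \<Otimes>\<^sub>M \<mu>)"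
          by (intro measurable_compose[OF measurable_fst measurable_sample]) simp
      qed measurable
      then show "{p \<in> space (M \<Otimes>\<^sub>M \<mu>). in_catchment m n (\<lambda>i. X i (fst p)) (X 1 (fst p)) (snd p)} \<in> sets (M \<Otimes>\<^sub>M \<mu>)" .
    qed
    then show ?thesis by (simp only: s Yeq UNIV_I simp_thms)
  qed
  define \<phi> where "\<phi> q = measure \<mu> {z. card {l \<in> {2..n}. snd q l \<in> ball_through (fst q) z} \<le> m - 1} ^ p" for q :: "(real ^ 'n) \<times> (nat \<Rightarrow> real ^ 'n)"
  have "(\<lambda>q :: (real ^ 'n) \<times> (nat \<Rightarrow> real ^ 'n). measure \<mu> {z \<in> space \<mu>. card {l \<in> {2..n}. snd q l \<in> ball_through (fst q) z} \<le> m - 1})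
    \<in> borel_measurable (borel \<Otimes>\<^sub>M Pi\<^sub>M {2..n} (\<lambda>_. borel))"
  proof (rule G.borel_measurable_measure_section, rule sets_few_points)
    show "(\<lambda>q. snd (fst q) l) \<in> borel_measurable ((borel \<Otimes>\<^sub>M Pi\<^sub>M {2..n} (\<lambda>_. borel)) \<Otimes>\<^sub>M \<mu>)" if "l \<in> {2..n}" for l
      using that by measurable
  qed measurable
  then have \<phi>m: "\<phi> \<in> borel_measurable (borel \<Otimes>\<^sub>M Pi\<^sub>M {2..n} (\<lambda>_. borel))"
    unfolding \<phi>_def[abs_def] by (intro borel_measurable_power) (simp only: s UNIV_I simp_thms)
  have "AE x in distr M borel (X 1). h x = (\<integral>y. \<phi> (x, y) \<partial>distr M (Pi\<^sub>M {2..n} (\<lambda>_. borel)) (\<lambda>\<omega>. restrict (\<lambda>i. X i \<omega>) {2..n}))"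
  proof (rule cond_exp_given_indep[OF _ _ joint_law_sample \<phi>m _ _ _ h])
    show "random_variable borel (X 1)" by (rule measurable_sample) simp
    show "random_variable (Pi\<^sub>M {2..n} (\<lambda>_. borel)) (\<lambda>\<omega>. restrict (\<lambda>i. X i \<omega>) {2..n})"
      by (rule measurable_restrict) (auto intro: measurable_sample)
    show "\<bar>\<phi> q\<bar> \<le> 1" for q unfolding \<phi>_def by (simp add: power_le_one)
    show "(\<lambda>\<omega>. measure \<mu> (catchment_area m n (\<lambda>i. X i \<omega>) (X 1 \<omega>)) ^ p) \<in> borel_measurable M"
      using Ym by (intro borel_measurable_power)
    show "AE \<omega> in M. measure \<mu> (catchment_area m n (\<lambda>i. X i \<omega>) (X 1 \<omega>)) ^ p = \<phi> (X 1 \<omega>, restrict (\<lambda>i. X i \<omega>) {2..n})"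
      using AE_sample_distinct[of n]
    proof eventually_elim
      case (elim \<omega>)
      have "AE z in lborel. inj_on (\<lambda>u. norm (u - z)) ((\<lambda>i. X i \<omega>) ` {1..n})" by (rule AE_inj_on_distance) simp
      then have "AE z in lborel. z \<in> {z. in_catchment m n (\<lambda>i. X i \<omega>) (X 1 \<omega>) z} \<longleftrightarrow> z \<in> {z. card {l \<in> {2..n}. X l \<omega> \<in> ball_through (X 1 \<omega>) z} \<le> m - 1}"
        by eventually_elim (simp only: mem_Collect_eq in_catchment_iff[OF elim _ n(1,2)])
      then have "measure \<mu> {z. in_catchment m n (\<lambda>i. X i \<omega>) (X 1 \<omega>) z} = measure \<mu> {z. card {l \<in> {2..n}. X l \<omega> \<in> ball_through (X 1 \<omega>) z} \<le> m - 1}"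
        using inc few by (intro G.finite_measure_eq_AE ac) (simp_all only: s)
      moreover have "{l \<in> {2..n}. restrict (\<lambda>i. X i \<omega>) {2..n} l \<in> S} = {l \<in> {2..n}. X l \<omega> \<in> S}" for S by auto
      ultimately show ?case by (simp only: Yeq \<phi>_def fst_conv snd_conv)
    qed
  qed
  then show ?thesis by (simp only: law[OF order_refl] law_sample[OF n(3)] \<phi>_def fst_conv snd_conv)
qed

end

end

section \<open>The charged part of the support and the limit theorem\<close>

text \<open>The complement of the topological support of the measure. By Lindelof countably many of
  these balls have the same union.\<close>

lemma union_null_balls:
  fixes \<nu> :: "'a::{metric_space, second_countable_topology} measure"
  assumes s: "sets \<nu> = sets borel"
  shows "\<Union>{ball x r | x r. emeasure \<nu> (ball x r) = 0} \<in> null_sets \<nu>"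
proof -
  let ?F = "{ball x r | x r. emeasure \<nu> (ball x r) = 0}"
  obtain F' where F': "F' \<subseteq> ?F" "countable F'" "\<Union>F' = \<Union>?F"
    using Lindelof[of ?F] by auto
  have "(\<Union>S\<in>F'. S) \<in> null_sets \<nu>"
    using F'(1,2) s by (intro null_sets_UN') (auto simp: null_sets_def)
  then show ?thesis using F'(3) by simp
qed

lemma density_restrict:
  fixes f :: "'a::euclidean_space \<Rightarrow> real"
  assumes [measurable]: "f \<in> borel_measurable borel" "K \<in> sets borel" and f0: "\<And>x. 0 \<le> f x"
    and null: "- K \<in> null_sets (density lborel (\<lambda>x. ennreal (f x)))"
  shows "density lborel (\<lambda>x. ennreal (f x)) = density lborel (\<lambda>x. ennreal (f x * indicator K x))"
proof (rule density_cong)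
  have "AE x in lborel. x \<in> - K \<longrightarrow> ennreal (f x) = 0"
    using null by (subst (asm) null_sets_density_iff) auto
  then show "AE x in lborel. ennreal (f x) = ennreal (f x * indicator K x)"
    by eventually_elim (auto simp: indicator_def)
qed auto

lemma catchment_moment_limits:
  fixes \<nu>0 \<nu>1 :: "(real ^ 'n) measure" and P :: "'w measure" and \<X> :: "(real ^ 'n) set"
  assumes M: "1 \<le> M" and p0: "prob_space \<nu>0" and d0: "is_lebesgue_density \<nu>0 f0" and p1: "prob_space \<nu>1" and d1: "is_lebesgue_density \<nu>1 f1"
    and P: "prob_space P" and indep: "prob_space.indep_vars P (\<lambda>_. borel) X {1..}" and law: "\<forall>i\<ge>1. distr P borel (X i) = \<nu>0"
    and ac: "absolutely_continuous \<nu>0 \<nu>1" and supp: "fun_support f0 = \<X>" and cpt: "compact \<X>"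
    and cont: "continuous_on \<X> f0" "continuous_on \<X> f1"
    and E1: "\<forall>n\<ge>1. cond_exp_given P (X 1) (\<lambda>\<omega>. measure \<nu>1 (catchment_area M n (\<lambda>i. X i \<omega>) (X 1 \<omega>))) (E1 n)"
    and E2: "\<forall>n\<ge>1. cond_exp_given P (X 1) (\<lambda>\<omega>. (measure \<nu>1 (catchment_area M n (\<lambda>i. X i \<omega>) (X 1 \<omega>)))\<^sup>2) (E2 n)"
  shows "AE x in \<nu>0. (\<lambda>n. real n * E1 n x) \<longlonglongrightarrow> real M * (f1 x / f0 x) \<and>
    (\<lambda>n. (real n)\<^sup>2 * E2 n x) \<longlonglongrightarrow> alpha_M M TYPE('n) * (f1 x / f0 x)\<^sup>2"
proof -
  interpret P: prob_space P by (rule P)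
  have f [measurable]: "f0 \<in> borel_measurable borel" "f1 \<in> borel_measurable borel"
    and nonneg: "\<And>z. 0 \<le> f0 z" "\<And>z. 0 \<le> f1 z"
    and dens: "\<nu>0 = density lborel (\<lambda>z. ennreal (f0 z))" "\<nu>1 = density lborel (\<lambda>z. ennreal (f1 z))"
    using d0 d1 by (auto simp: is_lebesgue_density_def)
  have s: "sets \<nu>0 = sets borel" "sets \<nu>1 = sets borel" by (simp_all add: dens)
  \<comment> \<open>Removing \<open>U\<close> leaves the points of \<open>\<X>\<close> all of whose
    balls have positive mass. Since \<open>U\<close> is open, what is left is still compact; it has
    full mass for \<open>\<nu>0\<close>, and by absolute continuity for
    \<open>\<nu>1\<close>.\<close>
  define U where "U = \<Union>{ball x r | x r. emeasure \<nu>0 (ball x r) = 0}"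
  have Uopen: "open U" unfolding U_def by auto
  have Unull: "U \<in> null_sets \<nu>0" unfolding U_def by (rule union_null_balls[OF s(1)])
  define K where "K = \<X> - U"
  have K: "compact K" unfolding K_def by (rule compact_diff[OF cpt Uopen])
  have KX: "K \<subseteq> \<X>" by (auto simp: K_def)
  have Kb [measurable]: "K \<in> sets borel" using K by (rule borel_compact)
  have Xb: "- \<X> \<in> sets borel" using borel_compact[OF cpt] by (rule borel_comp)
  have "- \<X> \<in> null_sets \<nu>0"
    unfolding dens(1)
  proof (subst null_sets_density_iff)
    have "f0 x = 0" if "x \<notin> \<X>" for x
      using that closure_subset[of "{x. f0 x \<noteq> 0}"] unfolding supp[symmetric] fun_support_def by blast
    then show "- \<X> \<in> sets lborel \<and> (AE x in lborel. x \<in> - \<X> \<longrightarrow> ennreal (f0 x) = 0)" using Xb by auto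
  qed simp
  then have "- \<X> \<union> U \<in> null_sets \<nu>0" using Unull by (rule null_sets.Un)
  then have K0: "- K \<in> null_sets \<nu>0" by (simp add: K_def Diff_eq)
  then have K1: "- K \<in> null_sets \<nu>1" using ac by (auto simp: absolutely_continuous_def)
  \<comment> \<open>Both densities are set to 0 off \<open>K\<close>, where they are almost
    everywhere 0 already. The laws do not change, and the new densities vanish off \<open>K\<close>
    at every point.\<close>
  define g0 where "g0 z = f0 z * indicator K z" for z
  define g1 where "g1 z = f1 z * indicator K z" for z
  have g [measurable]: "g0 \<in> borel_measurable borel" "g1 \<in> borel_measurable borel"
    unfolding g0_def[abs_def] g1_def[abs_def] by measurable
  have gdens: "\<nu>0 = density lborel (\<lambda>z. ennreal (g0 z))" "\<nu>1 = density lborel (\<lambda>z. ennreal (g1 z))"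
    unfolding dens g0_def g1_def using K0 K1 by (auto intro!: density_restrict simp: nonneg dens)
  have gnn: "0 \<le> g0 z" "0 \<le> g1 z" for z using nonneg by (simp_all add: g0_def g1_def)
  have gout: "g0 z = 0" "g1 z = 0" if "z \<notin> K" for z using that by (simp_all add: g0_def g1_def)
  have gK: "g0 z = f0 z" "g1 z = f1 z" if "z \<in> K" for z using that by (simp_all add: g0_def g1_def)
  have gcont: "continuous_on K g0" "continuous_on K g1"
    using continuous_on_subset[OF cont(1) KX] continuous_on_subset[OF cont(2) KX]
    by (simp_all add: gK cong: continuous_on_cong)
  have charged: "0 < measure \<nu>0 (cball z r)" if "z \<in> K" "0 < r" for z r
  proof -
    interpret N: prob_space \<nu>0 by (rule p0)
    have "emeasure \<nu>0 (ball z r) \<noteq> 0" using that unfolding K_def U_def by (auto dest: centre_in_ball[THEN iffD2])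
    then have "0 < measure \<nu>0 (ball z r)" by (simp add: N.emeasure_eq_measure zero_less_measure_iff)
    also have "\<dots> \<le> measure \<nu>0 (cball z r)" using s by (intro N.finite_measure_mono) auto
    finally show ?thesis .
  qed
  have lift: "AE x in \<nu>0. Q x" if "AE x in lborel. Q x" for Q
    unfolding dens(1) using that by (subst AE_density) (auto elim: eventually_mono)
  have law': "\<And>i. 1 \<le> i \<Longrightarrow> distr P borel (X i) = \<nu>0" using law by blast
  have p1': "prob_space (density lborel (\<lambda>z. ennreal (g1 z)))" using p1 by (simp only: gdens(2))
  \<comment> \<open>Each version \<open>E1 n\<close> is determined up to a null set depending on
    \<open>n\<close>; countably many of them have a common exceptional null set. The restriction to
    large \<open>n\<close> guarantees that an \<open>M\<close>-th neighbour exists and that other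
    sample points are present.\<close>
  have m1: "AE x in \<nu>0. \<forall>n. 2 \<le> n \<and> M \<le> n \<longrightarrow> E1 n x = (\<integral>z. g1 z * low_counts \<nu>0 {2..n} (M - 1) (ball_through x z) (ball_through x z) \<partial>lborel)"
    unfolding AE_all_countable
  proof (intro allI)
    fix n
    show "AE x in \<nu>0. 2 \<le> n \<and> M \<le> n \<longrightarrow> E1 n x = (\<integral>z. g1 z * low_counts \<nu>0 {2..n} (M - 1) (ball_through x z) (ball_through x z) \<partial>lborel)"
    proof (cases "2 \<le> n \<and> M \<le> n")
      case True
      have "AE x in \<nu>0. E1 n x = (\<integral>y. measure (density lborel (\<lambda>z. ennreal (g1 z))) {z. card {l \<in> {2..n}. y l \<in> ball_through x z} \<le> M - 1} ^ 1 \<partial>Pi\<^sub>M {2..n} (\<lambda>_. \<nu>0))"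
      proof (rule P.cond_exp_catchment[OF indep law' dens(1) f(1) g(2) p1' M])
        show "cond_exp_given P (X 1) (\<lambda>\<omega>. measure (density lborel (\<lambda>z. ennreal (g1 z))) (catchment_area M n (\<lambda>i. X i \<omega>) (X 1 \<omega>)) ^ 1) (E1 n)"
          unfolding gdens(2)[symmetric] power_one_right by (rule E1[rule_format]) (use True in simp)
      qed (use True in simp_all)
      then show ?thesis
        by eventually_elim (simp only: power_one_right simp_thms expectation_few_points[OF p0 s(1) finite_atLeastAtMost g(2) gnn(2) p1'])
    qed (intro AE_I2, blast)
  qed
  have m2: "AE x in \<nu>0. \<forall>n. 2 \<le> n \<and> M \<le> n \<longrightarrow> E2 n x = (\<integral>z1. g1 z1 * (\<integral>z2. g1 z2 * low_counts \<nu>0 {2..n} (M - 1) (ball_through x z2) (ball_through x z1) \<partial>lborel) \<partial>lborel)"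
    unfolding AE_all_countable
  proof (intro allI)
    fix n
    show "AE x in \<nu>0. 2 \<le> n \<and> M \<le> n \<longrightarrow> E2 n x = (\<integral>z1. g1 z1 * (\<integral>z2. g1 z2 * low_counts \<nu>0 {2..n} (M - 1) (ball_through x z2) (ball_through x z1) \<partial>lborel) \<partial>lborel)"
    proof (cases "2 \<le> n \<and> M \<le> n")
      case True
      have "AE x in \<nu>0. E2 n x = (\<integral>y. measure (density lborel (\<lambda>z. ennreal (g1 z))) {z. card {l \<in> {2..n}. y l \<in> ball_through x z} \<le> M - 1} ^ 2 \<partial>Pi\<^sub>M {2..n} (\<lambda>_. \<nu>0))"
      proof (rule P.cond_exp_catchment[OF indep law' dens(1) f(1) g(2) p1' M])
        show "cond_exp_given P (X 1) (\<lambda>\<omega>. measure (density lborel (\<lambda>z. ennreal (g1 z))) (catchment_area M n (\<lambda>i. X i \<omega>) (X 1 \<omega>)) ^ 2) (E2 n)"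
          unfolding gdens(2)[symmetric] by (rule E2[rule_format]) (use True in simp)
      qed (use True in simp_all)
      then show ?thesis
        by eventually_elim (simp only: power_one_right simp_thms expectation_few_points_square[OF p0 s(1) finite_atLeastAtMost g(2) gnn(2) p1'])
    qed (intro AE_I2, blast)
  qed
  have inK: "AE x in \<nu>0. x \<notin> - K" by (rule AE_not_in[OF K0])
  have pos: "AE x in \<nu>0. 0 < f0 x" unfolding dens(1) by (subst AE_density) auto
  have dp: "AE x in \<nu>0. x \<in> K \<longrightarrow> (\<forall>e>0. \<exists>\<delta>>0. \<forall>r. 0 < r \<and> r < \<delta> \<longrightarrow> measure lborel (ball x r - K) \<le> e * r ^ DIM(real ^ 'n))"
    by (rule lift[OF AE_lebesgue_density[OF K]])
  show ?thesis
    using m1 m2 inK pos dp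
  proof eventually_elim
    case (elim x)
    have xK: "x \<in> K" using elim(3) by simp
    interpret density_point K g0 x
    proof (rule density_point.intro)
      show "\<exists>\<delta>>0. \<forall>r. 0 < r \<and> r < \<delta> \<longrightarrow> measure lborel (ball x r - K) \<le> e * r ^ CARD('n)" if "0 < e" for e
        using elim(5) xK that by simp
    qed (use K xK g gnn gout gcont elim(4) p0 charged in \<open>simp_all add: gK gdens(1)[symmetric]\<close>)
    have e1: "E1 (n + 1) x = (\<integral>z. g1 z * counts (M - 1) n z z \<partial>lborel)" if "2 \<le> n + 1 \<and> M \<le> n + 1" for n
      using elim(1)[rule_format, OF that] by (simp only: counts_def gdens(1)[symmetric])
    have e2: "E2 (n + 1) x = (\<integral>z1. g1 z1 * (\<integral>z2. g1 z2 * counts (M - 1) n z1 z2 \<partial>lborel) \<partial>lborel)" if "2 \<le> n + 1 \<and> M \<le> n + 1" for n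
      using elim(2)[rule_format, OF that] by (simp only: counts_def gdens(1)[symmetric])
    \<comment> \<open>The moment limits are indexed by the number \<open>n\<close> of remaining
      points, the theorem by the sample size \<open>Suc n\<close>; the excluded small sizes do not
      affect the limit.\<close>
    have ev: "eventually (\<lambda>n. 2 \<le> Suc n \<and> M \<le> Suc n) sequentially"
      using eventually_ge_at_top[of "max 1 M"] by eventually_elim auto
    have "(\<lambda>n. real (n + 1) * (\<integral>z. g1 z * counts (M - 1) n z z \<partial>lborel)) \<longlonglongrightarrow> real (Suc (M - 1)) * (g1 x / g0 x)"
      by (rule first_moment_limit) (use g gnn gout gcont in auto)
    then have "(\<lambda>n. real (Suc n) * E1 (Suc n) x) \<longlonglongrightarrow> real (Suc (M - 1)) * (g1 x / g0 x)"
      by (rule Lim_transform_eventually) (use ev in eventually_elim, simp only: e1 Suc_eq_plus1)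
    then have l1: "(\<lambda>n. real n * E1 n x) \<longlonglongrightarrow> real M * (f1 x / f0 x)"
      unfolding filterlim_sequentially_Suc[of "\<lambda>n. real n * E1 n x"] using M xK by (simp add: gK)
    have "(\<lambda>n. (real (n + 1))\<^sup>2 * (\<integral>z1. g1 z1 * (\<integral>z2. g1 z2 * counts (M - 1) n z1 z2 \<partial>lborel) \<partial>lborel))
      \<longlonglongrightarrow> (\<Sum>(i, j, k)\<in>triples (M - 1). enn2real (poisson_integral TYPE('n) i j k)) * (g1 x / g0 x)\<^sup>2"
      by (rule second_moment_limit) (use g gnn gout gcont in auto)
    then have "(\<lambda>n. (real (Suc n))\<^sup>2 * E2 (Suc n) x) \<longlonglongrightarrow> (\<Sum>(i, j, k)\<in>triples (M - 1). enn2real (poisson_integral TYPE('n) i j k)) * (g1 x / g0 x)\<^sup>2"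
      by (rule Lim_transform_eventually) (use ev in eventually_elim, simp only: e2 Suc_eq_plus1)
    then have l2: "(\<lambda>n. (real n)\<^sup>2 * E2 n x) \<longlonglongrightarrow> alpha_M M TYPE('n) * (f1 x / f0 x)\<^sup>2"
      unfolding filterlim_sequentially_Suc[of "\<lambda>n. (real n)\<^sup>2 * E2 n x"] alpha_M_eq using xK by (simp add: gK)
    show ?case using l1 l2 by simp
  qed
qed

theorem theorem4p1:
  fixes M :: nat
  assumes "M \<ge> 1"
  shows
    "(\<forall>(\<nu>0 :: (real ^ 'n) measure) \<nu>1 f0 f1 (P :: 'w measure) X \<X> E1 E2.
        prob_space \<nu>0 \<and> is_lebesgue_density \<nu>0 f0 \<and>
        prob_space \<nu>1 \<and> is_lebesgue_density \<nu>1 f1 \<and>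
        prob_space P \<and> prob_space.indep_vars P (\<lambda>_. borel) X {1..} \<and>
        (\<forall>i\<ge>1. distr P borel (X i) = \<nu>0) \<and>
        absolutely_continuous \<nu>0 \<nu>1 \<and>
        fun_support f0 = \<X> \<and> fun_support f1 = \<X> \<and> compact \<X> \<and>
        continuous_on \<X> f0 \<and> continuous_on \<X> f1 \<and>
        (\<forall>n\<ge>1. cond_exp_given P (X 1)
           (\<lambda>\<omega>. measure \<nu>1 (catchment_area M n (\<lambda>i. X i \<omega>) (X 1 \<omega>))) (E1 n)) \<and>
        (\<forall>n\<ge>1. cond_exp_given P (X 1)
           (\<lambda>\<omega>. (measure \<nu>1 (catchment_area M n (\<lambda>i. X i \<omega>) (X 1 \<omega>)))\<^sup>2) (E2 n))
        \<longrightarrow>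
        (AE x in \<nu>0.
           (\<lambda>n. real n * E1 n x) \<longlonglongrightarrow> real M * (f1 x / f0 x) \<and>
           (\<lambda>n. (real n)\<^sup>2 * E2 n x) \<longlonglongrightarrow> alpha_M M TYPE('n) * (f1 x / f0 x)\<^sup>2)) \<and>
     (CARD('n) = 1 \<longrightarrow> alpha_M M TYPE('n) = real M * (2 * real M + 1) / 2) \<and>
     alpha_M 1 TYPE('n) = alpha TYPE('n)"
proof (intro conjI allI impI, goal_cases)
  case (1 \<nu>0 \<nu>1 f0 f1 P X \<X> E1 E2)
  then show ?case
    by (elim conjE) (rule catchment_moment_limits[OF assms, of \<nu>0 f0 \<nu>1 f1 P X \<X> E1 E2]; assumption)
next
  case 2
  then show ?case using assms by (rule alpha_M_dim1)
next
  case 3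
  show ?case by (rule alpha_M_1)
qed

end
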